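(* Let $R$ be a commutative Noetherian ring, $\mathfrak a$ a proper ideal of $R$, and $M$ an RCMF $R$-module with respect to $\mathfrak a$. Then $M_{\mathfrak p}$ is an RCMF $R_{\mathfrak p}$-module with respect to $\mathfrak aR_{\mathfrak p}$ for any prime ideal $\mathfrak p\in\operatorname{Supp}_R(M)\cap V(\mathfrak a)$.
   Context: $H^i_{\mathfrak a}(-)$ denotes local cohomology with respect to $\mathfrak a$ and $\operatorname{cd}(\mathfrak a,M)=\sup\{i\in\mathbb Z\mid H^i_{\mathfrak a}(M)\neq0\}$ (so the zero module has $\operatorname{cd}=-\infty$). $V(\mathfrak a)$ is the set of primes containing $\mathfrak a$. Cohomological dimension filtration (cd-filtration): for a finitely generated $R$-module $M$ with $c=\operatorname{cd}(\mathfrak a,M)$, it is the increasing filtration $\{M_i\}_{i=0}^c$ of submodules in which $M_i$ is the largest submodule of $M$ with $\operatorname{cd}(\mathfrak a,M_i)\le i$. Relative Cohen-Macaulay: a finitely generated $R$-module $N$ is relative Cohen-Macaulay with respect to $\mathfrak a$ if there is precisely one $i$ with $H^i_{\mathfrak a}(N)\ne0$ (equivalently $\operatorname{grade}(\mathfrak a,N)=\operatorname{cd}(\mathfrak a,N)$). RCMF (relative Cohen-Macaulay filtered): a finitely generated $R$-module $M$ with cd-filtration $\{M_i\}_{i=0}^c$, $c=\operatorname{cd}(\mathfrak a,M)$, is RCMF with respect to $\mathfrak a$ if for all $1\le i\le c$ the module $M_i/M_{i-1}$ is either zero or relative Cohen-Macaulay with respect to $\mathfrak a$ with $\operatorname{cd}(\mathfrak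 a,M_i/M_{i-1})=i$. *)

theory Defs
  imports "HOL-Algebra.Module" "HOL-Algebra.Ideal_Product" "HOL-Algebra.Ring_Divisibility"
    "HOL-Library.Extended_Real"
begin

section \<open>Modules\<close>

definition zero_module :: "('r, 'm, 'y) module_scheme \<Rightarrow> bool"
  where "zero_module M \<longleftrightarrow> carrier M = {\<zero>\<^bsub>M\<^esub>}"

definition finitely_generated :: "('r, 'x) ring_scheme \<Rightarrow> ('r, 'm, 'y) module_scheme \<Rightarrow> bool"
  where "finitely_generated R M \<longleftrightarrow> module R M \<and>
    (\<exists>A. finite A \<and> A \<subseteq> carrier M \<and> \<Inter>{H. submodule H R M \<and> A \<subseteq> H} = carrier M)"

definition mod_hom ::
  "('r, 'x) ring_scheme \<Rightarrow> ('r, 'm, 'y) module_scheme \<Rightarrow> ('r, 'n, 'z) module_scheme \<Rightarrow> ('m \<Rightarrow> 'n) set"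
  where "mod_hom R M N = {f \<in> carrier M \<rightarrow> carrier N.
    (\<forall>x\<in>carrier M. \<forall>y\<in>carrier M. f (x \<oplus>\<^bsub>M\<^esub> y) = f x \<oplus>\<^bsub>N\<^esub> f y) \<and>
    (\<forall>r\<in>carrier R. \<forall>x\<in>carrier M. f (r \<odot>\<^bsub>M\<^esub> x) = r \<odot>\<^bsub>N\<^esub> f x)}"

text \<open>The multiplication and unit that the record type of modules inherits from rings carry no
  meaning for a module; they are left \<^const>\<open>undefined\<close> below.\<close>

definition quotient_module :: "('r, 'm, 'y) module_scheme \<Rightarrow> 'm set \<Rightarrow> ('r, 'm set) module"
  where "quotient_module M N =
    \<lparr>carrier = a_rcosets\<^bsub>M\<^esub> N, monoid.mult = undefined, one = undefined, zero = N, add = set_add M,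
     smult = (\<lambda>r C. \<Union>x\<in>C. N +>\<^bsub>M\<^esub> (r \<odot>\<^bsub>M\<^esub> x))\<rparr>"

section \<open>Local cohomology\<close>

text \<open>Only test modules \<open>B\<close> with the same element type as \<open>E\<close> can be quantified over. As soon as
  this type is at least as large as the ring, a copy of the ring is among them, and by Baer's
  criterion the extension property then holds for modules of every element type. This is the case
  for the universe type used for resolutions below.\<close>

definition injective_module :: "('r, 'x) ring_scheme \<Rightarrow> ('r, 'u) module \<Rightarrow> bool"
  where "injective_module R E \<longleftrightarrow> module R E \<and>
    (\<forall>(B :: ('r, 'u) module) A. \<forall>f. module R B \<and> submodule A R B \<and> f \<in> mod_hom R (B\<lparr>carrier := A\<rparr>) E
       \<longrightarrow> (\<exists>g\<in>mod_hom R B E. \<forall>x\<in>A. g x = f x))"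

text \<open>\<open>0 \<rightarrow> M \<rightarrow> I 0 \<rightarrow> I 1 \<rightarrow> \<dots>\<close> with augmentation \<open>e\<close> and differentials \<open>d i : I i \<rightarrow> I (i + 1)\<close>.\<close>

definition injective_resolution ::
  "('r, 'x) ring_scheme \<Rightarrow> ('r, 'm, 'y) module_scheme \<Rightarrow>
   (nat \<Rightarrow> ('r, 'u) module) \<Rightarrow> ('m \<Rightarrow> 'u) \<Rightarrow> (nat \<Rightarrow> 'u \<Rightarrow> 'u) \<Rightarrow> bool"
  where "injective_resolution R M I e d \<longleftrightarrow>
    (\<forall>i. injective_module R (I i)) \<and>
    e \<in> mod_hom R M (I 0) \<and> (\<forall>i. d i \<in> mod_hom R (I i) (I (Suc i))) \<and>
    inj_on e (carrier M) \<and>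
    e ` carrier M = {x \<in> carrier (I 0). d 0 x = \<zero>\<^bsub>I 1\<^esub>} \<and>
    (\<forall>i. d i ` carrier (I i) = {x \<in> carrier (I (Suc i)). d (Suc i) x = \<zero>\<^bsub>I (Suc (Suc i))\<^esub>})"

definition torsion_part :: "('r, 'x) ring_scheme \<Rightarrow> 'r set \<Rightarrow> ('r, 'm, 'y) module_scheme \<Rightarrow> 'm set"
  where "torsion_part R \<aa> M =
    {x \<in> carrier M. \<exists>n::nat. \<forall>r \<in> \<aa> [^]\<^bsub>ideals_set R\<^esub> n. r \<odot>\<^bsub>M\<^esub> x = \<zero>\<^bsub>M\<^esub>}"

text \<open>An element type large enough for injective resolutions of modules \<open>M\<close> over rings \<open>R\<close>, where
  \<open>'r\<close> and \<open>'m\<close> are the element types of \<open>R\<close> and \<open>M\<close>. Every module \<open>X\<close> embeds into the injective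
  module of additive maps from \<open>R\<close> to \<open>D\<close>, where \<open>D\<close> is a divisible group containing \<open>X\<close> of
  cardinality at most \<open>max(|X|, \<aleph>\<^sub>0)\<close>. If \<open>\<kappa> = max(|'m|, \<aleph>\<^sub>0)\<close>, the universe has cardinality
  \<open>\<kappa>\<^bsup>|'r|\<^esup>\<close>, and this bound is preserved under \<open>X \<mapsto> Hom(R, D)\<close> and under quotients.\<close>

type_synonym ('r, 'm) resolution_univ = "'r \<Rightarrow> nat \<times> 'm"

text \<open>The \<open>i\<close>-th right derived functor of the \<open>\<aa>\<close>-torsion functor.\<close>

definition local_cohomology ::
  "('r, 'x) ring_scheme \<Rightarrow> 'r set \<Rightarrow> ('r, 'm, 'y) module_scheme \<Rightarrow> nat \<Rightarrow>
   ('r, ('r, 'm) resolution_univ set) module"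
  where "local_cohomology R \<aa> M i =
    (let (I, e, d) = (SOME (I :: nat \<Rightarrow> ('r, ('r, 'm) resolution_univ) module, e, d).
                        injective_resolution R M I e d);
         Z = {x \<in> torsion_part R \<aa> (I i). d i x = \<zero>\<^bsub>I (Suc i)\<^esub>};
         B = (if i = 0 then {\<zero>\<^bsub>I 0\<^esub>} else d (i - 1) ` torsion_part R \<aa> (I (i - 1)))
     in quotient_module ((I i)\<lparr>carrier := Z\<rparr>) B)"

text \<open>The supremum of the empty set is \<open>-\<infinity>\<close>.\<close>

definition cd :: "('r, 'x) ring_scheme \<Rightarrow> 'r set \<Rightarrow> ('r, 'm, 'y) module_scheme \<Rightarrow> ereal"
  where "cd R \<aa> M = Sup {ereal (real i) | i. \<not> zero_module (local_cohomology R \<aa> M i)}"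

section \<open>Relative Cohen-Macaulay filtered modules\<close>

definition relative_Cohen_Macaulay ::
  "('r, 'x) ring_scheme \<Rightarrow> 'r set \<Rightarrow> ('r, 'm, 'y) module_scheme \<Rightarrow> bool"
  where "relative_Cohen_Macaulay R \<aa> N \<longleftrightarrow>
    finitely_generated R N \<and> (\<exists>!i. \<not> zero_module (local_cohomology R \<aa> N i))"

text \<open>Only the values \<open>F i\<close> with \<open>0 \<le> i \<le> cd R \<aa> M\<close> belong to the filtration.\<close>

definition cd_filtration ::
  "('r, 'x) ring_scheme \<Rightarrow> 'r set \<Rightarrow> ('r, 'm, 'y) module_scheme \<Rightarrow> (nat \<Rightarrow> 'm set) \<Rightarrow> bool"
  where "cd_filtration R \<aa> M F \<longleftrightarrow>
    (\<forall>i. ereal (real i) \<le> cd R \<aa> M \<longrightarrow>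
      submodule (F i) R M \<and> cd R \<aa> (M\<lparr>carrier := F i\<rparr>) \<le> ereal (real i) \<and>
      (\<forall>N. submodule N R M \<and> cd R \<aa> (M\<lparr>carrier := N\<rparr>) \<le> ereal (real i) \<longrightarrow> N \<subseteq> F i))"

definition RCMF :: "('r, 'x) ring_scheme \<Rightarrow> 'r set \<Rightarrow> ('r, 'm, 'y) module_scheme \<Rightarrow> bool"
  where "RCMF R \<aa> M \<longleftrightarrow> finitely_generated R M \<and>
    (\<exists>F. cd_filtration R \<aa> M F \<and>
      (\<forall>i. 1 \<le> i \<and> ereal (real i) \<le> cd R \<aa> M \<longrightarrow>
        (let Q = quotient_module (M\<lparr>carrier := F i\<rparr>) (F (i - 1))
         in zero_module Q \<or> relative_Cohen_Macaulay R \<aa> Q \<and> cd R \<aa> Q = ereal (real i))))"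

section \<open>Localization\<close>

definition regular_module :: "('r, 'x) ring_scheme \<Rightarrow> ('r, 'r) module"
  where "regular_module R =
    \<lparr>carrier = carrier R, monoid.mult = monoid.mult R, one = \<one>\<^bsub>R\<^esub>, zero = \<zero>\<^bsub>R\<^esub>, add = add R, smult = monoid.mult R\<rparr>"

definition fraction ::
  "'r set \<Rightarrow> ('r, 'm, 'y) module_scheme \<Rightarrow> 'm \<Rightarrow> 'r \<Rightarrow> ('m \<times> 'r) set"
  where "fraction S M m s =
    {(m', s'). m' \<in> carrier M \<and> s' \<in> S \<and>
       (\<exists>t\<in>S. t \<odot>\<^bsub>M\<^esub> (s' \<odot>\<^bsub>M\<^esub> m) = t \<odot>\<^bsub>M\<^esub> (s \<odot>\<^bsub>M\<^esub> m'))}"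

definition localized_module ::
  "('r, 'x) ring_scheme \<Rightarrow> 'r set \<Rightarrow> ('r, 'm, 'y) module_scheme \<Rightarrow>
   (('r \<times> 'r) set, ('m \<times> 'r) set) module"
  where "localized_module R S M =
    \<lparr>carrier = {fraction S M m s | m s. m \<in> carrier M \<and> s \<in> S},
     monoid.mult = undefined, one = undefined,
     zero = fraction S M \<zero>\<^bsub>M\<^esub> \<one>\<^bsub>R\<^esub>,
     add = (\<lambda>U V. \<Union>(m, s)\<in>U. \<Union>(n, t)\<in>V.
              fraction S M (t \<odot>\<^bsub>M\<^esub> m \<oplus>\<^bsub>M\<^esub> s \<odot>\<^bsub>M\<^esub> n) (s \<otimes>\<^bsub>R\<^esub> t)),
     smult = (\<lambda>Q U. \<Union>(r, s)\<in>Q. \<Union>(m, t)\<in>U. fraction S M (r \<odot>\<^bsub>M\<^esub> m) (s \<otimes>\<^bsub>R\<^esub> t))\<rparr>"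

definition localized_ring :: "('r, 'x) ring_scheme \<Rightarrow> 'r set \<Rightarrow> ('r \<times> 'r) set ring"
  where "localized_ring R S =
    (let L = localized_module R S (regular_module R)
     in \<lparr>carrier = carrier L, monoid.mult = smult L, one = fraction S (regular_module R) \<one>\<^bsub>R\<^esub> \<one>\<^bsub>R\<^esub>,
         zero = \<zero>\<^bsub>L\<^esub>, add = add L\<rparr>)"

definition ring_at :: "('r, 'x) ring_scheme \<Rightarrow> 'r set \<Rightarrow> ('r \<times> 'r) set ring"
  where "ring_at R \<pp> = localized_ring R (carrier R - \<pp>)"

definition module_at ::
  "('r, 'x) ring_scheme \<Rightarrow> 'r set \<Rightarrow> ('r, 'm, 'y) module_scheme \<Rightarrow>
   (('r \<times> 'r) set, ('m \<times> 'r) set) module"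
  where "module_at R \<pp> M = localized_module R (carrier R - \<pp>) M"

definition extended_ideal_at :: "('r, 'x) ring_scheme \<Rightarrow> 'r set \<Rightarrow> 'r set \<Rightarrow> ('r \<times> 'r) set set"
  where "extended_ideal_at R \<pp> \<aa> =
    Idl\<^bsub>ring_at R \<pp>\<^esub> ((\<lambda>r. fraction (carrier R - \<pp>) (regular_module R) r \<one>\<^bsub>R\<^esub>) ` \<aa>)"

definition Supp :: "('r, 'x) ring_scheme \<Rightarrow> ('r, 'm, 'y) module_scheme \<Rightarrow> 'r set set"
  where "Supp R M = {\<pp>. primeideal \<pp> R \<and> \<not> zero_module (module_at R \<pp> M)}"

definition primes_containing :: "('r, 'x) ring_scheme \<Rightarrow> 'r set \<Rightarrow> 'r set set"
  where "primes_containing R \<aa> = {\<pp>. primeideal \<pp> R \<and> \<aa> \<subseteq> \<pp>}"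

end

theory Submission
  imports Defs "HOL-Algebra.Free_Abelian_Groups"
begin

text \<open>Let \<open>ys\<close> generate \<open>\<aa>\<close>. The vanishing of \<open>H\<^sup>i\<close> of a module is equivalent to an elementary condition on
  Koszul complexes: every degree \<open>i\<close> cocycle for the powers \<open>ys\<^sup>n\<close> becomes a coboundary for some higher powers
  \<open>ys\<^bsup>n+m\<^esup>\<close>. Both sides satisfy the same dimension shift along an injective resolution, because over a
  Noetherian ring the Koszul condition holds in positive degrees for injective modules.

  The Koszul condition passes to localizations. Hence \<open>(M\<^sub>i)\<^sub>\<pp>\<close> has cohomological dimension at most \<open>i\<close>, and
  \<open>(M\<^sub>i/M\<^sub>i\<^sub>-\<^sub>1)\<^sub>\<pp>\<close> has cohomology in degree \<open>i\<close> only. That \<open>(M\<^sub>i)\<^sub>\<pp>\<close> is the largest such submodule follows by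
  descending along the filtration from a vanishing statement over a Noetherian local ring: a homomorphism
  \<open>f : N \<rightarrow> Q\<close> to a finitely generated module is zero if the cohomology of \<open>N\<close> vanishes in all degrees \<open>\<ge> j\<close> and
  that of \<open>Q\<close> in all degrees \<open>< j\<close>. For this, an element \<open>w\<close> of \<open>N\<close> is extended to a cocycle of the total complex
  of two Koszul complexes; its components of degree \<open>\<ge> j\<close> are cleared over \<open>N\<close>, and after applying \<open>f\<close> those of
  degree \<open>< j\<close> are cleared over \<open>Q\<close>. What remains shows that \<open>f w\<close> lies in \<open>ys\<^sup>n Q\<close> for every \<open>n\<close>, so it is zero by
  Krull's intersection theorem. The case \<open>f = id\<close> shows that a nonzero \<open>Q\<close> has some nonzero cohomology.\<close>

section \<open>Koszul cochains\<close>

text \<open>Local cohomology is defined through one chosen injective resolution, in a type that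
  depends on the element types of ring and module, so neither homomorphisms nor localizations act on
  it directly. The Koszul condition mentions only finitely many elements of the module itself and
  can be compared across types. The obstacle is maximality. A submodule of the localized module is
  the localization of its preimage in \<open>M\<close>, but that preimage can have larger
  cohomological dimension, so maximality over \<open>R\<close> says nothing about it. What forces a
  submodule of small cohomological dimension down the filtration is the shape of the quotients: it
  maps into each higher quotient from cohomology in low degrees only to cohomology in a single
  higher degree. The vanishing of such maps is a local statement. As \<open>\<pp>\<close> contains
  \<open>\<aa>\<close>, the generators of the extended ideal lie in the Jacobson radical of the
  localized ring. Over \<open>R\<close> itself the vanishing can fail, since a module supported away
  from the primes containing \<open>\<aa>\<close> has no cohomology at all.\<close>

text \<open>A Koszul cochain is a function on bool lists of the length of the sequence; such a list is the
  characteristic function of a basis element of the exterior algebra. \<open>koszul_cone M zs w g\<close> adds the Koszul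
  differential of \<open>w\<close> and the values \<open>g\<close> of a further differential, with the signs of a total complex.\<close>

primrec koszul_cone :: "('r, 'm, 'y) module_scheme \<Rightarrow> 'r list \<Rightarrow> (bool list \<Rightarrow> 'm) \<Rightarrow> (bool list \<Rightarrow> 'm) \<Rightarrow> bool list \<Rightarrow> 'm" where
  "koszul_cone M [] w g bs = g bs"
| "koszul_cone M (z # zs) w g bs = (if hd bs
     then z \<odot>\<^bsub>M\<^esub> w (False # tl bs) \<ominus>\<^bsub>M\<^esub> koszul_cone M zs (\<lambda>cs. w (True # cs)) (\<lambda>cs. g (True # cs)) (tl bs)
     else koszul_cone M zs (\<lambda>cs. w (False # cs)) (\<lambda>cs. g (False # cs)) (tl bs))"

definition koszul_d :: "('r, 'm, 'y) module_scheme \<Rightarrow> 'r list \<Rightarrow> (bool list \<Rightarrow> 'm) \<Rightarrow> bool list \<Rightarrow> 'm" where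
  "koszul_d M zs w bs = koszul_cone M zs w (\<lambda>_. \<zero>\<^bsub>M\<^esub>) bs"

text \<open>Lists of every length are constrained, so that closure needs no side condition on
  lengths; the degree and cocycle conditions below look at lists of the right length only.\<close>

definition cochain :: "('r, 'm, 'y) module_scheme \<Rightarrow> (bool list \<Rightarrow> 'm) \<Rightarrow> bool" where
  "cochain M w \<longleftrightarrow> (\<forall>bs. w bs \<in> carrier M)"

abbreviation weight :: "bool list \<Rightarrow> nat" where "weight bs \<equiv> count_list bs True"

text \<open>The scalar by which the transition map between Koszul complexes acts on the basis
  element \<open>bs\<close>. For the powers \<open>ys^m\<close> it leads from exponent
  \<open>n\<close> to exponent \<open>n + m\<close>, see \<open>koszul_d_transition\<close>.\<close>

primrec koszul_prod :: "('r, 'x) ring_scheme \<Rightarrow> 'r list \<Rightarrow> bool list \<Rightarrow> 'r" where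
  "koszul_prod R [] bs = \<one>\<^bsub>R\<^esub>"
| "koszul_prod R (z # zs) bs = (if hd bs then z \<otimes>\<^bsub>R\<^esub> koszul_prod R zs (tl bs) else koszul_prod R zs (tl bs))"

definition powers :: "('r, 'x) ring_scheme \<Rightarrow> nat \<Rightarrow> 'r list \<Rightarrow> 'r list" where
  "powers R n ys = map (\<lambda>y. y [^]\<^bsub>R\<^esub> n) ys"

text \<open>The degree \<open>p\<close> cohomology of the colimit over \<open>n\<close> of the Koszul complexes of \<open>ys\<^sup>n\<close> vanishes.
  Writing \<open>Suc (weight bs) \<noteq> p\<close> instead of \<open>weight bs \<noteq> p - 1\<close> makes \<open>v\<close> zero for \<open>p = 0\<close>.\<close>

definition koszul_vanishes :: "('r, 'x) ring_scheme \<Rightarrow> 'r list \<Rightarrow> ('r, 'm, 'y) module_scheme \<Rightarrow> nat \<Rightarrow> bool" where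
  "koszul_vanishes R ys M p \<longleftrightarrow> (\<forall>n w. cochain M w \<longrightarrow>
     (\<forall>bs. length bs = length ys \<longrightarrow> weight bs \<noteq> p \<longrightarrow> w bs = \<zero>\<^bsub>M\<^esub>) \<longrightarrow>
     (\<forall>bs. length bs = length ys \<longrightarrow> koszul_d M (powers R n ys) w bs = \<zero>\<^bsub>M\<^esub>) \<longrightarrow>
     (\<exists>m v. cochain M v \<and> (\<forall>bs. length bs = length ys \<longrightarrow> Suc (weight bs) \<noteq> p \<longrightarrow> v bs = \<zero>\<^bsub>M\<^esub>) \<and>
       (\<forall>bs. length bs = length ys \<longrightarrow> koszul_prod R (powers R m ys) bs \<odot>\<^bsub>M\<^esub> w bs = koszul_d M (powers R (n + m) ys) v bs)))"

lemma powers_Nil [simp]: "powers R n [] = []" and powers_Cons [simp]: "powers R n (y # ys) = (y [^]\<^bsub>R\<^esub> n) # powers R n ys"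
  and length_powers [simp]: "length (powers R n ys) = length ys"
  by (auto simp: powers_def)

lemma (in ring) powers_closed: "set ys \<subseteq> carrier R \<Longrightarrow> set (powers R n ys) \<subseteq> carrier R"
  by (auto simp: powers_def)

lemma koszul_d_Nil [simp]: "koszul_d M [] w bs = \<zero>\<^bsub>M\<^esub>" by (simp add: koszul_d_def)

lemma koszul_d_Cons [simp]: "koszul_d M (z # zs) w (b # bs) = (if b
     then z \<odot>\<^bsub>M\<^esub> w (False # bs) \<ominus>\<^bsub>M\<^esub> koszul_d M zs (\<lambda>cs. w (True # cs)) bs
     else koszul_d M zs (\<lambda>cs. w (False # cs)) bs)"
  by (simp add: koszul_d_def)

lemma koszul_d_Cons': "koszul_d M (z # zs) w bs = (if hd bs
     then z \<odot>\<^bsub>M\<^esub> w (False # tl bs) \<ominus>\<^bsub>M\<^esub> koszul_d M zs (\<lambda>cs. w (True # cs)) (tl bs)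
     else koszul_d M zs (\<lambda>cs. w (False # cs)) (tl bs))"
  by (simp add: koszul_d_def)

lemma cochainD: "cochain M w \<Longrightarrow> w bs \<in> carrier M" by (simp add: cochain_def)

lemma koszul_cone_cong:
  assumes "length bs = length zs" "\<And>bs. length bs = length zs \<Longrightarrow> w bs = w' bs" "\<And>bs. length bs = length zs \<Longrightarrow> g bs = g' bs"
  shows "koszul_cone M zs w g bs = koszul_cone M zs w' g' bs"
  using assms
proof (induction zs arbitrary: w w' g g' bs)
  case (Cons z zs)
  have "koszul_cone M zs (\<lambda>cs. w (b # cs)) (\<lambda>cs. g (b # cs)) (tl bs) = koszul_cone M zs (\<lambda>cs. w' (b # cs)) (\<lambda>cs. g' (b # cs)) (tl bs)" for b
    by (rule Cons.IH) (use Cons.prems in auto)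
  moreover have "w (False # tl bs) = w' (False # tl bs)" using Cons.prems by auto
  ultimately show ?case by simp
qed simp

lemma koszul_d_cong:
  assumes "length bs = length zs" "\<And>bs. length bs = length zs \<Longrightarrow> w bs = w' bs"
  shows "koszul_d M zs w bs = koszul_d M zs w' bs"
  unfolding koszul_d_def by (rule koszul_cone_cong) (use assms in auto)

section \<open>Linearity of the Koszul differential and transition maps\<close>

context module begin

lemma diff_closed [simp]: "x \<in> carrier M \<Longrightarrow> y \<in> carrier M \<Longrightarrow> x \<ominus>\<^bsub>M\<^esub> y \<in> carrier M"
  by (simp add: a_minus_def)

lemma smult_diff: "a \<in> carrier R \<Longrightarrow> x \<in> carrier M \<Longrightarrow> y \<in> carrier M \<Longrightarrow> a \<odot>\<^bsub>M\<^esub> (x \<ominus>\<^bsub>M\<^esub> y) = a \<odot>\<^bsub>M\<^esub> x \<ominus>\<^bsub>M\<^esub> a \<odot>\<^bsub>M\<^esub> y"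
  by (simp add: a_minus_def smult_r_distr smult_r_minus)

lemma diff_eq_zero_iff: "x \<in> carrier M \<Longrightarrow> y \<in> carrier M \<Longrightarrow> x \<ominus>\<^bsub>M\<^esub> y = \<zero>\<^bsub>M\<^esub> \<longleftrightarrow> x = y"
  by (metis M.minus_equality M.minus_minus M.a_inv_closed M.r_neg a_minus_def)

lemma zero_diff_zero [simp]: "\<zero>\<^bsub>M\<^esub> \<ominus>\<^bsub>M\<^esub> \<zero>\<^bsub>M\<^esub> = \<zero>\<^bsub>M\<^esub>"
  by (simp add: a_minus_def)

lemma diff_zero [simp]: "x \<in> carrier M \<Longrightarrow> x \<ominus>\<^bsub>M\<^esub> \<zero>\<^bsub>M\<^esub> = x"
  by (simp add: a_minus_def)

lemma diff_self [simp]: "x \<in> carrier M \<Longrightarrow> x \<ominus>\<^bsub>M\<^esub> x = \<zero>\<^bsub>M\<^esub>"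
  by (simp add: a_minus_def M.r_neg)

lemma smult_commute: "a \<in> carrier R \<Longrightarrow> b \<in> carrier R \<Longrightarrow> x \<in> carrier M \<Longrightarrow> a \<odot>\<^bsub>M\<^esub> (b \<odot>\<^bsub>M\<^esub> x) = b \<odot>\<^bsub>M\<^esub> (a \<odot>\<^bsub>M\<^esub> x)"
  by (metis smult_assoc1 R.m_comm)

lemma koszul_cone_closed [simp]:
  assumes "set zs \<subseteq> carrier R" "\<And>bs. w bs \<in> carrier M" "\<And>bs. g bs \<in> carrier M"
  shows "koszul_cone M zs w g bs \<in> carrier M"
  using assms by (induction zs arbitrary: w g bs) auto

lemma koszul_d_closed [simp]: "set zs \<subseteq> carrier R \<Longrightarrow> cochain M w \<Longrightarrow> koszul_d M zs w bs \<in> carrier M"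
  unfolding koszul_d_def by (rule koszul_cone_closed) (auto simp: cochain_def)

lemma koszul_cone_add:
  assumes "set zs \<subseteq> carrier R" "\<And>bs. w bs \<in> carrier M" "\<And>bs. g bs \<in> carrier M" "\<And>bs. w' bs \<in> carrier M" "\<And>bs. g' bs \<in> carrier M"
  shows "koszul_cone M zs (\<lambda>bs. w bs \<oplus>\<^bsub>M\<^esub> w' bs) (\<lambda>bs. g bs \<oplus>\<^bsub>M\<^esub> g' bs) bs = koszul_cone M zs w g bs \<oplus>\<^bsub>M\<^esub> koszul_cone M zs w' g' bs"
  using assms
proof (induction zs arbitrary: w g w' g' bs)
  case (Cons z zs)
  have c: "a \<ominus>\<^bsub>M\<^esub> b \<oplus>\<^bsub>M\<^esub> (c \<ominus>\<^bsub>M\<^esub> d) = a \<oplus>\<^bsub>M\<^esub> c \<ominus>\<^bsub>M\<^esub> (b \<oplus>\<^bsub>M\<^esub> d)"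
    if "a \<in> carrier M" "b \<in> carrier M" "c \<in> carrier M" "d \<in> carrier M" for a b c d
    using that by (simp add: a_minus_def M.minus_add M.a_ac)
  show ?case using Cons.prems by (simp add: Cons.IH smult_r_distr c)
qed simp

lemma koszul_cone_diff:
  assumes "set zs \<subseteq> carrier R" "\<And>bs. w bs \<in> carrier M" "\<And>bs. g bs \<in> carrier M" "\<And>bs. w' bs \<in> carrier M" "\<And>bs. g' bs \<in> carrier M"
  shows "koszul_cone M zs (\<lambda>bs. w bs \<ominus>\<^bsub>M\<^esub> w' bs) (\<lambda>bs. g bs \<ominus>\<^bsub>M\<^esub> g' bs) bs = koszul_cone M zs w g bs \<ominus>\<^bsub>M\<^esub> koszul_cone M zs w' g' bs"
  using assms
proof (induction zs arbitrary: w g w' g' bs)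
  case (Cons z zs)
  have c: "a \<ominus>\<^bsub>M\<^esub> b \<ominus>\<^bsub>M\<^esub> (c \<ominus>\<^bsub>M\<^esub> d) = a \<ominus>\<^bsub>M\<^esub> c \<ominus>\<^bsub>M\<^esub> (b \<ominus>\<^bsub>M\<^esub> d)"
    if "a \<in> carrier M" "b \<in> carrier M" "c \<in> carrier M" "d \<in> carrier M" for a b c d
    using that by (simp add: a_minus_def M.minus_add M.a_ac M.minus_minus)
  show ?case using Cons.prems by (simp add: Cons.IH smult_diff c)
qed simp

lemma koszul_d_add:
  assumes "set zs \<subseteq> carrier R" "cochain M w" "cochain M w'"
  shows "koszul_d M zs (\<lambda>bs. w bs \<oplus>\<^bsub>M\<^esub> w' bs) bs = koszul_d M zs w bs \<oplus>\<^bsub>M\<^esub> koszul_d M zs w' bs"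
  using koszul_cone_add[of zs w "\<lambda>_. \<zero>\<^bsub>M\<^esub>" w' "\<lambda>_. \<zero>\<^bsub>M\<^esub>"] assms by (simp add: koszul_d_def cochain_def)

lemma koszul_d_diff:
  assumes "set zs \<subseteq> carrier R" "cochain M w" "cochain M w'"
  shows "koszul_d M zs (\<lambda>bs. w bs \<ominus>\<^bsub>M\<^esub> w' bs) bs = koszul_d M zs w bs \<ominus>\<^bsub>M\<^esub> koszul_d M zs w' bs"
  using koszul_cone_diff[of zs w "\<lambda>_. \<zero>\<^bsub>M\<^esub>" w' "\<lambda>_. \<zero>\<^bsub>M\<^esub>"] assms by (simp add: koszul_d_def cochain_def)

lemma koszul_cone_zero:
  assumes "set zs \<subseteq> carrier R"
  shows "koszul_cone M zs (\<lambda>_. \<zero>\<^bsub>M\<^esub>) (\<lambda>_. \<zero>\<^bsub>M\<^esub>) bs = \<zero>\<^bsub>M\<^esub>"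
  using assms by (induction zs arbitrary: bs) auto

lemma koszul_d_zero:
  assumes "set zs \<subseteq> carrier R" "length bs = length zs" "\<And>bs. length bs = length zs \<Longrightarrow> w bs = \<zero>\<^bsub>M\<^esub>"
  shows "koszul_d M zs w bs = \<zero>\<^bsub>M\<^esub>"
  using koszul_d_cong[OF assms(2), of w "\<lambda>_. \<zero>\<^bsub>M\<^esub>" M] assms koszul_cone_zero[of zs bs] by (simp add: koszul_d_def)

lemma koszul_cone_smult:
  assumes "set zs \<subseteq> carrier R" "r \<in> carrier R" "\<And>bs. w bs \<in> carrier M" "\<And>bs. g bs \<in> carrier M"
  shows "koszul_cone M zs (\<lambda>bs. r \<odot>\<^bsub>M\<^esub> w bs) (\<lambda>bs. r \<odot>\<^bsub>M\<^esub> g bs) bs = r \<odot>\<^bsub>M\<^esub> koszul_cone M zs w g bs"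
  using assms
proof (induction zs arbitrary: w g bs)
  case (Cons z zs)
  then show ?case by (simp add: smult_diff smult_commute)
qed simp

lemma koszul_d_smult:
  assumes "set zs \<subseteq> carrier R" "r \<in> carrier R" "cochain M w"
  shows "koszul_d M zs (\<lambda>bs. r \<odot>\<^bsub>M\<^esub> w bs) bs = r \<odot>\<^bsub>M\<^esub> koszul_d M zs w bs"
  using koszul_cone_smult[of zs r w "\<lambda>_. \<zero>\<^bsub>M\<^esub>"] assms by (simp add: koszul_d_def cochain_def)

text \<open>For a list starting with \<open>True\<close> the value is
  \<open>z d(w_F) - d(z w_F - d(w_T))\<close>, where \<open>w_F\<close> and \<open>w_T\<close> are
  the two halves of \<open>w\<close>. The terms in \<open>w_F\<close> cancel by linearity and the
  remaining one vanishes by induction.\<close>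

lemma koszul_d_koszul_d:
  assumes "set zs \<subseteq> carrier R" "cochain M w" "length bs = length zs"
  shows "koszul_d M zs (koszul_d M zs w) bs = \<zero>\<^bsub>M\<^esub>"
  using assms
proof (induction zs arbitrary: w bs)
  case (Cons z zs)
  then obtain b cs where bs: "bs = b # cs" "length cs = length zs" by (cases bs) auto
  have c: "cochain M (\<lambda>cs. w (b # cs))" for b using Cons.prems by (simp add: cochain_def)
  have c': "cochain M (koszul_d M zs (\<lambda>cs. w (b # cs)))" for b
    unfolding cochain_def using c Cons.prems by (auto intro!: koszul_d_closed)
  have c'': "cochain M (\<lambda>cs. z \<odot>\<^bsub>M\<^esub> w (b # cs))" for b using Cons.prems by (simp add: cochain_def)
  have IH: "koszul_d M zs (koszul_d M zs (\<lambda>cs. w (b # cs))) cs = \<zero>\<^bsub>M\<^esub>" for b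
    using Cons.IH[OF _ c] Cons.prems bs by simp
  show ?case
    using Cons.prems c c' c'' bs by (simp add: koszul_d_diff koszul_d_smult IH)
qed simp

lemma koszul_prod_closed [simp]: "set zs \<subseteq> carrier R \<Longrightarrow> koszul_prod R zs bs \<in> carrier R"
  by (induction zs arbitrary: bs) auto

text \<open>Where the differential turns an entry to \<open>True\<close>, the new complex multiplies
  by \<open>z \<otimes> x\<close> instead of \<open>z\<close>, and on the other side
  \<open>koszul_prod\<close> gains the factor \<open>x\<close>. So these coefficients define a map
  of complexes.\<close>

lemma koszul_d_transition:
  assumes "set zs \<subseteq> carrier R" "set xs \<subseteq> carrier R" "cochain M w" "length bs = length zs" "length xs = length zs"
  shows "koszul_d M (map2 (\<otimes>) zs xs) (\<lambda>bs. koszul_prod R xs bs \<odot>\<^bsub>M\<^esub> w bs) bs = koszul_prod R xs bs \<odot>\<^bsub>M\<^esub> koszul_d M zs w bs"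
  using assms
proof (induction zs arbitrary: xs w bs)
  case (Cons z zs)
  then obtain b cs where bs: "bs = b # cs" "length cs = length zs" by (cases bs) auto
  from Cons.prems obtain x xs' where xs: "xs = x # xs'" "length xs' = length zs" by (cases xs) auto
  have c: "cochain M (\<lambda>cs. w (b # cs))" for b using Cons.prems by (simp add: cochain_def)
  have c': "cochain M (\<lambda>cs. koszul_prod R xs' cs \<odot>\<^bsub>M\<^esub> w (b # cs))" for b using Cons.prems xs by (simp add: cochain_def)
  have IH: "koszul_d M (map2 (\<otimes>) zs xs') (\<lambda>bs. koszul_prod R xs' bs \<odot>\<^bsub>M\<^esub> w (b # bs)) cs = koszul_prod R xs' cs \<odot>\<^bsub>M\<^esub> koszul_d M zs (\<lambda>bs. w (b # bs)) cs" for b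
    using Cons.IH[OF _ _ c bs(2) xs(2)] Cons.prems xs by simp
  have s: "set (map2 (\<otimes>) zs xs') \<subseteq> carrier R"
    using Cons.prems xs by (auto simp: set_zip intro!: R.m_closed)
  have wc: "w bs \<in> carrier M" for bs using Cons.prems by (simp add: cochain_def)
  have k: "koszul_prod R xs' cs \<in> carrier R" "x \<in> carrier R" "z \<in> carrier R" using Cons.prems xs by auto
  have kdc: "koszul_d M zs (\<lambda>bs. w (b # bs)) cs \<in> carrier M" for b using Cons.prems c by (auto intro!: koszul_d_closed)
  have eq: "koszul_d M (map2 (\<otimes>) zs xs') (\<lambda>bs. x \<otimes> koszul_prod R xs' bs \<odot>\<^bsub>M\<^esub> w (True # bs)) cs
      = x \<odot>\<^bsub>M\<^esub> koszul_d M (map2 (\<otimes>) zs xs') (\<lambda>bs. koszul_prod R xs' bs \<odot>\<^bsub>M\<^esub> w (True # bs)) cs"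
    using Cons.prems xs by (subst koszul_d_smult[OF s _ c', symmetric]) (auto simp: smult_assoc1 wc)
  show ?case
    using bs xs k kdc wc
    by (simp add: eq IH smult_diff smult_assoc1 smult_commute[of "koszul_prod R xs' cs"] smult_commute[of z x])
qed simp

lemma powers_add: "set ys \<subseteq> carrier R \<Longrightarrow> powers R (n + m) ys = map2 (\<otimes>) (powers R n ys) (powers R m ys)"
  by (induction ys) (auto simp: R.nat_pow_mult)

lemma koszul_d_transition_powers:
  assumes "set ys \<subseteq> carrier R" "cochain M w" "length bs = length ys"
  shows "koszul_d M (powers R (n + m) ys) (\<lambda>bs. koszul_prod R (powers R m ys) bs \<odot>\<^bsub>M\<^esub> w bs) bs = koszul_prod R (powers R m ys) bs \<odot>\<^bsub>M\<^esub> koszul_d M (powers R n ys) w bs"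
  using koszul_d_transition[of "powers R n ys" "powers R m ys" w bs] assms R.powers_closed[OF assms(1)] by (simp add: powers_add)

lemma koszul_prod_powers_add:
  assumes "set ys \<subseteq> carrier R"
  shows "koszul_prod R (powers R (n + m) ys) bs = koszul_prod R (powers R n ys) bs \<otimes> koszul_prod R (powers R m ys) bs"
  using assms
proof (induction ys arbitrary: bs)
  case (Cons y ys)
  have "koszul_prod R (powers R k ys) cs \<in> carrier R" for k cs using Cons.prems R.powers_closed by auto
  then show ?case using Cons by (simp add: R.nat_pow_mult[symmetric] R.m_ac)
qed simp

lemma koszul_prod_transition_transition:
  assumes "set ys \<subseteq> carrier R" "x \<in> carrier M"
  shows "koszul_prod R (powers R m ys) bs \<odot>\<^bsub>M\<^esub> (koszul_prod R (powers R n ys) bs \<odot>\<^bsub>M\<^esub> x) = koszul_prod R (powers R (n + m) ys) bs \<odot>\<^bsub>M\<^esub> x"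
  using assms R.powers_closed by (metis koszul_prod_powers_add koszul_prod_closed smult_assoc1 R.m_comm)

end

text \<open>Two rings and an indexwise condition serve homomorphisms over one ring as well as
  localization, where the entries of \<open>zs'\<close> are the images of those of
  \<open>zs\<close>.\<close>

lemma koszul_cone_map:
  assumes "module R M" "module R' M'" "set zs \<subseteq> carrier R" "length zs' = length zs"
    and f: "\<And>x. x \<in> carrier M \<Longrightarrow> f x \<in> carrier M'"
      "\<And>x y. x \<in> carrier M \<Longrightarrow> y \<in> carrier M \<Longrightarrow> f (x \<oplus>\<^bsub>M\<^esub> y) = f x \<oplus>\<^bsub>M'\<^esub> f y"
      "\<And>i x. i < length zs \<Longrightarrow> x \<in> carrier M \<Longrightarrow> f (zs ! i \<odot>\<^bsub>M\<^esub> x) = zs' ! i \<odot>\<^bsub>M'\<^esub> f x"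
    and "\<And>bs. w bs \<in> carrier M" "\<And>bs. g bs \<in> carrier M"
  shows "f (koszul_cone M zs w g bs) = koszul_cone M' zs' (\<lambda>bs. f (w bs)) (\<lambda>bs. f (g bs)) bs"
proof -
  interpret M: module R M by fact
  interpret M': module R' M' by fact
  have f0: "f \<zero>\<^bsub>M\<^esub> = \<zero>\<^bsub>M'\<^esub>"
    using f(2)[of "\<zero>\<^bsub>M\<^esub>" "\<zero>\<^bsub>M\<^esub>"] f(1)[of "\<zero>\<^bsub>M\<^esub>"] by (simp add: M'.add.l_cancel_one')
  have fm: "f (x \<ominus>\<^bsub>M\<^esub> y) = f x \<ominus>\<^bsub>M'\<^esub> f y" if "x \<in> carrier M" "y \<in> carrier M" for x y
  proof -
    have "f (x \<ominus>\<^bsub>M\<^esub> y) \<oplus>\<^bsub>M'\<^esub> f y = f x"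
      using that f(2)[of "x \<ominus>\<^bsub>M\<^esub> y" y] by (simp add: a_minus_def M.a_assoc M.l_neg)
    then show ?thesis using that f(1) M.diff_closed
      by (metis M'.add.inv_solve_right a_minus_def)
  qed
  show ?thesis using assms(3,4) f(3) assms(8,9)
  proof (induction zs arbitrary: zs' w g bs)
    case (Cons z zs)
    then obtain z' zs'' where z: "zs' = z' # zs''" "length zs'' = length zs" by (cases zs') auto
    have zz: "f (z \<odot>\<^bsub>M\<^esub> x) = z' \<odot>\<^bsub>M'\<^esub> f x" if "x \<in> carrier M" for x
      using Cons.prems(3)[of 0 x] that z by simp
    have IH: "f (koszul_cone M zs (\<lambda>cs. w (b # cs)) (\<lambda>cs. g (b # cs)) bs) = koszul_cone M' zs'' (\<lambda>cs. f (w (b # cs))) (\<lambda>cs. f (g (b # cs))) bs" for b bs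
      using Cons.prems(3)[of "Suc _"] Cons.prems z by (intro Cons.IH) auto
    show ?case using z Cons.prems by (simp add: IH fm zz)
  qed simp
qed

section \<open>Degrees, cocycles and the direct system of powers\<close>

definition in_degree :: "('r, 'm, 'y) module_scheme \<Rightarrow> nat \<Rightarrow> nat \<Rightarrow> (bool list \<Rightarrow> 'm) \<Rightarrow> bool" where
  "in_degree M t p w \<longleftrightarrow> (\<forall>bs. length bs = t \<longrightarrow> weight bs \<noteq> p \<longrightarrow> w bs = \<zero>\<^bsub>M\<^esub>)"

definition in_pred_degree :: "('r, 'm, 'y) module_scheme \<Rightarrow> nat \<Rightarrow> nat \<Rightarrow> (bool list \<Rightarrow> 'm) \<Rightarrow> bool" where
  "in_pred_degree M t p w \<longleftrightarrow> (\<forall>bs. length bs = t \<longrightarrow> Suc (weight bs) \<noteq> p \<longrightarrow> w bs = \<zero>\<^bsub>M\<^esub>)"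

lemma in_pred_degree_Suc: "in_pred_degree M t (Suc p) w = in_degree M t p w" by (simp add: in_degree_def in_pred_degree_def)

definition cocycle :: "('r, 'm, 'y) module_scheme \<Rightarrow> 'r list \<Rightarrow> (bool list \<Rightarrow> 'm) \<Rightarrow> bool" where
  "cocycle M zs w \<longleftrightarrow> (\<forall>bs. length bs = length zs \<longrightarrow> koszul_d M zs w bs = \<zero>\<^bsub>M\<^esub>)"

text \<open>The map from the complex of \<open>ys^n\<close> to that of \<open>ys^(n+m)\<close>; its
  coefficients are the same for every \<open>n\<close>.\<close>

definition transition :: "('r, 'x) ring_scheme \<Rightarrow> ('r, 'm, 'y) module_scheme \<Rightarrow> 'r list \<Rightarrow> nat \<Rightarrow> (bool list \<Rightarrow> 'm) \<Rightarrow> bool list \<Rightarrow> 'm" where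
  "transition R M ys m w bs = koszul_prod R (powers R m ys) bs \<odot>\<^bsub>M\<^esub> w bs"

lemma koszul_vanishes_iff: "koszul_vanishes R ys M p \<longleftrightarrow> (\<forall>n w. cochain M w \<longrightarrow> in_degree M (length ys) p w \<longrightarrow> cocycle M (powers R n ys) w \<longrightarrow>
     (\<exists>m v. cochain M v \<and> in_pred_degree M (length ys) p v \<and>
       (\<forall>bs. length bs = length ys \<longrightarrow> transition R M ys m w bs = koszul_d M (powers R (n + m) ys) v bs)))"
  unfolding koszul_vanishes_def in_degree_def in_pred_degree_def cocycle_def transition_def by simp

lemma koszul_vanishes_D:
  assumes "koszul_vanishes R ys M p" "cochain M w" "in_degree M (length ys) p w" "cocycle M (powers R n ys) w"
  obtains m v where "cochain M v" "in_pred_degree M (length ys) p v"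
    "\<And>bs. length bs = length ys \<Longrightarrow> transition R M ys m w bs = koszul_d M (powers R (n + m) ys) v bs"
  using assms unfolding koszul_vanishes_iff by blast

context module begin

text \<open>The differential at \<open>bs\<close> reads only lists obtained from \<open>bs\<close>
  by turning one \<open>True\<close> into \<open>False\<close>.\<close>

lemma koszul_d_cong_deg:
  assumes "set zs \<subseteq> carrier R" "length bs = length zs"
    "\<And>cs. length cs = length zs \<Longrightarrow> Suc (weight cs) = weight bs \<Longrightarrow> w cs = w' cs"
  shows "koszul_d M zs w bs = koszul_d M zs w' bs"
  using assms
proof (induction zs arbitrary: w w' bs)
  case (Cons z zs)
  then obtain b cs where bs: "bs = b # cs" "length cs = length zs" by (cases bs) auto
  have "koszul_d M zs (\<lambda>cs. w (b # cs)) cs = koszul_d M zs (\<lambda>cs. w' (b # cs)) cs"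
    by (rule Cons.IH) (use Cons.prems bs in auto)
  moreover have "b \<Longrightarrow> w (False # cs) = w' (False # cs)" using Cons.prems bs by auto
  ultimately show ?case using bs by auto
qed simp

lemma koszul_d_in_degree:
  assumes "set zs \<subseteq> carrier R" "in_degree M (length zs) p w"
  shows "in_degree M (length zs) (Suc p) (koszul_d M zs w)"
  unfolding in_degree_def
proof (intro allI impI)
  fix bs :: "bool list" assume bs: "length bs = length zs" "weight bs \<noteq> Suc p"
  have "koszul_d M zs w bs = koszul_d M zs (\<lambda>_. \<zero>\<^bsub>M\<^esub>) bs"
    by (rule koszul_d_cong_deg) (use assms bs in \<open>auto simp: in_degree_def\<close>)
  then show "koszul_d M zs w bs = \<zero>\<^bsub>M\<^esub>" using koszul_d_zero[of zs bs "\<lambda>_. \<zero>\<^bsub>M\<^esub>"] assms bs by simp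
qed

lemma cochain_koszul_d [simp, intro]: "set zs \<subseteq> carrier R \<Longrightarrow> cochain M w \<Longrightarrow> cochain M (koszul_d M zs w)"
  unfolding cochain_def by (auto intro!: koszul_d_closed simp: cochain_def)

lemma cochain_transition [simp, intro]: "set ys \<subseteq> carrier R \<Longrightarrow> cochain M w \<Longrightarrow> cochain M (transition R M ys m w)"
  unfolding cochain_def transition_def by (auto intro!: smult_closed koszul_prod_closed R.powers_closed)

lemma cochain_diff [simp, intro]: "cochain M v \<Longrightarrow> cochain M w \<Longrightarrow> cochain M (\<lambda>bs. v bs \<ominus>\<^bsub>M\<^esub> w bs)"
  and cochain_add [simp, intro]: "cochain M v \<Longrightarrow> cochain M w \<Longrightarrow> cochain M (\<lambda>bs. v bs \<oplus>\<^bsub>M\<^esub> w bs)"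
  and cochain_zero [simp, intro]: "cochain M (\<lambda>_. \<zero>\<^bsub>M\<^esub>)"
  by (auto simp: cochain_def)

lemma transition_zero: "set ys \<subseteq> carrier R \<Longrightarrow> w bs = \<zero>\<^bsub>M\<^esub> \<Longrightarrow> transition R M ys m w bs = \<zero>\<^bsub>M\<^esub>"
  unfolding transition_def by (auto intro!: smult_r_null koszul_prod_closed R.powers_closed)

lemma transition_in_degree: "set ys \<subseteq> carrier R \<Longrightarrow> in_degree M t p w \<Longrightarrow> in_degree M t p (transition R M ys m w)"
  and transition_in_pred_degree: "set ys \<subseteq> carrier R \<Longrightarrow> in_pred_degree M t p w \<Longrightarrow> in_pred_degree M t p (transition R M ys m w)"
  by (auto simp: in_degree_def in_pred_degree_def transition_zero)

lemma koszul_d_of_transition: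
  assumes "set ys \<subseteq> carrier R" "cochain M w" "length bs = length ys"
  shows "koszul_d M (powers R (n + m) ys) (transition R M ys m w) bs = transition R M ys m (koszul_d M (powers R n ys) w) bs"
  unfolding transition_def using koszul_d_transition_powers[OF assms] .

lemma transition_transition:
  assumes "set ys \<subseteq> carrier R" "cochain M w"
  shows "transition R M ys m (transition R M ys n w) bs = transition R M ys (n + m) w bs"
  unfolding transition_def using assms by (auto simp: cochain_def intro!: koszul_prod_transition_transition)

lemma transition_add:
  assumes "set ys \<subseteq> carrier R" "cochain M v" "cochain M w"
  shows "transition R M ys m (\<lambda>bs. v bs \<oplus>\<^bsub>M\<^esub> w bs) bs = transition R M ys m v bs \<oplus>\<^bsub>M\<^esub> transition R M ys m w bs"
  unfolding transition_def using assms by (auto simp: cochain_def intro!: smult_r_distr koszul_prod_closed R.powers_closed)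

lemma cocycle_koszul_d: "set zs \<subseteq> carrier R \<Longrightarrow> cochain M w \<Longrightarrow> cocycle M zs (koszul_d M zs w)"
  unfolding cocycle_def by (auto intro: koszul_d_koszul_d)

lemma in_degree_diff: "in_degree M t p w \<Longrightarrow> in_degree M t p v \<Longrightarrow> in_degree M t p (\<lambda>bs. w bs \<ominus>\<^bsub>M\<^esub> v bs)"
  and in_pred_degree_diff: "in_pred_degree M t p w \<Longrightarrow> in_pred_degree M t p v \<Longrightarrow> in_pred_degree M t p (\<lambda>bs. w bs \<ominus>\<^bsub>M\<^esub> v bs)"
  and in_degree_add: "in_degree M t p w \<Longrightarrow> in_degree M t p v \<Longrightarrow> in_degree M t p (\<lambda>bs. w bs \<oplus>\<^bsub>M\<^esub> v bs)"
  and in_pred_degree_add: "in_pred_degree M t p w \<Longrightarrow> in_pred_degree M t p v \<Longrightarrow> in_pred_degree M t p (\<lambda>bs. w bs \<oplus>\<^bsub>M\<^esub> v bs)"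
  by (auto simp: in_degree_def in_pred_degree_def)

text \<open>A list has no more \<open>True\<close> entries than its length, so a cochain of degree
  \<open>p\<close> is zero on all lists that count. This bounds the cohomological dimension by the
  number of generators.\<close>

lemma koszul_vanishes_large:
  assumes "set ys \<subseteq> carrier R" "length ys < p"
  shows "koszul_vanishes R ys M p"
  unfolding koszul_vanishes_iff
proof (intro allI impI)
  fix n w assume w: "in_degree M (length ys) p w"
  have "w bs = \<zero>\<^bsub>M\<^esub>" if "length bs = length ys" for bs
    using that w assms count_le_length[of bs True] by (auto simp: in_degree_def)
  then show "\<exists>m v. cochain M v \<and> in_pred_degree M (length ys) p v \<and>
       (\<forall>bs. length bs = length ys \<longrightarrow> transition R M ys m w bs = koszul_d M (powers R (n + m) ys) v bs)"
    using assms by (intro exI[of _ 0] exI[of _ "\<lambda>_. \<zero>\<^bsub>M\<^esub>"]) (auto simp: in_pred_degree_def transition_zero koszul_d_zero R.powers_closed)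
qed

end

lemma mod_homD:
  assumes "f \<in> mod_hom R M N"
  shows "x \<in> carrier M \<Longrightarrow> f x \<in> carrier N"
    "x \<in> carrier M \<Longrightarrow> y \<in> carrier M \<Longrightarrow> f (x \<oplus>\<^bsub>M\<^esub> y) = f x \<oplus>\<^bsub>N\<^esub> f y"
    "r \<in> carrier R \<Longrightarrow> x \<in> carrier M \<Longrightarrow> f (r \<odot>\<^bsub>M\<^esub> x) = r \<odot>\<^bsub>N\<^esub> f x"
  using assms by (auto simp: mod_hom_def)

lemma mod_hom_zero:
  assumes "module R M" "module R N" "f \<in> mod_hom R M N"
  shows "f \<zero>\<^bsub>M\<^esub> = \<zero>\<^bsub>N\<^esub>"
proof -
  interpret M: module R M by fact
  interpret N: module R N by fact
  show ?thesis
    using mod_homD(3)[OF assms(3), of "\<zero>\<^bsub>R\<^esub>" "\<zero>\<^bsub>M\<^esub>"] mod_homD(1)[OF assms(3), of "\<zero>\<^bsub>M\<^esub>"] by simp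
qed

lemma mod_hom_minus:
  assumes "module R M" "module R N" "f \<in> mod_hom R M N" "x \<in> carrier M"
  shows "f (\<ominus>\<^bsub>M\<^esub> x) = \<ominus>\<^bsub>N\<^esub> f x"
proof -
  interpret M: module R M by fact
  interpret N: module R N by fact
  have "f (\<ominus>\<^bsub>M\<^esub> x) = f ((\<ominus>\<^bsub>R\<^esub> \<one>\<^bsub>R\<^esub>) \<odot>\<^bsub>M\<^esub> x)" using assms by (simp add: M.smult_l_minus)
  also have "\<dots> = \<ominus>\<^bsub>N\<^esub> f x" using mod_homD(1,3)[OF assms(3)] assms(4) by (simp add: N.smult_l_minus)
  finally show ?thesis .
qed

lemma mod_hom_diff:
  assumes "module R M" "module R N" "f \<in> mod_hom R M N" "x \<in> carrier M" "y \<in> carrier M"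
  shows "f (x \<ominus>\<^bsub>M\<^esub> y) = f x \<ominus>\<^bsub>N\<^esub> f y"
proof -
  interpret M: module R M by fact
  show ?thesis using assms mod_homD(2)[OF assms(3)] by (simp add: a_minus_def mod_hom_minus[OF assms(1,2,3)])
qed

lemma koszul_d_hom:
  assumes "module R M" "module R N" "f \<in> mod_hom R M N" "set zs \<subseteq> carrier R" "cochain M w"
  shows "f (koszul_d M zs w bs) = koszul_d N zs (\<lambda>bs. f (w bs)) bs"
proof -
  interpret M: module R M by fact
  have "f (koszul_cone M zs w (\<lambda>_. \<zero>\<^bsub>M\<^esub>) bs) = koszul_cone N zs (\<lambda>bs. f (w bs)) (\<lambda>_. f \<zero>\<^bsub>M\<^esub>) bs"
    by (rule koszul_cone_map[OF assms(1,2,4)]) (use assms mod_homD[OF assms(3)] in \<open>auto simp: cochain_def intro!: mod_homD(3)[OF assms(3)] dest: nth_mem\<close>)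
  then show ?thesis by (simp add: koszul_d_def mod_hom_zero[OF assms(1-3)])
qed

lemma transition_hom:
  assumes "module R M" "f \<in> mod_hom R M N" "set ys \<subseteq> carrier R" "cochain M w"
  shows "f (transition R M ys m w bs) = transition R N ys m (\<lambda>bs. f (w bs)) bs"
proof -
  interpret M: module R M by fact
  show ?thesis unfolding transition_def
    by (rule mod_homD(3)[OF assms(2)]) (use assms in \<open>auto simp: cochain_def intro!: M.koszul_prod_closed M.R.powers_closed\<close>)
qed

lemma cochain_hom: "f \<in> mod_hom R M N \<Longrightarrow> cochain M w \<Longrightarrow> cochain N (\<lambda>bs. f (w bs))"
  by (auto simp: cochain_def mod_homD)

lemma cocycle_hom:
  assumes "module R M" "module R N" "f \<in> mod_hom R M N" "set zs \<subseteq> carrier R" "cochain M w" "cocycle M zs w"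
  shows "cocycle N zs (\<lambda>bs. f (w bs))"
  using koszul_d_hom[OF assms(1-5), symmetric] mod_hom_zero[OF assms(1-3)] assms(6) by (simp add: cocycle_def)

text \<open>Surjectivity of the map induced by \<open>g : B \<rightarrow> C\<close> on the degree \<open>p\<close> cohomology of the colimit.\<close>

definition cocycle_lift where
  "cocycle_lift R ys B C g p \<longleftrightarrow> (\<forall>n c. cochain C c \<longrightarrow> in_degree C (length ys) p c \<longrightarrow> cocycle C (powers R n ys) c \<longrightarrow>
    (\<exists>m b v. cochain B b \<and> in_degree B (length ys) p b \<and> cocycle B (powers R (n + m) ys) b \<and> cochain C v \<and> in_pred_degree C (length ys) p v \<and>
      (\<forall>bs. length bs = length ys \<longrightarrow> transition R C ys m c bs = g (b bs) \<oplus>\<^bsub>C\<^esub> koszul_d C (powers R (n + m) ys) v bs)))"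

section \<open>Short exact sequences and the colimit of Koszul complexes\<close>

locale short_exact = A: module R A + B: module R B + C: module R C
  for R (structure) and A and B and C +
  fixes i g
  assumes i: "i \<in> mod_hom R A B" and g: "g \<in> mod_hom R B C"
    and inj: "inj_on i (carrier A)" and surj: "g ` carrier B = carrier C"
    and exact: "i ` carrier A = {b \<in> carrier B. g b = \<zero>\<^bsub>C\<^esub>}"
begin

lemmas iD = mod_homD[OF i] and gD = mod_homD[OF g]
lemmas i_zero = mod_hom_zero[OF A.module_axioms B.module_axioms i]
lemmas g_zero = mod_hom_zero[OF B.module_axioms C.module_axioms g]
lemmas g_diff = mod_hom_diff[OF B.module_axioms C.module_axioms g]
lemmas i_koszul_d = koszul_d_hom[OF A.module_axioms B.module_axioms i]
lemmas g_koszul_d = koszul_d_hom[OF B.module_axioms C.module_axioms g]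

lemma gi [simp]: "a \<in> carrier A \<Longrightarrow> g (i a) = \<zero>\<^bsub>C\<^esub>"
  using exact by blast

lemma i_inj0: "a \<in> carrier A \<Longrightarrow> i a = \<zero>\<^bsub>B\<^esub> \<Longrightarrow> a = \<zero>\<^bsub>A\<^esub>"
  using inj i_zero by (metis A.zero_closed inj_onD)

text \<open>Zero values are lifted to zero, so that a cochain of degree \<open>p\<close> has a lift
  of degree \<open>p\<close>.\<close>

lemma lift_cochain:
  assumes "cochain C c"
  obtains b where "cochain B b" "\<And>bs. g (b bs) = c bs" "\<And>bs. c bs = \<zero>\<^bsub>C\<^esub> \<Longrightarrow> b bs = \<zero>\<^bsub>B\<^esub>"
proof -
  have "\<forall>bs. \<exists>x. x \<in> carrier B \<and> g x = c bs \<and> (c bs = \<zero>\<^bsub>C\<^esub> \<longrightarrow> x = \<zero>\<^bsub>B\<^esub>)"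
  proof
    fix bs
    have "c bs \<in> g ` carrier B" using assms surj by (simp add: cochain_def)
    then show "\<exists>x. x \<in> carrier B \<and> g x = c bs \<and> (c bs = \<zero>\<^bsub>C\<^esub> \<longrightarrow> x = \<zero>\<^bsub>B\<^esub>)"
      using g_zero by (cases "c bs = \<zero>\<^bsub>C\<^esub>") auto
  qed
  then obtain b where "\<forall>bs. b bs \<in> carrier B \<and> g (b bs) = c bs \<and> (c bs = \<zero>\<^bsub>C\<^esub> \<longrightarrow> b bs = \<zero>\<^bsub>B\<^esub>)" by metis
  then show ?thesis using that[of b] by (auto simp: cochain_def)
qed

text \<open>At lists of other lengths than \<open>t\<close> the values are arbitrary, as nothing is
  known about \<open>g (b bs)\<close> there. Zero values pull back to zero by injectivity, which
  again preserves degrees.\<close>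

lemma pull_cochain:
  assumes "cochain B b" "\<And>bs. length bs = t \<Longrightarrow> g (b bs) = \<zero>\<^bsub>C\<^esub>"
  obtains a where "cochain A a" "\<And>bs. length bs = t \<Longrightarrow> i (a bs) = b bs" "\<And>bs. length bs = t \<Longrightarrow> b bs = \<zero>\<^bsub>B\<^esub> \<Longrightarrow> a bs = \<zero>\<^bsub>A\<^esub>"
proof -
  have "\<forall>bs. \<exists>x. x \<in> carrier A \<and> (length bs = t \<longrightarrow> i x = b bs)"
  proof
    fix bs
    show "\<exists>x. x \<in> carrier A \<and> (length bs = t \<longrightarrow> i x = b bs)"
    proof (cases "length bs = t")
      case True
      then have "b bs \<in> i ` carrier A" using assms unfolding exact by (simp add: cochainD)
      then show ?thesis by auto
    qed auto
  qed
  then obtain a where a: "\<forall>bs. a bs \<in> carrier A \<and> (length bs = t \<longrightarrow> i (a bs) = b bs)" by metis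
  show ?thesis
    by (rule that[of a]) (use a i_inj0 in \<open>auto simp: cochain_def\<close>)
qed

lemma cocycle_pull:
  assumes "set zs \<subseteq> carrier R" "cochain A a" "cochain B b" "\<And>bs. length bs = length zs \<Longrightarrow> i (a bs) = b bs" "cocycle B zs b"
  shows "cocycle A zs a"
  unfolding cocycle_def
proof (intro allI impI)
  fix bs :: "bool list" assume bs: "length bs = length zs"
  have "i (koszul_d A zs a bs) = koszul_d B zs b bs"
    using assms bs by (simp add: i_koszul_d) (rule koszul_d_cong, auto)
  then show "koszul_d A zs a bs = \<zero>\<^bsub>A\<^esub>" using assms bs by (intro i_inj0) (auto simp: cocycle_def)
qed

text \<open>The differential of a lift of \<open>c\<close> comes from a cocycle of \<open>A\<close>
  in degree \<open>p + 1\<close>, the connecting class of \<open>c\<close>. Once a transition turns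
  it into the coboundary of some \<open>a'\<close>, the lift minus \<open>i a'\<close> is a cocycle
  over \<open>c\<close>, and \<open>v\<close> can be taken to be zero.\<close>

lemma koszul_vanishes_imp_cocycle_lift:
  assumes ys: "set ys \<subseteq> carrier R" and kv: "koszul_vanishes R ys A (Suc p)"
  shows "cocycle_lift R ys B C g p"
  unfolding cocycle_lift_def
proof (intro allI impI)
  fix n c assume c: "cochain C c" "in_degree C (length ys) p c" "cocycle C (powers R n ys) c"
  note pws = A.R.powers_closed[OF ys]
  obtain b0 where b0: "cochain B b0" "\<And>bs. g (b0 bs) = c bs" "\<And>bs. c bs = \<zero>\<^bsub>C\<^esub> \<Longrightarrow> b0 bs = \<zero>\<^bsub>B\<^esub>"
    using lift_cochain[OF c(1)] by metis
  have db0: "in_degree B (length ys) p b0" using c(2) b0(3) by (auto simp: in_degree_def)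
  let ?e = "koszul_d B (powers R n ys) b0"
  have e: "cochain B ?e" using pws b0 by auto
  have de: "in_degree B (length ys) (Suc p) ?e" using B.koszul_d_in_degree[OF pws, of n p b0] db0 by simp
  have "g (?e bs) = \<zero>\<^bsub>C\<^esub>" if "length bs = length ys" for bs
    using c(3) that g_koszul_d[OF pws b0(1), of n bs] b0(2) by (simp add: cocycle_def)
  then obtain a where a: "cochain A a" "\<And>bs. length bs = length ys \<Longrightarrow> i (a bs) = ?e bs"
      "\<And>bs. length bs = length ys \<Longrightarrow> ?e bs = \<zero>\<^bsub>B\<^esub> \<Longrightarrow> a bs = \<zero>\<^bsub>A\<^esub>"
    using pull_cochain[OF e, of "length ys"] by metis
  have "in_degree A (length ys) (Suc p) a" using de a(3) by (auto simp: in_degree_def)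
  moreover have "cocycle A (powers R n ys) a"
    by (rule cocycle_pull[OF pws a(1) e]) (use a B.cocycle_koszul_d[OF pws b0(1)] in auto)
  ultimately obtain m a' where a': "cochain A a'" "in_degree A (length ys) p a'"
    "\<And>bs. length bs = length ys \<Longrightarrow> transition R A ys m a bs = koszul_d A (powers R (n + m) ys) a' bs"
    using koszul_vanishes_D[OF kv a(1)] unfolding in_pred_degree_Suc by metis
  let ?b = "\<lambda>bs. transition R B ys m b0 bs \<ominus>\<^bsub>B\<^esub> i (a' bs)"
  have ia': "cochain B (\<lambda>bs. i (a' bs))" using a' cochain_hom[OF i] by auto
  have dia': "in_degree B (length ys) p (\<lambda>bs. i (a' bs))" using a' i_zero by (auto simp: in_degree_def)
  have tb0: "cochain B (transition R B ys m b0)" using b0 ys by auto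
  have 1: "cochain B ?b" using ia' tb0 by auto
  have 2: "in_degree B (length ys) p ?b" using dia' B.transition_in_degree[OF ys db0] by (intro B.in_degree_diff) auto
  have 3: "cocycle B (powers R (n + m) ys) ?b"
    unfolding cocycle_def
  proof (intro allI impI)
    fix bs :: "bool list" assume "length bs = length (powers R (n + m) ys)"
    then have bs: "length bs = length ys" by simp
    have "koszul_d B (powers R (n + m) ys) (\<lambda>bs. i (a' bs)) bs = i (transition R A ys m a bs)"
      using a' bs by (simp add: i_koszul_d[OF pws])
    also have "\<dots> = transition R B ys m ?e bs"
      using transition_hom[OF A.module_axioms i ys a(1)] a(2)[OF bs] by (simp add: transition_def)
    also have "\<dots> = koszul_d B (powers R (n + m) ys) (transition R B ys m b0) bs"
      using B.koszul_d_of_transition[OF ys b0(1) bs] by simp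
    finally show "koszul_d B (powers R (n + m) ys) ?b bs = \<zero>\<^bsub>B\<^esub>"
      using B.koszul_d_diff[OF pws tb0 ia'] B.koszul_d_closed[OF pws tb0] by simp
  qed
  have 4: "transition R C ys m c bs = g (?b bs) \<oplus>\<^bsub>C\<^esub> koszul_d C (powers R (n + m) ys) (\<lambda>_. \<zero>\<^bsub>C\<^esub>) bs" if "length bs = length ys" for bs
  proof -
    have "g (?b bs) = g (transition R B ys m b0 bs)"
      using tb0 ia' a' gD(1) by (subst g_diff) (auto simp: cochain_def)
    also have "\<dots> = transition R C ys m c bs"
      using transition_hom[OF B.module_axioms g ys b0(1)] b0(2) by simp
    finally show ?thesis using that C.koszul_d_zero[OF pws, of bs _ "\<lambda>_. \<zero>\<^bsub>C\<^esub>"] C.cochain_transition[OF ys c(1)]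
      by (simp add: cochainD)
  qed
  show "\<exists>m b v. cochain B b \<and> in_degree B (length ys) p b \<and> cocycle B (powers R (n + m) ys) b \<and> cochain C v \<and> in_pred_degree C (length ys) p v \<and>
      (\<forall>bs. length bs = length ys \<longrightarrow> transition R C ys m c bs = g (b bs) \<oplus>\<^bsub>C\<^esub> koszul_d C (powers R (n + m) ys) v bs)"
    by (rule exI[of _ m], rule exI[of _ ?b], rule exI[of _ "\<lambda>_. \<zero>\<^bsub>C\<^esub>"]) (use 1 2 3 4 in \<open>auto simp: in_pred_degree_def\<close>)
qed

text \<open>In \<open>B\<close> the cocycle \<open>a\<close> becomes the coboundary of some
  \<open>b\<close>, and \<open>g b\<close> is a cocycle of \<open>C\<close>. By the lifting
  hypothesis it is, after a transition, the image of a cocycle \<open>b'\<close> plus a coboundary,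
  which also lifts to a coboundary of \<open>B\<close>. Subtracting both from \<open>b\<close>
  leaves a cochain that maps to zero in \<open>C\<close>, hence one of \<open>A\<close>, and its
  coboundary is a transition of \<open>a\<close>.\<close>

lemma cocycle_lift_imp_koszul_vanishes:
  assumes ys: "set ys \<subseteq> carrier R" and L: "cocycle_lift R ys B C g p" and kv: "koszul_vanishes R ys B (Suc p)"
  shows "koszul_vanishes R ys A (Suc p)"
  unfolding koszul_vanishes_iff in_pred_degree_Suc
proof (intro allI impI)
  fix n a assume a: "cochain A a" "in_degree A (length ys) (Suc p) a" "cocycle A (powers R n ys) a"
  note pws = A.R.powers_closed[OF ys]
  let ?t = "length ys"
  have ia: "cochain B (\<lambda>bs. i (a bs))" using a cochain_hom[OF i] by auto
  have dia: "in_degree B ?t (Suc p) (\<lambda>bs. i (a bs))" using a i_zero by (auto simp: in_degree_def)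
  obtain m1 b where b: "cochain B b" "in_degree B ?t p b"
    "\<And>bs. length bs = ?t \<Longrightarrow> transition R B ys m1 (\<lambda>bs. i (a bs)) bs = koszul_d B (powers R (n + m1) ys) b bs"
    using koszul_vanishes_D[OF kv ia dia cocycle_hom[OF A.module_axioms B.module_axioms i pws a(1) a(3)]] unfolding in_pred_degree_Suc by metis
  let ?c = "\<lambda>bs. g (b bs)"
  have c: "cochain C ?c" using cochain_hom[OF g b(1)] .
  have dc: "in_degree C ?t p ?c" using b g_zero by (auto simp: in_degree_def)
  have cc: "cocycle C (powers R (n + m1) ys) ?c"
    unfolding cocycle_def
  proof (intro allI impI)
    fix bs :: "bool list" assume "length bs = length (powers R (n + m1) ys)"
    then have bs: "length bs = ?t" by simp
    have "koszul_d C (powers R (n + m1) ys) ?c bs = g (transition R B ys m1 (\<lambda>bs. i (a bs)) bs)"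
      using b bs by (simp add: g_koszul_d[OF pws])
    also have "\<dots> = transition R C ys m1 (\<lambda>bs. g (i (a bs))) bs"
      by (rule transition_hom[OF B.module_axioms g ys ia])
    also have "\<dots> = \<zero>\<^bsub>C\<^esub>" using a by (intro C.transition_zero[OF ys]) (auto simp: cochain_def)
    finally show "koszul_d C (powers R (n + m1) ys) ?c bs = \<zero>\<^bsub>C\<^esub>" .
  qed
  obtain m2 b' v where b': "cochain B b'" "in_degree B ?t p b'" "cocycle B (powers R (n + m1 + m2) ys) b'"
      and v: "cochain C v" "in_pred_degree C ?t p v"
      "\<And>bs. length bs = ?t \<Longrightarrow> transition R C ys m2 ?c bs = g (b' bs) \<oplus>\<^bsub>C\<^esub> koszul_d C (powers R (n + m1 + m2) ys) v bs"
    using L c dc cc unfolding cocycle_lift_def by metis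
  obtain v' where v': "cochain B v'" "\<And>bs. g (v' bs) = v bs" "\<And>bs. v bs = \<zero>\<^bsub>C\<^esub> \<Longrightarrow> v' bs = \<zero>\<^bsub>B\<^esub>"
    using lift_cochain[OF v(1)] by metis
  let ?N = "n + m1 + m2"
  let ?z = "powers R ?N ys"
  let ?u = "\<lambda>bs. transition R B ys m2 b bs \<ominus>\<^bsub>B\<^esub> (b' bs \<oplus>\<^bsub>B\<^esub> koszul_d B ?z v' bs)"
  have kv': "cochain B (koszul_d B ?z v')" using pws v' by auto
  have dkv': "in_degree B ?t p (koszul_d B ?z v')"
  proof (cases p)
    \<comment> \<open>There is no degree below 0: \<open>v\<close> and hence \<open>v'\<close>
      vanish on all lists of the right length.\<close>
    case 0
    then have "v' bs = \<zero>\<^bsub>B\<^esub>" if "length bs = ?t" for bs using v(2) v'(3) that by (auto simp: in_pred_degree_def)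
    then show ?thesis using B.koszul_d_zero[OF pws] by (auto simp: in_degree_def)
  next
    case (Suc q)
    then have "in_degree B ?t q v'" using v(2) v'(3) by (auto simp: in_degree_def in_pred_degree_def)
    then show ?thesis using B.koszul_d_in_degree[OF pws, of ?N q v'] Suc by simp
  qed
  have u: "cochain B ?u" using b b' kv' ys by auto
  have tb: "cochain B (transition R B ys m2 b)" using b ys by auto
  have du: "in_degree B ?t p ?u" using b b' dkv' B.transition_in_degree[OF ys b(2)] by (intro B.in_degree_diff B.in_degree_add) auto
  have "g (?u bs) = \<zero>\<^bsub>C\<^esub>" if "length bs = ?t" for bs
  proof -
    have "g (?u bs) = g (transition R B ys m2 b bs) \<ominus>\<^bsub>C\<^esub> (g (b' bs) \<oplus>\<^bsub>C\<^esub> g (koszul_d B ?z v' bs))"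
      using tb b' kv' by (simp add: g_diff gD cochainD)
    also have "g (b' bs) \<oplus>\<^bsub>C\<^esub> g (koszul_d B ?z v' bs) = transition R C ys m2 ?c bs"
      using v(3)[OF that] v'(2) g_koszul_d[OF pws v'(1)] by simp
    also have "g (transition R B ys m2 b bs) = transition R C ys m2 ?c bs" by (rule transition_hom[OF B.module_axioms g ys b(1)])
    also have "transition R C ys m2 ?c bs \<ominus>\<^bsub>C\<^esub> transition R C ys m2 ?c bs = \<zero>\<^bsub>C\<^esub>"
      using C.cochain_transition[OF ys c] by (simp add: cochainD)
    finally show ?thesis .
  qed
  then obtain a' where a': "cochain A a'" "\<And>bs. length bs = ?t \<Longrightarrow> i (a' bs) = ?u bs"
      "\<And>bs. length bs = ?t \<Longrightarrow> ?u bs = \<zero>\<^bsub>B\<^esub> \<Longrightarrow> a' bs = \<zero>\<^bsub>A\<^esub>"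
    using pull_cochain[OF u, of ?t] by metis
  have da': "in_degree A ?t p a'" using du a'(3) by (auto simp: in_degree_def)
  have "transition R A ys (m1 + m2) a bs = koszul_d A (powers R (n + (m1 + m2)) ys) a' bs" if bs: "length bs = ?t" for bs
  proof -
    have "i (koszul_d A ?z a' bs) = koszul_d B ?z ?u bs"
      using a' bs by (simp add: i_koszul_d[OF pws]) (rule koszul_d_cong, auto)
    also have "\<dots> = koszul_d B ?z (transition R B ys m2 b) bs \<ominus>\<^bsub>B\<^esub> (koszul_d B ?z b' bs \<oplus>\<^bsub>B\<^esub> koszul_d B ?z (koszul_d B ?z v') bs)"
      using tb b' kv' by (simp add: B.koszul_d_diff[OF pws] B.koszul_d_add[OF pws])
    also have "\<dots> = koszul_d B ?z (transition R B ys m2 b) bs"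
      using b'(3) bs B.koszul_d_koszul_d[OF pws v'(1)] B.koszul_d_closed[OF pws tb] by (simp add: cocycle_def)
    also have "\<dots> = transition R B ys m2 (koszul_d B (powers R (n + m1) ys) b) bs"
      using B.koszul_d_of_transition[OF ys b(1) bs] by simp
    also have "\<dots> = transition R B ys m2 (transition R B ys m1 (\<lambda>bs. i (a bs))) bs"
      using b(3)[OF bs] by (simp add: transition_def)
    also have "\<dots> = i (transition R A ys (m1 + m2) a bs)"
      by (simp add: B.transition_transition[OF ys ia] transition_hom[OF A.module_axioms i ys a(1)])
    finally have e: "i (koszul_d A ?z a' bs) = i (transition R A ys (m1 + m2) a bs)" .
    have "koszul_d A ?z a' bs = transition R A ys (m1 + m2) a bs"
      by (rule inj_onD[OF inj e]) (use A.koszul_d_closed[OF pws a'(1)] A.cochain_transition[OF ys a(1)] in \<open>auto simp: cochainD\<close>)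
    then show ?thesis by (simp add: add.assoc)
  qed
  then show "\<exists>m v. cochain A v \<and> in_degree A ?t p v \<and>
       (\<forall>bs. length bs = ?t \<longrightarrow> transition R A ys m a bs = koszul_d A (powers R (n + m) ys) v bs)"
    using a' da' by blast
qed

text \<open>A class of \<open>C\<close> that dies in the colimit is lifted by zero.\<close>

lemma koszul_vanishes_imp_cocycle_lift_C:
  assumes ys: "set ys \<subseteq> carrier R" and "koszul_vanishes R ys C p"
  shows "cocycle_lift R ys B C g p"
  unfolding cocycle_lift_def
proof (intro allI impI)
  fix n c assume c: "cochain C c" "in_degree C (length ys) p c" "cocycle C (powers R n ys) c"
  obtain m v where v: "cochain C v" "in_pred_degree C (length ys) p v"
    "\<And>bs. length bs = length ys \<Longrightarrow> transition R C ys m c bs = koszul_d C (powers R (n + m) ys) v bs"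
    using koszul_vanishes_D[OF assms(2) c] by metis
  show "\<exists>m b v. cochain B b \<and> in_degree B (length ys) p b \<and> cocycle B (powers R (n + m) ys) b \<and> cochain C v \<and> in_pred_degree C (length ys) p v \<and>
      (\<forall>bs. length bs = length ys \<longrightarrow> transition R C ys m c bs = g (b bs) \<oplus>\<^bsub>C\<^esub> koszul_d C (powers R (n + m) ys) v bs)"
    by (rule exI[of _ m], rule exI[of _ "\<lambda>_. \<zero>\<^bsub>B\<^esub>"], rule exI[of _ v])
      (use v g_zero A.R.powers_closed[OF ys] in \<open>auto simp: in_degree_def cocycle_def B.koszul_d_zero\<close>)
qed

text \<open>The cocycle of \<open>B\<close> that lifts \<open>c\<close> becomes a coboundary; its
  bounding cochain, mapped to \<open>C\<close>, bounds \<open>c\<close> together with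
  \<open>v\<close>.\<close>

lemma cocycle_lift_imp_koszul_vanishes_C:
  assumes ys: "set ys \<subseteq> carrier R" and L: "cocycle_lift R ys B C g p" and kv: "koszul_vanishes R ys B p"
  shows "koszul_vanishes R ys C p"
  unfolding koszul_vanishes_iff
proof (intro allI impI)
  fix n c assume c: "cochain C c" "in_degree C (length ys) p c" "cocycle C (powers R n ys) c"
  note pws = A.R.powers_closed[OF ys]
  let ?t = "length ys"
  obtain m b v where b: "cochain B b" "in_degree B ?t p b" "cocycle B (powers R (n + m) ys) b"
      and v: "cochain C v" "in_pred_degree C ?t p v"
      "\<And>bs. length bs = ?t \<Longrightarrow> transition R C ys m c bs = g (b bs) \<oplus>\<^bsub>C\<^esub> koszul_d C (powers R (n + m) ys) v bs"
    using L c unfolding cocycle_lift_def by metis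
  obtain m2 b' where b': "cochain B b'" "in_pred_degree B ?t p b'"
    "\<And>bs. length bs = ?t \<Longrightarrow> transition R B ys m2 b bs = koszul_d B (powers R (n + m + m2) ys) b' bs"
    using koszul_vanishes_D[OF kv b] by metis
  let ?v = "\<lambda>bs. g (b' bs) \<oplus>\<^bsub>C\<^esub> transition R C ys m2 v bs"
  have gb': "cochain C (\<lambda>bs. g (b' bs))" and gb: "cochain C (\<lambda>bs. g (b bs))" using cochain_hom[OF g] b' b by auto
  have tv: "cochain C (transition R C ys m2 v)" using v ys by auto
  have "in_pred_degree C ?t p (\<lambda>bs. g (b' bs))" using b' g_zero by (auto simp: in_pred_degree_def)
  then have d: "in_pred_degree C ?t p ?v" using C.transition_in_pred_degree[OF ys v(2)] by (rule C.in_pred_degree_add)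
  have "transition R C ys (m + m2) c bs = koszul_d C (powers R (n + (m + m2)) ys) ?v bs" if bs: "length bs = ?t" for bs
  proof -
    have "transition R C ys (m + m2) c bs = transition R C ys m2 (transition R C ys m c) bs"
      using C.transition_transition[OF ys c(1)] by simp
    also have "\<dots> = transition R C ys m2 (\<lambda>bs. g (b bs) \<oplus>\<^bsub>C\<^esub> koszul_d C (powers R (n + m) ys) v bs) bs"
      using v(3)[OF bs] by (simp add: transition_def)
    also have "\<dots> = transition R C ys m2 (\<lambda>bs. g (b bs)) bs \<oplus>\<^bsub>C\<^esub> transition R C ys m2 (koszul_d C (powers R (n + m) ys) v) bs"
      by (rule C.transition_add[OF ys gb]) (use v pws in auto)
    also have "transition R C ys m2 (\<lambda>bs. g (b bs)) bs = koszul_d C (powers R (n + m + m2) ys) (\<lambda>bs. g (b' bs)) bs"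
      using transition_hom[OF B.module_axioms g ys b(1), symmetric] b'(3)[OF bs] by (simp add: g_koszul_d[OF pws b'(1)])
    also have "transition R C ys m2 (koszul_d C (powers R (n + m) ys) v) bs = koszul_d C (powers R (n + m + m2) ys) (transition R C ys m2 v) bs"
      using C.koszul_d_of_transition[OF ys v(1) bs] by simp
    finally show ?thesis using C.koszul_d_add[OF pws gb' tv] by (simp add: add.assoc)
  qed
  then show "\<exists>m v. cochain C v \<and> in_pred_degree C ?t p v \<and>
       (\<forall>bs. length bs = ?t \<longrightarrow> transition R C ys m c bs = koszul_d C (powers R (n + m) ys) v bs)"
    using d C.cochain_add[OF gb' tv] by blast
qed

end

section \<open>Degree zero\<close>

definition degree0_cochain :: "('r, 'm, 'y) module_scheme \<Rightarrow> nat \<Rightarrow> 'm \<Rightarrow> bool list \<Rightarrow> 'm" where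
  "degree0_cochain M t x bs = (if bs = replicate t False then x else \<zero>\<^bsub>M\<^esub>)"

lemma weight_eq_0: "weight bs = 0 \<longleftrightarrow> bs = replicate (length bs) False"
  by (induction bs) auto

context module begin

lemma koszul_prod_replicate_False: "koszul_prod R zs (replicate (length zs) False) = \<one>"
  by (induction zs) auto

text \<open>At a list whose single \<open>True\<close> stands at position \<open>i\<close> the
  differential has the value \<open>z_i x\<close>; at all other lists it is zero.\<close>

lemma cocycle_degree0_cochain:
  assumes "set zs \<subseteq> carrier R" "x \<in> carrier M"
  shows "cocycle M zs (degree0_cochain M (length zs) x) \<longleftrightarrow> (\<forall>z\<in>set zs. z \<odot>\<^bsub>M\<^esub> x = \<zero>\<^bsub>M\<^esub>)"
  using assms(1)
proof (induction zs)
  case (Cons z zs)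
  let ?t = "length zs"
  have 1: "(\<lambda>cs. degree0_cochain M (Suc ?t) x (False # cs)) = degree0_cochain M ?t x" by (auto simp: degree0_cochain_def fun_eq_iff)
  have 2: "(\<lambda>cs. degree0_cochain M (Suc ?t) x (True # cs)) = (\<lambda>_. \<zero>\<^bsub>M\<^esub>)" by (auto simp: degree0_cochain_def fun_eq_iff)
  have 3: "koszul_d M (z # zs) (degree0_cochain M (Suc ?t) x) (True # cs) = z \<odot>\<^bsub>M\<^esub> degree0_cochain M ?t x cs" if "length cs = ?t" for cs
    using that Cons.prems assms(2) koszul_d_zero[of zs cs "\<lambda>_. \<zero>\<^bsub>M\<^esub>"] 1
    by (simp add: 2 fun_eq_iff) (simp add: degree0_cochain_def)
  have 4: "koszul_d M (z # zs) (degree0_cochain M (Suc ?t) x) (False # cs) = koszul_d M zs (degree0_cochain M ?t x) cs" for cs by (simp add: 1)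
  have "cocycle M (z # zs) (degree0_cochain M (Suc ?t) x) \<longleftrightarrow>
    (\<forall>b cs. length cs = ?t \<longrightarrow> koszul_d M (z # zs) (degree0_cochain M (Suc ?t) x) (b # cs) = \<zero>\<^bsub>M\<^esub>)"
    unfolding cocycle_def by (metis length_Cons length_Suc_conv)
  also have "\<dots> \<longleftrightarrow> (\<forall>cs. length cs = ?t \<longrightarrow> z \<odot>\<^bsub>M\<^esub> degree0_cochain M ?t x cs = \<zero>\<^bsub>M\<^esub>) \<and> cocycle M zs (degree0_cochain M ?t x)"
    unfolding cocycle_def using 3 4 by (metis (full_types))
  also have "(\<forall>cs. length cs = ?t \<longrightarrow> z \<odot>\<^bsub>M\<^esub> degree0_cochain M ?t x cs = \<zero>\<^bsub>M\<^esub>) \<longleftrightarrow> z \<odot>\<^bsub>M\<^esub> x = \<zero>\<^bsub>M\<^esub>"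
    using Cons.prems by (auto simp: degree0_cochain_def)
  finally show ?case using Cons by simp
qed (auto simp: cocycle_def)

text \<open>For finite \<open>Y\<close> this is the torsion with respect to the ideal generated by
  \<open>Y\<close>, see \<open>torsion_part_eq_power_torsion\<close>. The elementwise form allows
  elements to be added to \<open>Y\<close> one at a time, starting from \<open>Y = {}\<close>, where
  it is all of \<open>M\<close>.\<close>

definition power_torsion :: "'a set \<Rightarrow> 'c set" where
  "power_torsion Y = {x \<in> carrier M. \<exists>n::nat. \<forall>y\<in>Y. (y [^] n) \<odot>\<^bsub>M\<^esub> x = \<zero>\<^bsub>M\<^esub>}"

lemma cochain_degree0_cochain: "x \<in> carrier M \<Longrightarrow> cochain M (degree0_cochain M t x)" and in_degree_degree0_cochain: "in_degree M t 0 (degree0_cochain M t x)"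
  by (auto simp: cochain_def degree0_cochain_def in_degree_def)

lemma degree0_degree0_cochain:
  assumes "in_degree M t 0 w" "length bs = t"
  shows "w bs = degree0_cochain M t (w (replicate t False)) bs"
  using assms by (auto simp: in_degree_def degree0_cochain_def weight_eq_0)

text \<open>Degree 0 has no coboundaries, and transitions are the identity at the list without
  \<open>True\<close>. What is left of the condition is that every degree 0 cocycle, that is every
  torsion element, is zero.\<close>

lemma koszul_vanishes_0:
  assumes ys: "set ys \<subseteq> carrier R"
  shows "koszul_vanishes R ys M 0 \<longleftrightarrow> power_torsion (set ys) = {\<zero>\<^bsub>M\<^esub>}"
proof
  let ?t = "length ys"
  assume kv: "koszul_vanishes R ys M 0"
  have "x = \<zero>\<^bsub>M\<^esub>" if "x \<in> power_torsion (set ys)" for x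
  proof -
    from that obtain n where x: "x \<in> carrier M" "\<forall>y\<in>set ys. (y [^] (n::nat)) \<odot>\<^bsub>M\<^esub> x = \<zero>\<^bsub>M\<^esub>"
      by (auto simp: power_torsion_def)
    have "cocycle M (powers R n ys) (degree0_cochain M ?t x)"
      using cocycle_degree0_cochain[OF R.powers_closed[OF ys] x(1), of n] x(2) by (auto simp: powers_def)
    then obtain m v where v: "in_pred_degree M ?t 0 v"
      "\<And>bs. length bs = ?t \<Longrightarrow> transition R M ys m (degree0_cochain M ?t x) bs = koszul_d M (powers R (n + m) ys) v bs"
      using koszul_vanishes_D[OF kv cochain_degree0_cochain[OF x(1)] in_degree_degree0_cochain] by metis
    have "koszul_d M (powers R (n + m) ys) v (replicate ?t False) = \<zero>\<^bsub>M\<^esub>"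
      using v(1) R.powers_closed[OF ys] by (intro koszul_d_zero) (auto simp: in_pred_degree_def)
    moreover have "transition R M ys m (degree0_cochain M ?t x) (replicate ?t False) = x"
      using koszul_prod_replicate_False[of "powers R m ys"] x by (simp add: transition_def degree0_cochain_def)
    ultimately show ?thesis using v(2)[of "replicate ?t False"] by simp
  qed
  moreover have "\<zero>\<^bsub>M\<^esub> \<in> power_torsion (set ys)" using ys by (auto simp: power_torsion_def intro!: exI[of _ "0::nat"])
  ultimately show "power_torsion (set ys) = {\<zero>\<^bsub>M\<^esub>}" by blast
next
  let ?t = "length ys"
  assume t: "power_torsion (set ys) = {\<zero>\<^bsub>M\<^esub>}"
  show "koszul_vanishes R ys M 0" unfolding koszul_vanishes_iff
  proof (intro allI impI)
    fix n w assume w: "cochain M w" "in_degree M ?t 0 w" "cocycle M (powers R n ys) w"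
    let ?x = "w (replicate ?t False)"
    have x: "?x \<in> carrier M" using w by (simp add: cochain_def)
    have "cocycle M (powers R n ys) (degree0_cochain M ?t ?x)"
      unfolding cocycle_def
    proof (intro allI impI)
      fix bs :: "bool list" assume bs: "length bs = length (powers R n ys)"
      have "koszul_d M (powers R n ys) (degree0_cochain M ?t ?x) bs = koszul_d M (powers R n ys) w bs"
        by (rule koszul_d_cong) (use bs degree0_degree0_cochain[OF w(2), symmetric] in auto)
      then show "koszul_d M (powers R n ys) (degree0_cochain M ?t ?x) bs = \<zero>\<^bsub>M\<^esub>" using w(3) bs by (simp add: cocycle_def)
    qed
    then have "?x \<in> power_torsion (set ys)"
      using cocycle_degree0_cochain[OF R.powers_closed[OF ys] x, of n] x by (auto simp: powers_def power_torsion_def)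
    then have "?x = \<zero>\<^bsub>M\<^esub>" using t by auto
    then have "w bs = \<zero>\<^bsub>M\<^esub>" if "length bs = ?t" for bs using degree0_degree0_cochain[OF w(2) that] by (simp add: degree0_cochain_def)
    then show "\<exists>m v. cochain M v \<and> in_pred_degree M ?t 0 v \<and>
       (\<forall>bs. length bs = ?t \<longrightarrow> transition R M ys m w bs = koszul_d M (powers R (n + m) ys) v bs)"
      using ys by (intro exI[of _ 0] exI[of _ "\<lambda>_. \<zero>\<^bsub>M\<^esub>"]) (auto simp: in_pred_degree_def transition_zero koszul_d_zero R.powers_closed)
  qed
qed

section \<open>Torsion with respect to an ideal and to its generators\<close>

lemma ideals_set_one: "\<one>\<^bsub>ideals_set R\<^esub> = carrier R"
  and ideals_set_mult: "I \<otimes>\<^bsub>ideals_set R\<^esub> J = ideal_prod R I J"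
  by (simp_all add: ideals_set_def)

lemma idealpow_ideal: "ideal I R \<Longrightarrow> ideal (I [^]\<^bsub>ideals_set R\<^esub> (n::nat)) R"
  by (induction n) (auto simp: ideals_set_one ideals_set_mult R.oneideal intro: R.ideal_prod_is_ideal)

lemma pow_in_idealpow: "ideal I R \<Longrightarrow> y \<in> I \<Longrightarrow> y [^] n \<in> I [^]\<^bsub>ideals_set R\<^esub> (n::nat)"
  by (induction n) (auto simp: ideals_set_one ideals_set_mult intro: ideal_prod.prod)

text \<open>Peeling off one factor of a product lowers one exponent: \<open>y x\<close> satisfies
  the hypothesis with \<open>e y\<close> reduced by one. The elements \<open>r\<close> for which
  \<open>r x\<close> is annihilated by a given ideal form an ideal \<open>J\<close>, so it is enough
  to peel off generators. The power is \<open>Suc N\<close> rather than \<open>N\<close> because of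
  \<open>Y = {}\<close>, where the zeroth power is the whole ring.\<close>

lemma annihilated_idealpow:
  assumes "Y \<subseteq> carrier R" "finite Y" "x \<in> carrier M" "\<And>y. y \<in> Y \<Longrightarrow> (y [^] (e y :: nat)) \<odot>\<^bsub>M\<^esub> x = \<zero>\<^bsub>M\<^esub>"
    "(\<Sum>y\<in>Y. e y) = N"
  shows "\<forall>r \<in> (Idl Y) [^]\<^bsub>ideals_set R\<^esub> (Suc N). r \<odot>\<^bsub>M\<^esub> x = \<zero>\<^bsub>M\<^esub>"
  using assms(3-5)
proof (induction N arbitrary: x e)
  case (0 x e)
  show ?case
  proof (cases "Y = {}")
    case False
    then obtain y where "y \<in> Y" by auto
    then have "x = \<zero>\<^bsub>M\<^esub>" using 0 assms(2) by fastforce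
    have "ideal ((Idl Y) [^]\<^bsub>ideals_set R\<^esub> (Suc 0)) R" by (intro idealpow_ideal R.genideal_ideal assms)
    then show ?thesis using \<open>x = _\<close> by (metis ideal.Icarr smult_r_null)
  next
    case True
    have i: "ideal (Idl {}) R" by (rule R.genideal_ideal) simp
    have "Idl {} \<subseteq> {\<zero>}" by (rule R.genideal_minimal[OF R.zeroideal]) simp
    then have "ideal_prod R (carrier R) (Idl {}) \<subseteq> {\<zero>}"
      using R.ideal_prod_inter[OF R.oneideal i] by auto
    then show ?thesis using 0 True by (auto simp: ideals_set_one ideals_set_mult)
  qed
next
  case (Suc N x e)
  let ?a = "Idl Y"
  have a: "ideal ?a R" by (rule R.genideal_ideal[OF assms(1)])
  let ?P = "?a [^]\<^bsub>ideals_set R\<^esub> (Suc N)"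
  have P: "ideal ?P R" by (rule idealpow_ideal[OF a])
  have Pc: "s \<in> carrier R" if "s \<in> ?P" for s using P that by (rule ideal.Icarr)
  define J where "J = {r \<in> carrier R. \<forall>s\<in>?P. s \<odot>\<^bsub>M\<^esub> (r \<odot>\<^bsub>M\<^esub> x) = \<zero>\<^bsub>M\<^esub>}"
  have J: "ideal J R"
  proof (rule idealI)
    show "ring R" by (rule R.ring_axioms)
    show "subgroup J (add_monoid R)"
      by (rule R.add.subgroupI) (use Suc.prems in \<open>auto simp: J_def smult_l_distr smult_r_distr smult_l_minus smult_r_minus Pc
         simp flip: a_inv_def intro: exI[of _ \<zero>]\<close>)
  next
    fix r s assume rs: "r \<in> J" "s \<in> carrier R"
    have "u \<odot>\<^bsub>M\<^esub> (s \<otimes> r \<odot>\<^bsub>M\<^esub> x) = \<zero>\<^bsub>M\<^esub>" if "u \<in> ?P" for u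
    proof -
      have "u \<odot>\<^bsub>M\<^esub> (s \<otimes> r \<odot>\<^bsub>M\<^esub> x) = s \<odot>\<^bsub>M\<^esub> (u \<odot>\<^bsub>M\<^esub> (r \<odot>\<^bsub>M\<^esub> x))"
        using rs that Suc.prems Pc[OF that] by (simp add: J_def smult_assoc1 smult_commute)
      then show ?thesis using rs that by (simp add: J_def)
    qed
    then show "s \<otimes> r \<in> J" "r \<otimes> s \<in> J" using rs R.m_comm[of r s] by (auto simp: J_def)
  qed
  have "y \<in> J" if y: "y \<in> Y" for y
  proof (cases "e y")
    case 0
    then have "x = \<zero>\<^bsub>M\<^esub>" using Suc.prems y by fastforce
    then show ?thesis using y assms(1) Pc by (auto simp: J_def)
  next
    case (Suc k)
    let ?e = "e(y := k)"
    have "(\<Sum>z\<in>Y. ?e z) = N"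
      using Suc.prems(3) Suc y assms(2) by (simp add: sum.remove[of Y y])
    moreover have "(z [^] ?e z) \<odot>\<^bsub>M\<^esub> (y \<odot>\<^bsub>M\<^esub> x) = \<zero>\<^bsub>M\<^esub>" if "z \<in> Y" for z
    proof (cases "z = y")
      case True
      then show ?thesis using Suc.prems(2)[OF y] Suc Suc.prems(1) assms(1) y
        by (simp add: smult_assoc1[symmetric] subsetD)
    next
      case False
      then have "(z [^] ?e z) \<odot>\<^bsub>M\<^esub> (y \<odot>\<^bsub>M\<^esub> x) = y \<odot>\<^bsub>M\<^esub> ((z [^] e z) \<odot>\<^bsub>M\<^esub> x)"
        using that y assms(1) Suc.prems(1) by (simp add: smult_commute subsetD)
      then show ?thesis using Suc.prems(2)[OF that] y assms(1) by (simp add: subsetD)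
    qed
    ultimately have "\<forall>r \<in> ?P. r \<odot>\<^bsub>M\<^esub> (y \<odot>\<^bsub>M\<^esub> x) = \<zero>\<^bsub>M\<^esub>"
      using Suc.prems(1) y assms(1) by (intro Suc.IH[of _ ?e]) auto
    then show ?thesis using y assms(1) by (auto simp: J_def)
  qed
  then have "?a \<subseteq> J" by (intro R.genideal_minimal[OF J]) auto
  have "r \<odot>\<^bsub>M\<^esub> x = \<zero>\<^bsub>M\<^esub>" if "r \<in> ideal_prod R ?P ?a" for r
    using that
  proof (induction rule: ideal_prod.induct)
    case (prod s r)
    then have "r \<in> J" using \<open>?a \<subseteq> J\<close> by auto
    then show ?case using prod Pc Suc.prems by (simp add: J_def smult_assoc1)
  next
    case (sum r s)
    have "r \<in> carrier R" "s \<in> carrier R" using sum R.ideal_prod_in_carrier[OF P a] by auto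
    then show ?case using sum Suc.prems by (simp add: smult_l_distr)
  qed
  then show ?case by (simp add: ideals_set_mult)
qed

lemma torsion_part_eq_power_torsion:
  assumes "set ys \<subseteq> carrier R"
  shows "torsion_part R (Idl (set ys)) M = power_torsion (set ys)"
proof (rule Set.set_eqI, rule iffI)
  fix x assume "x \<in> torsion_part R (Idl (set ys)) M"
  then obtain n where x: "x \<in> carrier M" "\<forall>r \<in> (Idl (set ys)) [^]\<^bsub>ideals_set R\<^esub> (n::nat). r \<odot>\<^bsub>M\<^esub> x = \<zero>\<^bsub>M\<^esub>"
    by (auto simp: torsion_part_def)
  then show "x \<in> power_torsion (set ys)"
    using pow_in_idealpow[OF R.genideal_ideal[OF assms]] R.genideal_self[OF assms] by (fastforce simp: power_torsion_def)
next
  fix x assume "x \<in> power_torsion (set ys)"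
  then obtain n where x: "x \<in> carrier M" "\<forall>y\<in>set ys. (y [^] (n::nat)) \<odot>\<^bsub>M\<^esub> x = \<zero>\<^bsub>M\<^esub>"
    by (auto simp: power_torsion_def)
  then show "x \<in> torsion_part R (Idl (set ys)) M"
    using annihilated_idealpow[OF assms _ x(1), of "\<lambda>_. n", OF _ _ refl] x
    unfolding torsion_part_def by blast
qed

lemma power_torsion_submodule:
  assumes "Y \<subseteq> carrier R"
  shows "submodule (power_torsion Y) R M"
proof (rule submoduleI)
  show "power_torsion Y \<subseteq> carrier M" "\<zero>\<^bsub>M\<^esub> \<in> power_torsion Y" using assms by (auto simp: power_torsion_def intro!: exI[of _ "0::nat"])
next
  fix a assume "a \<in> power_torsion Y"
  then show "\<ominus>\<^bsub>M\<^esub> a \<in> power_torsion Y" using assms by (fastforce simp: power_torsion_def smult_r_minus subsetD)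
next
  fix a b assume "a \<in> power_torsion Y" "b \<in> power_torsion Y"
  then obtain n m where nm: "a \<in> carrier M" "b \<in> carrier M" "\<forall>y\<in>Y. (y [^] (n::nat)) \<odot>\<^bsub>M\<^esub> a = \<zero>\<^bsub>M\<^esub>"
     "\<forall>y\<in>Y. (y [^] (m::nat)) \<odot>\<^bsub>M\<^esub> b = \<zero>\<^bsub>M\<^esub>" by (auto simp: power_torsion_def)
  have "(y [^] (n + m)) \<odot>\<^bsub>M\<^esub> (a \<oplus>\<^bsub>M\<^esub> b) = \<zero>\<^bsub>M\<^esub>" if y: "y \<in> Y" for y
  proof -
    have yc: "y \<in> carrier R" using y assms by auto
    have "(y [^] (n + m)) \<odot>\<^bsub>M\<^esub> a = (y [^] m) \<odot>\<^bsub>M\<^esub> ((y [^] n) \<odot>\<^bsub>M\<^esub> a)"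
      "(y [^] (n + m)) \<odot>\<^bsub>M\<^esub> b = (y [^] n) \<odot>\<^bsub>M\<^esub> ((y [^] m) \<odot>\<^bsub>M\<^esub> b)"
      using nm yc by (simp_all add: smult_assoc1[symmetric] R.nat_pow_mult add.commute)
    then show ?thesis using nm y yc by (simp add: smult_r_distr)
  qed
  then show "a \<oplus>\<^bsub>M\<^esub> b \<in> power_torsion Y" using nm by (auto simp: power_torsion_def)
next
  fix r x assume r: "r \<in> carrier R" and "x \<in> power_torsion Y"
  then obtain n where n: "x \<in> carrier M" "\<forall>y\<in>Y. (y [^] (n::nat)) \<odot>\<^bsub>M\<^esub> x = \<zero>\<^bsub>M\<^esub>" by (auto simp: power_torsion_def)
  have "(y [^] n) \<odot>\<^bsub>M\<^esub> (r \<odot>\<^bsub>M\<^esub> x) = \<zero>\<^bsub>M\<^esub>" if "y \<in> Y" for y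
    using n r that assms smult_commute[of "y [^] n" r x] by (simp add: subsetD)
  then show "r \<odot>\<^bsub>M\<^esub> x \<in> power_torsion Y" using n r by (auto simp: power_torsion_def)
qed

lemma pow_kill_mono:
  assumes "y \<in> carrier R" "x \<in> carrier M" "(y [^] (n::nat)) \<odot>\<^bsub>M\<^esub> x = \<zero>\<^bsub>M\<^esub>" "n \<le> m"
  shows "(y [^] m) \<odot>\<^bsub>M\<^esub> x = \<zero>\<^bsub>M\<^esub>"
proof -
  have "(y [^] m) \<odot>\<^bsub>M\<^esub> x = (y [^] (m - n)) \<odot>\<^bsub>M\<^esub> ((y [^] n) \<odot>\<^bsub>M\<^esub> x)"
    using assms R.nat_pow_mult[of y "m - n" n] smult_assoc1[of "y [^] (m - n)" "y [^] n" x] by simp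
  then show ?thesis using assms by simp
qed

end

section \<open>Injective modules\<close>

text \<open>\<open>M'\<close> is only a record with operations. Every axiom is an equation between
  images and is pulled back along the surjection \<open>h\<close>.\<close>

lemma module_image:
  assumes "module R M"
    and im: "h ` carrier M = carrier M'"
    and add: "\<And>x y. x \<in> carrier M \<Longrightarrow> y \<in> carrier M \<Longrightarrow> h (x \<oplus>\<^bsub>M\<^esub> y) = h x \<oplus>\<^bsub>M'\<^esub> h y"
    and smult: "\<And>r x. r \<in> carrier R \<Longrightarrow> x \<in> carrier M \<Longrightarrow> h (r \<odot>\<^bsub>M\<^esub> x) = r \<odot>\<^bsub>M'\<^esub> h x"
    and zero: "h \<zero>\<^bsub>M\<^esub> = \<zero>\<^bsub>M'\<^esub>"
  shows "module R M'" "h \<in> mod_hom R M M'"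
proof -
  interpret M: module R M by fact
  have ex: "\<exists>x\<in>carrier M. x' = h x" if "x' \<in> carrier M'" for x' using that im by auto
  have c: "h x \<in> carrier M'" if "x \<in> carrier M" for x using that im by auto
  show "h \<in> mod_hom R M M'" using c add smult by (auto simp: mod_hom_def)
  show "module R M'"
  proof (intro moduleI abelian_groupI)
    show "cring R" by (rule M.R.is_cring)
    fix x assume x: "x \<in> carrier M'"
    obtain u where u: "u \<in> carrier M" "x = h u" using ex[OF x] by auto
    show "\<exists>y\<in>carrier M'. y \<oplus>\<^bsub>M'\<^esub> x = \<zero>\<^bsub>M'\<^esub>"
      by (rule bexI[of _ "h (\<ominus>\<^bsub>M\<^esub> u)"]) (use u c in \<open>auto simp: add[symmetric] M.M.l_neg zero\<close>)
    show "\<zero>\<^bsub>M'\<^esub> \<oplus>\<^bsub>M'\<^esub> x = x" using u add[of "\<zero>\<^bsub>M\<^esub>" u] zero by simp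
    show "\<one>\<^bsub>R\<^esub> \<odot>\<^bsub>M'\<^esub> x = x" using u smult[of "\<one>\<^bsub>R\<^esub>" u] by simp
    fix y assume y: "y \<in> carrier M'"
    obtain v where v: "v \<in> carrier M" "y = h v" using ex[OF y] by auto
    show "x \<oplus>\<^bsub>M'\<^esub> y \<in> carrier M'" using u v c[of "u \<oplus>\<^bsub>M\<^esub> v"] add by simp
    show "x \<oplus>\<^bsub>M'\<^esub> y = y \<oplus>\<^bsub>M'\<^esub> x" using u v add[symmetric] M.M.a_comm by simp
    show "a \<odot>\<^bsub>M'\<^esub> (x \<oplus>\<^bsub>M'\<^esub> y) = a \<odot>\<^bsub>M'\<^esub> x \<oplus>\<^bsub>M'\<^esub> a \<odot>\<^bsub>M'\<^esub> y" if "a \<in> carrier R" for a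
      using u v that by (simp add: add[symmetric] smult[symmetric] M.smult_r_distr)
    fix z assume z: "z \<in> carrier M'"
    obtain w where w: "w \<in> carrier M" "z = h w" using ex[OF z] by auto
    show "x \<oplus>\<^bsub>M'\<^esub> y \<oplus>\<^bsub>M'\<^esub> z = x \<oplus>\<^bsub>M'\<^esub> (y \<oplus>\<^bsub>M'\<^esub> z)"
      using u v w by (simp add: add[symmetric] M.M.a_assoc)
  next
    show "\<zero>\<^bsub>M'\<^esub> \<in> carrier M'" using zero c by (metis M.M.zero_closed)
  next
    fix a x assume a: "a \<in> carrier R" and x: "x \<in> carrier M'"
    obtain u where u: "u \<in> carrier M" "x = h u" using ex[OF x] by auto
    show "a \<odot>\<^bsub>M'\<^esub> x \<in> carrier M'" using a u c[of "a \<odot>\<^bsub>M\<^esub> u"] smult by simp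
    fix b assume b: "b \<in> carrier R"
    show "(a \<oplus>\<^bsub>R\<^esub> b) \<odot>\<^bsub>M'\<^esub> x = a \<odot>\<^bsub>M'\<^esub> x \<oplus>\<^bsub>M'\<^esub> b \<odot>\<^bsub>M'\<^esub> x"
      using a b u by (simp add: add[symmetric] smult[symmetric] M.smult_l_distr)
    show "a \<otimes>\<^bsub>R\<^esub> b \<odot>\<^bsub>M'\<^esub> x = a \<odot>\<^bsub>M'\<^esub> (b \<odot>\<^bsub>M'\<^esub> x)"
      using a b u by (simp add: add[symmetric] smult[symmetric] M.smult_assoc1)
  qed
qed

text \<open>A quotient of \<open>M\<close> whose elements are values of \<open>h\<close> instead of
  cosets, so that it lives in a prescribed element type. Taking sets of elements would leave the
  type at each step of a resolution.\<close>

definition push_module :: "('r, 'm, 'y) module_scheme \<Rightarrow> ('m \<Rightarrow> 'n) \<Rightarrow> ('r, 'n) module" where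
  "push_module M h = (let s = inv_into (carrier M) h in
     \<lparr>carrier = h ` carrier M, monoid.mult = undefined, one = undefined, ring.zero = h \<zero>\<^bsub>M\<^esub>,
      add = (\<lambda>x y. h (s x \<oplus>\<^bsub>M\<^esub> s y)), smult = (\<lambda>r x. h (r \<odot>\<^bsub>M\<^esub> s x))\<rparr>)"

text \<open>The operations are computed on chosen preimages. Two preimages of a value differ by an
  element of \<open>K\<close>, and since the fibres of \<open>h\<close> are the cosets of
  \<open>K\<close>, the result is the same.\<close>

lemma push_module:
  assumes "module R M" "submodule K R M"
    and h: "\<And>x y. x \<in> carrier M \<Longrightarrow> y \<in> carrier M \<Longrightarrow> h x = h y \<longleftrightarrow> x \<ominus>\<^bsub>M\<^esub> y \<in> K"
  shows "module R (push_module M h)" "h \<in> mod_hom R M (push_module M h)"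
    "h ` carrier M = carrier (push_module M h)"
    "{x \<in> carrier M. h x = \<zero>\<^bsub>push_module M h\<^esub>} = K"
proof -
  interpret M: module R M by fact
  note K = M.submoduleE[OF assms(2)]
  let ?s = "inv_into (carrier M) h"
  have s: "?s (h x) \<in> carrier M" "h (?s (h x)) = h x" if "x \<in> carrier M" for x
    using that by (auto intro: inv_into_into f_inv_into_f)
  have sK: "?s (h x) \<ominus>\<^bsub>M\<^esub> x \<in> K" if "x \<in> carrier M" for x using s h that by blast
  have add: "h (x \<oplus>\<^bsub>M\<^esub> y) = h (?s (h x) \<oplus>\<^bsub>M\<^esub> ?s (h y))" if "x \<in> carrier M" "y \<in> carrier M" for x y
  proof -
    have "?s (h x) \<oplus>\<^bsub>M\<^esub> ?s (h y) \<ominus>\<^bsub>M\<^esub> (x \<oplus>\<^bsub>M\<^esub> y) = (?s (h x) \<ominus>\<^bsub>M\<^esub> x) \<oplus>\<^bsub>M\<^esub> (?s (h y) \<ominus>\<^bsub>M\<^esub> y)"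
      using that s by (simp add: a_minus_def M.M.minus_add M.M.a_ac)
    also have "\<dots> \<in> K" using sK that K(5) by blast
    finally show ?thesis using h that s by (metis M.M.a_closed)
  qed
  have sm: "h (r \<odot>\<^bsub>M\<^esub> x) = h (r \<odot>\<^bsub>M\<^esub> ?s (h x))" if "x \<in> carrier M" "r \<in> carrier R" for x r
  proof -
    have "r \<odot>\<^bsub>M\<^esub> ?s (h x) \<ominus>\<^bsub>M\<^esub> r \<odot>\<^bsub>M\<^esub> x = r \<odot>\<^bsub>M\<^esub> (?s (h x) \<ominus>\<^bsub>M\<^esub> x)"
      using that s by (simp add: M.smult_diff)
    also have "\<dots> \<in> K" using sK that K(4) by blast
    finally show ?thesis using h that s by (metis M.smult_closed)
  qed
  show "h ` carrier M = carrier (push_module M h)" by (simp add: push_module_def Let_def)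
  show "module R (push_module M h)" "h \<in> mod_hom R M (push_module M h)"
    by (rule module_image[OF assms(1)]; use add sm in \<open>simp add: push_module_def Let_def\<close>)+
  show "{x \<in> carrier M. h x = \<zero>\<^bsub>push_module M h\<^esub>} = K"
    using h[of _ "\<zero>\<^bsub>M\<^esub>"] K(1) by (auto simp: push_module_def Let_def)
qed

lemma (in module) zero_submodule: "submodule {\<zero>\<^bsub>M\<^esub>} R M"
  by (rule submoduleI) auto

lemma push_module_inj:
  assumes "module R M" "inj_on h (carrier M)"
  shows "module R (push_module M h)" "h \<in> mod_hom R M (push_module M h)"
    "h ` carrier M = carrier (push_module M h)"
proof -
  interpret M: module R M by fact
  have "h x = h y \<longleftrightarrow> x \<ominus>\<^bsub>M\<^esub> y \<in> {\<zero>\<^bsub>M\<^esub>}" if "x \<in> carrier M" "y \<in> carrier M" for x y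
    using that assms(2) M.diff_eq_zero_iff by (auto dest: inj_onD)
  from push_module[OF assms(1) M.zero_submodule this]
  show "module R (push_module M h)" "h \<in> mod_hom R M (push_module M h)"
    "h ` carrier M = carrier (push_module M h)" by auto
qed

section \<open>Baer's criterion and Koszul cohomology of injective modules\<close>

lemma regular_module: "cring R \<Longrightarrow> module R (regular_module R)"
proof -
  assume "cring R"
  then interpret R: cring R .
  show ?thesis
    by (intro moduleI abelian_groupI R.is_cring)
      (auto simp: regular_module_def R.a_ac R.l_distr R.r_distr R.m_assoc intro: R.a_inv_closed R.l_neg bexI[of _ "\<ominus>\<^bsub>R\<^esub> _"])
qed

lemma regular_module_simps [simp]:
  "carrier (regular_module R) = carrier R" "ring.zero (regular_module R) = \<zero>\<^bsub>R\<^esub>"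
  "add (regular_module R) = add R" "smult (regular_module R) = monoid.mult R"
  by (simp_all add: regular_module_def)

text \<open>Submodules of the regular module are the ideals. Test modules of the element type of
  \<open>E\<close> do not occur, and the condition yields elements of \<open>E\<close>
  directly.\<close>

definition baer :: "('r, 'x) ring_scheme \<Rightarrow> ('r, 'm, 'y) module_scheme \<Rightarrow> bool" where
  "baer R E \<longleftrightarrow> (\<forall>J f. submodule J R (regular_module R) \<longrightarrow> f \<in> mod_hom R ((regular_module R)\<lparr>carrier := J\<rparr>) E \<longrightarrow>
     (\<exists>v\<in>carrier E. \<forall>r\<in>J. f r = r \<odot>\<^bsub>E\<^esub> v))"

text \<open>\<open>injective_module\<close> tests only modules with the element type of
  \<open>E\<close>. The injection \<open>\<epsilon>\<close> places a copy of the ring among them,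
  and \<open>v\<close> is the image of the copy of one under the extended map.\<close>

lemma injective_imp_baer:
  fixes E :: "('r, 'u) module" and \<epsilon> :: "'r \<Rightarrow> 'u"
  assumes "cring R" "injective_module R E" "inj \<epsilon>"
  shows "baer R E"
  unfolding baer_def
proof (intro allI impI)
  fix J f assume J: "submodule J R (regular_module R)" and f: "f \<in> mod_hom R ((regular_module R)\<lparr>carrier := J\<rparr>) E"
  interpret R: cring R by fact
  interpret L: module R "regular_module R" by (rule regular_module[OF assms(1)])
  define B where "B = push_module (regular_module R) \<epsilon>"
  have inj: "inj_on \<epsilon> (carrier (regular_module R))" using assms(3) by (simp add: inj_on_def)
  note B = push_module_inj[OF L.module_axioms inj, folded B_def]
  interpret B: module R B by (rule B(1))
  note \<epsilon> = mod_homD[OF B(2)]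
  define \<eta> where "\<eta> = inv_into UNIV \<epsilon>"
  have \<eta>[simp]: "\<eta> (\<epsilon> x) = x" for x using assms(3) by (simp add: \<eta>_def)
  note JE = L.submoduleE[OF J]
  let ?A = "\<epsilon> ` J"
  have Jc: "J \<subseteq> carrier R" using JE(1) by simp
  have A: "submodule ?A R B"
  proof (rule B.submoduleI)
    show "?A \<subseteq> carrier B" using JE(1) \<epsilon>(1) by auto
    show "\<zero>\<^bsub>B\<^esub> \<in> ?A" using mod_hom_zero[OF L.module_axioms B(1,2)] JE(2,3,5) Jc
      by (metis L.M.r_neg ex_in_conv image_iff subsetD regular_module_simps(1))
  next
    fix a assume "a \<in> ?A"
    then obtain x where x: "x \<in> J" "a = \<epsilon> x" by auto
    then have "\<ominus>\<^bsub>B\<^esub> a = \<epsilon> (\<ominus>\<^bsub>regular_module R\<^esub> x)"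
      using mod_hom_minus[OF L.module_axioms B(1,2), of x] Jc by (simp add: subsetD)
    then show "\<ominus>\<^bsub>B\<^esub> a \<in> ?A" using JE(3)[OF x(1)] by simp
  next
    fix a b assume "a \<in> ?A" "b \<in> ?A"
    then obtain x y where x: "x \<in> J" "y \<in> J" "a = \<epsilon> x" "b = \<epsilon> y" by auto
    then have "a \<oplus>\<^bsub>B\<^esub> b = \<epsilon> (x \<oplus>\<^bsub>regular_module R\<^esub> y)"
      using \<epsilon>(2)[of x y] JE(1) by (simp add: subsetD)
    then show "a \<oplus>\<^bsub>B\<^esub> b \<in> ?A" using JE(5)[OF x(1,2)] by simp
  next
    fix r a assume r: "r \<in> carrier R" and "a \<in> ?A"
    then obtain x where x: "x \<in> J" "a = \<epsilon> x" by auto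
    then have "r \<odot>\<^bsub>B\<^esub> a = \<epsilon> (r \<odot>\<^bsub>regular_module R\<^esub> x)"
      using \<epsilon>(3)[OF r, of x] JE(1) by (simp add: subsetD)
    then show "r \<odot>\<^bsub>B\<^esub> a \<in> ?A" using JE(4)[OF r x(1)] by simp
  qed
  have "(\<lambda>x. f (\<eta> x)) \<in> mod_hom R (B\<lparr>carrier := ?A\<rparr>) E"
  proof -
    note ff = mod_homD[OF f, simplified]
    have "f (\<eta> (\<epsilon> x \<oplus>\<^bsub>B\<^esub> \<epsilon> y)) = f x \<oplus>\<^bsub>E\<^esub> f y" if "x \<in> J" "y \<in> J" for x y
      using that Jc \<epsilon>(2)[of x y, symmetric] ff(2)[of x y] by (auto simp: subsetD)
    moreover have "f (\<eta> (r \<odot>\<^bsub>B\<^esub> \<epsilon> x)) = r \<odot>\<^bsub>E\<^esub> f x" if "x \<in> J" "r \<in> carrier R" for x r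
      using that Jc \<epsilon>(3)[of r x, symmetric] ff(3)[of r x] by (auto simp: subsetD)
    ultimately show ?thesis using ff(1) by (auto simp: mod_hom_def)
  qed
  then obtain g where g: "g \<in> mod_hom R B E" "\<forall>x\<in>?A. g x = f (\<eta> x)"
    using assms(2) A B(1) unfolding injective_module_def by blast
  have "f r = r \<odot>\<^bsub>E\<^esub> g (\<epsilon> \<one>\<^bsub>R\<^esub>)" if "r \<in> J" for r
  proof -
    have "f r = g (\<epsilon> r)" using g(2) that by auto
    also have "\<epsilon> r = r \<odot>\<^bsub>B\<^esub> \<epsilon> \<one>\<^bsub>R\<^esub>" using \<epsilon>(3)[of r "\<one>\<^bsub>R\<^esub>"] that Jc by auto
    finally show ?thesis using mod_homD(3)[OF g(1)] that Jc \<epsilon>(1) by auto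
  qed
  then show "\<exists>v\<in>carrier E. \<forall>r\<in>J. f r = r \<odot>\<^bsub>E\<^esub> v"
    using mod_homD(1)[OF g(1)] \<epsilon>(1)[of "\<one>\<^bsub>R\<^esub>"] by auto
qed

text \<open>The colon ideals \<open>(J : y^k)\<close> increase with \<open>k\<close>, so they become
  stationary.\<close>

lemma noetherian_colon_stable:
  assumes "cring R" "noetherian_ring R" "ideal J R" "y \<in> carrier R"
  shows "\<exists>k. \<forall>n. \<forall>r\<in>carrier R. y [^]\<^bsub>R\<^esub> (k + n :: nat) \<otimes>\<^bsub>R\<^esub> r \<in> J \<longrightarrow> y [^]\<^bsub>R\<^esub> k \<otimes>\<^bsub>R\<^esub> r \<in> J"
proof -
  interpret R: cring R by fact
  interpret N: noetherian_ring R by fact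
  interpret J: ideal J R by fact
  define C where "C k = {r \<in> carrier R. y [^]\<^bsub>R\<^esub> (k::nat) \<otimes>\<^bsub>R\<^esub> r \<in> J}" for k
  have id: "ideal (C k) R" for k
  proof (rule idealI)
    show "ring R" by (rule R.ring_axioms)
    show "subgroup (C k) (add_monoid R)"
      by (rule R.add.subgroupI)
        (use assms(4) in \<open>auto simp: C_def R.r_distr R.r_minus simp flip: a_inv_def intro: exI[of _ "\<zero>\<^bsub>R\<^esub>"]\<close>)
  next
    fix r s assume rs: "r \<in> C k" "s \<in> carrier R"
    have "y [^]\<^bsub>R\<^esub> k \<otimes>\<^bsub>R\<^esub> (s \<otimes>\<^bsub>R\<^esub> r) = s \<otimes>\<^bsub>R\<^esub> (y [^]\<^bsub>R\<^esub> k \<otimes>\<^bsub>R\<^esub> r)"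
      using rs assms(4) by (auto simp: C_def R.m_ac)
    then show "s \<otimes>\<^bsub>R\<^esub> r \<in> C k" using rs by (auto simp: C_def J.I_l_closed)
    then show "r \<otimes>\<^bsub>R\<^esub> s \<in> C k" using rs R.m_comm[of r s] by (auto simp: C_def)
  qed
  have mono: "C k \<subseteq> C (k + n)" for k n
  proof
    fix r assume r: "r \<in> C k"
    have "y [^]\<^bsub>R\<^esub> (k + n) \<otimes>\<^bsub>R\<^esub> r = y [^]\<^bsub>R\<^esub> n \<otimes>\<^bsub>R\<^esub> (y [^]\<^bsub>R\<^esub> k \<otimes>\<^bsub>R\<^esub> r)"
      using r assms(4) by (auto simp: C_def R.nat_pow_mult[symmetric] R.m_ac)
    then show "r \<in> C (k + n)" using r assms(4) by (auto simp: C_def J.I_l_closed)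
  qed
  have "subset.chain {I. ideal I R} (range C)"
    unfolding subset_chain_def
  proof (intro conjI subsetI ballI)
    fix A B assume "A \<in> range C" "B \<in> range C"
    then obtain i j where "A = C i" "B = C j" by auto
    then show "A \<subseteq> B \<or> B \<subseteq> A" using mono[of i "j - i"] mono[of j "i - j"] by (cases "i \<le> j") auto
  qed (use id in auto)
  then have "\<Union>(range C) \<in> range C" by (intro N.ideal_chain_is_trivial) auto
  then obtain k where k: "\<Union>(range C) = C k" by auto
  show ?thesis
  proof (intro exI[of _ k] allI ballI impI)
    fix n r assume "r \<in> carrier R" "y [^]\<^bsub>R\<^esub> (k + n) \<otimes>\<^bsub>R\<^esub> r \<in> J"
    then have "r \<in> C (k + n)" by (auto simp: C_def)
    then have "r \<in> C k" using k by auto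
    then show "y [^]\<^bsub>R\<^esub> k \<otimes>\<^bsub>R\<^esub> r \<in> J" by (auto simp: C_def)
  qed
qed

lemma (in abelian_group) diff_eq_diffI:
  assumes "a \<oplus> j = b \<oplus> i" "a \<in> carrier G" "b \<in> carrier G" "i \<in> carrier G" "j \<in> carrier G"
  shows "a \<ominus> b = i \<ominus> j"
proof -
  have c: "(x \<oplus> z) \<ominus> (y \<oplus> z) = x \<ominus> y" if "x \<in> carrier G" "y \<in> carrier G" "z \<in> carrier G" for x y z
  proof -
    have "(x \<oplus> z) \<ominus> (y \<oplus> z) = (x \<oplus> \<ominus> y) \<oplus> (z \<oplus> \<ominus> z)"
      using that by (simp only: a_minus_def minus_add a_inv_closed a_closed a_ac)
    then show ?thesis using that by (simp add: r_neg a_minus_def)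
  qed
  have "a \<ominus> b = (b \<oplus> i) \<ominus> (b \<oplus> j)" using c[of a b j] assms by simp
  also have "\<dots> = i \<ominus> j" using c[of i j b] assms by (simp add: a_comm)
  finally show ?thesis .
qed

context module begin

text \<open>If \<open>k\<close> is so large that the ideals \<open>(Ann u : y\<^sup>k)\<close> have become stationary, then \<open>y\<^bsup>k+n\<^esup> r + j \<mapsto> y\<^sup>k r u\<close> is
  well defined on \<open>y\<^bsup>k+n\<^esup> R + Ann u\<close>; Baer's criterion applied to this map yields \<open>v\<close>.\<close>

lemma baer_divisible:
  assumes "noetherian_ring R" "baer R M" "W \<subseteq> carrier R" "y \<in> carrier R" "u \<in> power_torsion W"
  shows "\<exists>v\<in>power_torsion W. (y [^] (n::nat)) \<odot>\<^bsub>M\<^esub> v \<ominus>\<^bsub>M\<^esub> u \<in> power_torsion (insert y W)"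
proof -
  have uc: "u \<in> carrier M" using assms(5) by (simp add: power_torsion_def)
  define J where "J = {r \<in> carrier R. r \<odot>\<^bsub>M\<^esub> u = \<zero>\<^bsub>M\<^esub>}"
  have J: "ideal J R"
  proof (rule idealI)
    show "ring R" by (rule R.ring_axioms)
    show "subgroup J (add_monoid R)"
      by (rule R.add.subgroupI) (use uc in \<open>auto simp: J_def smult_l_distr smult_l_minus simp flip: a_inv_def intro: exI[of _ \<zero>]\<close>)
  next
    fix r s assume rs: "r \<in> J" "s \<in> carrier R"
    show "s \<otimes> r \<in> J" using rs uc by (auto simp: J_def smult_assoc1)
    then show "r \<otimes> s \<in> J" using rs R.m_comm[of r s] by (auto simp: J_def)
  qed
  have Ju: "j \<odot>\<^bsub>M\<^esub> u = \<zero>\<^bsub>M\<^esub>" if "j \<in> J" for j using that by (simp add: J_def)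
  have JI: "j \<in> J" if "j \<in> carrier R" "j \<odot>\<^bsub>M\<^esub> u = \<zero>\<^bsub>M\<^esub>" for j using that by (simp add: J_def)
  interpret J: ideal J R by (rule J)
  obtain k where k: "\<And>n r. r \<in> carrier R \<Longrightarrow> y [^] (k + n :: nat) \<otimes> r \<in> J \<Longrightarrow> y [^] k \<otimes> r \<in> J"
    using noetherian_colon_stable[OF R.is_cring assms(1) J assms(4)] by blast
  define Y where "Y = y [^] (k + n)"
  have Y: "Y \<in> carrier R" using assms(4) by (simp add: Y_def)
  have yk: "y [^] k \<in> carrier R" using assms(4) by simp
  define A where "A = {Y \<otimes> r \<oplus> j | r j. r \<in> carrier R \<and> j \<in> J}"
  interpret L: module R "regular_module R" by (rule regular_module[OF R.is_cring])
  have Jc: "j \<in> carrier R" if "j \<in> J" for j using that by (rule J.Icarr)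
  have A: "submodule A R (regular_module R)"
  proof (rule L.submoduleI)
    show "A \<subseteq> carrier (regular_module R)" using Y Jc by (auto simp: A_def)
    have "\<zero> = Y \<otimes> \<zero> \<oplus> \<zero>" using Y by simp
    then show "\<zero>\<^bsub>regular_module R\<^esub> \<in> A" unfolding A_def using J.zero_closed by (auto intro!: exI[of _ \<zero>])
  next
    fix a b assume "a \<in> A" "b \<in> A"
    then obtain r j s i where a: "a = Y \<otimes> r \<oplus> j" "b = Y \<otimes> s \<oplus> i" "r \<in> carrier R" "s \<in> carrier R" "i \<in> J" "j \<in> J"
      by (auto simp: A_def)
    have "a \<oplus> b = Y \<otimes> (r \<oplus> s) \<oplus> (j \<oplus> i)" using a Y Jc by (simp add: R.r_distr R.a_ac)
    then show "a \<oplus>\<^bsub>regular_module R\<^esub> b \<in> A" unfolding A_def using a by auto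
  next
    fix c a assume c: "c \<in> carrier R" "a \<in> A"
    then obtain r j where a: "a = Y \<otimes> r \<oplus> j" "r \<in> carrier R" "j \<in> J" by (auto simp: A_def)
    have "c \<otimes> a = Y \<otimes> (c \<otimes> r) \<oplus> c \<otimes> j" using a Y Jc c by (simp add: R.r_distr R.m_ac)
    then show *: "c \<odot>\<^bsub>regular_module R\<^esub> a \<in> A" unfolding A_def using a c J.I_l_closed by auto
  next
    fix a assume "a \<in> A"
    then obtain r j where a: "a = Y \<otimes> r \<oplus> j" "r \<in> carrier R" "j \<in> J" by (auto simp: A_def)
    have "\<ominus>\<^bsub>regular_module R\<^esub> a = (\<ominus> \<one>) \<otimes> a"
      using L.smult_l_minus[of \<one> a] a Y Jc by simp
    also have "\<dots> = Y \<otimes> (\<ominus> \<one> \<otimes> r) \<oplus> (\<ominus> \<one>) \<otimes> j" using a Y Jc by (simp add: R.r_distr R.m_ac R.l_minus R.r_minus R.minus_add)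
    finally show "\<ominus>\<^bsub>regular_module R\<^esub> a \<in> A" unfolding A_def
      using a J.I_l_closed[OF a(3), of "\<ominus> \<one>"] by blast
  qed
  \<comment> \<open>If two representations agree, then \<open>y^(k+n) (r - s)\<close> lies in
    \<open>J\<close>, and by the choice of \<open>k\<close> already \<open>y^k (r - s)\<close>
    does.\<close>
  have wd: "y [^] k \<odot>\<^bsub>M\<^esub> (r \<odot>\<^bsub>M\<^esub> u) = y [^] k \<odot>\<^bsub>M\<^esub> (s \<odot>\<^bsub>M\<^esub> u)"
    if "Y \<otimes> r \<oplus> j = Y \<otimes> s \<oplus> i" "r \<in> carrier R" "s \<in> carrier R" "i \<in> J" "j \<in> J" for r s i j
  proof -
    have "Y \<otimes> (r \<ominus> s) = Y \<otimes> r \<ominus> Y \<otimes> s"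
      using that Y by (simp add: a_minus_def R.r_distr R.r_minus)
    also have "\<dots> = i \<ominus> j" using that Y Jc by (intro R.diff_eq_diffI) auto
    also have "\<dots> \<in> J" using that by (simp add: a_minus_def)
    finally have "y [^] k \<otimes> (r \<ominus> s) \<in> J" using k[of "r \<ominus> s" n] that by (simp add: Y_def)
    then have "y [^] k \<odot>\<^bsub>M\<^esub> ((r \<ominus> s) \<odot>\<^bsub>M\<^esub> u) = \<zero>\<^bsub>M\<^esub>" using that yk uc Ju[of "y [^] k \<otimes> (r \<ominus> s)"] by (simp add: smult_assoc1)
    moreover have "(r \<ominus> s) \<odot>\<^bsub>M\<^esub> u = r \<odot>\<^bsub>M\<^esub> u \<ominus>\<^bsub>M\<^esub> s \<odot>\<^bsub>M\<^esub> u" using that uc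
      by (simp add: a_minus_def smult_l_distr smult_l_minus)
    ultimately show ?thesis using that yk uc by (simp add: smult_diff diff_eq_zero_iff)
  qed
  \<comment> \<open>The coefficient \<open>r\<close> of a representation is chosen arbitrarily;
    \<open>wd\<close> makes the value independent of the choice.\<close>
  define f where "f a = y [^] k \<odot>\<^bsub>M\<^esub> ((SOME r. r \<in> carrier R \<and> (\<exists>j\<in>J. a = Y \<otimes> r \<oplus> j)) \<odot>\<^bsub>M\<^esub> u)" for a
  have f: "f (Y \<otimes> r \<oplus> j) = y [^] k \<odot>\<^bsub>M\<^esub> (r \<odot>\<^bsub>M\<^esub> u)" if "r \<in> carrier R" "j \<in> J" for r j
  proof -
    let ?s = "SOME s. s \<in> carrier R \<and> (\<exists>i\<in>J. Y \<otimes> r \<oplus> j = Y \<otimes> s \<oplus> i)"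
    have "?s \<in> carrier R \<and> (\<exists>i\<in>J. Y \<otimes> r \<oplus> j = Y \<otimes> ?s \<oplus> i)"
      by (rule someI[of _ r]) (use that in auto)
    then obtain i where i: "?s \<in> carrier R" "i \<in> J" "Y \<otimes> r \<oplus> j = Y \<otimes> ?s \<oplus> i" by blast
    show ?thesis unfolding f_def using wd[OF i(3) that(1) i(1,2) that(2)] by simp
  qed
  have fhom: "f \<in> mod_hom R ((regular_module R)\<lparr>carrier := A\<rparr>) M"
    unfolding mod_hom_def
  proof (safe, simp_all)
    fix a assume "a \<in> A"
    then obtain r j where a: "a = Y \<otimes> r \<oplus> j" "r \<in> carrier R" "j \<in> J" by (auto simp: A_def)
    show "f a \<in> carrier M" using a f yk uc by simp
    show "f (c \<otimes> a) = c \<odot>\<^bsub>M\<^esub> f a" if "c \<in> carrier R" for c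
    proof -
      have "c \<otimes> a = Y \<otimes> (c \<otimes> r) \<oplus> c \<otimes> j" using a Y Jc that by (simp add: R.r_distr R.m_ac)
      then show ?thesis using f[of "c \<otimes> r" "c \<otimes> j"] f[of r j] a that J.I_l_closed yk uc
        by (simp add: smult_assoc1 smult_commute)
    qed
    fix b assume "b \<in> A"
    then obtain s i where b: "b = Y \<otimes> s \<oplus> i" "s \<in> carrier R" "i \<in> J" by (auto simp: A_def)
    have "a \<oplus> b = Y \<otimes> (r \<oplus> s) \<oplus> (j \<oplus> i)" using a b Y Jc by (simp add: R.r_distr R.a_ac)
    then show "f (a \<oplus> b) = f a \<oplus>\<^bsub>M\<^esub> f b" using f[of "r \<oplus> s" "j \<oplus> i"] f a b yk uc
      by (simp add: smult_l_distr smult_r_distr)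
  qed
  then obtain v where v: "v \<in> carrier M" "\<And>r. r \<in> A \<Longrightarrow> f r = r \<odot>\<^bsub>M\<^esub> v"
    using assms(2) A unfolding baer_def by blast
  \<comment> \<open>The domain of \<open>f\<close> contains \<open>J\<close>, on which
    \<open>f\<close> vanishes. So \<open>v\<close> is killed by whatever kills \<open>u\<close>,
    which keeps it in the \<open>W\<close>-torsion.\<close>
  have jv: "j \<odot>\<^bsub>M\<^esub> v = \<zero>\<^bsub>M\<^esub>" if "j \<in> J" for j
  proof -
    have e: "j = Y \<otimes> \<zero> \<oplus> j" using Y Jc[OF that] by simp
    then have "j \<in> A" unfolding A_def using that by blast
    then show ?thesis using v(2)[of j] f[of \<zero> j] e that yk uc by simp
  qed
  have e: "Y = Y \<otimes> \<one> \<oplus> \<zero>" using Y by simp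
  then have "Y \<in> A" unfolding A_def using J.zero_closed by blast
  then have Yv: "Y \<odot>\<^bsub>M\<^esub> v = y [^] k \<odot>\<^bsub>M\<^esub> u" using v(2)[of Y] f[of \<one> \<zero>] e uc J.zero_closed by simp
  obtain s where s: "\<forall>z\<in>W. (z [^] (s::nat)) \<odot>\<^bsub>M\<^esub> u = \<zero>\<^bsub>M\<^esub>" using assms(5) by (auto simp: power_torsion_def)
  have zs: "z [^] s \<in> J" if "z \<in> W" for z using that s assms(3) by (intro JI) auto
  let ?d = "(y [^] n) \<odot>\<^bsub>M\<^esub> v \<ominus>\<^bsub>M\<^esub> u"
  have vt: "v \<in> power_torsion W" using v(1) jv zs by (auto simp: power_torsion_def)
  have dc: "?d \<in> carrier M" using v(1) uc assms(4) by simp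
  have "y [^] k \<odot>\<^bsub>M\<^esub> ((y [^] n) \<odot>\<^bsub>M\<^esub> v) = y [^] k \<odot>\<^bsub>M\<^esub> u"
    using Yv v(1) assms(4) by (simp add: Y_def R.nat_pow_mult[symmetric] smult_assoc1)
  then have d1: "y [^] k \<odot>\<^bsub>M\<^esub> ?d = \<zero>\<^bsub>M\<^esub>" using v(1) uc assms(4) by (simp add: smult_diff)
  have d2: "z [^] s \<odot>\<^bsub>M\<^esub> ?d = \<zero>\<^bsub>M\<^esub>" if "z \<in> W" for z
  proof -
    have z: "z [^] s \<in> carrier R" using zs[OF that] by (rule Jc)
    have "z [^] s \<odot>\<^bsub>M\<^esub> ((y [^] n) \<odot>\<^bsub>M\<^esub> v) = (y [^] n) \<odot>\<^bsub>M\<^esub> (z [^] s \<odot>\<^bsub>M\<^esub> v)"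
      using z v(1) assms(4) by (simp add: smult_commute)
    then show ?thesis using z v(1) uc assms(4) jv[OF zs[OF that]] s that by (simp add: smult_diff)
  qed
  have "?d \<in> power_torsion (insert y W)" unfolding power_torsion_def
    using dc assms(3,4) by (auto intro!: exI[of _ "k + s"] pow_kill_mono[OF _ _ d1] pow_kill_mono[OF _ _ d2])
  then show ?thesis using vt by blast
qed

text \<open>\<open>W\<close> collects the elements already treated, for which all values are
  torsion. Split \<open>w\<close> at its first entry into halves \<open>a\<close> and
  \<open>b\<close>. By divisibility \<open>b\<close> is \<open>y^n \<alpha>\<close> up to
  \<open>y\<close>-torsion, so removing the coboundary of \<open>\<alpha>\<close> leaves, up to
  sign, a cocycle with halves \<open>a1\<close> and \<open>b1\<close> of \<open>y\<close>-torsion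
  values. The induction hypothesis with \<open>y\<close> added to \<open>W\<close> bounds
  \<open>a1\<close> by \<open>\<beta>\<close>. In the \<open>True\<close> half the leftovers
  \<open>b1\<close> and \<open>\<beta>\<close> are killed by a power of \<open>y\<close>, which
  further transitions supply.\<close>

lemma baer_koszul_vanishes_aux:
  assumes noeth: "noetherian_ring R" and baer: "baer R M"
  assumes "set ys \<subseteq> carrier R" "W \<subseteq> carrier R" "\<And>bs. w bs \<in> power_torsion W" "in_degree M (length ys) (Suc q) w" "cocycle M (powers R n ys) w"
  shows "\<exists>m v. (\<forall>bs. v bs \<in> power_torsion W) \<and> in_degree M (length ys) q v \<and>
       (\<forall>bs. length bs = length ys \<longrightarrow> transition R M ys m w bs = koszul_d M (powers R (n + m) ys) v bs)"
  using assms(3-7)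
proof (induction ys arbitrary: W w)
  case Nil
  have "\<zero>\<^bsub>M\<^esub> \<in> power_torsion W" using power_torsion_submodule[OF Nil(2)] submodule.axioms(1) subgroup.one_closed by fastforce
  then show ?case using Nil by (intro exI[of _ 0] exI[of _ "\<lambda>_. \<zero>\<^bsub>M\<^esub>"]) (auto simp: in_degree_def transition_zero)
next
  case (Cons y ys)
  let ?t = "length ys" and ?W = "insert y W"
  have y: "y \<in> carrier R" and ys: "set ys \<subseteq> carrier R" and W: "?W \<subseteq> carrier R" and W0: "W \<subseteq> carrier R" using Cons.prems by auto
  note pws = R.powers_closed[OF ys]
  note T = submoduleE[OF power_torsion_submodule[OF W0]]
  note T' = submoduleE[OF power_torsion_submodule[OF W]]
  have 0: "\<zero>\<^bsub>M\<^esub> \<in> power_torsion W" "\<zero>\<^bsub>M\<^esub> \<in> power_torsion ?W"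
    using power_torsion_submodule[OF W0] power_torsion_submodule[OF W] submodule.axioms(1) subgroup.one_closed by fastforce+
  have minus: "x \<ominus>\<^bsub>M\<^esub> x' \<in> power_torsion V" if "x \<in> power_torsion V" "x' \<in> power_torsion V" "V \<subseteq> carrier R" for x x' V
    using submoduleE[OF power_torsion_submodule[OF that(3)]] that by (simp add: a_minus_def)
  have sub: "koszul_d M zs v bs \<in> power_torsion V" if "\<And>bs. v bs \<in> power_torsion V" "V \<subseteq> carrier R" "set zs \<subseteq> carrier R" for v V zs bs
    using that(1,3)
  proof (induction zs arbitrary: v bs)
    case Nil then show ?case using power_torsion_submodule[OF that(2)] submodule.axioms(1) subgroup.one_closed by fastforce
  next
    case (Cons z zs)
    show ?case unfolding koszul_d_Cons' using Cons minus submoduleE(4)[OF power_torsion_submodule[OF that(2)]] that(2) by auto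
  qed
  let ?a = "\<lambda>cs. w (False # cs)" and ?b = "\<lambda>cs. w (True # cs)"
  have wc: "cochain M w" using Cons.prems T(1) by (auto simp: cochain_def)
  then have ac: "cochain M ?a" and bc: "cochain M ?b" and wcl: "\<And>bs. w bs \<in> carrier M" by (auto simp: cochain_def)
  have yn: "y [^] n \<in> carrier R" for n :: nat using y by simp
  have ka: "koszul_d M (powers R n ys) ?a cs = \<zero>\<^bsub>M\<^esub>" if "length cs = ?t" for cs
    using Cons.prems(5) that unfolding cocycle_def by (auto dest: spec[of _ "False # cs"])
  have kb: "y [^] n \<odot>\<^bsub>M\<^esub> ?a cs = koszul_d M (powers R n ys) ?b cs" if "length cs = ?t" for cs
  proof -
    have "y [^] n \<odot>\<^bsub>M\<^esub> ?a cs \<ominus>\<^bsub>M\<^esub> koszul_d M (powers R n ys) ?b cs = \<zero>\<^bsub>M\<^esub>"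
      using Cons.prems(5) that unfolding cocycle_def by (auto dest: spec[of _ "True # cs"])
    then show ?thesis using diff_eq_zero_iff[OF smult_closed[OF yn cochainD[OF wc]] koszul_d_closed[OF pws bc]] by simp
  qed
  have "\<forall>cs. \<exists>v. v \<in> power_torsion W \<and> (y [^] n) \<odot>\<^bsub>M\<^esub> v \<ominus>\<^bsub>M\<^esub> ?b cs \<in> power_torsion ?W \<and> (?b cs = \<zero>\<^bsub>M\<^esub> \<longrightarrow> v = \<zero>\<^bsub>M\<^esub>)"
  proof
    fix cs
    show "\<exists>v. v \<in> power_torsion W \<and> (y [^] n) \<odot>\<^bsub>M\<^esub> v \<ominus>\<^bsub>M\<^esub> ?b cs \<in> power_torsion ?W \<and> (?b cs = \<zero>\<^bsub>M\<^esub> \<longrightarrow> v = \<zero>\<^bsub>M\<^esub>)"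
    proof (cases "?b cs = \<zero>\<^bsub>M\<^esub>")
      case True
      then show ?thesis using 0 yn by (intro exI[of _ "\<zero>\<^bsub>M\<^esub>"]) simp
    next
      case False
      then show ?thesis using baer_divisible[OF noeth baer W0 y, of "?b cs" n] Cons.prems by blast
    qed
  qed
  then obtain \<alpha> where \<alpha>: "\<And>cs. \<alpha> cs \<in> power_torsion W" "\<And>cs. (y [^] n) \<odot>\<^bsub>M\<^esub> \<alpha> cs \<ominus>\<^bsub>M\<^esub> ?b cs \<in> power_torsion ?W" "\<And>cs. ?b cs = \<zero>\<^bsub>M\<^esub> \<Longrightarrow> \<alpha> cs = \<zero>\<^bsub>M\<^esub>"
    by metis
  have \<alpha>c: "cochain M \<alpha>" using \<alpha> T by (auto simp: cochain_def)
  have y\<alpha>c: "cochain M (\<lambda>cs. (y [^] n) \<odot>\<^bsub>M\<^esub> \<alpha> cs)" using \<alpha>c yn by (auto simp: cochain_def)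
  have d\<alpha>: "in_degree M ?t q \<alpha>" using Cons.prems(4) \<alpha>(3) by (auto simp: in_degree_def)
  define b1 where "b1 cs = (y [^] n) \<odot>\<^bsub>M\<^esub> \<alpha> cs \<ominus>\<^bsub>M\<^esub> ?b cs" for cs
  define a1 where "a1 cs = (if length cs = ?t then ?a cs \<ominus>\<^bsub>M\<^esub> koszul_d M (powers R n ys) \<alpha> cs else \<zero>\<^bsub>M\<^esub>)" for cs
  have b1: "b1 cs \<in> power_torsion ?W" for cs using \<alpha>(2) by (simp add: b1_def)
  have b1c: "cochain M b1" using b1 T' by (auto simp: cochain_def)
  have a1c: "cochain M a1" using ac pws \<alpha>c by (auto simp: cochain_def a1_def intro!: diff_closed koszul_d_closed)
  have ya1: "(y [^] n) \<odot>\<^bsub>M\<^esub> a1 cs = \<ominus>\<^bsub>M\<^esub> koszul_d M (powers R n ys) b1 cs" if cs: "length cs = ?t" for cs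
  proof -
    have "(y [^] n) \<odot>\<^bsub>M\<^esub> a1 cs = koszul_d M (powers R n ys) ?b cs \<ominus>\<^bsub>M\<^esub> (y [^] n) \<odot>\<^bsub>M\<^esub> koszul_d M (powers R n ys) \<alpha> cs"
      using cs kb[OF cs] wcl \<alpha>c yn pws by (simp add: a1_def smult_diff cochainD)
    also have "(y [^] n) \<odot>\<^bsub>M\<^esub> koszul_d M (powers R n ys) \<alpha> cs = koszul_d M (powers R n ys) (\<lambda>cs. (y [^] n) \<odot>\<^bsub>M\<^esub> \<alpha> cs) cs"
      using koszul_d_smult[OF pws yn \<alpha>c] by simp
    also have "koszul_d M (powers R n ys) ?b cs \<ominus>\<^bsub>M\<^esub> koszul_d M (powers R n ys) (\<lambda>cs. (y [^] n) \<odot>\<^bsub>M\<^esub> \<alpha> cs) cs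
      = \<ominus>\<^bsub>M\<^esub> (koszul_d M (powers R n ys) (\<lambda>cs. (y [^] n) \<odot>\<^bsub>M\<^esub> \<alpha> cs) cs \<ominus>\<^bsub>M\<^esub> koszul_d M (powers R n ys) ?b cs)"
      using koszul_d_closed[OF pws bc] koszul_d_closed[OF pws y\<alpha>c] by (simp add: a_minus_def M.minus_add M.a_comm)
    also have "koszul_d M (powers R n ys) (\<lambda>cs. (y [^] n) \<odot>\<^bsub>M\<^esub> \<alpha> cs) cs \<ominus>\<^bsub>M\<^esub> koszul_d M (powers R n ys) ?b cs = koszul_d M (powers R n ys) b1 cs"
      using koszul_d_diff[OF pws y\<alpha>c bc] by (simp add: b1_def[abs_def])
    finally show ?thesis .
  qed
  \<comment> \<open>\<open>W\<close>-torsion holds by construction. For \<open>y\<close>, note that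
    \<open>y^n a1\<close> is up to sign the differential of \<open>b1\<close>, whose values are
    \<open>y\<close>-torsion.\<close>
  have a1: "a1 cs \<in> power_torsion ?W" for cs
  proof (cases "length cs = ?t")
    case True
    have "a1 cs \<in> power_torsion W" using True Cons.prems(3) sub[OF \<alpha>(1) W0 pws] minus W0 by (simp add: a1_def)
    moreover have "(y [^] n) \<odot>\<^bsub>M\<^esub> a1 cs \<in> power_torsion ?W"
      unfolding ya1[OF True] by (rule T'(3)[OF sub[OF b1 W pws]])
    ultimately obtain s r where s: "\<forall>z\<in>W. (z [^] (s::nat)) \<odot>\<^bsub>M\<^esub> a1 cs = \<zero>\<^bsub>M\<^esub>" "a1 cs \<in> carrier M"
      and r: "(y [^] (r::nat)) \<odot>\<^bsub>M\<^esub> ((y [^] n) \<odot>\<^bsub>M\<^esub> a1 cs) = \<zero>\<^bsub>M\<^esub>" by (auto simp: power_torsion_def)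
    have r': "(y [^] (r + n)) \<odot>\<^bsub>M\<^esub> a1 cs = \<zero>\<^bsub>M\<^esub>" using r s y by (simp add: R.nat_pow_mult[symmetric] smult_assoc1)
    show ?thesis unfolding power_torsion_def using s r' W0 y
      by (auto intro!: exI[of _ "s + (r + n)"] intro: pow_kill_mono)
  next
    case False then show ?thesis using 0 by (simp add: a1_def)
  qed
  have da1: "in_degree M ?t (Suc q) a1"
  proof -
    have "in_degree M ?t (Suc q) ?a" using Cons.prems(4) by (auto simp: in_degree_def)
    moreover have "in_degree M ?t (Suc q) (koszul_d M (powers R n ys) \<alpha>)" using koszul_d_in_degree[OF pws, of n q \<alpha>] d\<alpha> by simp
    ultimately show ?thesis by (auto simp: in_degree_def a1_def)
  qed
  have ca1: "cocycle M (powers R n ys) a1" unfolding cocycle_def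
  proof (intro allI impI)
    fix cs :: "bool list" assume cs: "length cs = length (powers R n ys)"
    have "koszul_d M (powers R n ys) a1 cs = koszul_d M (powers R n ys) (\<lambda>cs. ?a cs \<ominus>\<^bsub>M\<^esub> koszul_d M (powers R n ys) \<alpha> cs) cs"
      by (rule koszul_d_cong) (use cs in \<open>auto simp: a1_def\<close>)
    also have "\<dots> = \<zero>\<^bsub>M\<^esub>"
      using koszul_d_diff[OF pws ac cochain_koszul_d[OF pws \<alpha>c]] ka koszul_d_koszul_d[OF pws \<alpha>c cs] cs by simp
    finally show "koszul_d M (powers R n ys) a1 cs = \<zero>\<^bsub>M\<^esub>" .
  qed
  obtain m1 \<beta> where \<beta>: "\<And>cs. \<beta> cs \<in> power_torsion ?W" "in_degree M ?t q \<beta>"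
    "\<And>cs. length cs = ?t \<Longrightarrow> transition R M ys m1 a1 cs = koszul_d M (powers R (n + m1) ys) \<beta> cs"
    using Cons.IH[OF ys W a1 da1 ca1] by blast
  have \<beta>c: "cochain M \<beta>" using \<beta>(1) T' by (auto simp: cochain_def)
  \<comment> \<open>One exponent serves all values, since only finitely many lists have length
    \<open>?t\<close>.\<close>
  have "\<exists>m2. \<forall>cs\<in>{cs. length cs = ?t}. (y [^] (m2::nat)) \<odot>\<^bsub>M\<^esub> b1 cs = \<zero>\<^bsub>M\<^esub> \<and> (y [^] m2) \<odot>\<^bsub>M\<^esub> \<beta> cs = \<zero>\<^bsub>M\<^esub>"
  proof -
    have fin: "finite {cs :: bool list. length cs = ?t}" using finite_lists_length_eq[of "UNIV :: bool set" ?t] by simp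
    have "\<forall>cs. \<exists>m. (y [^] (m::nat)) \<odot>\<^bsub>M\<^esub> b1 cs = \<zero>\<^bsub>M\<^esub> \<and> (y [^] m) \<odot>\<^bsub>M\<^esub> \<beta> cs = \<zero>\<^bsub>M\<^esub>"
    proof
      fix cs
      obtain i j where "(y [^] (i::nat)) \<odot>\<^bsub>M\<^esub> b1 cs = \<zero>\<^bsub>M\<^esub>" "(y [^] (j::nat)) \<odot>\<^bsub>M\<^esub> \<beta> cs = \<zero>\<^bsub>M\<^esub>"
        using b1[of cs] \<beta>(1)[of cs] by (auto simp: power_torsion_def)
      then show "\<exists>m. (y [^] (m::nat)) \<odot>\<^bsub>M\<^esub> b1 cs = \<zero>\<^bsub>M\<^esub> \<and> (y [^] m) \<odot>\<^bsub>M\<^esub> \<beta> cs = \<zero>\<^bsub>M\<^esub>"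
        using y b1c \<beta>c by (intro exI[of _ "i + j"]) (auto intro: pow_kill_mono simp: cochainD)
    qed
    then obtain k where k: "\<And>cs. (y [^] (k cs::nat)) \<odot>\<^bsub>M\<^esub> b1 cs = \<zero>\<^bsub>M\<^esub> \<and> (y [^] k cs) \<odot>\<^bsub>M\<^esub> \<beta> cs = \<zero>\<^bsub>M\<^esub>" by metis
    have "k cs \<le> Max (k ` {cs. length cs = ?t})" if "length cs = ?t" for cs using fin that by auto
    then show ?thesis using k y b1c \<beta>c by (blast intro: pow_kill_mono cochainD)
  qed
  then obtain m2 where m2: "\<And>cs. length cs = ?t \<Longrightarrow> (y [^] (m2::nat)) \<odot>\<^bsub>M\<^esub> b1 cs = \<zero>\<^bsub>M\<^esub>"
      "\<And>cs. length cs = ?t \<Longrightarrow> (y [^] m2) \<odot>\<^bsub>M\<^esub> \<beta> cs = \<zero>\<^bsub>M\<^esub>" by auto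
  let ?m = "m1 + m2"
  let ?N = "n + ?m"
  \<comment> \<open>The term from \<open>\<alpha>\<close> accounts for the coboundary that was
    removed from \<open>w\<close>, the term from \<open>\<beta>\<close> bounds the remainder
    \<open>a1\<close>. The \<open>True\<close> half of \<open>v\<close> is zero.\<close>
  define vF where "vF cs = transition R M ys ?m \<alpha> cs \<oplus>\<^bsub>M\<^esub> transition R M ys m2 \<beta> cs" for cs
  define v where "v bs = (if bs = [] \<or> hd bs then \<zero>\<^bsub>M\<^esub> else vF (tl bs))" for bs
  have trT: "transition R M ys m u cs \<in> power_torsion W" if "u cs \<in> power_torsion W" for m u cs
    unfolding transition_def using T(4) that koszul_prod_closed R.powers_closed[OF ys] by blast
  have \<beta>W: "\<beta> cs \<in> power_torsion W" for cs using \<beta>(1)[of cs] by (auto simp: power_torsion_def)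
  have vW: "v bs \<in> power_torsion W" for bs using 0 trT \<alpha>(1) \<beta>W T(5) by (simp add: v_def vF_def)
  have dv: "in_degree M (length (y # ys)) q v"
    using transition_in_degree[OF ys d\<alpha>, of ?m] transition_in_degree[OF ys \<beta>(2), of m2]
    by (auto simp: in_degree_def v_def vF_def length_Suc_conv)
  have t\<alpha>c: "cochain M (transition R M ys ?m \<alpha>)" "cochain M (transition R M ys m2 \<beta>)" using \<alpha>c \<beta>c ys by auto
  have vFc: "cochain M vF" using t\<alpha>c by (auto simp: cochain_def vF_def)
  have "transition R M (y # ys) ?m w bs = koszul_d M (powers R ?N (y # ys)) v bs" if "length bs = length (y # ys)" for bs
  proof -
    from that obtain b cs where bs: "bs = b # cs" and cs: "length cs = ?t" by (cases bs) auto
    have vF_koszul_d: "koszul_d M (powers R ?N ys) vF cs = transition R M ys ?m ?a cs"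
    proof -
      have "koszul_d M (powers R ?N ys) vF cs = koszul_d M (powers R ?N ys) (transition R M ys ?m \<alpha>) cs \<oplus>\<^bsub>M\<^esub> koszul_d M (powers R ?N ys) (transition R M ys m2 \<beta>) cs"
        unfolding vF_def[abs_def] by (rule koszul_d_add[OF pws t\<alpha>c])
      also have "koszul_d M (powers R ?N ys) (transition R M ys ?m \<alpha>) cs = transition R M ys ?m (koszul_d M (powers R n ys) \<alpha>) cs"
        using koszul_d_of_transition[OF ys \<alpha>c cs] by simp
      also have "koszul_d M (powers R ?N ys) (transition R M ys m2 \<beta>) cs = transition R M ys m2 (koszul_d M (powers R (n + m1) ys) \<beta>) cs"
        using koszul_d_of_transition[OF ys \<beta>c cs, of "n + m1" m2] by (simp add: add.assoc)
      also have "\<dots> = transition R M ys m2 (transition R M ys m1 a1) cs"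
        using \<beta>(3)[OF cs] by (simp add: transition_def)
      also have "\<dots> = transition R M ys ?m a1 cs" by (rule transition_transition[OF ys a1c])
      also have "transition R M ys ?m (koszul_d M (powers R n ys) \<alpha>) cs \<oplus>\<^bsub>M\<^esub> transition R M ys ?m a1 cs = transition R M ys ?m (\<lambda>cs. koszul_d M (powers R n ys) \<alpha> cs \<oplus>\<^bsub>M\<^esub> a1 cs) cs"
        by (rule transition_add[OF ys cochain_koszul_d[OF pws \<alpha>c] a1c, symmetric])
      also have "\<dots> = transition R M ys ?m ?a cs"
        using cs wcl koszul_d_closed[OF pws \<alpha>c] by (simp add: transition_def a1_def a_minus_def cochainD M.a_lcomm M.r_neg)
      finally show ?thesis .
    qed
    have kz0: "koszul_d M (powers R ?N ys) (\<lambda>cs. v (True # cs)) cs = \<zero>\<^bsub>M\<^esub>"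
      using cs pws by (intro koszul_d_zero) (auto simp: v_def)
    show ?thesis
    proof (cases b)
      case False
      then show ?thesis using bs vF_koszul_d by (simp add: transition_def v_def)
    next
      case True
      have kpc: "koszul_prod R (powers R m ys) cs \<in> carrier R" for m by (intro koszul_prod_closed R.powers_closed ys)
      have "y [^] ?N \<odot>\<^bsub>M\<^esub> transition R M ys m2 \<beta> cs = \<zero>\<^bsub>M\<^esub>"
      proof -
        have "y [^] ?N \<odot>\<^bsub>M\<^esub> \<beta> cs = \<zero>\<^bsub>M\<^esub>" by (rule pow_kill_mono[OF y cochainD[OF \<beta>c] m2(2)[OF cs]]) simp
        then show ?thesis using smult_commute[OF yn kpc cochainD[OF \<beta>c]] kpc by (simp add: transition_def)
      qed
      then have 1: "y [^] ?N \<odot>\<^bsub>M\<^esub> vF cs = y [^] ?N \<odot>\<^bsub>M\<^esub> transition R M ys ?m \<alpha> cs"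
        using t\<alpha>c yn by (simp add: vF_def smult_r_distr cochainD)
      have 2: "y [^] ?m \<odot>\<^bsub>M\<^esub> ?b cs = y [^] ?N \<odot>\<^bsub>M\<^esub> \<alpha> cs"
      proof -
        have "y [^] ?m \<odot>\<^bsub>M\<^esub> b1 cs = \<zero>\<^bsub>M\<^esub>" by (rule pow_kill_mono[OF y cochainD[OF b1c] m2(1)[OF cs]]) simp
        then have "y [^] ?m \<odot>\<^bsub>M\<^esub> ((y [^] n) \<odot>\<^bsub>M\<^esub> \<alpha> cs) \<ominus>\<^bsub>M\<^esub> y [^] ?m \<odot>\<^bsub>M\<^esub> ?b cs = \<zero>\<^bsub>M\<^esub>"
          using yn \<alpha>c wcl by (simp add: b1_def smult_diff cochainD)
        then have "y [^] ?m \<odot>\<^bsub>M\<^esub> ((y [^] n) \<odot>\<^bsub>M\<^esub> \<alpha> cs) = y [^] ?m \<odot>\<^bsub>M\<^esub> ?b cs"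
          using diff_eq_zero_iff yn \<alpha>c wcl by (simp add: cochainD)
        moreover have "y [^] ?m \<odot>\<^bsub>M\<^esub> ((y [^] n) \<odot>\<^bsub>M\<^esub> \<alpha> cs) = y [^] ?N \<odot>\<^bsub>M\<^esub> \<alpha> cs"
          using y \<alpha>c smult_assoc1[of "y [^] ?m" "y [^] n" "\<alpha> cs"] R.nat_pow_mult[of y ?m n] by (simp add: cochainD add.commute)
        ultimately show ?thesis by simp
      qed
      have "transition R M (y # ys) ?m w bs = koszul_prod R (powers R ?m ys) cs \<odot>\<^bsub>M\<^esub> (y [^] ?m \<odot>\<^bsub>M\<^esub> ?b cs)"
        using True bs kpc yn wcl smult_commute[OF yn kpc cochainD[OF bc]] by (simp add: transition_def smult_assoc1 cochainD)
      also have "\<dots> = y [^] ?N \<odot>\<^bsub>M\<^esub> transition R M ys ?m \<alpha> cs"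
        unfolding 2 transition_def using smult_commute[OF yn kpc cochainD[OF \<alpha>c]] by simp
      finally show ?thesis using True bs 1 kz0 t\<alpha>c yn by (simp add: v_def cochainD)
    qed
  qed
  then show ?case using vW dv by blast
qed

lemma baer_koszul_vanishes:
  assumes "noetherian_ring R" "baer R M" "set ys \<subseteq> carrier R" "0 < p"
  shows "koszul_vanishes R ys M p"
proof -
  obtain q where q: "p = Suc q" using assms(4) gr0_implies_Suc by blast
  \<comment> \<open>The induction starts from \<open>W = {}\<close>, where being torsion is no
    restriction.\<close>
  have t: "power_torsion {} = carrier M" by (auto simp: power_torsion_def)
  show ?thesis unfolding koszul_vanishes_iff q in_pred_degree_Suc
    using baer_koszul_vanishes_aux[OF assms(1-3), of "{}"] unfolding t cochain_def by blast
qed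

end

section \<open>The total complex of two Koszul complexes\<close>

text \<open>\<open>c\<close> is indexed by basis elements of two Koszul complexes, the outer one in
  \<open>s\<close> and the inner one in \<open>t\<close>. The inner differential carries the sign
  given by the number of \<open>True\<close> entries of \<open>s\<close>, which the recursion of
  \<open>koszul_cone\<close> produces.\<close>

definition total_d :: "('r, 'm, 'y) module_scheme \<Rightarrow> 'r list \<Rightarrow> 'r list \<Rightarrow> (bool list \<Rightarrow> bool list \<Rightarrow> 'm) \<Rightarrow> bool list \<Rightarrow> bool list \<Rightarrow> 'm" where
  "total_d M xs zs c s t = koszul_cone M xs (\<lambda>s. c s t) (\<lambda>s. koszul_d M zs (c s) t) s"

text \<open>Interior multiplication at position \<open>i\<close>, with a factor -1 for each
  \<open>True\<close> before it. It lowers the degree by one and is the homotopy of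
  \<open>koszul_cone_contraction\<close>.\<close>

primrec contraction :: "('r, 'm, 'y) module_scheme \<Rightarrow> nat \<Rightarrow> (bool list \<Rightarrow> 'm) \<Rightarrow> bool list \<Rightarrow> 'm" where
  "contraction M 0 c bs = (if hd bs then \<zero>\<^bsub>M\<^esub> else c (True # tl bs))"
| "contraction M (Suc i) c bs = (if hd bs then \<ominus>\<^bsub>M\<^esub> contraction M i (\<lambda>cs. c (True # cs)) (tl bs) else contraction M i (\<lambda>cs. c (False # cs)) (tl bs))"

definition bicochain :: "('r, 'm, 'y) module_scheme \<Rightarrow> (bool list \<Rightarrow> bool list \<Rightarrow> 'm) \<Rightarrow> bool" where
  "bicochain M c \<longleftrightarrow> (\<forall>s t. c s t \<in> carrier M)"

lemma total_d_Nil [simp]: "total_d M [] zs c s t = koszul_d M zs (c s) t" by (simp add: total_d_def)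

lemma total_d_Cons [simp]: "total_d M (x # xs) zs c (b # s) t = (if b
    then x \<odot>\<^bsub>M\<^esub> c (False # s) t \<ominus>\<^bsub>M\<^esub> total_d M xs zs (\<lambda>s. c (True # s)) s t
    else total_d M xs zs (\<lambda>s. c (False # s)) s t)"
  by (simp add: total_d_def)

lemma bicochainD: "bicochain M c \<Longrightarrow> c s t \<in> carrier M" and bicochain_cochain: "bicochain M c \<Longrightarrow> cochain M (c s)"
  and bicochain_cochain': "bicochain M c \<Longrightarrow> cochain M (\<lambda>s. c s t)" and bicochain_sub: "bicochain M c \<Longrightarrow> bicochain M (\<lambda>s. c (b # s))"
  by (simp_all add: bicochain_def cochain_def)

context module begin

lemma contraction_closed [simp]: "(\<And>bs. c bs \<in> carrier M) \<Longrightarrow> contraction M i c bs \<in> carrier M"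
  by (induction i arbitrary: c bs) auto

lemma minus_diff_distr: "a \<in> carrier M \<Longrightarrow> b \<in> carrier M \<Longrightarrow> \<ominus>\<^bsub>M\<^esub> (a \<ominus>\<^bsub>M\<^esub> b) = (\<ominus>\<^bsub>M\<^esub> a) \<ominus>\<^bsub>M\<^esub> (\<ominus>\<^bsub>M\<^esub> b)"
  by (simp add: a_minus_def M.minus_add)

lemma contraction_diff: "(\<And>bs. c bs \<in> carrier M) \<Longrightarrow> (\<And>bs. d bs \<in> carrier M) \<Longrightarrow>
   contraction M i (\<lambda>bs. c bs \<ominus>\<^bsub>M\<^esub> d bs) bs = contraction M i c bs \<ominus>\<^bsub>M\<^esub> contraction M i d bs"
  by (induction i arbitrary: c d bs) (auto simp: minus_diff_distr)

lemma contraction_smult: "r \<in> carrier R \<Longrightarrow> (\<And>bs. c bs \<in> carrier M) \<Longrightarrow> contraction M i (\<lambda>bs. r \<odot>\<^bsub>M\<^esub> c bs) bs = r \<odot>\<^bsub>M\<^esub> contraction M i c bs"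
  by (induction i arbitrary: c bs) (auto simp: smult_r_minus)

text \<open>The two operations act on different arguments of \<open>c\<close>.\<close>

lemma contraction_koszul_d: "set zs \<subseteq> carrier R \<Longrightarrow> bicochain M c \<Longrightarrow> koszul_d M zs (\<lambda>t. contraction M i (\<lambda>s. c s t) s) t = contraction M i (\<lambda>s. koszul_d M zs (c s) t) s"
proof (induction i arbitrary: c s)
  case 0
  then show ?case using koszul_cone_zero[of zs t] by (cases "hd s") (auto simp: koszul_d_def)
next
  case (Suc i)
  have IH: "koszul_d M zs (\<lambda>t. contraction M i (\<lambda>s. c (b # s) t) (tl s)) t = contraction M i (\<lambda>s. koszul_d M zs (c (b # s)) t) (tl s)" for b
    using Suc.IH[OF Suc.prems(1) bicochain_sub[OF Suc.prems(2)]] .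
  have cc: "cochain M (\<lambda>t. contraction M i (\<lambda>s. c (b # s) t) (tl s))" for b
    unfolding cochain_def using Suc.prems by (auto simp: bicochain_def)
  have e: "\<ominus>\<^bsub>M\<^esub> x = \<zero>\<^bsub>M\<^esub> \<ominus>\<^bsub>M\<^esub> x" if "x \<in> carrier M" for x using that by (simp add: a_minus_def)
  have "koszul_d M zs (\<lambda>t. \<ominus>\<^bsub>M\<^esub> contraction M i (\<lambda>s. c (True # s) t) (tl s)) t
      = koszul_d M zs (\<lambda>t. \<zero>\<^bsub>M\<^esub> \<ominus>\<^bsub>M\<^esub> contraction M i (\<lambda>s. c (True # s) t) (tl s)) t"
    by (subst e) (use cc in \<open>auto simp: cochain_def\<close>)
  also have "\<dots> = \<zero>\<^bsub>M\<^esub> \<ominus>\<^bsub>M\<^esub> koszul_d M zs (\<lambda>t. contraction M i (\<lambda>s. c (True # s) t) (tl s)) t"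
    using koszul_d_diff[OF Suc.prems(1) cochain_zero cc] koszul_cone_zero[OF Suc.prems(1)] by (simp add: koszul_d_def)
  also have "\<dots> = \<ominus>\<^bsub>M\<^esub> koszul_d M zs (\<lambda>t. contraction M i (\<lambda>s. c (True # s) t) (tl s)) t"
    using e koszul_d_closed[OF Suc.prems(1) cc] by simp
  finally show ?case using IH by simp
qed

lemma koszul_cone_uminus:
  assumes "set zs \<subseteq> carrier R" "\<And>bs. w bs \<in> carrier M" "\<And>bs. g bs \<in> carrier M"
  shows "koszul_cone M zs (\<lambda>bs. \<ominus>\<^bsub>M\<^esub> w bs) (\<lambda>bs. \<ominus>\<^bsub>M\<^esub> g bs) bs = \<ominus>\<^bsub>M\<^esub> koszul_cone M zs w g bs"
  using assms
  by (induction zs arbitrary: w g bs) (auto simp: smult_r_minus minus_diff_distr)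

text \<open>The values \<open>g\<close> of the other differential drop out, because contraction
  changes the weight by one and with it their sign. What remains is the homotopy formula
  \<open>d h + h d = x_i\<close> of the Koszul complex of \<open>xs\<close>.\<close>

lemma koszul_cone_contraction:
  assumes "set xs \<subseteq> carrier R" "i < length xs" "\<And>bs. c bs \<in> carrier M" "\<And>bs. g bs \<in> carrier M" "length bs = length xs"
  shows "koszul_cone M xs (contraction M i c) (contraction M i g) bs \<oplus>\<^bsub>M\<^esub> contraction M i (koszul_cone M xs c g) bs = (xs ! i) \<odot>\<^bsub>M\<^esub> c bs"
  using assms
proof (induction i arbitrary: xs c g bs)
  case 0
  then obtain x xs' b cs where xs: "xs = x # xs'" "bs = b # cs" by (cases xs; cases bs) auto
  have k: "koszul_cone M xs' (\<lambda>cs. c (True # cs)) (\<lambda>cs. g (True # cs)) cs \<in> carrier M" using 0 xs by simp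
  have e: "a \<oplus>\<^bsub>M\<^esub> (b \<ominus>\<^bsub>M\<^esub> a) = b" if "a \<in> carrier M" "b \<in> carrier M" for a b
    using that M.a_lcomm[of a b "\<ominus>\<^bsub>M\<^esub> a"] by (simp add: a_minus_def M.r_neg)
  show ?case using 0 xs k koszul_cone_zero[of xs' cs] by (cases b) (auto simp: e)
next
  case (Suc i)
  then obtain x xs' b cs where xs: "xs = x # xs'" "bs = b # cs" by (cases xs; cases bs) auto
  have xs': "set xs' \<subseteq> carrier R" "x \<in> carrier R" "i < length xs'" "length cs = length xs'" using Suc.prems xs by auto
  note cc = Suc.prems(3,4)
  let ?c = "\<lambda>b cs. c (b # cs)" and ?g = "\<lambda>b cs. g (b # cs)"
  let ?K = "koszul_cone M xs' (contraction M i (?c b)) (contraction M i (?g b)) cs" and ?L = "contraction M i (koszul_cone M xs' (?c b) (?g b)) cs"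
  have IH: "?K \<oplus>\<^bsub>M\<^esub> ?L = (xs' ! i) \<odot>\<^bsub>M\<^esub> ?c b cs"
    by (rule Suc.IH) (use xs' cc in auto)
  show ?case
  proof (cases b)
    case False
    then show ?thesis using IH xs by simp
  next
    case True
    let ?A = "x \<odot>\<^bsub>M\<^esub> contraction M i (?c False) cs"
    have cl: "?A \<in> carrier M" "?K \<in> carrier M" "?L \<in> carrier M" using cc xs' by auto
    have "koszul_cone M xs (contraction M (Suc i) c) (contraction M (Suc i) g) bs = ?A \<ominus>\<^bsub>M\<^esub> (\<ominus>\<^bsub>M\<^esub> ?K)"
      using True xs koszul_cone_uminus[OF xs'(1), of "contraction M i (?c True)" "contraction M i (?g True)" cs] cc by simp
    moreover have "contraction M (Suc i) (koszul_cone M xs c g) bs = \<ominus>\<^bsub>M\<^esub> (?A \<ominus>\<^bsub>M\<^esub> ?L)"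
      using True xs cc xs' contraction_diff[of "\<lambda>cs. x \<odot>\<^bsub>M\<^esub> c (False # cs)" "koszul_cone M xs' (?c True) (?g True)" i cs]
        contraction_smult[OF xs'(2), of "?c False" i cs] by simp
    moreover have "a \<ominus>\<^bsub>M\<^esub> (\<ominus>\<^bsub>M\<^esub> k) \<oplus>\<^bsub>M\<^esub> \<ominus>\<^bsub>M\<^esub> (a \<ominus>\<^bsub>M\<^esub> l) = k \<oplus>\<^bsub>M\<^esub> l" if "a \<in> carrier M" "k \<in> carrier M" "l \<in> carrier M" for a k l
    proof -
      have "a \<ominus>\<^bsub>M\<^esub> (\<ominus>\<^bsub>M\<^esub> k) \<oplus>\<^bsub>M\<^esub> \<ominus>\<^bsub>M\<^esub> (a \<ominus>\<^bsub>M\<^esub> l) = (a \<oplus>\<^bsub>M\<^esub> \<ominus>\<^bsub>M\<^esub> a) \<oplus>\<^bsub>M\<^esub> (k \<oplus>\<^bsub>M\<^esub> l)"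
        using that by (simp only: a_minus_def M.minus_add M.minus_minus M.a_inv_closed M.a_closed M.a_ac)
      then show ?thesis using that by (simp add: M.r_neg)
    qed
    ultimately show ?thesis using IH True xs cl by simp
  qed
qed

text \<open>With zero in place of \<open>w\<close> the cone only multiplies \<open>g bs\<close> by
  -1 for each \<open>True\<close> in \<open>bs\<close>; this is the sign operator of the
  grading.\<close>

abbreviation sign_twist where "sign_twist xs g \<equiv> koszul_cone M xs (\<lambda>_. \<zero>\<^bsub>M\<^esub>) g"

lemma koszul_cone_split:
  assumes "set xs \<subseteq> carrier R" "\<And>bs. w bs \<in> carrier M" "\<And>bs. g bs \<in> carrier M"  "\<And>bs. g' bs \<in> carrier M"
  shows "koszul_cone M xs w (\<lambda>bs. g bs \<oplus>\<^bsub>M\<^esub> g' bs) bs = koszul_cone M xs w g bs \<oplus>\<^bsub>M\<^esub> sign_twist xs g' bs"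
  using koszul_cone_add[OF assms(1), of w g "\<lambda>_. \<zero>\<^bsub>M\<^esub>" g' bs] assms by simp

text \<open>The sign operator anticommutes with the differential of \<open>xs\<close>, which raises
  the weight by one. Negating the twisted \<open>g\<close> lets both parts of the cone change by the
  same sign.\<close>

lemma koszul_cone_twist:
  assumes "set xs \<subseteq> carrier R" "\<And>bs. u bs \<in> carrier M" "\<And>bs. g bs \<in> carrier M" "length bs = length xs"
  shows "koszul_cone M xs (sign_twist xs u) (\<lambda>bs. \<ominus>\<^bsub>M\<^esub> sign_twist xs g bs) bs = \<ominus>\<^bsub>M\<^esub> sign_twist xs (koszul_cone M xs u g) bs"
  using assms
proof (induction xs arbitrary: u g bs)
  case (Cons x xs)
  then obtain b cs where bs: "bs = b # cs" by (cases bs) auto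
  have xs: "set xs \<subseteq> carrier R" "x \<in> carrier R" "length cs = length xs" using Cons.prems bs by auto
  note cc = Cons.prems(2,3)
  have IH: "koszul_cone M xs (sign_twist xs (\<lambda>cs. u (b # cs))) (\<lambda>bs. \<ominus>\<^bsub>M\<^esub> sign_twist xs (\<lambda>cs. g (b # cs)) bs) cs = \<ominus>\<^bsub>M\<^esub> sign_twist xs (koszul_cone M xs (\<lambda>cs. u (b # cs)) (\<lambda>cs. g (b # cs))) cs"
    by (rule Cons.IH) (use xs cc in auto)
  have z: "\<zero>\<^bsub>M\<^esub> \<ominus>\<^bsub>M\<^esub> v = \<ominus>\<^bsub>M\<^esub> v" if "v \<in> carrier M" for v using that by (simp add: a_minus_def)
  show ?case
  proof (cases b)
    case False
    then show ?thesis using IH bs by simp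
  next
    case True
    let ?u = "\<lambda>b cs. u (b # cs)" and ?g = "\<lambda>cs. g (True # cs)"
    have "koszul_cone M (x # xs) (sign_twist (x # xs) u) (\<lambda>bs. \<ominus>\<^bsub>M\<^esub> sign_twist (x # xs) g bs) bs
       = x \<odot>\<^bsub>M\<^esub> sign_twist xs (?u False) cs \<ominus>\<^bsub>M\<^esub> koszul_cone M xs (\<lambda>cs. \<ominus>\<^bsub>M\<^esub> sign_twist xs (?u True) cs) (\<lambda>cs. \<ominus>\<^bsub>M\<^esub> (\<ominus>\<^bsub>M\<^esub> sign_twist xs ?g cs)) cs"
      using bs True xs cc by (simp add: z)
    also have "\<dots> = x \<odot>\<^bsub>M\<^esub> sign_twist xs (?u False) cs \<ominus>\<^bsub>M\<^esub> \<ominus>\<^bsub>M\<^esub> koszul_cone M xs (sign_twist xs (?u True)) (\<lambda>cs. \<ominus>\<^bsub>M\<^esub> sign_twist xs ?g cs) cs"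
      using xs cc by (subst koszul_cone_uminus) auto
    also have "\<dots> = x \<odot>\<^bsub>M\<^esub> sign_twist xs (?u False) cs \<ominus>\<^bsub>M\<^esub> sign_twist xs (koszul_cone M xs (?u True) ?g) cs"
      using IH True xs cc by simp
    also have "\<dots> = sign_twist xs (\<lambda>cs. x \<odot>\<^bsub>M\<^esub> u (False # cs) \<ominus>\<^bsub>M\<^esub> koszul_cone M xs (?u True) ?g cs) cs"
      using koszul_cone_diff[OF xs(1), of "\<lambda>_. \<zero>\<^bsub>M\<^esub>" "\<lambda>cs. x \<odot>\<^bsub>M\<^esub> u (False # cs)" "\<lambda>_. \<zero>\<^bsub>M\<^esub>" "koszul_cone M xs (?u True) ?g" cs]
        koszul_cone_smult[OF xs(1,2), of "\<lambda>_. \<zero>\<^bsub>M\<^esub>" "?u False" cs] xs cc by simp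
    also have "\<dots> = \<ominus>\<^bsub>M\<^esub> sign_twist (x # xs) (koszul_cone M (x # xs) u g) bs"
      using bs True xs cc by (simp add: z)
    finally show ?thesis .
  qed
qed simp

lemma sign_twist_koszul_d:
  assumes "set zs \<subseteq> carrier R" "set xs \<subseteq> carrier R" "bicochain M c"
  shows "koszul_d M zs (\<lambda>t. sign_twist xs (\<lambda>s. c s t) s) t = sign_twist xs (\<lambda>s. koszul_d M zs (c s) t) s"
  using assms(2,3)
proof (induction xs arbitrary: c s)
  case (Cons x xs)
  have IH: "koszul_d M zs (\<lambda>t. sign_twist xs (\<lambda>s. c (b # s) t) s) t = sign_twist xs (\<lambda>s. koszul_d M zs (c (b # s)) t) s" for b s
    using Cons.IH[OF _ bicochain_sub[OF Cons.prems(2)]] Cons.prems by simp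
  have cc: "cochain M (\<lambda>t. sign_twist xs (\<lambda>s. c (True # s) t) (tl s))"
    unfolding cochain_def using Cons.prems by (auto simp: bicochain_def intro!: koszul_cone_closed)
  show ?case
    using IH koszul_d_diff[OF assms(1) cochain_zero cc] koszul_cone_zero[OF assms(1)] Cons.prems by (cases "hd s") (auto simp: koszul_d_def)
qed simp

lemma total_d_closed [simp]: "set xs \<subseteq> carrier R \<Longrightarrow> set zs \<subseteq> carrier R \<Longrightarrow> bicochain M c \<Longrightarrow> total_d M xs zs c s t \<in> carrier M"
  unfolding total_d_def by (rule koszul_cone_closed) (auto simp: bicochainD bicochain_cochain intro!: koszul_d_closed)

lemma koszul_d_top: "set xs \<subseteq> carrier R \<Longrightarrow> w \<in> carrier M \<Longrightarrow> length s = length xs \<Longrightarrow> koszul_d M xs (\<lambda>s. if s = replicate (length xs) True then w else \<zero>\<^bsub>M\<^esub>) s = \<zero>\<^bsub>M\<^esub>"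
proof (induction xs arbitrary: s)
  case (Cons x xs)
  then obtain b cs where s: "s = b # cs" by (cases s) auto
  show ?case using Cons s koszul_d_zero[of xs cs "\<lambda>_. \<zero>\<^bsub>M\<^esub>"] by auto
qed simp

text \<open>Every element of \<open>zs\<close> acts null-homotopically on the Koszul complex of \<open>xs\<close>, by the homotopy
  \<^const>\<open>contraction\<close>. This extends the cocycle along \<open>zs\<close>, one element at a time.\<close>

lemma total_d_lift:
  assumes xs: "set xs \<subseteq> carrier R" and w: "w \<in> carrier M" and "set zs \<subseteq> set xs"
  shows "\<exists>c. bicochain M c \<and> (\<forall>s t. length s = length xs \<longrightarrow> length t = length zs \<longrightarrow> total_d M xs zs c s t = \<zero>\<^bsub>M\<^esub>) \<and>
     c (replicate (length xs) True) (replicate (length zs) False) = w"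
  using assms(3)
proof (induction zs)
  case Nil
  \<comment> \<open>Nothing lies above the top degree, so placing \<open>w\<close> at the
    all-\<open>True\<close> list gives a cocycle.\<close>
  let ?c = "\<lambda>s (t :: bool list). if s = replicate (length xs) True then w else \<zero>\<^bsub>M\<^esub>"
  have "total_d M xs [] ?c s t = \<zero>\<^bsub>M\<^esub>" if "length s = length xs" for s t
    using koszul_d_top[OF xs w that] by (simp add: total_d_def koszul_d_def)
  then show ?case using w by (intro exI[of _ ?c]) (auto simp: bicochain_def)
next
  case (Cons z zs)
  then obtain c where c: "bicochain M c" "\<And>s t. length s = length xs \<Longrightarrow> length t = length zs \<Longrightarrow> total_d M xs zs c s t = \<zero>\<^bsub>M\<^esub>"
     "c (replicate (length xs) True) (replicate (length zs) False) = w" by auto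
  have z: "z \<in> carrier R" and zs: "set zs \<subseteq> carrier R" using Cons.prems xs by auto
  obtain i where i: "i < length xs" "xs ! i = z" using Cons.prems by (auto simp: in_set_conv_nth)
  define h where "h s t = contraction M i (\<lambda>s. c s t) s" for s t
  have h: "bicochain M h" using c(1) by (auto simp: bicochain_def h_def)
  \<comment> \<open>By the homotopy formula the total differential of \<open>h\<close> is
    \<open>z c\<close>, since that of \<open>c\<close> vanishes. The sign twist turns this into the
    term that cancels \<open>z c\<close> in the component of the new element.\<close>
  define b where "b s t = sign_twist xs (\<lambda>s. h s t) s" for s t
  have b: "bicochain M b" using h xs by (auto simp: bicochain_def b_def intro!: koszul_cone_closed)
  define c' where "c' s t = (if t \<noteq> [] \<and> hd t then b s (tl t) else c s (tl t))" for s t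
  have c': "bicochain M c'" using b c(1) by (auto simp: bicochain_def c'_def)
  have "total_d M xs (z # zs) c' s t = \<zero>\<^bsub>M\<^esub>" if s: "length s = length xs" and "length t = length (z # zs)" for s t
  proof -
    from that obtain u t0 where t: "t = u # t0" "length t0 = length zs" by (cases t) auto
    show ?thesis
    proof (cases u)
      case False
      then have "total_d M xs (z # zs) c' s t = total_d M xs zs c s t0" using t by (simp add: total_d_def c'_def)
      then show ?thesis using c(2)[OF s t(2)] by simp
    next
      case True
      let ?g = "\<lambda>s. koszul_d M zs (h s) t0"
      have gc: "?g s \<in> carrier M" for s using zs h by (auto simp: bicochain_cochain intro!: koszul_d_closed)
      have hc: "h s t \<in> carrier M" "c s t \<in> carrier M" for s t using h c(1) by (auto simp: bicochainD)
      have Sg: "koszul_d M zs (b s) t0 = sign_twist xs ?g s" for s using sign_twist_koszul_d[OF zs xs h] by (simp add: b_def[abs_def])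
      have Sgc: "sign_twist xs ?g s \<in> carrier M" for s using xs gc by (intro koszul_cone_closed) auto
      have yc: "z \<odot>\<^bsub>M\<^esub> c s t0 \<in> carrier M" for s using z hc by simp
      have "total_d M xs (z # zs) c' s t = koszul_cone M xs (sign_twist xs (\<lambda>s. h s t0)) (\<lambda>s. z \<odot>\<^bsub>M\<^esub> c s t0 \<ominus>\<^bsub>M\<^esub> sign_twist xs ?g s) s"
        using t True by (simp add: total_d_def c'_def Sg) (simp add: b_def)
      also have "(\<lambda>s. z \<odot>\<^bsub>M\<^esub> c s t0 \<ominus>\<^bsub>M\<^esub> sign_twist xs ?g s) = (\<lambda>s. \<ominus>\<^bsub>M\<^esub> sign_twist xs ?g s \<oplus>\<^bsub>M\<^esub> z \<odot>\<^bsub>M\<^esub> c s t0)"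
        using yc Sgc by (simp add: a_minus_def M.a_comm)
      also have "koszul_cone M xs (sign_twist xs (\<lambda>s. h s t0)) (\<lambda>s. \<ominus>\<^bsub>M\<^esub> sign_twist xs ?g s \<oplus>\<^bsub>M\<^esub> z \<odot>\<^bsub>M\<^esub> c s t0) s
        = koszul_cone M xs (sign_twist xs (\<lambda>s. h s t0)) (\<lambda>s. \<ominus>\<^bsub>M\<^esub> sign_twist xs ?g s) s \<oplus>\<^bsub>M\<^esub> sign_twist xs (\<lambda>s. z \<odot>\<^bsub>M\<^esub> c s t0) s"
        using xs Sgc yc hc by (intro koszul_cone_split) (auto intro!: koszul_cone_closed)
      also have "koszul_cone M xs (sign_twist xs (\<lambda>s. h s t0)) (\<lambda>s. \<ominus>\<^bsub>M\<^esub> sign_twist xs ?g s) s = \<ominus>\<^bsub>M\<^esub> sign_twist xs (koszul_cone M xs (\<lambda>s. h s t0) ?g) s"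
        using xs hc gc s by (intro koszul_cone_twist) auto
      also have "sign_twist xs (koszul_cone M xs (\<lambda>s. h s t0) ?g) s = sign_twist xs (\<lambda>s. z \<odot>\<^bsub>M\<^esub> c s t0) s"
      proof (rule koszul_cone_cong[OF s])
        fix s :: "bool list" assume s: "length s = length xs"
        have g: "?g = contraction M i (\<lambda>s. koszul_d M zs (c s) t0)" using contraction_koszul_d[OF zs c(1)] by (simp add: h_def[abs_def])
        have kc: "koszul_d M zs (c s) t0 \<in> carrier M" for s using zs c(1) by (auto simp: bicochain_cochain intro!: koszul_d_closed)
        have e: "contraction M i (koszul_cone M xs (\<lambda>s. c s t0) (\<lambda>s. koszul_d M zs (c s) t0)) s = \<zero>\<^bsub>M\<^esub>"
        proof -
          \<comment> \<open>Contraction reads only lists of unchanged length, and just for those the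
            total differential of \<open>c\<close> is known to vanish.\<close>
          have "contraction M j u s = \<zero>\<^bsub>M\<^esub>" if "\<And>s. length s = n \<Longrightarrow> u s = \<zero>\<^bsub>M\<^esub>" "length s = n" "j < n" for j u s n
            using that
          proof (induction j arbitrary: u s n)
            case 0
            then show ?case by (cases s) auto
          next
            case (Suc j)
            then obtain b s' n' where s: "s = b # s'" "n = Suc n'" "length s' = n'" by (cases s) auto
            have "contraction M j (\<lambda>s. u (b # s)) s' = \<zero>\<^bsub>M\<^esub>" by (rule Suc.IH[of n']) (use Suc.prems s in auto)
            then show ?case using s by (cases b) auto
          qed
          from this[of "length xs" "koszul_cone M xs (\<lambda>s. c s t0) (\<lambda>s. koszul_d M zs (c s) t0)" s i]
          show ?thesis using c(2)[OF _ t(2)] s i(1) by (simp add: total_d_def)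
        qed
        have "koszul_cone M xs (\<lambda>s. h s t0) ?g s \<oplus>\<^bsub>M\<^esub> contraction M i (koszul_cone M xs (\<lambda>s. c s t0) (\<lambda>s. koszul_d M zs (c s) t0)) s = z \<odot>\<^bsub>M\<^esub> c s t0"
          using koszul_cone_contraction[OF xs i(1) hc(2)[of _ t0] kc s] i(2) by (simp add: g h_def)
        then show "koszul_cone M xs (\<lambda>s. h s t0) ?g s = z \<odot>\<^bsub>M\<^esub> c s t0"
          using e xs hc gc by simp
      qed auto
      also have "\<ominus>\<^bsub>M\<^esub> sign_twist xs (\<lambda>s. z \<odot>\<^bsub>M\<^esub> c s t0) s \<oplus>\<^bsub>M\<^esub> sign_twist xs (\<lambda>s. z \<odot>\<^bsub>M\<^esub> c s t0) s = \<zero>\<^bsub>M\<^esub>"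
        using xs yc by (intro M.l_neg koszul_cone_closed) auto
      finally show ?thesis .
    qed
  qed
  moreover have "c' (replicate (length xs) True) (replicate (length (z # zs)) False) = w"
    using c(3) by (simp add: c'_def)
  ultimately show ?case using c' by blast
qed

lemma total_d_diff:
  assumes "set xs \<subseteq> carrier R" "set zs \<subseteq> carrier R" "bicochain M c" "bicochain M d"
  shows "total_d M xs zs (\<lambda>s t. c s t \<ominus>\<^bsub>M\<^esub> d s t) s t = total_d M xs zs c s t \<ominus>\<^bsub>M\<^esub> total_d M xs zs d s t"
  unfolding total_d_def using assms
  by (subst koszul_cone_diff[symmetric]) (auto simp: bicochainD bicochain_cochain koszul_d_diff intro!: koszul_d_closed)

lemma total_d_add:
  assumes "set xs \<subseteq> carrier R" "set zs \<subseteq> carrier R" "bicochain M c" "bicochain M d"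
  shows "total_d M xs zs (\<lambda>s t. c s t \<oplus>\<^bsub>M\<^esub> d s t) s t = total_d M xs zs c s t \<oplus>\<^bsub>M\<^esub> total_d M xs zs d s t"
  unfolding total_d_def using assms
  by (subst koszul_cone_add[symmetric]) (auto simp: bicochainD bicochain_cochain koszul_d_add intro!: koszul_d_closed)

lemma total_d_smult:
  assumes "set xs \<subseteq> carrier R" "set zs \<subseteq> carrier R" "bicochain M c" "r \<in> carrier R"
  shows "total_d M xs zs (\<lambda>s t. r \<odot>\<^bsub>M\<^esub> c s t) s t = r \<odot>\<^bsub>M\<^esub> total_d M xs zs c s t"
  unfolding total_d_def using assms
  by (subst koszul_cone_smult[symmetric]) (auto simp: bicochainD bicochain_cochain koszul_d_smult intro!: koszul_d_closed)

lemma bicochain_diff: "bicochain M c \<Longrightarrow> bicochain M d \<Longrightarrow> bicochain M (\<lambda>s t. c s t \<ominus>\<^bsub>M\<^esub> d s t)"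
  and bicochain_add: "bicochain M c \<Longrightarrow> bicochain M d \<Longrightarrow> bicochain M (\<lambda>s t. c s t \<oplus>\<^bsub>M\<^esub> d s t)"
  and bicochain_zero: "bicochain M (\<lambda>_ _. \<zero>\<^bsub>M\<^esub>)"
  by (auto simp: bicochain_def)

lemma bicochain_total_d: "set xs \<subseteq> carrier R \<Longrightarrow> set zs \<subseteq> carrier R \<Longrightarrow> bicochain M c \<Longrightarrow> bicochain M (total_d M xs zs c)"
  unfolding bicochain_def by (auto intro!: total_d_closed simp: bicochain_def)

lemma bicochain_transition: "set ys \<subseteq> carrier R \<Longrightarrow> bicochain M c \<Longrightarrow> bicochain M (\<lambda>s. transition R M ys m (c s))"
  unfolding bicochain_def transition_def by (auto intro!: smult_closed koszul_prod_closed R.powers_closed)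

lemma total_d_zero:
  assumes "set xs \<subseteq> carrier R" "set zs \<subseteq> carrier R"
  shows "total_d M xs zs (\<lambda>_ _. \<zero>\<^bsub>M\<^esub>) s t = \<zero>\<^bsub>M\<^esub>"
  using koszul_cone_zero[OF assms(1)] koszul_cone_zero[OF assms(2)] by (simp add: total_d_def koszul_d_def)

text \<open>The cancellation is that of \<open>koszul_d_koszul_d\<close>, with the inner
  differential instead of zero at the end of the recursion.\<close>

lemma total_d_total_d:
  assumes "set xs \<subseteq> carrier R" "set zs \<subseteq> carrier R" "bicochain M c" "length s = length xs" "length t = length zs"
  shows "total_d M xs zs (total_d M xs zs c) s t = \<zero>\<^bsub>M\<^esub>"
  using assms(1,3,4)
proof (induction xs arbitrary: c s)
  case Nil
  have "(\<lambda>t. total_d M [] zs c s t) = koszul_d M zs (c s)" by (simp add: fun_eq_iff)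
  then show ?case using koszul_d_koszul_d[OF assms(2) bicochain_cochain[OF Nil(2)] assms(5)] by simp
next
  case (Cons x xs)
  then obtain b s' where s: "s = b # s'" by (cases s) auto
  have xs: "set xs \<subseteq> carrier R" "x \<in> carrier R" using Cons.prems by auto
  note c = bicochain_sub[OF Cons.prems(2)]
  have IH: "total_d M xs zs (total_d M xs zs (\<lambda>s. c (b # s))) s' t = \<zero>\<^bsub>M\<^esub>" for b
    by (rule Cons.IH) (use Cons.prems s c in auto)
  have F: "(\<lambda>s. total_d M (x # xs) zs c (False # s)) = total_d M xs zs (\<lambda>s. c (False # s))" by (simp add: fun_eq_iff)
  have T: "(\<lambda>s. total_d M (x # xs) zs c (True # s)) = (\<lambda>s t. x \<odot>\<^bsub>M\<^esub> c (False # s) t \<ominus>\<^bsub>M\<^esub> total_d M xs zs (\<lambda>s. c (True # s)) s t)"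
    by (simp add: fun_eq_iff)
  have xc: "bicochain M (\<lambda>s t. x \<odot>\<^bsub>M\<^esub> c (False # s) t)" using c xs by (auto simp: bicochain_def)
  have "total_d M xs zs (\<lambda>s. total_d M (x # xs) zs c (True # s)) s' t = x \<odot>\<^bsub>M\<^esub> total_d M xs zs (\<lambda>s. c (False # s)) s' t"
    unfolding T total_d_diff[OF xs(1) assms(2) xc bicochain_total_d[OF xs(1) assms(2) c]] total_d_smult[OF xs(1) assms(2) c xs(2)] IH
    using xs c assms(2) by simp
  then show ?case using s F IH[of False] xs c assms(2) by (cases b) (auto simp: F)
qed

lemma total_d_transition:
  assumes "set xs \<subseteq> carrier R" "set ys \<subseteq> carrier R" "bicochain M c" "length s = length xs" "length t = length ys"
  shows "total_d M xs (powers R (n + m) ys) (\<lambda>s. transition R M ys m (c s)) s t = transition R M ys m (total_d M xs (powers R n ys) c s) t"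
proof -
  have k: "koszul_prod R (powers R m ys) t \<in> carrier R" using assms(2) by (intro koszul_prod_closed R.powers_closed)
  have "total_d M xs (powers R (n + m) ys) (\<lambda>s. transition R M ys m (c s)) s t =
    koszul_cone M xs (\<lambda>s. koszul_prod R (powers R m ys) t \<odot>\<^bsub>M\<^esub> c s t) (\<lambda>s. koszul_prod R (powers R m ys) t \<odot>\<^bsub>M\<^esub> koszul_d M (powers R n ys) (c s) t) s"
    unfolding total_d_def using koszul_d_of_transition[OF assms(2) bicochain_cochain[OF assms(3)] assms(5)] by (simp add: transition_def)
  also have "\<dots> = koszul_prod R (powers R m ys) t \<odot>\<^bsub>M\<^esub> total_d M xs (powers R n ys) c s t"
    unfolding total_d_def using assms k R.powers_closed[OF assms(2)]
    by (intro koszul_cone_smult) (auto simp: bicochainD bicochain_cochain intro!: koszul_d_closed)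
  finally show ?thesis by (simp add: transition_def)
qed

text \<open>In inner weight \<open>q + 1\<close> the outer differential contributes nothing, because
  \<open>c\<close> is zero there. So for each \<open>s\<close> the part of inner weight
  \<open>q\<close> is an inner cocycle and becomes an inner coboundary. Induction on
  \<open>xs\<close> yields a common \<open>m\<close> for all \<open>s\<close> and takes care of the
  signs.\<close>

lemma total_d_reduce:
  assumes ys: "set ys \<subseteq> carrier R" and kv: "koszul_vanishes R ys M q"
    and "set xs \<subseteq> carrier R" "bicochain M c"
    "\<And>s t. length s = length xs \<Longrightarrow> length t = length ys \<Longrightarrow> q < weight t \<Longrightarrow> c s t = \<zero>\<^bsub>M\<^esub>"
    "\<And>s t. length s = length xs \<Longrightarrow> length t = length ys \<Longrightarrow> q < weight t \<Longrightarrow> total_d M xs (powers R n ys) c s t = \<zero>\<^bsub>M\<^esub>"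
  shows "\<exists>m \<alpha>. bicochain M \<alpha> \<and>
    (\<forall>s t. length s = length xs \<longrightarrow> length t = length ys \<longrightarrow> q \<le> weight t \<longrightarrow>
       \<alpha> s t = \<zero>\<^bsub>M\<^esub> \<and> transition R M ys m (c s) t = total_d M xs (powers R (n + m) ys) \<alpha> s t)"
  using assms(3-6)
proof (induction xs arbitrary: c)
  case Nil
  note pws = R.powers_closed[OF ys]
  let ?t = "length ys"
  define w where "w t = (if weight t = q then c [] t else \<zero>\<^bsub>M\<^esub>)" for t
  have w: "cochain M w" "in_degree M ?t q w" using Nil by (auto simp: w_def cochain_def bicochain_def in_degree_def)
  have "cocycle M (powers R n ys) w" unfolding cocycle_def
  proof (intro allI impI)
    fix t :: "bool list" assume t: "length t = length (powers R n ys)"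
    show "koszul_d M (powers R n ys) w t = \<zero>\<^bsub>M\<^esub>"
    proof (cases "weight t = Suc q")
      case True
      have "koszul_d M (powers R n ys) w t = koszul_d M (powers R n ys) (c []) t"
        by (rule koszul_d_cong_deg) (use t True pws in \<open>auto simp: w_def\<close>)
      then show ?thesis using Nil(4)[of "[]" t] t True by simp
    next
      case False
      then show ?thesis using koszul_d_in_degree[OF pws, of n q w] w t by (simp add: in_degree_def)
    qed
  qed
  then obtain m v where v: "cochain M v" "in_pred_degree M ?t q v"
    "\<And>t. length t = ?t \<Longrightarrow> transition R M ys m w t = koszul_d M (powers R (n + m) ys) v t" using koszul_vanishes_D[OF kv w] by metis
  have "transition R M ys m (c []) t = koszul_d M (powers R (n + m) ys) v t" if "length t = ?t" "q \<le> weight t" for t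
    using v(3)[OF that(1)] Nil(3)[of "[]" t] that by (cases "weight t = q") (auto simp: transition_def w_def)
  then show ?case using v(1,2)
    by (intro exI[of _ m] exI[of _ "\<lambda>_. v"]) (auto simp: bicochain_def cochain_def in_pred_degree_def)
next
  case (Cons x xs)
  note pws = R.powers_closed[OF ys]
  let ?t = "length ys"
  have xs: "set xs \<subseteq> carrier R" "x \<in> carrier R" using Cons.prems by auto
  note c = bicochain_sub[OF Cons.prems(2)]
  have c0: "c (b # s) t = \<zero>\<^bsub>M\<^esub>" if "length s = length xs" "length t = ?t" "q < weight t" for b s t
    using Cons.prems(3)[of "b # s" t] that by simp
  have tF: "total_d M xs (powers R n ys) (\<lambda>s. c (False # s)) s t = \<zero>\<^bsub>M\<^esub>" if "length s = length xs" "length t = ?t" "q < weight t" for s t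
    using Cons.prems(4)[of "False # s" t] that by simp
  have tT: "total_d M xs (powers R n ys) (\<lambda>s. c (True # s)) s t = \<zero>\<^bsub>M\<^esub>" if "length s = length xs" "length t = ?t" "q < weight t" for s t
  proof -
    have "\<zero>\<^bsub>M\<^esub> \<ominus>\<^bsub>M\<^esub> total_d M xs (powers R n ys) (\<lambda>s. c (True # s)) s t = \<zero>\<^bsub>M\<^esub>"
      using Cons.prems(4)[of "True # s" t] that c0[OF that] xs by simp
    then show ?thesis using diff_eq_zero_iff[OF M.zero_closed total_d_closed[OF xs(1) pws c]] by metis
  qed
  obtain m1 \<alpha> where \<alpha>: "bicochain M \<alpha>" "\<And>s t. length s = length xs \<Longrightarrow> length t = ?t \<Longrightarrow> q \<le> weight t \<Longrightarrow>
       \<alpha> s t = \<zero>\<^bsub>M\<^esub> \<and> transition R M ys m1 (c (False # s)) t = total_d M xs (powers R (n + m1) ys) \<alpha> s t"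
    using Cons.IH[OF xs(1) c c0 tF] by blast
  obtain m2 \<beta> where \<beta>: "bicochain M \<beta>" "\<And>s t. length s = length xs \<Longrightarrow> length t = ?t \<Longrightarrow> q \<le> weight t \<Longrightarrow>
       \<beta> s t = \<zero>\<^bsub>M\<^esub> \<and> transition R M ys m2 (c (True # s)) t = total_d M xs (powers R (n + m2) ys) \<beta> s t"
    using Cons.IH[OF xs(1) c c0 tT] by blast
  let ?m = "m1 + m2"
  let ?a = "\<lambda>s. transition R M ys m2 (\<alpha> s)" and ?b = "\<lambda>s. transition R M ys m1 (\<beta> s)"
  have ab: "bicochain M ?a" "bicochain M ?b" using bicochain_transition[OF ys] \<alpha>(1) \<beta>(1) by auto
  \<comment> \<open>In the \<open>True\<close> half the inner differential carries a minus sign,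
    which the negation of \<open>?b\<close> compensates.\<close>
  define \<gamma> where "\<gamma> s t = (if s \<noteq> [] \<and> hd s then \<zero>\<^bsub>M\<^esub> \<ominus>\<^bsub>M\<^esub> ?b (tl s) t else ?a (tl s) t)" for s t
  have \<gamma>: "bicochain M \<gamma>" using ab by (auto simp: bicochain_def \<gamma>_def)
  have *: "\<gamma> s t = \<zero>\<^bsub>M\<^esub> \<and> transition R M ys ?m (c s) t = total_d M (x # xs) (powers R (n + ?m) ys) \<gamma> s t"
    if s: "length s = length (x # xs)" and t: "length t = ?t" "q \<le> weight t" for s t
  proof -
    from s obtain b s' where s': "s = b # s'" "length s' = length xs" by (cases s) auto
    have a0: "?a s' t = \<zero>\<^bsub>M\<^esub>" and b0: "?b s' t = \<zero>\<^bsub>M\<^esub>" using \<alpha>(2)[OF s'(2) t] \<beta>(2)[OF s'(2) t] transition_zero[OF ys] by auto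
    have cF: "transition R M ys ?m (c (False # s')) t = total_d M xs (powers R (n + ?m) ys) ?a s' t"
    proof -
      have "transition R M ys ?m (c (False # s')) t = transition R M ys m2 (transition R M ys m1 (c (False # s'))) t"
        using transition_transition[OF ys bicochain_cochain[OF c]] by simp
      also have "\<dots> = transition R M ys m2 (total_d M xs (powers R (n + m1) ys) \<alpha> s') t" using \<alpha>(2)[OF s'(2) t] by (simp add: transition_def)
      also have "\<dots> = total_d M xs (powers R (n + m1 + m2) ys) ?a s' t" by (rule total_d_transition[OF xs(1) ys \<alpha>(1) s'(2) t(1), symmetric])
      finally show ?thesis by (simp add: add.assoc)
    qed
    have cT: "transition R M ys ?m (c (True # s')) t = total_d M xs (powers R (n + ?m) ys) ?b s' t"
    proof -
      have "transition R M ys ?m (c (True # s')) t = transition R M ys m1 (transition R M ys m2 (c (True # s'))) t"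
        using transition_transition[OF ys bicochain_cochain[OF c]] by (simp add: add.commute)
      also have "\<dots> = transition R M ys m1 (total_d M xs (powers R (n + m2) ys) \<beta> s') t" using \<beta>(2)[OF s'(2) t] by (simp add: transition_def)
      also have "\<dots> = total_d M xs (powers R (n + m2 + m1) ys) ?b s' t" by (rule total_d_transition[OF xs(1) ys \<beta>(1) s'(2) t(1), symmetric])
      finally show ?thesis by (simp add: add.assoc add.commute add.left_commute)
    qed
    have g1: "(\<lambda>s. \<gamma> (False # s)) = ?a" by (simp add: \<gamma>_def fun_eq_iff)
    have g2: "(\<lambda>s. \<gamma> (True # s)) = (\<lambda>s t. \<zero>\<^bsub>M\<^esub> \<ominus>\<^bsub>M\<^esub> ?b s t)" by (simp add: \<gamma>_def fun_eq_iff)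
    show ?thesis
    proof (cases b)
      case False
      then show ?thesis using s' a0 cF g1 by (simp add: \<gamma>_def)
    next
      case True
      have "total_d M xs (powers R (n + ?m) ys) (\<lambda>s. \<gamma> (True # s)) s' t = \<zero>\<^bsub>M\<^esub> \<ominus>\<^bsub>M\<^esub> total_d M xs (powers R (n + ?m) ys) ?b s' t"
        unfolding g2 using total_d_diff[OF xs(1) pws bicochain_zero ab(2)] total_d_zero[OF xs(1) pws] by simp
      moreover have "\<zero>\<^bsub>M\<^esub> \<ominus>\<^bsub>M\<^esub> (\<zero>\<^bsub>M\<^esub> \<ominus>\<^bsub>M\<^esub> u) = u" if "u \<in> carrier M" for u using that by (simp add: a_minus_def)
      moreover have "\<gamma> (False # s') t = \<zero>\<^bsub>M\<^esub>" using a0 by (simp add: \<gamma>_def)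
      ultimately have "total_d M (x # xs) (powers R (n + ?m) ys) \<gamma> s t = total_d M xs (powers R (n + ?m) ys) ?b s' t"
        using True s' xs(2) total_d_closed[OF xs(1) pws ab(2)] by simp
      moreover have "\<gamma> s t = \<zero>\<^bsub>M\<^esub>" using b0 True s' by (simp add: \<gamma>_def)
      ultimately show ?thesis using cT True s' by simp
    qed
  qed
  then show ?case using \<gamma> by blast
qed

lemma koszul_prod_powers_0: "set ys \<subseteq> carrier R \<Longrightarrow> koszul_prod R (powers R 0 ys) bs = \<one>"
  by (induction ys arbitrary: bs) auto

text \<open>Subtracting the total coboundary given by \<open>total_d_reduce\<close> clears the
  highest inner weight and changes only lower ones, so the weights from \<open>k - 1\<close> down to
  \<open>j\<close> can be cleared in turn. Each step stays in the same class of the total complex,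
  up to transitions.\<close>

lemma total_d_clear:
  assumes ys: "set ys \<subseteq> carrier R" and xs: "set xs \<subseteq> carrier R" and kv: "\<And>q. j \<le> q \<Longrightarrow> q < k \<Longrightarrow> koszul_vanishes R ys M q"
    and "bicochain M c"
    "\<And>s t. length s = length xs \<Longrightarrow> length t = length ys \<Longrightarrow> k \<le> weight t \<Longrightarrow> c s t = \<zero>\<^bsub>M\<^esub>"
    "\<And>s t. length s = length xs \<Longrightarrow> length t = length ys \<Longrightarrow> total_d M xs (powers R n ys) c s t = \<zero>\<^bsub>M\<^esub>"
  shows "\<exists>m \<alpha> c'. bicochain M \<alpha> \<and> bicochain M c' \<and>
    (\<forall>s t. length s = length xs \<longrightarrow> length t = length ys \<longrightarrow>
       (j \<le> weight t \<longrightarrow> c' s t = \<zero>\<^bsub>M\<^esub>) \<and> total_d M xs (powers R (n + m) ys) c' s t = \<zero>\<^bsub>M\<^esub> \<and>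
       transition R M ys m (c s) t = c' s t \<oplus>\<^bsub>M\<^esub> total_d M xs (powers R (n + m) ys) \<alpha> s t)"
  using kv assms(4-6)
proof (induction k arbitrary: c n)
  case 0
  have "c s t = \<zero>\<^bsub>M\<^esub>" if "length s = length xs" "length t = length ys" for s t using 0 that by auto
  then show ?case using total_d_zero[OF xs R.powers_closed[OF ys]] bicochain_zero transition_zero[OF ys]
    by (intro exI[of _ 0] exI[of _ "\<lambda>_ _. \<zero>\<^bsub>M\<^esub>"]) auto
next
  case (Suc q)
  note pws = R.powers_closed[OF ys]
  show ?case
  proof (cases "j \<le> q")
    case False
    then have *: "c s t = \<zero>\<^bsub>M\<^esub>" if "length s = length xs" "length t = length ys" "j \<le> weight t" for s t
      using Suc.prems(3) that by auto
    have "transition R M ys 0 (c s) t = c s t \<oplus>\<^bsub>M\<^esub> \<zero>\<^bsub>M\<^esub>" for s t using koszul_prod_powers_0[OF ys] Suc.prems(2) by (simp add: transition_def bicochainD)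
    then show ?thesis using * total_d_zero[OF xs pws] bicochain_zero Suc.prems(2,4)
      by (intro exI[of _ 0] exI[of _ "\<lambda>_ _. \<zero>\<^bsub>M\<^esub>"] exI[of _ c]) auto
  next
    case True
    obtain m1 \<alpha> where \<alpha>: "bicochain M \<alpha>" "\<And>s t. length s = length xs \<Longrightarrow> length t = length ys \<Longrightarrow> q \<le> weight t \<Longrightarrow>
       \<alpha> s t = \<zero>\<^bsub>M\<^esub> \<and> transition R M ys m1 (c s) t = total_d M xs (powers R (n + m1) ys) \<alpha> s t"
      using total_d_reduce[OF ys Suc.prems(1)[OF True] xs Suc.prems(2), of n] Suc.prems(3,4) by (metis Suc_leI lessI)
    let ?tc = "\<lambda>s. transition R M ys m1 (c s)" and ?ta = "total_d M xs (powers R (n + m1) ys) \<alpha>"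
    let ?c = "\<lambda>s t. ?tc s t \<ominus>\<^bsub>M\<^esub> ?ta s t"
    have tc: "bicochain M ?tc" "bicochain M ?ta" using bicochain_transition[OF ys Suc.prems(2)] bicochain_total_d[OF xs pws \<alpha>(1)] by auto
    have c: "bicochain M ?c" by (rule bicochain_diff[OF tc])
    have c0: "?c s t = \<zero>\<^bsub>M\<^esub>" if "length s = length xs" "length t = length ys" "q \<le> weight t" for s t
      using \<alpha>(2)[OF that] tc(2) by (simp add: bicochainD)
    have ct: "total_d M xs (powers R (n + m1) ys) ?c s t = \<zero>\<^bsub>M\<^esub>" if "length s = length xs" "length t = length ys" for s t
      unfolding total_d_diff[OF xs pws tc]
      using total_d_transition[OF xs ys Suc.prems(2) that] Suc.prems(4)[OF that] total_d_total_d[OF xs pws \<alpha>(1)] that transition_zero[OF ys] by simp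
    have kvq: "koszul_vanishes R ys M r" if "j \<le> r" "r < q" for r using Suc.prems(1) that by simp
    obtain m2 \<beta> c' where IH: "bicochain M \<beta>" "bicochain M c'"
      "\<And>s t. length s = length xs \<Longrightarrow> length t = length ys \<Longrightarrow> j \<le> weight t \<Longrightarrow> c' s t = \<zero>\<^bsub>M\<^esub>"
      "\<And>s t. length s = length xs \<Longrightarrow> length t = length ys \<Longrightarrow> total_d M xs (powers R (n + m1 + m2) ys) c' s t = \<zero>\<^bsub>M\<^esub>"
      "\<And>s t. length s = length xs \<Longrightarrow> length t = length ys \<Longrightarrow> transition R M ys m2 (?c s) t = c' s t \<oplus>\<^bsub>M\<^esub> total_d M xs (powers R (n + m1 + m2) ys) \<beta> s t"
      using Suc.IH[OF kvq c c0 ct] by blast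
    let ?b = "\<lambda>s t. \<beta> s t \<oplus>\<^bsub>M\<^esub> transition R M ys m2 (\<alpha> s) t"
    have ta: "bicochain M (\<lambda>s. transition R M ys m2 (\<alpha> s))" by (rule bicochain_transition[OF ys \<alpha>(1)])
    have "transition R M ys (m1 + m2) (c s) t = c' s t \<oplus>\<^bsub>M\<^esub> total_d M xs (powers R (n + (m1 + m2)) ys) ?b s t"
      if "length s = length xs" "length t = length ys" for s t
    proof -
      have "transition R M ys (m1 + m2) (c s) t = transition R M ys m2 (?tc s) t" using transition_transition[OF ys bicochain_cochain[OF Suc.prems(2)]] by simp
      also have "?tc s = (\<lambda>t. ?c s t \<oplus>\<^bsub>M\<^esub> ?ta s t)"
      proof
        fix t show "?tc s t = ?c s t \<oplus>\<^bsub>M\<^esub> ?ta s t"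
          using bicochainD[OF tc(1), of s t] bicochainD[OF tc(2), of s t] by (simp add: a_minus_def M.a_assoc M.l_neg)
      qed
      also have "transition R M ys m2 (\<lambda>t. ?c s t \<oplus>\<^bsub>M\<^esub> ?ta s t) t = transition R M ys m2 (?c s) t \<oplus>\<^bsub>M\<^esub> transition R M ys m2 (?ta s) t"
        by (rule transition_add[OF ys bicochain_cochain[OF c] bicochain_cochain[OF tc(2)]])
      also have "transition R M ys m2 (?ta s) t = total_d M xs (powers R (n + m1 + m2) ys) (\<lambda>s. transition R M ys m2 (\<alpha> s)) s t"
        by (rule total_d_transition[OF xs ys \<alpha>(1) that, symmetric])
      also have "transition R M ys m2 (?c s) t = c' s t \<oplus>\<^bsub>M\<^esub> total_d M xs (powers R (n + m1 + m2) ys) \<beta> s t"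
        by (rule IH(5)[OF that])
      finally show ?thesis
        using total_d_add[OF xs pws IH(1) ta] total_d_closed[OF xs pws] IH(1,2) ta by (simp add: add.assoc M.a_assoc bicochainD)
    qed
    then show ?thesis using IH bicochain_add[OF IH(1) ta]
      by (intro exI[of _ "m1 + m2"] exI[of _ ?b] exI[of _ c']) (auto simp: add.assoc)
  qed
qed

lemma koszul_d_in_submodule:
  assumes "submodule H R M" "set zs \<subseteq> carrier R" "cochain M v" "\<And>z x. z \<in> set zs \<Longrightarrow> x \<in> carrier M \<Longrightarrow> z \<odot>\<^bsub>M\<^esub> x \<in> H"
  shows "koszul_d M zs v bs \<in> H"
  using assms(2-4)
proof (induction zs arbitrary: v bs)
  case Nil then show ?case using assms(1) submodule.axioms(1) subgroup.one_closed by fastforce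
next
  case (Cons z zs)
  have "koszul_d M zs (\<lambda>cs. v (b # cs)) cs \<in> H" for b cs
    by (rule Cons.IH) (use Cons.prems in \<open>auto simp: cochain_def\<close>)
  then show ?case unfolding koszul_d_Cons' using Cons.prems submoduleE[OF assms(1)] by (auto simp: a_minus_def cochainD)
qed

end

section \<open>Images of homomorphisms as Koszul coboundaries\<close>

lemma koszul_d_replicate_False: "koszul_d M zs u (replicate (length zs) False) = \<zero>\<^bsub>M\<^esub>"
  by (induction zs arbitrary: u) auto

lemma total_d_hom:
  assumes "module R M" "module R N" "f \<in> mod_hom R M N" "set xs \<subseteq> carrier R" "set zs \<subseteq> carrier R" "bicochain M c"
  shows "f (total_d M xs zs c s t) = total_d N xs zs (\<lambda>s t. f (c s t)) s t"
proof -
  interpret M: module R M by fact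
  have "f (koszul_cone M xs (\<lambda>s. c s t) (\<lambda>s. koszul_d M zs (c s) t) s) = koszul_cone N xs (\<lambda>s. f (c s t)) (\<lambda>s. f (koszul_d M zs (c s) t)) s"
    by (rule koszul_cone_map[OF assms(1,2,4)]) (use assms mod_homD[OF assms(3)] in \<open>auto simp: bicochainD bicochain_cochain intro!: M.koszul_d_closed mod_homD(3)[OF assms(3)] dest: nth_mem\<close>)
  then show ?thesis unfolding total_d_def using koszul_d_hom[OF assms(1-3,5) bicochain_cochain[OF assms(6)]] by simp
qed

text \<open>The outer complex keeps the exponent \<open>n\<close>, only the inner one passes to
  higher powers. At the pair of the all-\<open>True\<close> and the all-\<open>False\<close> list
  the transitions are the identity and the inner differential contributes nothing. Read at this
  pair, the equations of the two clearings express \<open>f w\<close> by outer coboundaries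
  alone.\<close>

lemma hom_image_koszul_boundary:
  assumes "module R N" "module R Q" "f \<in> mod_hom R N Q" "set ys \<subseteq> carrier R"
    and kvN: "\<And>q. j \<le> q \<Longrightarrow> koszul_vanishes R ys N q" and kvQ: "\<And>q. q < j \<Longrightarrow> koszul_vanishes R ys Q q" and w: "w \<in> carrier N"
  shows "\<exists>v. cochain Q v \<and> f w = koszul_d Q (powers R n ys) v (replicate (length ys) True)"
proof -
  interpret N: module R N by fact
  interpret Q: module R Q by fact
  note ys = assms(4)
  note pws = N.R.powers_closed[OF ys]
  let ?x = "powers R n ys" and ?t = "length ys"
  note x = pws[of n]
  obtain c where c: "bicochain N c" "\<And>s t. length s = ?t \<Longrightarrow> length t = ?t \<Longrightarrow> total_d N ?x ?x c s t = \<zero>\<^bsub>N\<^esub>"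
    "c (replicate ?t True) (replicate ?t False) = w"
    using N.total_d_lift[OF x w, of ?x] by auto
  \<comment> \<open>No list of length \<open>?t\<close> has weight \<open>Suc ?t\<close>, so the
    clearing can start above all weights that occur.\<close>
  have c0: "c s t = \<zero>\<^bsub>N\<^esub>" if "length s = length ?x" "length t = ?t" "Suc ?t \<le> weight t" for s t
    using that count_le_length[of t True] by simp
  have c2: "total_d N ?x ?x c s t = \<zero>\<^bsub>N\<^esub>" if "length s = length ?x" "length t = ?t" for s t using c(2) that by simp
  have kvN': "koszul_vanishes R ys N q" if "j \<le> q" "q < Suc ?t" for q using kvN that by simp
  have kvQ': "koszul_vanishes R ys Q q" if "0 \<le> q" "q < j" for q using kvQ that by simp
  have "\<exists>m \<alpha> c'. bicochain N \<alpha> \<and> bicochain N c' \<and>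
      (\<forall>s t. length s = length ?x \<longrightarrow> length t = ?t \<longrightarrow>
       (j \<le> weight t \<longrightarrow> c' s t = \<zero>\<^bsub>N\<^esub>) \<and> total_d N ?x (powers R (n + m) ys) c' s t = \<zero>\<^bsub>N\<^esub> \<and>
       transition R N ys m (c s) t = c' s t \<oplus>\<^bsub>N\<^esub> total_d N ?x (powers R (n + m) ys) \<alpha> s t)"
    by (rule N.total_d_clear[OF ys x, of j "Suc ?t"]) (fact kvN' c(1) c0 c2)+
  then obtain m1 \<alpha> c' where A: "bicochain N \<alpha>" "bicochain N c'"
      "\<forall>s t. length s = length ?x \<longrightarrow> length t = ?t \<longrightarrow>
       (j \<le> weight t \<longrightarrow> c' s t = \<zero>\<^bsub>N\<^esub>) \<and> total_d N ?x (powers R (n + m1) ys) c' s t = \<zero>\<^bsub>N\<^esub> \<and>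
       transition R N ys m1 (c s) t = c' s t \<oplus>\<^bsub>N\<^esub> total_d N ?x (powers R (n + m1) ys) \<alpha> s t"
    by (elim exE conjE) (rule that)
  have a: "bicochain N \<alpha>" "bicochain N c'"
      "\<And>s t. length s = ?t \<Longrightarrow> length t = ?t \<Longrightarrow> j \<le> weight t \<Longrightarrow> c' s t = \<zero>\<^bsub>N\<^esub>"
      "\<And>s t. length s = ?t \<Longrightarrow> length t = ?t \<Longrightarrow> total_d N ?x (powers R (n + m1) ys) c' s t = \<zero>\<^bsub>N\<^esub>"
      "\<And>s t. length s = ?t \<Longrightarrow> length t = ?t \<Longrightarrow> transition R N ys m1 (c s) t = c' s t \<oplus>\<^bsub>N\<^esub> total_d N ?x (powers R (n + m1) ys) \<alpha> s t"
    using A by auto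
  define fc where "fc s t = f (c' s t)" for s t
  define fa where "fa s t = f (\<alpha> s t)" for s t
  have fc: "bicochain Q fc" "bicochain Q fa" using a mod_homD(1)[OF assms(3)] by (auto simp: bicochain_def fc_def fa_def)
  have fc0: "fc s t = \<zero>\<^bsub>Q\<^esub>" if "length s = length ?x" "length t = ?t" "j \<le> weight t" for s t
    using a(3) that mod_hom_zero[OF assms(1-3)] by (simp add: fc_def)
  have fct: "total_d Q ?x (powers R (n + m1) ys) fc s t = \<zero>\<^bsub>Q\<^esub>" if "length s = length ?x" "length t = ?t" for s t
    using total_d_hom[OF assms(1-3) x pws a(2), of "n + m1" s t] a(4) that mod_hom_zero[OF assms(1-3)] by (simp add: fc_def[abs_def])
  \<comment> \<open>Clearing down to weight 0 leaves a remainder that is zero on all lists that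
    count.\<close>
  have "\<exists>m \<alpha> c'. bicochain Q \<alpha> \<and> bicochain Q c' \<and>
      (\<forall>s t. length s = length ?x \<longrightarrow> length t = ?t \<longrightarrow>
       (0 \<le> weight t \<longrightarrow> c' s t = \<zero>\<^bsub>Q\<^esub>) \<and> total_d Q ?x (powers R (n + m1 + m) ys) c' s t = \<zero>\<^bsub>Q\<^esub> \<and>
       transition R Q ys m (fc s) t = c' s t \<oplus>\<^bsub>Q\<^esub> total_d Q ?x (powers R (n + m1 + m) ys) \<alpha> s t)"
    by (rule Q.total_d_clear[OF ys x, of 0 "j"]) (fact kvQ' fc(1) fc0 fct)+
  then obtain m2 \<beta> c'' where B: "bicochain Q \<beta>" "bicochain Q c''"
      "\<forall>s t. length s = length ?x \<longrightarrow> length t = ?t \<longrightarrow>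
       (0 \<le> weight t \<longrightarrow> c'' s t = \<zero>\<^bsub>Q\<^esub>) \<and> total_d Q ?x (powers R (n + m1 + m2) ys) c'' s t = \<zero>\<^bsub>Q\<^esub> \<and>
       transition R Q ys m2 (fc s) t = c'' s t \<oplus>\<^bsub>Q\<^esub> total_d Q ?x (powers R (n + m1 + m2) ys) \<beta> s t"
    by (elim exE conjE) (rule that)
  have b: "bicochain Q \<beta>" "bicochain Q c''"
      "\<And>s t. length s = ?t \<Longrightarrow> length t = ?t \<Longrightarrow> 0 \<le> weight t \<Longrightarrow> c'' s t = \<zero>\<^bsub>Q\<^esub>"
      "\<And>s t. length s = ?t \<Longrightarrow> length t = ?t \<Longrightarrow> transition R Q ys m2 (fc s) t = c'' s t \<oplus>\<^bsub>Q\<^esub> total_d Q ?x (powers R (n + m1 + m2) ys) \<beta> s t"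
    using B by auto
  let ?T = "replicate ?t True" and ?F = "replicate ?t False"
  have trF': "transition R N ys m u ?F = u ?F" if "u ?F \<in> carrier N" for m u
    using N.koszul_prod_replicate_False[of "powers R m ys"] that by (simp add: transition_def)
  have trQ': "transition R Q ys m u ?F = u ?F" if "u ?F \<in> carrier Q" for m u
    using Q.koszul_prod_replicate_False[of "powers R m ys"] that by (simp add: transition_def)
  have tF: "total_d Q ?x (powers R m ys) u s ?F = koszul_d Q ?x (\<lambda>s. u s ?F) s" for m u s
    using koszul_d_replicate_False[of Q "powers R m ys"] by (simp add: total_d_def koszul_d_def[of Q ?x])
  have cl: "c' ?T ?F \<in> carrier N" "total_d N ?x (powers R (n + m1) ys) \<alpha> ?T ?F \<in> carrier N" "fc ?T ?F \<in> carrier Q"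
    "c ?T ?F \<in> carrier N" "total_d Q ?x (powers R (n + m1 + m2) ys) \<beta> ?T ?F \<in> carrier Q"
    using a(1,2) c(1) fc b N.total_d_closed[OF x pws a(1)] Q.total_d_closed[OF x pws b(1)] by (auto simp: bicochainD)
  have "w = c' ?T ?F \<oplus>\<^bsub>N\<^esub> total_d N ?x (powers R (n + m1) ys) \<alpha> ?T ?F"
    using a(5)[of ?T ?F] trF'[of "c ?T" m1] c(3) cl by simp
  then have "f w = fc ?T ?F \<oplus>\<^bsub>Q\<^esub> total_d Q ?x (powers R (n + m1) ys) fa ?T ?F"
    using mod_homD(2)[OF assms(3) cl(1,2)] total_d_hom[OF assms(1-3) x pws a(1)] by (simp add: fc_def fa_def[abs_def])
  also have "fc ?T ?F = total_d Q ?x (powers R (n + m1 + m2) ys) \<beta> ?T ?F"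
    using b(4)[of ?T ?F] b(3)[of ?T ?F] trQ'[of "fc ?T" m2] cl by simp
  also have "\<dots> \<oplus>\<^bsub>Q\<^esub> total_d Q ?x (powers R (n + m1) ys) fa ?T ?F = koszul_d Q ?x (\<lambda>s. \<beta> s ?F \<oplus>\<^bsub>Q\<^esub> fa s ?F) ?T"
    unfolding tF by (rule Q.koszul_d_add[OF x bicochain_cochain'[OF b(1)] bicochain_cochain'[OF fc(2)], symmetric])
  finally show ?thesis
    using Q.cochain_add[OF bicochain_cochain'[OF b(1)] bicochain_cochain'[OF fc(2)]] by blast
qed

section \<open>Noetherian modules\<close>

definition ascending_chain_condition where
  "ascending_chain_condition R M \<longleftrightarrow> (\<forall>H. (\<forall>n::nat. submodule (H n) R M \<and> H n \<subseteq> H (Suc n)) \<longrightarrow> (\<exists>k. \<forall>n\<ge>k. H n = H k))"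

lemma accD:
  assumes "ascending_chain_condition R M" "\<And>n::nat. submodule (H n) R M" "\<And>n. H n \<subseteq> H (Suc n)"
  shows "\<exists>k. \<forall>n\<ge>k. H n = H k"
  using assms unfolding ascending_chain_condition_def by blast

lemma noetherian_ideal_chain:
  assumes "noetherian_ring R" "\<And>n. ideal (C n) R" "\<And>n. C n \<subseteq> C (Suc n)"
  shows "\<exists>k. \<forall>n\<ge>k. C n = C k"
proof -
  interpret noetherian_ring R by fact
  have mono: "i \<le> j \<Longrightarrow> C i \<subseteq> C j" for i j using assms(3) by (rule lift_Suc_mono_le)
  have "subset.chain {I. ideal I R} (range C)"
    unfolding subset_chain_def using assms(2) mono by (auto simp: image_iff) (metis linear subsetD)
  then have "\<Union>(range C) \<in> range C" by (intro ideal_chain_is_trivial) auto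
  then obtain k where k: "\<Union>(range C) = C k" by auto
  show ?thesis using mono k by (intro exI[of _ k]) blast
qed

lemma (in cring) idealI_cring:
  assumes "I \<subseteq> carrier R" "\<zero> \<in> I" "\<And>a b. a \<in> I \<Longrightarrow> b \<in> I \<Longrightarrow> a \<oplus> b \<in> I" "\<And>a r. a \<in> I \<Longrightarrow> r \<in> carrier R \<Longrightarrow> r \<otimes> a \<in> I"
  shows "ideal I R"
proof (rule idealI)
  show "ring R" by (rule ring_axioms)
  have m: "\<ominus> a \<in> I" if "a \<in> I" for a
  proof -
    have "\<ominus> a = (\<ominus> \<one>) \<otimes> a" using that assms(1) by (simp add: l_minus subsetD)
    then show ?thesis using assms(4)[OF that, of "\<ominus> \<one>"] by simp
  qed
  show "subgroup I (add_monoid R)"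
    by (rule add.subgroupI) (use assms m in \<open>auto simp flip: a_inv_def\<close>)
  fix a x assume ax: "a \<in> I" "x \<in> carrier R"
  show "x \<otimes> a \<in> I" by (rule assms(4)[OF ax])
  then show "a \<otimes> x \<in> I" using ax assms(1) m_comm[of a x] by auto
qed

context module begin

lemma submodule_zero: "submodule H R M \<Longrightarrow> \<zero>\<^bsub>M\<^esub> \<in> H"
  using submodule.axioms(1) subgroup.one_closed by fastforce

lemma submodule_diff: "submodule H R M \<Longrightarrow> x \<in> H \<Longrightarrow> y \<in> H \<Longrightarrow> x \<ominus>\<^bsub>M\<^esub> y \<in> H"
  unfolding a_minus_def using submoduleE(3,5) by blast

lemma submoduleI':
  assumes "H \<subseteq> carrier M" "\<zero>\<^bsub>M\<^esub> \<in> H" "\<And>a b. a \<in> H \<Longrightarrow> b \<in> H \<Longrightarrow> a \<oplus>\<^bsub>M\<^esub> b \<in> H"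
    "\<And>a x. a \<in> carrier R \<Longrightarrow> x \<in> H \<Longrightarrow> a \<odot>\<^bsub>M\<^esub> x \<in> H"
  shows "submodule H R M"
proof (rule submoduleI[OF assms(1,2) _ assms(3,4)])
  fix a assume a: "a \<in> H"
  have "\<ominus>\<^bsub>M\<^esub> a = (\<ominus> \<one>) \<odot>\<^bsub>M\<^esub> a" using a assms(1) by (simp add: smult_l_minus subsetD)
  then show "\<ominus>\<^bsub>M\<^esub> a \<in> H" using assms(4)[OF _ a] by simp
qed

lemma submodule_sum:
  assumes "submodule H R M" "submodule K R M"
  shows "submodule {h \<oplus>\<^bsub>M\<^esub> k | h k. h \<in> H \<and> k \<in> K} R M"
proof (rule submoduleI')
  note H = submoduleE[OF assms(1)] and K = submoduleE[OF assms(2)]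
  show "{h \<oplus>\<^bsub>M\<^esub> k | h k. h \<in> H \<and> k \<in> K} \<subseteq> carrier M" using H(1) K(1) by auto
  show "\<zero>\<^bsub>M\<^esub> \<in> {h \<oplus>\<^bsub>M\<^esub> k | h k. h \<in> H \<and> k \<in> K}"
    using submodule_zero[OF assms(1)] submodule_zero[OF assms(2)] by force
  show "a \<odot>\<^bsub>M\<^esub> x \<in> {h \<oplus>\<^bsub>M\<^esub> k | h k. h \<in> H \<and> k \<in> K}" if "a \<in> carrier R" "x \<in> {h \<oplus>\<^bsub>M\<^esub> k | h k. h \<in> H \<and> k \<in> K}" for a x
  proof -
    from that obtain h k where x: "x = h \<oplus>\<^bsub>M\<^esub> k" "h \<in> H" "k \<in> K" by blast
    then have "a \<odot>\<^bsub>M\<^esub> x = a \<odot>\<^bsub>M\<^esub> h \<oplus>\<^bsub>M\<^esub> a \<odot>\<^bsub>M\<^esub> k" using that H(1) K(1) by (simp add: smult_r_distr subsetD)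
    then show ?thesis using H(4)[OF that(1) x(2)] K(4)[OF that(1) x(3)] by blast
  qed
  show "a \<oplus>\<^bsub>M\<^esub> b \<in> {h \<oplus>\<^bsub>M\<^esub> k | h k. h \<in> H \<and> k \<in> K}"
    if ab: "a \<in> {h \<oplus>\<^bsub>M\<^esub> k | h k. h \<in> H \<and> k \<in> K}" "b \<in> {h \<oplus>\<^bsub>M\<^esub> k | h k. h \<in> H \<and> k \<in> K}" for a b
  proof -
    from ab obtain h k h' k' where x: "a = h \<oplus>\<^bsub>M\<^esub> k" "h \<in> H" "k \<in> K" "b = h' \<oplus>\<^bsub>M\<^esub> k'" "h' \<in> H" "k' \<in> K" by blast
    then have "a \<oplus>\<^bsub>M\<^esub> b = (h \<oplus>\<^bsub>M\<^esub> h') \<oplus>\<^bsub>M\<^esub> (k \<oplus>\<^bsub>M\<^esub> k')" using H(1) K(1) by (simp add: M.a_ac subsetD)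
    then show ?thesis using H(5)[OF x(2,5)] K(5)[OF x(3,6)] by blast
  qed
qed

lemma submodule_image_smult:
  assumes "r \<in> carrier R"
  shows "submodule ((\<lambda>x. r \<odot>\<^bsub>M\<^esub> x) ` carrier M) R M"
proof (rule submoduleI')
  show "a \<odot>\<^bsub>M\<^esub> x \<in> (\<lambda>x. r \<odot>\<^bsub>M\<^esub> x) ` carrier M" if "a \<in> carrier R" "x \<in> (\<lambda>x. r \<odot>\<^bsub>M\<^esub> x) ` carrier M" for a x
    using that assms by (auto simp: smult_commute[of a r])
  show "a \<oplus>\<^bsub>M\<^esub> b \<in> (\<lambda>x. r \<odot>\<^bsub>M\<^esub> x) ` carrier M" if "a \<in> (\<lambda>x. r \<odot>\<^bsub>M\<^esub> x) ` carrier M" "b \<in> (\<lambda>x. r \<odot>\<^bsub>M\<^esub> x) ` carrier M" for a b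
    using that assms by (auto simp: smult_r_distr[symmetric])
  show "\<zero>\<^bsub>M\<^esub> \<in> (\<lambda>x. r \<odot>\<^bsub>M\<^esub> x) ` carrier M" using assms by (intro image_eqI[of _ _ "\<zero>\<^bsub>M\<^esub>"]) auto
qed (use assms in auto)

lemma cyclic_submodule:
  assumes "g \<in> carrier M"
  shows "submodule ((\<lambda>r. r \<odot>\<^bsub>M\<^esub> g) ` carrier R) R M"
proof (rule submoduleI')
  show "a \<odot>\<^bsub>M\<^esub> x \<in> (\<lambda>r. r \<odot>\<^bsub>M\<^esub> g) ` carrier R" if "a \<in> carrier R" "x \<in> (\<lambda>r. r \<odot>\<^bsub>M\<^esub> g) ` carrier R" for a x
    using that assms by (auto simp: smult_assoc1[symmetric])
  show "a \<oplus>\<^bsub>M\<^esub> b \<in> (\<lambda>r. r \<odot>\<^bsub>M\<^esub> g) ` carrier R" if "a \<in> (\<lambda>r. r \<odot>\<^bsub>M\<^esub> g) ` carrier R" "b \<in> (\<lambda>r. r \<odot>\<^bsub>M\<^esub> g) ` carrier R" for a b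
    using that assms by (auto simp: smult_l_distr[symmetric])
  show "\<zero>\<^bsub>M\<^esub> \<in> (\<lambda>r. r \<odot>\<^bsub>M\<^esub> g) ` carrier R" using assms by (intro image_eqI[of _ _ "\<zero>"]) auto
qed (use assms in auto)

text \<open>Without a maximal member, passing again and again to a strictly larger one gives a chain
  that never becomes stationary.\<close>

lemma acc_maximal:
  assumes "ascending_chain_condition R M" "H0 \<in> C" "\<And>H. H \<in> C \<Longrightarrow> submodule H R M"
  shows "\<exists>H\<in>C. \<forall>K\<in>C. H \<subseteq> K \<longrightarrow> K = H"
  proof (rule ccontr)
    assume "\<not> ?thesis"
    then have "\<forall>H\<in>C. \<exists>K\<in>C. H \<subseteq> K \<and> K \<noteq> H" by blast
    then obtain f where f: "\<And>H. H \<in> C \<Longrightarrow> f H \<in> C \<and> H \<subseteq> f H \<and> f H \<noteq> H" by metis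
    define G where "G n = (f ^^ n) H0" for n
    have G: "G n \<in> C" for n by (induction n) (auto simp: G_def assms(2) f)
    have s: "G (Suc n) = f (G n)" for n by (simp add: G_def)
    have "\<exists>k. \<forall>n\<ge>k. G n = G k"
      by (rule accD[OF assms(1)]) (use G assms(3) f s in auto)
    then obtain k where "\<And>n. n \<ge> k \<Longrightarrow> G n = G k" by blast
    from this[of "Suc k"] show False using f[OF G[of k]] s by simp
  qed

text \<open>For nested submodules of \<open>X + R g\<close>, equality follows from equal
  intersections with \<open>X\<close> and equal ideals of coefficients of \<open>g\<close>; both
  chains become stationary. Chains are taken inside \<open>X\<close> but consist of submodules of
  \<open>M\<close>, so the induction never changes the ambient module.\<close>

lemma noetherian_span_acc:
  assumes noeth: "noetherian_ring R" and "finite A" "A \<subseteq> carrier M"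
  shows "\<exists>X. submodule X R M \<and> A \<subseteq> X \<and>
    (\<forall>H. (\<forall>n::nat. submodule (H n) R M \<and> H n \<subseteq> X \<and> H n \<subseteq> H (Suc n)) \<longrightarrow> (\<exists>k. \<forall>n\<ge>k. H n = H k))"
  using assms(2,3)
proof (induction A rule: finite_induct)
  case empty
  have "submodule {\<zero>\<^bsub>M\<^esub>} R M" by (rule submoduleI') auto
  moreover have "\<exists>k. \<forall>n\<ge>k. H n = H k" if "\<forall>n::nat. submodule (H n) R M \<and> H n \<subseteq> {\<zero>\<^bsub>M\<^esub>} \<and> H n \<subseteq> H (Suc n)" for H
  proof -
    have "H n = {\<zero>\<^bsub>M\<^esub>}" for n using that submodule_zero by blast
    then show ?thesis by auto
  qed
  ultimately show ?case by (intro exI[of _ "{\<zero>\<^bsub>M\<^esub>}"]) auto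
next
  case (insert g A)
  then obtain X where X: "submodule X R M" "A \<subseteq> X" and
    acc: "\<And>H. (\<And>n::nat. submodule (H n) R M \<and> H n \<subseteq> X \<and> H n \<subseteq> H (Suc n)) \<Longrightarrow> (\<exists>k. \<forall>n\<ge>k. H n = H k)" by auto
  have g: "g \<in> carrier M" using insert by auto
  note XE = submoduleE[OF X(1)]
  let ?Y = "{x \<oplus>\<^bsub>M\<^esub> y | x y. x \<in> X \<and> y \<in> (\<lambda>r. r \<odot>\<^bsub>M\<^esub> g) ` carrier R}"
  have Y: "submodule ?Y R M" by (rule submodule_sum[OF X(1) cyclic_submodule[OF g]])
  have "A \<subseteq> ?Y"
  proof
    fix a assume "a \<in> A"
    then have "a = a \<oplus>\<^bsub>M\<^esub> \<zero> \<odot>\<^bsub>M\<^esub> g" "a \<in> X" using X XE(1) g by auto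
    then show "a \<in> ?Y" by blast
  qed
  moreover have "g \<in> ?Y"
  proof -
    have "g = \<zero>\<^bsub>M\<^esub> \<oplus>\<^bsub>M\<^esub> \<one> \<odot>\<^bsub>M\<^esub> g" using g by simp
    then show ?thesis using submodule_zero[OF X(1)] R.one_closed by blast
  qed
  moreover have "\<exists>k. \<forall>n\<ge>k. H n = H k" if H: "\<forall>n::nat. submodule (H n) R M \<and> H n \<subseteq> ?Y \<and> H n \<subseteq> H (Suc n)" for H
  proof -
    have Hs: "submodule (H n) R M" for n using H by blast
    note HE = submoduleE[OF Hs]
    have inc: "H n \<subseteq> H (Suc n)" for n using H by blast
    have mono: "i \<le> j \<Longrightarrow> H i \<subseteq> H j" for i j using inc by (rule lift_Suc_mono_le)
    define C where "C n = {r \<in> carrier R. \<exists>x\<in>X. x \<oplus>\<^bsub>M\<^esub> r \<odot>\<^bsub>M\<^esub> g \<in> H n}" for n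
    have id: "ideal (C n) R" for n
    proof (rule R.idealI_cring)
      show "C n \<subseteq> carrier R" by (auto simp: C_def)
      have "\<zero>\<^bsub>M\<^esub> \<oplus>\<^bsub>M\<^esub> \<zero> \<odot>\<^bsub>M\<^esub> g \<in> H n" using submodule_zero[OF Hs] g by simp
      then show "\<zero> \<in> C n" using submodule_zero[OF X(1)] by (auto simp: C_def)
    next
      fix r s assume r: "r \<in> C n" and s: "s \<in> carrier R"
      from r obtain x where x: "r \<in> carrier R" "x \<in> X" "x \<oplus>\<^bsub>M\<^esub> r \<odot>\<^bsub>M\<^esub> g \<in> H n" by (auto simp: C_def)
      have "s \<odot>\<^bsub>M\<^esub> (x \<oplus>\<^bsub>M\<^esub> r \<odot>\<^bsub>M\<^esub> g) = s \<odot>\<^bsub>M\<^esub> x \<oplus>\<^bsub>M\<^esub> (s \<otimes> r) \<odot>\<^bsub>M\<^esub> g"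
        using x s g XE(1) by (simp add: smult_r_distr smult_assoc1 subsetD)
      then show "s \<otimes> r \<in> C n" using HE(4)[OF s x(3)] XE(4)[OF s x(2)] x(1) s by (auto simp: C_def)
    next
      fix a b assume "a \<in> C n" "b \<in> C n"
      then obtain x y where x: "a \<in> carrier R" "x \<in> X" "x \<oplus>\<^bsub>M\<^esub> a \<odot>\<^bsub>M\<^esub> g \<in> H n" "b \<in> carrier R" "y \<in> X" "y \<oplus>\<^bsub>M\<^esub> b \<odot>\<^bsub>M\<^esub> g \<in> H n"
        unfolding C_def by blast
      have "(x \<oplus>\<^bsub>M\<^esub> a \<odot>\<^bsub>M\<^esub> g) \<oplus>\<^bsub>M\<^esub> (y \<oplus>\<^bsub>M\<^esub> b \<odot>\<^bsub>M\<^esub> g) = (x \<oplus>\<^bsub>M\<^esub> y) \<oplus>\<^bsub>M\<^esub> (a \<oplus> b) \<odot>\<^bsub>M\<^esub> g"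
        using x g XE(1) by (simp add: smult_l_distr M.a_ac subsetD)
      then show "a \<oplus> b \<in> C n" using HE(5)[OF x(3,6)] XE(5)[OF x(2,5)] x unfolding C_def by auto
    qed
    have "C n \<subseteq> C (Suc n)" for n using inc[of n] by (auto simp: C_def)
    then have "\<exists>k. \<forall>n\<ge>k. C n = C k" by (rule noetherian_ideal_chain[OF noeth id])
    then obtain k1 where k1: "\<And>n. n \<ge> k1 \<Longrightarrow> C n = C k1" by blast
    have "\<exists>k. \<forall>n\<ge>k. H n \<inter> X = H k \<inter> X"
    proof (rule acc, intro conjI)
      fix n
      show "submodule (H n \<inter> X) R M"
        by (rule submoduleI') (use HE XE submodule_zero[OF Hs] submodule_zero[OF X(1)] in auto)
      show "H n \<inter> X \<subseteq> X" by simp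
      show "H n \<inter> X \<subseteq> H (Suc n) \<inter> X" using inc[of n] by blast
    qed
    then obtain k2 where k2: "\<And>n. n \<ge> k2 \<Longrightarrow> H n \<inter> X = H k2 \<inter> X" by blast
    let ?k = "max k1 k2"
    have "H n \<subseteq> H ?k" if "n \<ge> ?k" for n
    proof
      fix h assume h: "h \<in> H n"
      then obtain x r where xr: "x \<in> X" "r \<in> carrier R" "h = x \<oplus>\<^bsub>M\<^esub> r \<odot>\<^bsub>M\<^esub> g" using H by blast
      then have "r \<in> C n" using h by (auto simp: C_def)
      then have "r \<in> C ?k" using k1[of n] k1[of ?k] that by simp
      then obtain x' where x': "x' \<in> X" "x' \<oplus>\<^bsub>M\<^esub> r \<odot>\<^bsub>M\<^esub> g \<in> H ?k" by (auto simp: C_def)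
      have c: "x \<in> carrier M" "x' \<in> carrier M" "r \<odot>\<^bsub>M\<^esub> g \<in> carrier M" using xr x' XE(1) g by auto
      \<comment> \<open>Two elements with the same coefficient of \<open>g\<close> differ by an
        element of \<open>X\<close>.\<close>
      have "h \<ominus>\<^bsub>M\<^esub> (x' \<oplus>\<^bsub>M\<^esub> r \<odot>\<^bsub>M\<^esub> g) \<in> H n" using submodule_diff[OF Hs h] x' mono[OF that] by blast
      moreover have "h \<ominus>\<^bsub>M\<^esub> (x' \<oplus>\<^bsub>M\<^esub> r \<odot>\<^bsub>M\<^esub> g) = x \<ominus>\<^bsub>M\<^esub> x'"
      proof -
        have "h \<ominus>\<^bsub>M\<^esub> (x' \<oplus>\<^bsub>M\<^esub> r \<odot>\<^bsub>M\<^esub> g) = (x \<oplus>\<^bsub>M\<^esub> \<ominus>\<^bsub>M\<^esub> x') \<oplus>\<^bsub>M\<^esub> (r \<odot>\<^bsub>M\<^esub> g \<oplus>\<^bsub>M\<^esub> \<ominus>\<^bsub>M\<^esub> (r \<odot>\<^bsub>M\<^esub> g))"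
          unfolding xr(3) using c by (simp only: a_minus_def M.minus_add M.a_inv_closed M.a_closed M.a_ac)
        then show ?thesis using c by (simp add: M.r_neg a_minus_def)
      qed
      ultimately have "x \<ominus>\<^bsub>M\<^esub> x' \<in> H n \<inter> X" using submodule_diff[OF X(1) xr(1) x'(1)] by simp
      then have "x \<ominus>\<^bsub>M\<^esub> x' \<in> H ?k" using k2[of n] k2[of ?k] that by auto
      then have "(x \<ominus>\<^bsub>M\<^esub> x') \<oplus>\<^bsub>M\<^esub> (x' \<oplus>\<^bsub>M\<^esub> r \<odot>\<^bsub>M\<^esub> g) \<in> H ?k" using HE(5) x'(2) by blast
      moreover have "(x \<ominus>\<^bsub>M\<^esub> x') \<oplus>\<^bsub>M\<^esub> (x' \<oplus>\<^bsub>M\<^esub> r \<odot>\<^bsub>M\<^esub> g) = h"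
        unfolding xr(3) using c by (simp add: a_minus_def M.a_assoc M.r_neg2 M.r_neg1)
      ultimately show "h \<in> H ?k" by simp
    qed
    then show ?thesis using mono by (intro exI[of _ ?k]) blast
  qed
  ultimately show ?case using Y by (intro exI[of _ ?Y]) auto
qed

end

lemma finitely_generated_acc:
  assumes "noetherian_ring R" "finitely_generated R M"
  shows "ascending_chain_condition R M"
proof -
  from assms(2) interpret module R M by (simp add: finitely_generated_def)
  obtain A where A: "finite A" "A \<subseteq> carrier M" "\<Inter>{H. submodule H R M \<and> A \<subseteq> H} = carrier M"
    using assms(2) by (auto simp: finitely_generated_def)
  obtain X where X: "submodule X R M" "A \<subseteq> X"
    "\<And>H. (\<forall>n::nat. submodule (H n) R M \<and> H n \<subseteq> X \<and> H n \<subseteq> H (Suc n)) \<Longrightarrow> (\<exists>k. \<forall>n\<ge>k. H n = H k)"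
    using noetherian_span_acc[OF assms(1) A(1,2)] by metis
  have "carrier M \<subseteq> X" using A(3) X(1,2) by blast
  then show ?thesis unfolding ascending_chain_condition_def using X(3) submoduleE(1) by (meson order_trans)
qed

context module begin

text \<open>If \<open>L\<close> is nonzero, let \<open>P\<close> be maximal among its proper submodules, so that \<open>y L \<subseteq> P\<close> for all \<open>y\<close> in \<open>ys\<close>, and let
  \<open>H\<close> be maximal with \<open>H \<inter> L = P\<close>. Then \<open>H\<close> contains some \<open>y\<^sup>n M\<close> for all \<open>y\<close>, but not \<open>L\<close>.\<close>

lemma krull_intersection:
  assumes acc: "ascending_chain_condition R M" and ys: "set ys \<subseteq> carrier R"
    and rad: "\<And>y r. y \<in> set ys \<Longrightarrow> r \<in> carrier R \<Longrightarrow> \<one> \<ominus> r \<otimes> y \<in> Units R"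
    and L: "submodule L R M"
    and sub: "\<And>n H. submodule H R M \<Longrightarrow> (\<And>y x. y \<in> set ys \<Longrightarrow> x \<in> carrier M \<Longrightarrow> (y [^] (n::nat)) \<odot>\<^bsub>M\<^esub> x \<in> H) \<Longrightarrow> L \<subseteq> H"
  shows "L = {\<zero>\<^bsub>M\<^esub>}"
proof (rule ccontr)
  assume ne: "L \<noteq> {\<zero>\<^bsub>M\<^esub>}"
  note LE = submoduleE[OF L]
  have "submodule {\<zero>\<^bsub>M\<^esub>} R M" by (rule submoduleI') auto
  then have "{\<zero>\<^bsub>M\<^esub>} \<in> {P. submodule P R M \<and> P \<subseteq> L \<and> P \<noteq> L}" using ne submodule_zero[OF L] by auto
  then have "\<exists>P\<in>{P. submodule P R M \<and> P \<subseteq> L \<and> P \<noteq> L}. \<forall>K\<in>{P. submodule P R M \<and> P \<subseteq> L \<and> P \<noteq> L}. P \<subseteq> K \<longrightarrow> K = P"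
    by (rule acc_maximal[OF acc]) auto
  then obtain P where P': "P \<in> {P. submodule P R M \<and> P \<subseteq> L \<and> P \<noteq> L}"
    "\<forall>K\<in>{P. submodule P R M \<and> P \<subseteq> L \<and> P \<noteq> L}. P \<subseteq> K \<longrightarrow> K = P" by (rule bexE)
  from P'(1) have P: "submodule P R M" "P \<subseteq> L" "P \<noteq> L" by auto
  have Pmax: "K = P" if "submodule K R M" "K \<subseteq> L" "K \<noteq> L" "P \<subseteq> K" for K
    using P'(2) that by simp
  note PE = submoduleE[OF P(1)]
  \<comment> \<open>Otherwise \<open>P + R y u\<close> is all of \<open>L\<close> by maximality, so
    \<open>u = p + r y u\<close>. As \<open>\<one> \<ominus> r \<otimes> y\<close> is a unit,
    \<open>u\<close> and then also \<open>y u\<close> lie in \<open>P\<close>.\<close>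
  have yL: "y \<odot>\<^bsub>M\<^esub> u \<in> P" if y: "y \<in> set ys" and u: "u \<in> L" for y u
  proof (rule ccontr)
    assume nP: "y \<odot>\<^bsub>M\<^esub> u \<notin> P"
    have yc: "y \<in> carrier R" and uc: "u \<in> carrier M" using y ys u LE(1) by auto
    have yu: "y \<odot>\<^bsub>M\<^esub> u \<in> carrier M" "y \<odot>\<^bsub>M\<^esub> u \<in> L" using yc uc LE(4)[OF yc u] by auto
    let ?K = "{p \<oplus>\<^bsub>M\<^esub> q | p q. p \<in> P \<and> q \<in> (\<lambda>r. r \<odot>\<^bsub>M\<^esub> (y \<odot>\<^bsub>M\<^esub> u)) ` carrier R}"
    have K: "submodule ?K R M" by (rule submodule_sum[OF P(1) cyclic_submodule[OF yu(1)]])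
    have KL: "?K \<subseteq> L" using P(2) LE(4)[OF _ yu(2)] LE(5) by auto
    have PK: "P \<subseteq> ?K"
    proof
      fix p assume "p \<in> P"
      then have "p = p \<oplus>\<^bsub>M\<^esub> \<zero> \<odot>\<^bsub>M\<^esub> (y \<odot>\<^bsub>M\<^esub> u)" "p \<in> P" using PE(1) yu by auto
      then show "p \<in> ?K" by blast
    qed
    have "y \<odot>\<^bsub>M\<^esub> u = \<zero>\<^bsub>M\<^esub> \<oplus>\<^bsub>M\<^esub> \<one> \<odot>\<^bsub>M\<^esub> (y \<odot>\<^bsub>M\<^esub> u)" using yu by simp
    then have "y \<odot>\<^bsub>M\<^esub> u \<in> ?K" using submodule_zero[OF P(1)] R.one_closed by blast
    then have KeqL: "?K = L" using Pmax[OF K KL _ PK] nP by blast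
    have "u \<in> ?K" unfolding KeqL by (rule u)
    then obtain p q where pq: "u = p \<oplus>\<^bsub>M\<^esub> q" "p \<in> P" "q \<in> (\<lambda>r. r \<odot>\<^bsub>M\<^esub> (y \<odot>\<^bsub>M\<^esub> u)) ` carrier R"
      unfolding mem_Collect_eq by (elim exE conjE)
    from pq(3) obtain r where r: "q = r \<odot>\<^bsub>M\<^esub> (y \<odot>\<^bsub>M\<^esub> u)" "r \<in> carrier R" by (rule imageE)
    note pr = pq(2) r(2) pq(1)[unfolded r(1)]
    have pc: "p \<in> carrier M" using pr PE(1) by auto
    let ?e = "\<one> \<ominus> r \<otimes> y"
    have eu: "?e \<in> Units R" by (rule rad[OF y pr(2)])
    have ec: "?e \<in> carrier R" using eu by (rule R.Units_closed)
    have "?e \<odot>\<^bsub>M\<^esub> u = u \<ominus>\<^bsub>M\<^esub> r \<odot>\<^bsub>M\<^esub> (y \<odot>\<^bsub>M\<^esub> u)"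
      using pr(2) yc uc by (simp add: a_minus_def smult_l_distr smult_l_minus smult_assoc1)
    also have "\<dots> = p"
    proof -
      have "(p \<oplus>\<^bsub>M\<^esub> q) \<ominus>\<^bsub>M\<^esub> q = p" if "q \<in> carrier M" for q using that pc by (simp add: a_minus_def M.a_assoc M.r_neg)
      moreover have "q \<in> carrier M" unfolding r(1) using r(2) yu(1) by (rule smult_closed)
      ultimately have "(p \<oplus>\<^bsub>M\<^esub> q) \<ominus>\<^bsub>M\<^esub> q = p" .
      then show ?thesis unfolding r(1)[symmetric] pq(1)[symmetric] .
    qed
    finally have "inv ?e \<odot>\<^bsub>M\<^esub> (?e \<odot>\<^bsub>M\<^esub> u) \<in> P" using PE(4)[OF R.Units_inv_closed[OF eu] pr(1)] by simp
    then have "u \<in> P" using eu ec uc by (simp add: smult_assoc1[symmetric])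
    then show False using nP PE(4)[OF yc] by blast
  qed
  have "P \<in> {H. submodule H R M \<and> H \<inter> L = P}" using P by auto
  then have "\<exists>H\<in>{H. submodule H R M \<and> H \<inter> L = P}. \<forall>K\<in>{H. submodule H R M \<and> H \<inter> L = P}. H \<subseteq> K \<longrightarrow> K = H"
    by (rule acc_maximal[OF acc]) auto
  then obtain H where H': "H \<in> {H. submodule H R M \<and> H \<inter> L = P}"
    "\<forall>K\<in>{H. submodule H R M \<and> H \<inter> L = P}. H \<subseteq> K \<longrightarrow> K = H" by (rule bexE)
  from H'(1) have H: "submodule H R M" "H \<inter> L = P" by auto
  have Hmax: "K = H" if "submodule K R M" "K \<inter> L = P" "H \<subseteq> K" for K
    using H'(2) that by simp
  note HE = submoduleE[OF H(1)]
  have "\<exists>n::nat. \<forall>x\<in>carrier M. (y [^] n) \<odot>\<^bsub>M\<^esub> x \<in> H" if y: "y \<in> set ys" for y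
  proof -
    have yc: "y \<in> carrier R" using y ys by auto
    \<comment> \<open>The submodules \<open>(H : y^k)\<close> become stationary. For such a
      \<open>k\<close>, an element \<open>e\<close> of \<open>L\<close> in \<open>H + y^k M\<close>
      lies in \<open>H\<close>: since \<open>y e\<close> is in \<open>P\<close>, its second summand
      lies in \<open>H\<close> after one more factor \<open>y\<close>, hence already without it.
      Maximality of \<open>H\<close> then gives \<open>y^k M \<subseteq> H\<close>.\<close>
    define C where "C k = {x \<in> carrier M. (y [^] (k::nat)) \<odot>\<^bsub>M\<^esub> x \<in> H}" for k
    have step: "(y [^] Suc k) \<odot>\<^bsub>M\<^esub> x = y \<odot>\<^bsub>M\<^esub> ((y [^] k) \<odot>\<^bsub>M\<^esub> x)" if "x \<in> carrier M" for k :: nat and x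
      using that yc R.m_comm[of "y [^] k" y] smult_assoc1[of y "y [^] k" x] by simp
    have "\<exists>k. \<forall>n\<ge>k. C n = C k"
    proof (rule accD[OF acc])
      fix k
      show "submodule (C k) R M"
        by (rule submoduleI') (use HE yc submodule_zero[OF H(1)] in \<open>auto simp: C_def smult_r_distr smult_commute[of "y [^] k"]\<close>)
      show "C k \<subseteq> C (Suc k)" using step HE(4)[OF yc] by (auto simp: C_def)
    qed
    then obtain k where k: "C (Suc k) = C k" by (metis le_SucI order_refl)
    let ?K = "{h \<oplus>\<^bsub>M\<^esub> q | h q. h \<in> H \<and> q \<in> (\<lambda>x. (y [^] k) \<odot>\<^bsub>M\<^esub> x) ` carrier M}"
    have ykc: "y [^] k \<in> carrier R" using yc by simp
    have K: "submodule ?K R M" by (rule submodule_sum[OF H(1) submodule_image_smult[OF ykc]])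
    have HK: "H \<subseteq> ?K"
    proof
      fix h assume h: "h \<in> H"
      then have "h = h \<oplus>\<^bsub>M\<^esub> (y [^] k) \<odot>\<^bsub>M\<^esub> \<zero>\<^bsub>M\<^esub>" using HE(1) ykc by auto
      then show "h \<in> ?K" using h by blast
    qed
    have "?K \<inter> L \<subseteq> P"
    proof
      fix e assume "e \<in> ?K \<inter> L"
      then obtain h x where e: "e \<in> L" "h \<in> H" "x \<in> carrier M" "e = h \<oplus>\<^bsub>M\<^esub> (y [^] k) \<odot>\<^bsub>M\<^esub> x" by blast
      have hc: "h \<in> carrier M" using e HE(1) by auto
      have "y \<odot>\<^bsub>M\<^esub> e \<in> H" using yL[OF y e(1)] H(2) by blast
      moreover have "y \<odot>\<^bsub>M\<^esub> e \<ominus>\<^bsub>M\<^esub> y \<odot>\<^bsub>M\<^esub> h = (y [^] Suc k) \<odot>\<^bsub>M\<^esub> x"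
        using e hc yc ykc step[OF e(3), of k] M.a_comm[of "y \<odot>\<^bsub>M\<^esub> h"]
        by (simp add: smult_r_distr a_minus_def M.a_assoc M.r_neg)
      ultimately have "(y [^] Suc k) \<odot>\<^bsub>M\<^esub> x \<in> H"
        using submodule_diff[OF H(1), of "y \<odot>\<^bsub>M\<^esub> e" "y \<odot>\<^bsub>M\<^esub> h"] HE(4)[OF yc e(2)] by simp
      then have "x \<in> C (Suc k)" using e by (simp add: C_def)
      then have "x \<in> C k" using k by simp
      then have "e \<in> H" using e HE(5) by (auto simp: C_def)
      then show "e \<in> P" using e H(2) by blast
    qed
    then have "?K \<inter> L = P" using HK H(2) by blast
    then have "?K = H" by (rule Hmax[OF K _ HK])
    moreover have "(y [^] k) \<odot>\<^bsub>M\<^esub> x \<in> ?K" if "x \<in> carrier M" for x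
    proof -
      have "(y [^] k) \<odot>\<^bsub>M\<^esub> x = \<zero>\<^bsub>M\<^esub> \<oplus>\<^bsub>M\<^esub> (y [^] k) \<odot>\<^bsub>M\<^esub> x" using that ykc by simp
      then show ?thesis using submodule_zero[OF H(1)] that by blast
    qed
    ultimately show ?thesis by auto
  qed
  then obtain k where k: "\<And>y x. y \<in> set ys \<Longrightarrow> x \<in> carrier M \<Longrightarrow> (y [^] (k y::nat)) \<odot>\<^bsub>M\<^esub> x \<in> H" by metis
  \<comment> \<open>Zero is inserted to keep the maximum meaningful when \<open>ys\<close> is
    empty.\<close>
  define n where "n = Max (insert 0 (k ` set ys))"
  have "(y [^] n) \<odot>\<^bsub>M\<^esub> x \<in> H" if y: "y \<in> set ys" and x: "x \<in> carrier M" for y x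
  proof -
    have le: "k y \<le> n" using y by (simp add: n_def)
    have yc: "y \<in> carrier R" using y ys by auto
    have "(y [^] n) \<odot>\<^bsub>M\<^esub> x = (y [^] k y) \<odot>\<^bsub>M\<^esub> ((y [^] (n - k y)) \<odot>\<^bsub>M\<^esub> x)"
      using yc x le R.nat_pow_mult[of y "k y" "n - k y"] smult_assoc1[of "y [^] k y" "y [^] (n - k y)" x] by simp
    then show ?thesis using k[OF y, of "(y [^] (n - k y)) \<odot>\<^bsub>M\<^esub> x"] yc x by simp
  qed
  then have "L \<subseteq> H" by (rule sub[OF H(1)])
  then show False using H(2) P by blast
qed

end

lemma hom_eq_zero:
  assumes "module R N" "module R Q" "f \<in> mod_hom R N Q" "set ys \<subseteq> carrier R"
    and acc: "ascending_chain_condition R Q"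
    and rad: "\<And>y r. y \<in> set ys \<Longrightarrow> r \<in> carrier R \<Longrightarrow> \<one>\<^bsub>R\<^esub> \<ominus>\<^bsub>R\<^esub> r \<otimes>\<^bsub>R\<^esub> y \<in> Units R"
    and kvN: "\<And>q. j \<le> q \<Longrightarrow> koszul_vanishes R ys N q" and kvQ: "\<And>q. q < j \<Longrightarrow> koszul_vanishes R ys Q q" and w: "w \<in> carrier N"
  shows "f w = \<zero>\<^bsub>Q\<^esub>"
proof -
  interpret N: module R N by fact
  interpret Q: module R Q by fact
  note f = mod_homD[OF assms(3)]
  let ?L = "f ` carrier N"
  have L: "submodule ?L R Q"
  proof (rule Q.submoduleI')
    show "\<zero>\<^bsub>Q\<^esub> \<in> ?L" using mod_hom_zero[OF assms(1-3)] by (metis N.M.zero_closed imageI)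
    show "a \<oplus>\<^bsub>Q\<^esub> b \<in> ?L" if "a \<in> ?L" "b \<in> ?L" for a b using that by (auto simp: f(2)[symmetric])
    show "a \<odot>\<^bsub>Q\<^esub> x \<in> ?L" if "a \<in> carrier R" "x \<in> ?L" for a x using that by (auto simp: f(3)[symmetric])
  qed (use f in auto)
  have "?L = {\<zero>\<^bsub>Q\<^esub>}"
  proof (rule Q.krull_intersection[OF acc assms(4) rad L])
    fix n :: nat and H assume H: "submodule H R Q" "\<And>y x. y \<in> set ys \<Longrightarrow> x \<in> carrier Q \<Longrightarrow> (y [^]\<^bsub>R\<^esub> n) \<odot>\<^bsub>Q\<^esub> x \<in> H"
    show "?L \<subseteq> H"
    proof
      fix z assume "z \<in> ?L"
      then obtain x where x: "x \<in> carrier N" "z = f x" by auto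
      obtain v where v: "cochain Q v" "f x = koszul_d Q (powers R n ys) v (replicate (length ys) True)"
        using hom_image_koszul_boundary[OF assms(1-4) kvN kvQ x(1)] by blast
      show "z \<in> H" unfolding x(2) v(2)
        by (rule Q.koszul_d_in_submodule[OF H(1) N.R.powers_closed[OF assms(4)] v(1)]) (use H(2) in \<open>auto simp: powers_def\<close>)
    qed
  qed
  then show ?thesis using w by blast
qed

lemma koszul_vanishes_nonvanishing:
  assumes "module R Q" "set ys \<subseteq> carrier R" "ascending_chain_condition R Q"
    "\<And>y r. y \<in> set ys \<Longrightarrow> r \<in> carrier R \<Longrightarrow> \<one>\<^bsub>R\<^esub> \<ominus>\<^bsub>R\<^esub> r \<otimes>\<^bsub>R\<^esub> y \<in> Units R"
    "\<And>q. koszul_vanishes R ys Q q"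
  shows "zero_module Q"
proof -
  interpret Q: module R Q by fact
  have "(\<lambda>x. x) \<in> mod_hom R Q Q" by (auto simp: mod_hom_def)
  \<comment> \<open>With \<open>j = 0\<close> the condition on the target is void.\<close>
  then have "w = \<zero>\<^bsub>Q\<^esub>" if "w \<in> carrier Q" for w
    using hom_eq_zero[OF assms(1,1) _ assms(2-4), of "\<lambda>x. x" 0 w] assms(5) that by simp
  then show ?thesis unfolding zero_module_def by blast
qed

section \<open>Koszul vanishing under localization\<close>

text \<open>A characterization of \<open>N'\<close> as the localization of \<open>N\<close> at
  \<open>S\<close>, not a construction: submodules of a module of fractions and quotients of these
  satisfy it although their elements are of different kinds. Rings and element types on the two
  sides are independent.\<close>

locale module_localization = N: module R N + N': module R' N'
  for R :: "('r, 'x) ring_scheme" and N :: "('r, 'm, 'y) module_scheme"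
    and R' :: "('s, 'z) ring_scheme" and N' :: "('s, 'n, 'w) module_scheme" +
  fixes S :: "'r set" and \<phi> :: "'r \<Rightarrow> 's" and \<iota> :: "'m \<Rightarrow> 'n"
  assumes S: "S \<subseteq> carrier R" "\<one>\<^bsub>R\<^esub> \<in> S" "\<And>s t. s \<in> S \<Longrightarrow> t \<in> S \<Longrightarrow> s \<otimes>\<^bsub>R\<^esub> t \<in> S"
    and \<phi>: "\<phi> \<in> ring_hom R R'"
    and \<iota>_closed: "\<And>x. x \<in> carrier N \<Longrightarrow> \<iota> x \<in> carrier N'"
    and \<iota>_add: "\<And>x y. x \<in> carrier N \<Longrightarrow> y \<in> carrier N \<Longrightarrow> \<iota> (x \<oplus>\<^bsub>N\<^esub> y) = \<iota> x \<oplus>\<^bsub>N'\<^esub> \<iota> y"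
    and \<iota>_smult: "\<And>r x. r \<in> carrier R \<Longrightarrow> x \<in> carrier N \<Longrightarrow> \<iota> (r \<odot>\<^bsub>N\<^esub> x) = \<phi> r \<odot>\<^bsub>N'\<^esub> \<iota> x"
    and surj: "\<And>x'. x' \<in> carrier N' \<Longrightarrow> \<exists>x\<in>carrier N. \<exists>s\<in>S. \<phi> s \<odot>\<^bsub>N'\<^esub> x' = \<iota> x"
    and ker: "\<And>x. x \<in> carrier N \<Longrightarrow> \<iota> x = \<zero>\<^bsub>N'\<^esub> \<Longrightarrow> \<exists>s\<in>S. s \<odot>\<^bsub>N\<^esub> x = \<zero>\<^bsub>N\<^esub>"
    and inj: "\<And>s x'. s \<in> S \<Longrightarrow> x' \<in> carrier N' \<Longrightarrow> \<phi> s \<odot>\<^bsub>N'\<^esub> x' = \<zero>\<^bsub>N'\<^esub> \<Longrightarrow> x' = \<zero>\<^bsub>N'\<^esub>"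
    and div: "\<And>s x'. s \<in> S \<Longrightarrow> x' \<in> carrier N' \<Longrightarrow> \<exists>x''\<in>carrier N'. \<phi> s \<odot>\<^bsub>N'\<^esub> x'' = x'"
begin

lemma \<phi>_closed: "r \<in> carrier R \<Longrightarrow> \<phi> r \<in> carrier R'"
  using \<phi> by (simp add: ring_hom_closed)

lemma \<phi>_mult: "r \<in> carrier R \<Longrightarrow> s \<in> carrier R \<Longrightarrow> \<phi> (r \<otimes>\<^bsub>R\<^esub> s) = \<phi> r \<otimes>\<^bsub>R'\<^esub> \<phi> s"
  using \<phi> by (simp add: ring_hom_mult)

lemma \<phi>_one: "\<phi> \<one>\<^bsub>R\<^esub> = \<one>\<^bsub>R'\<^esub>" using \<phi> by (simp add: ring_hom_one)

lemma \<phi>_pow: "r \<in> carrier R \<Longrightarrow> \<phi> (r [^]\<^bsub>R\<^esub> (n::nat)) = \<phi> r [^]\<^bsub>R'\<^esub> n"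
  by (induction n) (auto simp: \<phi>_one \<phi>_mult)

lemma \<phi>_pw: "set ys \<subseteq> carrier R \<Longrightarrow> powers R' n (map \<phi> ys) = map \<phi> (powers R n ys)"
  by (induction ys) (auto simp: \<phi>_pow)

lemma \<phi>_kp: "set zs \<subseteq> carrier R \<Longrightarrow> \<phi> (koszul_prod R zs bs) = koszul_prod R' (map \<phi> zs) bs"
  by (induction zs arbitrary: bs) (auto simp: \<phi>_one \<phi>_mult N.koszul_prod_closed)

lemma \<phi>_set: "set zs \<subseteq> carrier R \<Longrightarrow> set (map \<phi> zs) \<subseteq> carrier R'"
  using \<phi>_closed by auto

lemma \<iota>_zero: "\<iota> \<zero>\<^bsub>N\<^esub> = \<zero>\<^bsub>N'\<^esub>"
proof -
  have "\<phi> \<zero>\<^bsub>R\<^esub> = \<zero>\<^bsub>R'\<^esub>" using \<phi> by (simp add: ring_hom_zero N.R.ring_axioms N'.R.ring_axioms)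
  then show ?thesis using \<iota>_smult[of "\<zero>\<^bsub>R\<^esub>" "\<zero>\<^bsub>N\<^esub>"] \<iota>_closed[of "\<zero>\<^bsub>N\<^esub>"] by simp
qed

lemma \<iota>_kd:
  assumes "set zs \<subseteq> carrier R" "cochain N w"
  shows "\<iota> (koszul_d N zs w bs) = koszul_d N' (map \<phi> zs) (\<lambda>bs. \<iota> (w bs)) bs"
proof -
  have "\<iota> (koszul_cone N zs w (\<lambda>_. \<zero>\<^bsub>N\<^esub>) bs) = koszul_cone N' (map \<phi> zs) (\<lambda>bs. \<iota> (w bs)) (\<lambda>_. \<iota> \<zero>\<^bsub>N\<^esub>) bs"
    by (rule koszul_cone_map[OF N.module_axioms N'.module_axioms assms(1)])
      (use assms in \<open>auto simp: cochainD \<iota>_closed \<iota>_add intro!: \<iota>_smult dest: nth_mem\<close>)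
  then show ?thesis by (simp add: koszul_d_def \<iota>_zero)
qed

text \<open>The product of the single denominators serves all elements of \<open>T\<close>. It is
  applied to the values of a cochain at the finitely many lists of the right length.\<close>

lemma clear_denominators:
  assumes "finite T" "\<And>b. b \<in> T \<Longrightarrow> w b \<in> carrier N'"
  shows "\<exists>s\<in>S. \<forall>b\<in>T. \<exists>x\<in>carrier N. \<phi> s \<odot>\<^bsub>N'\<^esub> w b = \<iota> x"
  using assms
proof (induction T rule: finite_induct)
  case empty then show ?case using S by auto
next
  case (insert a T)
  then obtain s where s: "s \<in> S" "\<And>b. b \<in> T \<Longrightarrow> \<exists>x\<in>carrier N. \<phi> s \<odot>\<^bsub>N'\<^esub> w b = \<iota> x" by auto
  obtain x t where t: "t \<in> S" "x \<in> carrier N" "\<phi> t \<odot>\<^bsub>N'\<^esub> w a = \<iota> x" using surj[of "w a"] insert by auto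
  have c: "s \<in> carrier R" "t \<in> carrier R" using s t S by auto
  have "\<exists>x\<in>carrier N. \<phi> (s \<otimes>\<^bsub>R\<^esub> t) \<odot>\<^bsub>N'\<^esub> w b = \<iota> x" if "b \<in> insert a T" for b
  proof (cases "b = a")
    case True
    then have "\<phi> (s \<otimes>\<^bsub>R\<^esub> t) \<odot>\<^bsub>N'\<^esub> w b = \<iota> (s \<odot>\<^bsub>N\<^esub> x)"
      using t c insert.prems by (simp add: \<phi>_mult \<phi>_closed N'.smult_assoc1 \<iota>_smult)
    then show ?thesis using c t by (intro bexI[of _ "s \<odot>\<^bsub>N\<^esub> x"]) auto
  next
    case False
    then have "b \<in> T" using that by auto
    then obtain z where z: "z \<in> carrier N" "\<phi> s \<odot>\<^bsub>N'\<^esub> w b = \<iota> z" using s(2) by blast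
    have "\<phi> (s \<otimes>\<^bsub>R\<^esub> t) \<odot>\<^bsub>N'\<^esub> w b = \<phi> t \<odot>\<^bsub>N'\<^esub> (\<phi> s \<odot>\<^bsub>N'\<^esub> w b)"
      using c insert.prems that N'.smult_commute by (simp add: \<phi>_mult \<phi>_closed N'.smult_assoc1)
    also have "\<dots> = \<iota> (t \<odot>\<^bsub>N\<^esub> z)" using z c by (simp add: \<iota>_smult)
    finally show ?thesis using c z by (intro bexI[of _ "t \<odot>\<^bsub>N\<^esub> z"]) auto
  qed
  then show ?case using S(3)[OF s(1) t(1)] by blast
qed

lemma clear_kernel:
  assumes "finite T" "\<And>b. b \<in> T \<Longrightarrow> w b \<in> carrier N \<and> \<iota> (w b) = \<zero>\<^bsub>N'\<^esub>"
  shows "\<exists>s\<in>S. \<forall>b\<in>T. s \<odot>\<^bsub>N\<^esub> w b = \<zero>\<^bsub>N\<^esub>"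
  using assms
proof (induction T rule: finite_induct)
  case empty then show ?case using S by auto
next
  case (insert a T)
  then obtain s where s: "s \<in> S" "\<And>b. b \<in> T \<Longrightarrow> s \<odot>\<^bsub>N\<^esub> w b = \<zero>\<^bsub>N\<^esub>" by auto
  obtain t where t: "t \<in> S" "t \<odot>\<^bsub>N\<^esub> w a = \<zero>\<^bsub>N\<^esub>" using ker[of "w a"] insert by auto
  have c: "s \<in> carrier R" "t \<in> carrier R" using s t S by auto
  have "(s \<otimes>\<^bsub>R\<^esub> t) \<odot>\<^bsub>N\<^esub> w b = \<zero>\<^bsub>N\<^esub>" if "b \<in> insert a T" for b
  proof (cases "b = a")
    case True
    then show ?thesis using t c insert.prems by (simp add: N.smult_assoc1)
  next
    case False
    then have "s \<odot>\<^bsub>N\<^esub> w b = \<zero>\<^bsub>N\<^esub>" using s that by auto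
    then show ?thesis using c insert.prems that by (simp add: N.smult_assoc1 N.smult_commute[of s t])
  qed
  then show ?case using S(3)[OF s(1) t(1)] by blast
qed

text \<open>Multiplying \<open>w\<close> by some \<open>s\<close> in \<open>S\<close> gives
  numerators in \<open>N\<close>, and a further factor \<open>u\<close> kills their differential,
  which so far vanishes only in \<open>N'\<close>. The resulting cocycle of \<open>N\<close> becomes
  a coboundary, and dividing the bounding cochain by \<open>u s\<close> bounds
  \<open>w\<close>.\<close>

lemma koszul_vanishes_localization:
  assumes ys: "set ys \<subseteq> carrier R" and kv: "koszul_vanishes R ys N p"
  shows "koszul_vanishes R' (map \<phi> ys) N' p"
  unfolding koszul_vanishes_iff
proof (intro allI impI)
  let ?ys = "map \<phi> ys" and ?t = "length ys"
  fix n w assume w: "cochain N' w" "in_degree N' (length ?ys) p w" "cocycle N' (powers R' n ?ys) w"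
  note pws = N.R.powers_closed[OF ys]
  note ys' = \<phi>_set[OF ys]
  note pws' = N'.R.powers_closed[OF ys']
  let ?T = "{bs :: bool list. length bs = ?t}"
  have fin: "finite ?T" using finite_lists_length_eq[of "UNIV :: bool set" ?t] by simp
  obtain s where s: "s \<in> S" "\<forall>bs\<in>?T. \<exists>x\<in>carrier N. \<phi> s \<odot>\<^bsub>N'\<^esub> w bs = \<iota> x"
    using clear_denominators[OF fin, of w] w(1) by (auto simp: cochainD)
  have sc: "s \<in> carrier R" using s S by auto
  \<comment> \<open>Zero values get the numerator zero, so that the degree is preserved.\<close>
  have "\<forall>bs. \<exists>x\<in>carrier N. bs \<in> ?T \<longrightarrow> \<phi> s \<odot>\<^bsub>N'\<^esub> w bs = \<iota> x \<and> (w bs = \<zero>\<^bsub>N'\<^esub> \<longrightarrow> x = \<zero>\<^bsub>N\<^esub>)"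
  proof
    fix bs
    show "\<exists>x\<in>carrier N. bs \<in> ?T \<longrightarrow> \<phi> s \<odot>\<^bsub>N'\<^esub> w bs = \<iota> x \<and> (w bs = \<zero>\<^bsub>N'\<^esub> \<longrightarrow> x = \<zero>\<^bsub>N\<^esub>)"
    proof (cases "w bs = \<zero>\<^bsub>N'\<^esub>")
      case True
      then show ?thesis using \<phi>_closed[OF sc] by (intro bexI[of _ "\<zero>\<^bsub>N\<^esub>"]) (auto simp: \<iota>_zero)
    next
      case False
      then show ?thesis using s(2) by (cases "bs \<in> ?T") auto
    qed
  qed
  then obtain w0 where w0: "\<And>bs. w0 bs \<in> carrier N" "\<And>bs. bs \<in> ?T \<Longrightarrow> \<phi> s \<odot>\<^bsub>N'\<^esub> w bs = \<iota> (w0 bs)"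
     "\<And>bs. bs \<in> ?T \<Longrightarrow> w bs = \<zero>\<^bsub>N'\<^esub> \<Longrightarrow> w0 bs = \<zero>\<^bsub>N\<^esub>" by metis
  have w0c: "cochain N w0" using w0 by (simp add: cochain_def)
  have "\<iota> (koszul_d N (powers R n ys) w0 bs) = \<zero>\<^bsub>N'\<^esub>" if bs: "bs \<in> ?T" for bs
  proof -
    have "\<iota> (koszul_d N (powers R n ys) w0 bs) = koszul_d N' (powers R' n ?ys) (\<lambda>bs. \<iota> (w0 bs)) bs"
      using \<iota>_kd[OF pws w0c] by (simp add: \<phi>_pw[OF ys])
    also have "\<dots> = koszul_d N' (powers R' n ?ys) (\<lambda>bs. \<phi> s \<odot>\<^bsub>N'\<^esub> w bs) bs"
      by (rule koszul_d_cong) (use bs w0(2) in auto)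
    also have "\<dots> = \<phi> s \<odot>\<^bsub>N'\<^esub> koszul_d N' (powers R' n ?ys) w bs" by (rule N'.koszul_d_smult[OF pws' \<phi>_closed[OF sc] w(1)])
    also have "\<dots> = \<zero>\<^bsub>N'\<^esub>" using w(3) bs \<phi>_closed[OF sc] by (simp add: cocycle_def)
    finally show ?thesis .
  qed
  then obtain u where u: "u \<in> S" "\<forall>bs\<in>?T. u \<odot>\<^bsub>N\<^esub> koszul_d N (powers R n ys) w0 bs = \<zero>\<^bsub>N\<^esub>"
    using clear_kernel[OF fin, of "koszul_d N (powers R n ys) w0"] N.koszul_d_closed[OF pws w0c] by blast
  have uc: "u \<in> carrier R" using u S by auto
  let ?w1 = "\<lambda>bs. u \<odot>\<^bsub>N\<^esub> w0 bs"
  have w1: "cochain N ?w1" "in_degree N ?t p ?w1" "cocycle N (powers R n ys) ?w1"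
    using w0 uc w(2) u(2) N.koszul_d_smult[OF pws uc w0c] by (auto simp: cochain_def in_degree_def cocycle_def)
  obtain m v where v: "cochain N v" "in_pred_degree N ?t p v" "\<And>bs. length bs = ?t \<Longrightarrow> transition R N ys m ?w1 bs = koszul_d N (powers R (n + m) ys) v bs"
    using koszul_vanishes_D[OF kv w1] by metis
  let ?e = "u \<otimes>\<^bsub>R\<^esub> s"
  have e: "?e \<in> S" "?e \<in> carrier R" using S(3)[OF u(1) s(1)] uc sc by auto
  have ec: "\<phi> ?e \<in> carrier R'" by (rule \<phi>_closed[OF e(2)])
  have "\<forall>bs. \<exists>x\<in>carrier N'. \<phi> ?e \<odot>\<^bsub>N'\<^esub> x = \<iota> (v bs) \<and> (v bs = \<zero>\<^bsub>N\<^esub> \<longrightarrow> x = \<zero>\<^bsub>N'\<^esub>)"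
  proof
    fix bs
    show "\<exists>x\<in>carrier N'. \<phi> ?e \<odot>\<^bsub>N'\<^esub> x = \<iota> (v bs) \<and> (v bs = \<zero>\<^bsub>N\<^esub> \<longrightarrow> x = \<zero>\<^bsub>N'\<^esub>)"
      using div[OF e(1) \<iota>_closed[OF cochainD[OF v(1)]], of bs] ec by (cases "v bs = \<zero>\<^bsub>N\<^esub>") (auto simp: \<iota>_zero)
  qed
  then obtain v' where v': "\<And>bs. v' bs \<in> carrier N'" "\<And>bs. \<phi> ?e \<odot>\<^bsub>N'\<^esub> v' bs = \<iota> (v bs)"
     "\<And>bs. v bs = \<zero>\<^bsub>N\<^esub> \<Longrightarrow> v' bs = \<zero>\<^bsub>N'\<^esub>" by metis
  have v'c: "cochain N' v'" using v'(1) by (simp add: cochain_def)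
  have "transition R' N' ?ys m w bs = koszul_d N' (powers R' (n + m) ?ys) v' bs" if bs: "length bs = ?t" for bs
  proof -
    have k: "koszul_prod R (powers R m ys) bs \<in> carrier R" by (rule N.koszul_prod_closed[OF pws])
    have c1: "transition R' N' ?ys m w bs \<in> carrier N'" using N'.cochain_transition[OF ys' w(1)] by (rule cochainD)
    have c2: "koszul_d N' (powers R' (n + m) ?ys) v' bs \<in> carrier N'" by (rule N'.koszul_d_closed[OF pws' v'c])
    have kk: "koszul_prod R' (powers R' m ?ys) bs = \<phi> (koszul_prod R (powers R m ys) bs)" by (simp add: \<phi>_kp[OF pws] \<phi>_pw[OF ys])
    have "\<phi> ?e \<odot>\<^bsub>N'\<^esub> w bs = \<iota> (?w1 bs)"
      using w0(2)[of bs] w0(1) bs uc sc cochainD[OF w(1)] by (simp add: \<phi>_mult \<phi>_closed N'.smult_assoc1 \<iota>_smult)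
    then have "\<phi> ?e \<odot>\<^bsub>N'\<^esub> transition R' N' ?ys m w bs = \<phi> (koszul_prod R (powers R m ys) bs) \<odot>\<^bsub>N'\<^esub> \<iota> (?w1 bs)"
      unfolding transition_def kk using N'.smult_commute[OF ec \<phi>_closed[OF k] cochainD[OF w(1)]] by simp
    also have "\<dots> = \<iota> (transition R N ys m ?w1 bs)" unfolding transition_def using \<iota>_smult[OF k cochainD[OF w1(1)]] by simp
    also have "\<dots> = koszul_d N' (powers R' (n + m) ?ys) (\<lambda>bs. \<iota> (v bs)) bs"
      using v(3)[OF bs] \<iota>_kd[OF pws v(1)] by (simp add: \<phi>_pw[OF ys])
    also have "\<dots> = koszul_d N' (powers R' (n + m) ?ys) (\<lambda>bs. \<phi> ?e \<odot>\<^bsub>N'\<^esub> v' bs) bs" using v'(2) by simp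
    also have "\<dots> = \<phi> ?e \<odot>\<^bsub>N'\<^esub> koszul_d N' (powers R' (n + m) ?ys) v' bs" by (rule N'.koszul_d_smult[OF pws' ec v'c])
    finally have "\<phi> ?e \<odot>\<^bsub>N'\<^esub> (transition R' N' ?ys m w bs \<ominus>\<^bsub>N'\<^esub> koszul_d N' (powers R' (n + m) ?ys) v' bs) = \<zero>\<^bsub>N'\<^esub>"
      using c1 c2 ec by (simp add: N'.smult_diff)
    then show ?thesis using inj[OF e(1) N'.diff_closed[OF c1 c2]] N'.diff_eq_zero_iff[OF c1 c2] by blast
  qed
  moreover have "in_pred_degree N' ?t p v'" using v(2) v'(3) by (auto simp: in_pred_degree_def)
  ultimately show "\<exists>m v. cochain N' v \<and> in_pred_degree N' (length ?ys) p v \<and>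
       (\<forall>bs. length bs = length ?ys \<longrightarrow> transition R' N' ?ys m w bs = koszul_d N' (powers R' (n + m) ?ys) v bs)"
    using v'c by auto
qed

end

section \<open>Existence of injective resolutions\<close>

text \<open>A divisible group containing a given abelian group \<open>X\<close> is the quotient of the rational vector space on the
  set \<open>X\<close> by the group \<open>K\<close> of integral relations of \<open>X\<close>. To stay within the type of the vector space,
  homomorphisms to this quotient are maps that are additive modulo \<open>K\<close>.\<close>

definition rat_scale :: "rat \<Rightarrow> ('a \<Rightarrow>\<^sub>0 rat) \<Rightarrow> ('a \<Rightarrow>\<^sub>0 rat)" where
  "rat_scale q p = Poly_Mapping.map ((*) q) p"

lemma lookup_rat_scale [simp]: "Poly_Mapping.lookup (rat_scale q p) k = q * Poly_Mapping.lookup p k"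
  by (simp add: rat_scale_def Poly_Mapping.map.rep_eq when_def)

lemma rat_scale_simps: "rat_scale (q + r) p = rat_scale q p + rat_scale r p" "rat_scale q (p + p') = rat_scale q p + rat_scale q p'" "rat_scale 0 p = 0" "rat_scale 1 p = p"
  "rat_scale q (rat_scale r p) = rat_scale (q * r) p" "rat_scale (- q) p = - rat_scale q p"
  by (auto intro!: poly_mapping_eqI simp: lookup_add algebra_simps)

lemma int_pow_add_monoid:
  assumes "abelian_group B" "b \<in> carrier B"
  shows "b [^]\<^bsub>add_monoid B\<^esub> (i + j :: int) = b [^]\<^bsub>add_monoid B\<^esub> i \<oplus>\<^bsub>B\<^esub> b [^]\<^bsub>add_monoid B\<^esub> j"
    "b [^]\<^bsub>add_monoid B\<^esub> (- i :: int) = \<ominus>\<^bsub>B\<^esub> (b [^]\<^bsub>add_monoid B\<^esub> i)"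
    "b [^]\<^bsub>add_monoid B\<^esub> (0 :: int) = \<zero>\<^bsub>B\<^esub>"
    "b [^]\<^bsub>add_monoid B\<^esub> (1 :: int) = b"
    "b [^]\<^bsub>add_monoid B\<^esub> (i :: int) \<in> carrier B"
    "b [^]\<^bsub>add_monoid B\<^esub> (i * j :: int) = (b [^]\<^bsub>add_monoid B\<^esub> i) [^]\<^bsub>add_monoid B\<^esub> j"
proof -
  interpret abelian_group B by fact
  show "b [^]\<^bsub>add_monoid B\<^esub> (i + j :: int) = b [^]\<^bsub>add_monoid B\<^esub> i \<oplus>\<^bsub>B\<^esub> b [^]\<^bsub>add_monoid B\<^esub> j"
    using group.int_pow_mult[OF a_group, of b i j] assms by simp
  show "b [^]\<^bsub>add_monoid B\<^esub> (- i :: int) = \<ominus>\<^bsub>B\<^esub> (b [^]\<^bsub>add_monoid B\<^esub> i)"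
    using group.int_pow_neg[OF a_group, of b i] assms by (simp add: a_inv_def)
  show "b [^]\<^bsub>add_monoid B\<^esub> (0 :: int) = \<zero>\<^bsub>B\<^esub>" by simp
  show "b [^]\<^bsub>add_monoid B\<^esub> (1 :: int) = b" using group.int_pow_1[OF a_group, of b] assms by simp
  show "b [^]\<^bsub>add_monoid B\<^esub> (i :: int) \<in> carrier B" using group.int_pow_closed[OF a_group, of b i] assms by simp
  show "b [^]\<^bsub>add_monoid B\<^esub> (i * j :: int) = (b [^]\<^bsub>add_monoid B\<^esub> i) [^]\<^bsub>add_monoid B\<^esub> j"
    using group.int_pow_pow[OF a_group, of b i j] assms by simp
qed

definition additive_set :: "('a::ab_group_add) set \<Rightarrow> bool" where
  "additive_set K \<longleftrightarrow> 0 \<in> K \<and> (\<forall>x\<in>K. \<forall>y\<in>K. x - y \<in> K)"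

lemma additive_setD: assumes "additive_set K" shows "0 \<in> K" "x \<in> K \<Longrightarrow> y \<in> K \<Longrightarrow> x - y \<in> K" "x \<in> K \<Longrightarrow> - x \<in> K" "x \<in> K \<Longrightarrow> y \<in> K \<Longrightarrow> x + y \<in> K"
proof -
  show 0: "0 \<in> K" and d: "\<And>x y. x \<in> K \<Longrightarrow> y \<in> K \<Longrightarrow> x - y \<in> K" using assms by (auto simp: additive_set_def)
  show n: "\<And>x. x \<in> K \<Longrightarrow> - x \<in> K" using d[OF 0] by simp
  show "x \<in> K \<Longrightarrow> y \<in> K \<Longrightarrow> x + y \<in> K" using d[of x "- y"] n by simp
qed

text \<open>Zorn's lemma is applied to graphs: subgroups of \<open>carrier B\<close> times the
  rational vector space whose fibre over zero lies in \<open>K\<close>. They stand for partial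
  homomorphisms to the quotient by \<open>K\<close>, and a maximal one is defined everywhere because
  values can be divided by integers.\<close>

lemma extend_additive:
  fixes f :: "'b \<Rightarrow> ('a \<Rightarrow>\<^sub>0 rat)"
  assumes B: "abelian_group B" and A: "A \<subseteq> carrier B" "\<zero>\<^bsub>B\<^esub> \<in> A" "\<And>x y. x \<in> A \<Longrightarrow> y \<in> A \<Longrightarrow> x \<oplus>\<^bsub>B\<^esub> y \<in> A"
      "\<And>x. x \<in> A \<Longrightarrow> \<ominus>\<^bsub>B\<^esub> x \<in> A"
    and K: "additive_set K" and f: "\<And>x y. x \<in> A \<Longrightarrow> y \<in> A \<Longrightarrow> f (x \<oplus>\<^bsub>B\<^esub> y) - f x - f y \<in> K"
  shows "\<exists>g. (\<forall>x\<in>carrier B. \<forall>y\<in>carrier B. g (x \<oplus>\<^bsub>B\<^esub> y) - g x - g y \<in> K) \<and> (\<forall>a\<in>A. g a - f a \<in> K)"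
proof -
  interpret B: abelian_group B by fact
  note K = additive_setD[OF K]
  \<comment> \<open>Thickening the graph of \<open>f\<close> by \<open>K\<close> makes it a
    subgroup, as \<open>f\<close> is additive only modulo \<open>K\<close>.\<close>
  define Gf where "Gf = {(a, f a + k) | a k. a \<in> A \<and> k \<in> K}"
  define GG where "GG = {G. G \<subseteq> carrier B \<times> UNIV \<and> (\<forall>x u y v. (x,u) \<in> G \<longrightarrow> (y,v) \<in> G \<longrightarrow> (x \<oplus>\<^bsub>B\<^esub> y, u + v) \<in> G) \<and>
     (\<forall>x u. (x,u) \<in> G \<longrightarrow> (\<ominus>\<^bsub>B\<^esub> x, - u) \<in> G) \<and> (\<forall>z. (\<zero>\<^bsub>B\<^esub>,z) \<in> G \<longrightarrow> z \<in> K) \<and> Gf \<subseteq> G}"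
  have f0: "f \<zero>\<^bsub>B\<^esub> \<in> K" using f[OF A(2) A(2)] K(3) by fastforce
  have fn: "f x + f (\<ominus>\<^bsub>B\<^esub> x) \<in> K" if "x \<in> A" for x
  proof -
    have "f (x \<oplus>\<^bsub>B\<^esub> \<ominus>\<^bsub>B\<^esub> x) - f x - f (\<ominus>\<^bsub>B\<^esub> x) \<in> K" using f that A(4) by blast
    then have "f \<zero>\<^bsub>B\<^esub> - f x - f (\<ominus>\<^bsub>B\<^esub> x) \<in> K" using that A(1) B.r_neg by (simp add: subsetD)
    from K(2)[OF f0 this] have "f \<zero>\<^bsub>B\<^esub> - (f \<zero>\<^bsub>B\<^esub> - f x - f (\<ominus>\<^bsub>B\<^esub> x)) \<in> K" .
    then show ?thesis by (simp add: algebra_simps)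
  qed
  have "Gf \<in> GG"
    unfolding GG_def
  proof (intro CollectI conjI allI impI)
    show "Gf \<subseteq> carrier B \<times> UNIV" using A(1) by (auto simp: Gf_def)
    show "(x \<oplus>\<^bsub>B\<^esub> y, u + v) \<in> Gf" if xy: "(x, u) \<in> Gf" "(y, v) \<in> Gf" for x u y v
    proof -
      from xy obtain k l where k: "x \<in> A" "y \<in> A" "k \<in> K" "l \<in> K" "u = f x + k" "v = f y + l" by (auto simp: Gf_def)
      have "u + v = f (x \<oplus>\<^bsub>B\<^esub> y) + (k + l - (f (x \<oplus>\<^bsub>B\<^esub> y) - f x - f y))" using k by (simp add: algebra_simps)
      moreover have "k + l - (f (x \<oplus>\<^bsub>B\<^esub> y) - f x - f y) \<in> K" by (intro K(2) K(4) f k)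
      ultimately show ?thesis using A(3)[OF k(1,2)] unfolding Gf_def by blast
    qed
    show "(\<ominus>\<^bsub>B\<^esub> x, - u) \<in> Gf" if "(x, u) \<in> Gf" for x u
    proof -
      from that obtain k where k: "x \<in> A" "k \<in> K" "u = f x + k" by (auto simp: Gf_def)
      have "- u = f (\<ominus>\<^bsub>B\<^esub> x) + (- k - (f x + f (\<ominus>\<^bsub>B\<^esub> x)))" using k by (simp add: algebra_simps)
      moreover have "- k - (f x + f (\<ominus>\<^bsub>B\<^esub> x)) \<in> K" by (intro K(2) K(3) fn k)
      ultimately show ?thesis using A(4)[OF k(1)] unfolding Gf_def by blast
    qed
    show "z \<in> K" if "(\<zero>\<^bsub>B\<^esub>, z) \<in> Gf" for z using that f0 K by (auto simp: Gf_def)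
  qed auto
  then have "GG \<noteq> {}" by auto
  moreover have "\<Union>\<C> \<in> GG" if C: "\<C> \<noteq> {}" "subset.chain GG \<C>" for \<C>
  proof -
    have G: "G \<in> GG" if "G \<in> \<C>" for G using C(2) that by (auto simp: subset_chain_def)
    have lin: "G \<subseteq> G' \<or> G' \<subseteq> G" if "G \<in> \<C>" "G' \<in> \<C>" for G G' using C(2) that by (auto simp: subset_chain_def)
    show ?thesis unfolding GG_def
    proof (intro CollectI conjI allI impI)
      show "\<Union>\<C> \<subseteq> carrier B \<times> UNIV" using G unfolding GG_def by blast
      show "(\<ominus>\<^bsub>B\<^esub> x, - u) \<in> \<Union>\<C>" if "(x, u) \<in> \<Union>\<C>" for x u using that G unfolding GG_def by blast
      show "z \<in> K" if "(\<zero>\<^bsub>B\<^esub>, z) \<in> \<Union>\<C>" for z using that G unfolding GG_def by blast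
      show "Gf \<subseteq> \<Union>\<C>" using C(1) G unfolding GG_def by blast
      show "(x \<oplus>\<^bsub>B\<^esub> y, u + v) \<in> \<Union>\<C>" if xy: "(x, u) \<in> \<Union>\<C>" "(y, v) \<in> \<Union>\<C>" for x u y v
      proof -
        from xy obtain G G' where GG': "G \<in> \<C>" "G' \<in> \<C>" "(x,u) \<in> G" "(y,v) \<in> G'" by blast
        then obtain G'' where "G'' \<in> \<C>" "(x,u) \<in> G''" "(y,v) \<in> G''" using lin by blast
        then show ?thesis using G unfolding GG_def by blast
      qed
    qed
  qed
  ultimately obtain G where G: "G \<in> GG" "\<And>X. X \<in> GG \<Longrightarrow> G \<subseteq> X \<Longrightarrow> X = G"
    using subset_Zorn_nonempty[of GG] by blast
  have Gc: "x \<in> carrier B" if "(x,u) \<in> G" for x u using G(1) that unfolding GG_def by blast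
  have Ga: "(x \<oplus>\<^bsub>B\<^esub> y, u + v) \<in> G" if "(x,u) \<in> G" "(y,v) \<in> G" for x u y v using G(1) that unfolding GG_def by blast
  have Gn: "(\<ominus>\<^bsub>B\<^esub> x, - u) \<in> G" if "(x,u) \<in> G" for x u using G(1) that unfolding GG_def by blast
  have G0: "z \<in> K" if "(\<zero>\<^bsub>B\<^esub>, z) \<in> G" for z using G(1) that unfolding GG_def by blast
  have Gf: "Gf \<subseteq> G" using G(1) unfolding GG_def by blast
  have Gd: "u - v \<in> K" if "(x,u) \<in> G" "(x,v) \<in> G" for x u v
    using G0[of "u - v"] Ga[OF that(1) Gn[OF that(2)]] Gc[OF that(1)] B.r_neg by simp
  have Gz: "(\<zero>\<^bsub>B\<^esub>, 0) \<in> G"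
  proof -
    have "(\<zero>\<^bsub>B\<^esub>, f \<zero>\<^bsub>B\<^esub> + - f \<zero>\<^bsub>B\<^esub>) \<in> Gf" unfolding Gf_def using A(2) K(3)[OF f0] by blast
    then show ?thesis using Gf by auto
  qed
  let ?p = "\<lambda>(b::'b) (k::int). b [^]\<^bsub>add_monoid B\<^esub> k"
  note ip = int_pow_add_monoid[OF B]
  have Gk: "(?p x k, rat_scale (of_int k) u) \<in> G" if "(x,u) \<in> G" for x u k
  proof -
    have xc: "x \<in> carrier B" using that by (rule Gc)
    have nat: "(?p x (int n), rat_scale (of_nat n) u) \<in> G" for n
    proof (induction n)
      case 0
      then show ?case using Gz ip(3)[OF xc] by (simp add: rat_scale_simps)
    next
      case (Suc n)
      have "?p x (int (Suc n)) = ?p x (int n) \<oplus>\<^bsub>B\<^esub> x" using ip(1)[OF xc, of "int n" 1] ip(4)[OF xc] by (simp add: add.commute)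
      moreover have "rat_scale (of_nat (Suc n)) u = rat_scale (of_nat n) u + u"
        using rat_scale_simps(1)[of "of_nat n" 1 u] by (simp add: rat_scale_simps add.commute)
      ultimately show ?case using Ga[OF Suc that] by simp
    qed
    show ?thesis
    proof (cases "k \<ge> 0")
      case True
      then show ?thesis using nat[of "nat k"] by (simp add: of_nat_nat)
    next
      case False
      then have k: "k = - int (nat (- k))" by simp
      have "(\<ominus>\<^bsub>B\<^esub> ?p x (int (nat (- k))), - rat_scale (of_nat (nat (- k))) u) \<in> G" by (rule Gn[OF nat])
      moreover have "\<ominus>\<^bsub>B\<^esub> ?p x (int (nat (- k))) = ?p x k" using ip(2)[OF xc, of "int (nat (- k))"] False by simp
      moreover have "- rat_scale (of_nat (nat (- k))) u = rat_scale (of_int k) u" using False by (simp add: rat_scale_simps(6)[symmetric] of_nat_nat)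
      ultimately show ?thesis by simp
    qed
  qed
  have total: "\<exists>u. (b,u) \<in> G" if b: "b \<in> carrier B" for b
  proof (rule ccontr)
    assume nb: "\<not> ?thesis"
    \<comment> \<open>The future value \<open>d\<close> of \<open>b\<close> must agree modulo
      \<open>K\<close> with the values that multiples of \<open>b\<close> already have. If no
      positive multiple has a value, 0 will do. Otherwise \<open>d\<close> is a value at the least
      such multiple, divided by it; leastness makes every other one a multiple of it.\<close>
    have "\<exists>d. \<forall>k v. (?p b k, v) \<in> G \<longrightarrow> v - rat_scale (of_int k) d \<in> K"
    proof (cases "\<exists>n>0. \<exists>v. (?p b (int n), v) \<in> G")
      case False
      have "v - rat_scale (of_int k) 0 \<in> K" if kv: "(?p b k, v) \<in> G" for k v
      proof -
        have "k = 0"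
        proof (rule ccontr)
          assume "k \<noteq> 0"
          then consider "k > 0" | "k < 0" by linarith
          then show False
          proof cases
            case 1
            then show False using False kv by (metis zero_less_imp_eq_int)
          next
            case 2
            have "(?p b (- k), - v) \<in> G" using Gn[OF kv] ip(2)[OF b] by simp
            moreover have "int (nat (- k)) = - k" "nat (- k) > 0" using 2 by auto
            ultimately show False using False by metis
          qed
        qed
        then have "v \<in> K" using kv ip(3)[OF b] G0 by simp
        then show ?thesis by (simp add: poly_mapping_eqI[of "rat_scale (of_int k) 0" 0])
      qed
      then show ?thesis by blast
    next
      case True
      define n where "n = (LEAST n. n > 0 \<and> (\<exists>v. (?p b (int n), v) \<in> G))"
      have n: "n > 0" "\<exists>v. (?p b (int n), v) \<in> G"
        using LeastI_ex[of "\<lambda>n. n > 0 \<and> (\<exists>v. (?p b (int n), v) \<in> G)"] True unfolding n_def by blast+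
      have nmin: "\<not> (\<exists>v. (?p b (int m), v) \<in> G)" if "m > 0" "m < n" for m
        using not_less_Least[of m "\<lambda>n. n > 0 \<and> (\<exists>v. (?p b (int n), v) \<in> G)"] that unfolding n_def by blast
      obtain v0 where v0: "(?p b (int n), v0) \<in> G" using n by blast
      define d where "d = rat_scale (1 / of_nat n) v0"
      have d: "rat_scale (of_nat n) d = v0" using n(1) by (simp add: d_def rat_scale_simps)
      have "v - rat_scale (of_int k) d \<in> K" if kv: "(?p b k, v) \<in> G" for k v
      proof -
        let ?q = "k div int n" and ?r = "k mod int n"
        have q: "(?p b (int n * ?q), rat_scale (of_int ?q) v0) \<in> G" using Gk[OF v0, of ?q] ip(6)[OF b, of "int n" ?q] by simp
        have "(?p b k \<oplus>\<^bsub>B\<^esub> \<ominus>\<^bsub>B\<^esub> ?p b (int n * ?q), v + - rat_scale (of_int ?q) v0) \<in> G" by (rule Ga[OF kv Gn[OF q]])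
        moreover have "?p b k \<oplus>\<^bsub>B\<^esub> \<ominus>\<^bsub>B\<^esub> ?p b (int n * ?q) = ?p b ?r"
          using ip(1)[OF b, of k "- (int n * ?q)"] ip(2)[OF b] by (simp add: minus_mult_div_eq_mod)
        ultimately have rG: "(?p b ?r, v - rat_scale (of_int ?q) v0) \<in> G" by simp
        have r0: "?r = 0"
        proof (rule ccontr)
          assume "?r \<noteq> 0"
          moreover have "?r \<ge> 0" "?r < int n" using n(1) by auto
          ultimately have "nat ?r > 0" "nat ?r < n" "int (nat ?r) = ?r" by auto
          then show False using nmin[of "nat ?r"] rG by metis
        qed
        then have "v - rat_scale (of_int ?q) v0 \<in> K" using rG ip(3)[OF b] G0 by simp
        moreover have "rat_scale (of_int k) d = rat_scale (of_int ?q) v0"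
        proof -
          have "k = ?q * int n" using r0 by auto
          then have "(of_int k :: rat) = of_int ?q * of_nat n" by (metis of_int_mult of_int_of_nat_eq)
          then show ?thesis using d rat_scale_simps(5)[of "of_int ?q" "of_nat n" d] by simp
        qed
        ultimately show ?thesis by simp
      qed
      then show ?thesis by blast
    qed
    then obtain d where d: "\<And>k v. (?p b k, v) \<in> G \<Longrightarrow> v - rat_scale (of_int k) d \<in> K" by blast
    define G' where "G' = {(x \<oplus>\<^bsub>B\<^esub> ?p b k, u + rat_scale (of_int k) d) | x u k. (x,u) \<in> G}"
    have GG': "G \<subseteq> G'"
    proof (safe)
      fix x u assume xu: "(x,u) \<in> G"
      have "(x, u) = (x \<oplus>\<^bsub>B\<^esub> ?p b 0, u + rat_scale (of_int 0) d)" using ip(3)[OF b] Gc[OF xu] by (simp add: rat_scale_simps)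
      then show "(x,u) \<in> G'" unfolding G'_def using xu by blast
    qed
    have "G' \<in> GG" unfolding GG_def
    proof (intro CollectI conjI allI impI)
      show "G' \<subseteq> carrier B \<times> UNIV" using Gc ip(5)[OF b] by (auto simp: G'_def)
      show "Gf \<subseteq> G'" using Gf GG' by blast
      show "(x \<oplus>\<^bsub>B\<^esub> y, u + v) \<in> G'" if xy: "(x, u) \<in> G'" "(y, v) \<in> G'" for x u y v
      proof -
        from xy obtain x0 u0 k y0 v0 l where z: "x = x0 \<oplus>\<^bsub>B\<^esub> ?p b k" "u = u0 + rat_scale (of_int k) d" "(x0,u0) \<in> G"
          "y = y0 \<oplus>\<^bsub>B\<^esub> ?p b l" "v = v0 + rat_scale (of_int l) d" "(y0,v0) \<in> G" unfolding G'_def by blast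
        have "x \<oplus>\<^bsub>B\<^esub> y = (x0 \<oplus>\<^bsub>B\<^esub> y0) \<oplus>\<^bsub>B\<^esub> ?p b (k + l)"
          using z(1,4) Gc[OF z(3)] Gc[OF z(6)] ip(1,5)[OF b] by (simp add: B.a_ac)
        moreover have "u + v = (u0 + v0) + rat_scale (of_int (k + l)) d" using z by (simp add: rat_scale_simps)
        ultimately show ?thesis unfolding G'_def using Ga[OF z(3,6)] by blast
      qed
      show "(\<ominus>\<^bsub>B\<^esub> x, - u) \<in> G'" if "(x, u) \<in> G'" for x u
      proof -
        from that obtain x0 u0 k where z: "x = x0 \<oplus>\<^bsub>B\<^esub> ?p b k" "u = u0 + rat_scale (of_int k) d" "(x0,u0) \<in> G" unfolding G'_def by blast
        have "\<ominus>\<^bsub>B\<^esub> x = \<ominus>\<^bsub>B\<^esub> x0 \<oplus>\<^bsub>B\<^esub> ?p b (- k)"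
          using z(1) Gc[OF z(3)] ip(2,5)[OF b] by (simp add: B.minus_add)
        moreover have "- u = - u0 + rat_scale (of_int (- k)) d" using z by (simp add: rat_scale_simps)
        ultimately show ?thesis unfolding G'_def using Gn[OF z(3)] by blast
      qed
      show "z \<in> K" if "(\<zero>\<^bsub>B\<^esub>, z) \<in> G'" for z
      proof -
        from that obtain x0 u0 k where z: "\<zero>\<^bsub>B\<^esub> = x0 \<oplus>\<^bsub>B\<^esub> ?p b k" "z = u0 + rat_scale (of_int k) d" "(x0,u0) \<in> G" unfolding G'_def by blast
        have "?p b k = \<ominus>\<^bsub>B\<^esub> x0" using z(1) Gc[OF z(3)] ip(5)[OF b, of k] B.minus_equality[of "?p b k" x0] by (simp add: B.a_comm)
        then have "- u0 - rat_scale (of_int k) d \<in> K" using d[of k "- u0"] Gn[OF z(3)] by simp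
        then have "- (- u0 - rat_scale (of_int k) d) \<in> K" by (rule K(3))
        then show ?thesis using z(2) by (simp add: add.commute)
      qed
    qed
    then have "G' = G" by (rule G(2)[OF _ GG'])
    moreover have "(\<zero>\<^bsub>B\<^esub> \<oplus>\<^bsub>B\<^esub> ?p b 1, 0 + rat_scale (of_int 1) d) \<in> G'" unfolding G'_def using Gz by blast
    ultimately show False using nb ip(4)[OF b] b by auto
  qed
  define g where "g x = (SOME u. (x,u) \<in> G)" for x
  have g: "(x, g x) \<in> G" if "x \<in> carrier B" for x unfolding g_def using total[OF that] by (rule someI_ex)
  have "g (x \<oplus>\<^bsub>B\<^esub> y) - g x - g y \<in> K" if "x \<in> carrier B" "y \<in> carrier B" for x y
    using Gd[OF g[of "x \<oplus>\<^bsub>B\<^esub> y"] Ga[OF g[OF that(1)] g[OF that(2)]]] that by (simp add: diff_diff_eq)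
  moreover have "g a - f a \<in> K" if "a \<in> A" for a
  proof -
    have "(a, f a + 0) \<in> Gf" unfolding Gf_def using that K(1) by blast
    then show ?thesis using Gd[OF g[of a]] Gf that A(1) by auto
  qed
  ultimately show ?thesis by blast
qed

text \<open>A normal form for cosets of \<open>K\<close>, which turns equality modulo
  \<open>K\<close> into equality. The coset \<open>K\<close> itself is represented by 0, so that the
  zero function is an element of the module below.\<close>

definition coset_rep :: "('a::ab_group_add) set \<Rightarrow> 'a \<Rightarrow> 'a" where
  "coset_rep K x = (if x \<in> K then 0 else SOME y. y - x \<in> K)"

lemma coset_rep:
  assumes "additive_set K"
  shows "coset_rep K x - x \<in> K" "coset_rep K x = coset_rep K y \<longleftrightarrow> x - y \<in> K" "coset_rep K 0 = 0" "coset_rep K (coset_rep K x) = coset_rep K x"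
proof -
  note K = additive_setD[OF assms]
  show 1: "coset_rep K x - x \<in> K" for x
  proof (cases "x \<in> K")
    case False
    have "(SOME y. y - x \<in> K) - x \<in> K" by (rule someI[of _ x]) (use K in simp)
    then show ?thesis using False by (simp add: coset_rep_def)
  qed (use K in \<open>auto simp: coset_rep_def\<close>)
  show 2: "coset_rep K x = coset_rep K y \<longleftrightarrow> x - y \<in> K" for x y
  proof
    assume e: "coset_rep K x = coset_rep K y"
    have "(coset_rep K y - y) - (coset_rep K x - x) \<in> K" using 1 K by blast
    then show "x - y \<in> K" using e by (simp add: algebra_simps)
  next
    assume xy: "x - y \<in> K"
    have "z - x \<in> K \<longleftrightarrow> z - y \<in> K" for z
      using K(4)[of "z - x" "x - y"] K(2)[of "z - y" "x - y"] xy by (auto simp: algebra_simps)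
    moreover have "x \<in> K \<longleftrightarrow> y \<in> K" using K(2)[of x "x - y"] K(4)[of "x - y" y] xy by auto
    ultimately show "coset_rep K x = coset_rep K y" by (simp add: coset_rep_def)
  qed
  show "coset_rep K 0 = 0" using K by (simp add: coset_rep_def)
  show "coset_rep K (coset_rep K x) = coset_rep K x" using 1 2 by blast
qed

text \<open>The additive maps from the ring to the quotient by \<open>K\<close>, stored with values
  in normal form and 0 outside the ring, so that equality of elements is equality of
  functions.\<close>

definition coinduced_module :: "('r, 'x) ring_scheme \<Rightarrow> ('a \<Rightarrow>\<^sub>0 rat) set \<Rightarrow> ('r, 'r \<Rightarrow> ('a \<Rightarrow>\<^sub>0 rat)) module" where
  "coinduced_module R K = \<lparr>carrier = {\<phi>. (\<forall>r\<in>carrier R. coset_rep K (\<phi> r) = \<phi> r) \<and> (\<forall>r. r \<notin> carrier R \<longrightarrow> \<phi> r = 0) \<and>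
      (\<forall>r\<in>carrier R. \<forall>s\<in>carrier R. \<phi> (r \<oplus>\<^bsub>R\<^esub> s) - \<phi> r - \<phi> s \<in> K)},
     monoid.mult = undefined, one = undefined, ring.zero = (\<lambda>_. 0),
     add = (\<lambda>\<phi> \<psi> r. if r \<in> carrier R then coset_rep K (\<phi> r + \<psi> r) else 0),
     smult = (\<lambda>s \<phi> r. if r \<in> carrier R then \<phi> (r \<otimes>\<^bsub>R\<^esub> s) else 0)\<rparr>"

locale coinduced = cring R for R :: "('r, 'x) ring_scheme" (structure) +
  fixes K :: "('u \<Rightarrow>\<^sub>0 rat) set"
  assumes K: "additive_set K"
begin

abbreviation "E \<equiv> coinduced_module R K"

lemmas Kg = additive_setD[OF K] and coset_rep' = coset_rep[OF K]

lemma E_simps: "\<phi> \<in> carrier E \<longleftrightarrow> (\<forall>r\<in>carrier R. coset_rep K (\<phi> r) = \<phi> r) \<and> (\<forall>r. r \<notin> carrier R \<longrightarrow> \<phi> r = 0) \<and>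
      (\<forall>r\<in>carrier R. \<forall>s\<in>carrier R. \<phi> (r \<oplus> s) - \<phi> r - \<phi> s \<in> K)"
  "ring.zero E = (\<lambda>_. 0)" "(\<phi> \<oplus>\<^bsub>E\<^esub> \<psi>) r = (if r \<in> carrier R then coset_rep K (\<phi> r + \<psi> r) else 0)"
  "(s \<odot>\<^bsub>E\<^esub> \<phi>) r = (if r \<in> carrier R then \<phi> (r \<otimes> s) else 0)"
  by (simp_all add: coinduced_module_def)

lemma ED: assumes "\<phi> \<in> carrier E" shows "r \<in> carrier R \<Longrightarrow> coset_rep K (\<phi> r) = \<phi> r" "r \<notin> carrier R \<Longrightarrow> \<phi> r = 0"
   "r \<in> carrier R \<Longrightarrow> s \<in> carrier R \<Longrightarrow> \<phi> (r \<oplus> s) - \<phi> r - \<phi> s \<in> K"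
  using assms unfolding E_simps(1) by blast+

text \<open>Passing to normal forms changes values by elements of \<open>K\<close> only, so
  additivity modulo \<open>K\<close> survives.\<close>

lemma additive_imp_E:
  assumes g: "\<And>r s. r \<in> carrier R \<Longrightarrow> s \<in> carrier R \<Longrightarrow> g (r \<oplus> s) - g r - g s \<in> K"
  shows "(\<lambda>r. if r \<in> carrier R then coset_rep K (g r) else 0) \<in> carrier E"
proof -
  have "coset_rep K (g (r \<oplus> s)) - coset_rep K (g r) - coset_rep K (g s) \<in> K" if "r \<in> carrier R" "s \<in> carrier R" for r s
  proof -
    have "((coset_rep K (g (r \<oplus> s)) - g (r \<oplus> s)) - (coset_rep K (g r) - g r) - (coset_rep K (g s) - g s)) + (g (r \<oplus> s) - g r - g s) \<in> K"
      by (intro Kg(4) Kg(2) coset_rep'(1) g that)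
    then show ?thesis by (simp add: algebra_simps)
  qed
  then show ?thesis by (simp add: E_simps coset_rep'(4))
qed

lemma coinduced_module_module: "module R E"
proof (intro moduleI abelian_groupI)
  show "cring R" by (rule is_cring)
  show "\<zero>\<^bsub>E\<^esub> \<in> carrier E" using Kg by (auto simp: E_simps coset_rep')
next
  fix \<phi> \<psi> assume p: "\<phi> \<in> carrier E" "\<psi> \<in> carrier E"
  have "\<phi> \<oplus>\<^bsub>E\<^esub> \<psi> = (\<lambda>r. if r \<in> carrier R then coset_rep K (\<phi> r + \<psi> r) else 0)" by (simp add: coinduced_module_def)
  also have "\<dots> \<in> carrier E"
  proof (rule additive_imp_E)
    fix r s assume rs: "r \<in> carrier R" "s \<in> carrier R"
    have "(\<phi> (r \<oplus> s) - \<phi> r - \<phi> s) + (\<psi> (r \<oplus> s) - \<psi> r - \<psi> s) \<in> K" by (intro Kg(4) ED(3) p rs)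
    then show "\<phi> (r \<oplus> s) + \<psi> (r \<oplus> s) - (\<phi> r + \<psi> r) - (\<phi> s + \<psi> s) \<in> K" by (simp add: algebra_simps)
  qed
  finally show "\<phi> \<oplus>\<^bsub>E\<^esub> \<psi> \<in> carrier E" .
  show "\<phi> \<oplus>\<^bsub>E\<^esub> \<psi> = \<psi> \<oplus>\<^bsub>E\<^esub> \<phi>" by (auto simp: coinduced_module_def add.commute)
  show "a \<odot>\<^bsub>E\<^esub> (\<phi> \<oplus>\<^bsub>E\<^esub> \<psi>) = a \<odot>\<^bsub>E\<^esub> \<phi> \<oplus>\<^bsub>E\<^esub> a \<odot>\<^bsub>E\<^esub> \<psi>" if "a \<in> carrier R" for a
    using that by (auto simp: coinduced_module_def)
  fix \<chi> assume c: "\<chi> \<in> carrier E"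
  show "\<phi> \<oplus>\<^bsub>E\<^esub> \<psi> \<oplus>\<^bsub>E\<^esub> \<chi> = \<phi> \<oplus>\<^bsub>E\<^esub> (\<psi> \<oplus>\<^bsub>E\<^esub> \<chi>)"
  proof
    fix r
    have "coset_rep K (coset_rep K (\<phi> r + \<psi> r) + \<chi> r) = coset_rep K (\<phi> r + coset_rep K (\<psi> r + \<chi> r))"
    proof -
      have "(coset_rep K (\<phi> r + \<psi> r) - (\<phi> r + \<psi> r)) - (coset_rep K (\<psi> r + \<chi> r) - (\<psi> r + \<chi> r)) \<in> K" by (intro Kg(2) coset_rep'(1))
      then show ?thesis unfolding coset_rep'(2) by (simp add: algebra_simps)
    qed
    then show "(\<phi> \<oplus>\<^bsub>E\<^esub> \<psi> \<oplus>\<^bsub>E\<^esub> \<chi>) r = (\<phi> \<oplus>\<^bsub>E\<^esub> (\<psi> \<oplus>\<^bsub>E\<^esub> \<chi>)) r" by (simp add: E_simps)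
  qed
next
  fix \<phi> assume p: "\<phi> \<in> carrier E"
  show "\<zero>\<^bsub>E\<^esub> \<oplus>\<^bsub>E\<^esub> \<phi> = \<phi>" using ED(1,2)[OF p] by (auto simp: coinduced_module_def)
  show "\<one> \<odot>\<^bsub>E\<^esub> \<phi> = \<phi>" using ED(2)[OF p] by (auto simp: coinduced_module_def)
  let ?n = "\<lambda>r. if r \<in> carrier R then coset_rep K (- \<phi> r) else 0"
  have "?n \<in> carrier E"
  proof (rule additive_imp_E)
    fix r s assume "r \<in> carrier R" "s \<in> carrier R"
    then have "- (\<phi> (r \<oplus> s) - \<phi> r - \<phi> s) \<in> K" using ED(3)[OF p] Kg(3) by blast
    then show "- \<phi> (r \<oplus> s) - - \<phi> r - - \<phi> s \<in> K" by (simp add: algebra_simps)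
  qed
  moreover have "?n \<oplus>\<^bsub>E\<^esub> \<phi> = \<zero>\<^bsub>E\<^esub>"
  proof
    fix r
    have "coset_rep K (coset_rep K (- \<phi> r) + \<phi> r) = coset_rep K 0" unfolding coset_rep'(2) using coset_rep'(1)[of "- \<phi> r"] by simp
    then show "(?n \<oplus>\<^bsub>E\<^esub> \<phi>) r = \<zero>\<^bsub>E\<^esub> r" using coset_rep'(3) by (simp add: E_simps)
  qed
  ultimately show "\<exists>\<psi>\<in>carrier E. \<psi> \<oplus>\<^bsub>E\<^esub> \<phi> = \<zero>\<^bsub>E\<^esub>" by blast
next
  fix a \<phi> assume a: "a \<in> carrier R" and p: "\<phi> \<in> carrier E"
  have "\<phi> ((r \<oplus> s) \<otimes> a) - \<phi> (r \<otimes> a) - \<phi> (s \<otimes> a) \<in> K" if "r \<in> carrier R" "s \<in> carrier R" for r s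
    using ED(3)[OF p, of "r \<otimes> a" "s \<otimes> a"] a that by (simp add: l_distr)
  then show "a \<odot>\<^bsub>E\<^esub> \<phi> \<in> carrier E" using ED(1)[OF p] a by (auto simp: E_simps)
  fix b assume b: "b \<in> carrier R"
  show "(a \<otimes> b) \<odot>\<^bsub>E\<^esub> \<phi> = a \<odot>\<^bsub>E\<^esub> (b \<odot>\<^bsub>E\<^esub> \<phi>)" using a b by (auto simp: coinduced_module_def m_ac)
  show "(a \<oplus> b) \<odot>\<^bsub>E\<^esub> \<phi> = a \<odot>\<^bsub>E\<^esub> \<phi> \<oplus>\<^bsub>E\<^esub> b \<odot>\<^bsub>E\<^esub> \<phi>"
  proof
    fix r
    have "\<phi> (r \<otimes> (a \<oplus> b)) = coset_rep K (\<phi> (r \<otimes> a) + \<phi> (r \<otimes> b))" if r: "r \<in> carrier R"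
    proof -
      have "coset_rep K (\<phi> (r \<otimes> a \<oplus> r \<otimes> b)) = coset_rep K (\<phi> (r \<otimes> a) + \<phi> (r \<otimes> b))"
        unfolding coset_rep'(2) using ED(3)[OF p, of "r \<otimes> a" "r \<otimes> b"] a b r by (simp add: diff_diff_eq)
      then show ?thesis using ED(1)[OF p, of "r \<otimes> a \<oplus> r \<otimes> b"] a b r by (simp add: r_distr)
    qed
    then show "((a \<oplus> b) \<odot>\<^bsub>E\<^esub> \<phi>) r = (a \<odot>\<^bsub>E\<^esub> \<phi> \<oplus>\<^bsub>E\<^esub> b \<odot>\<^bsub>E\<^esub> \<phi>) r" by (simp add: E_simps)
  qed
qed

text \<open>One half of the adjunction between additive maps on \<open>B\<close> and homomorphisms
  to the coinduced module; the hypothesis on \<open>g\<close> is additivity modulo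
  \<open>K\<close>.\<close>

lemma coinduced_module_hom:
  assumes "module R B" and g: "\<And>x y. x \<in> carrier B \<Longrightarrow> y \<in> carrier B \<Longrightarrow> g (x \<oplus>\<^bsub>B\<^esub> y) - g x - g y \<in> K"
  shows "(\<lambda>b r. if r \<in> carrier R then coset_rep K (g (r \<odot>\<^bsub>B\<^esub> b)) else 0) \<in> mod_hom R B E"
proof -
  interpret B: module R B by fact
  let ?h = "\<lambda>b r. if r \<in> carrier R then coset_rep K (g (r \<odot>\<^bsub>B\<^esub> b)) else 0"
  have "?h b \<in> carrier E" if "b \<in> carrier B" for b
    using g that by (intro additive_imp_E) (simp add: B.smult_l_distr)
  moreover have "?h (b \<oplus>\<^bsub>B\<^esub> c) = ?h b \<oplus>\<^bsub>E\<^esub> ?h c" if bc: "b \<in> carrier B" "c \<in> carrier B" for b c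
  proof
    fix r
    have "coset_rep K (g (r \<odot>\<^bsub>B\<^esub> b \<oplus>\<^bsub>B\<^esub> r \<odot>\<^bsub>B\<^esub> c)) = coset_rep K (coset_rep K (g (r \<odot>\<^bsub>B\<^esub> b)) + coset_rep K (g (r \<odot>\<^bsub>B\<^esub> c)))" if r: "r \<in> carrier R"
    proof -
      have "(g (r \<odot>\<^bsub>B\<^esub> b \<oplus>\<^bsub>B\<^esub> r \<odot>\<^bsub>B\<^esub> c) - g (r \<odot>\<^bsub>B\<^esub> b) - g (r \<odot>\<^bsub>B\<^esub> c)) - (coset_rep K (g (r \<odot>\<^bsub>B\<^esub> b)) - g (r \<odot>\<^bsub>B\<^esub> b))
         - (coset_rep K (g (r \<odot>\<^bsub>B\<^esub> c)) - g (r \<odot>\<^bsub>B\<^esub> c)) \<in> K"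
        using r bc by (intro Kg(2) coset_rep'(1) g) auto
      then show ?thesis unfolding coset_rep'(2) by (simp add: algebra_simps)
    qed
    then show "?h (b \<oplus>\<^bsub>B\<^esub> c) r = (?h b \<oplus>\<^bsub>E\<^esub> ?h c) r" using bc by (simp add: E_simps B.smult_r_distr)
  qed
  moreover have "?h (s \<odot>\<^bsub>B\<^esub> b) = s \<odot>\<^bsub>E\<^esub> ?h b" if "s \<in> carrier R" "b \<in> carrier B" for s b
    using that by (auto simp: E_simps B.smult_assoc1)
  ultimately show ?thesis unfolding mod_hom_def by simp
qed

text \<open>Evaluation at one turns \<open>f\<close> into a map that is additive modulo
  \<open>K\<close>, and this extends to \<open>B\<close>. The homomorphism that corresponds to the
  extension restricts to \<open>f\<close>, because \<open>f a r\<close> is the value of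
  \<open>f (r a)\<close> at one.\<close>

lemma coinduced_module_injective:
  assumes "module R B" "submodule A R B" "f \<in> mod_hom R (B\<lparr>carrier := A\<rparr>) E"
  shows "\<exists>g\<in>mod_hom R B E. \<forall>x\<in>A. g x = f x"
proof -
  interpret B: module R B by fact
  note A = B.submoduleE[OF assms(2)]
  note f = mod_homD[OF assms(3), simplified]
  have add: "f (x \<oplus>\<^bsub>B\<^esub> y) \<one> - f x \<one> - f y \<one> \<in> K" if "x \<in> A" "y \<in> A" for x y
    using f(2)[OF that] coset_rep'(1)[of "f x \<one> + f y \<one>"] by (simp add: E_simps diff_diff_eq)
  have "\<zero>\<^bsub>B\<^esub> \<in> A" using submodule.axioms(1)[OF assms(2)] subgroup.one_closed by fastforce
  have "\<exists>g. (\<forall>x\<in>carrier B. \<forall>y\<in>carrier B. g (x \<oplus>\<^bsub>B\<^esub> y) - g x - g y \<in> K) \<and> (\<forall>a\<in>A. g a - f a \<one> \<in> K)"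
    by (rule extend_additive[OF B.M.abelian_group_axioms A(1) \<open>\<zero>\<^bsub>B\<^esub> \<in> A\<close>]) (fact A(5) A(3) K add)+
  then obtain g where g': "\<forall>x\<in>carrier B. \<forall>y\<in>carrier B. g (x \<oplus>\<^bsub>B\<^esub> y) - g x - g y \<in> K" "\<forall>a\<in>A. g a - f a \<one> \<in> K"
    by (elim exE conjE)
  have g: "\<And>x y. x \<in> carrier B \<Longrightarrow> y \<in> carrier B \<Longrightarrow> g (x \<oplus>\<^bsub>B\<^esub> y) - g x - g y \<in> K" "\<And>a. a \<in> A \<Longrightarrow> g a - f a \<one> \<in> K"
    using g' by simp_all
  let ?h = "\<lambda>b r. if r \<in> carrier R then coset_rep K (g (r \<odot>\<^bsub>B\<^esub> b)) else 0"
  have "?h a = f a" if a: "a \<in> A" for a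
  proof
    fix r
    have fa: "f a \<in> carrier E" using f(1)[OF a] .
    show "?h a r = f a r"
    proof (cases "r \<in> carrier R")
      case True
      have "coset_rep K (g (r \<odot>\<^bsub>B\<^esub> a)) = coset_rep K (f (r \<odot>\<^bsub>B\<^esub> a) \<one>)" unfolding coset_rep'(2) by (rule g(2)[OF A(4)[OF True a]])
      also have "f (r \<odot>\<^bsub>B\<^esub> a) \<one> = f a r" using f(3)[OF True a] True by (simp add: E_simps)
      finally show ?thesis using True ED(1)[OF fa True] by simp
    qed (use ED(2)[OF fa] in auto)
  qed
  then show ?thesis by (intro bexI[OF _ coinduced_module_hom[OF assms(1) g(1)]] ballI)
qed

end

text \<open>\<open>K\<close> is the kernel of the map from the free abelian group on the set
  \<open>X\<close> to the group \<open>X\<close>, read with rational coefficients. Passing from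
  integral to rational coefficients is injective, so a basis vector in \<open>K\<close> is itself an
  integral relation, and this relation says that its index is zero.\<close>

lemma divisible_hull:
  fixes X :: "('r, 'a, 'y) module_scheme"
  assumes "module R X"
  shows "\<exists>K :: ('a \<Rightarrow>\<^sub>0 rat) set. \<exists>\<delta>. additive_set K \<and>
    (\<forall>x\<in>carrier X. \<forall>y\<in>carrier X. \<delta> (x \<oplus>\<^bsub>X\<^esub> y) - \<delta> x - \<delta> y \<in> K) \<and> (\<forall>x\<in>carrier X. \<delta> x \<in> K \<longrightarrow> x = \<zero>\<^bsub>X\<^esub>)"
proof -
  interpret X: module R X by fact
  let ?F = "free_Abelian_group (carrier X)"
  have im: "(\<lambda>x. x) ` carrier X \<subseteq> carrier (add_monoid X)" by simp
  obtain h where h: "h \<in> hom ?F (add_monoid X)" "\<And>x. x \<in> carrier X \<Longrightarrow> h (frag_of x) = x"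
    by (rule comm_group.free_Abelian_group_universal[OF X.a_comm_group im]) (rule that, assumption, assumption)
  interpret gh: group_hom ?F "add_monoid X" h
    by (rule group_hom.intro[OF group_free_Abelian_group X.M.a_group group_hom_axioms.intro[OF h(1)]])
  define emb :: "('a \<Rightarrow>\<^sub>0 int) \<Rightarrow> ('a \<Rightarrow>\<^sub>0 rat)" where "emb = Poly_Mapping.map rat_of_int"
  have lk: "Poly_Mapping.lookup (emb p) k = rat_of_int (Poly_Mapping.lookup p k)" for p k
    by (simp add: emb_def Poly_Mapping.map.rep_eq when_def)
  have emb_diff: "emb (p - q) = emb p - emb q" for p q by (rule poly_mapping_eqI) (simp add: lk lookup_minus)
  have emb_inj: "p = q" if "emb p = emb q" for p q
    by (rule poly_mapping_eqI) (metis lk of_int_eq_iff that)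
  define K where "K = {emb p | p. Poly_Mapping.keys p \<subseteq> carrier X \<and> h p = \<zero>\<^bsub>X\<^esub>}"
  have hd: "h (p - q) = h p \<oplus>\<^bsub>X\<^esub> \<ominus>\<^bsub>X\<^esub> h q" if "Poly_Mapping.keys p \<subseteq> carrier X" "Poly_Mapping.keys q \<subseteq> carrier X" for p q
    using gh.hom_mult[of p "- q"] gh.hom_inv[of q] that by (simp add: a_inv_def)
  have koszul_d: "Poly_Mapping.keys (p - q) \<subseteq> carrier X" if "Poly_Mapping.keys p \<subseteq> carrier X" "Poly_Mapping.keys q \<subseteq> carrier X" for p q :: "'a \<Rightarrow>\<^sub>0 int"
    using keys_diff[of p q] that by blast
  have "additive_set K" unfolding additive_set_def
  proof (intro conjI ballI)
    have "emb 0 = 0" by (rule poly_mapping_eqI) (simp add: lk)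
    moreover have "h 0 = \<zero>\<^bsub>X\<^esub>" using gh.hom_one by simp
    ultimately show "0 \<in> K" unfolding K_def by (auto intro!: exI[of _ 0])
  next
    fix x y assume "x \<in> K" "y \<in> K"
    then obtain p q where pq: "x = emb p" "y = emb q" "Poly_Mapping.keys p \<subseteq> carrier X" "h p = \<zero>\<^bsub>X\<^esub>" "Poly_Mapping.keys q \<subseteq> carrier X" "h q = \<zero>\<^bsub>X\<^esub>"
      unfolding K_def by blast
    have "x - y = emb (p - q)" "h (p - q) = \<zero>\<^bsub>X\<^esub>" using pq hd[OF pq(3,5)] by (auto simp: emb_diff)
    then show "x - y \<in> K" unfolding K_def using koszul_d[OF pq(3,5)] by blast
  qed
  moreover have "emb (frag_of (x \<oplus>\<^bsub>X\<^esub> y)) - emb (frag_of x) - emb (frag_of y) \<in> K" if xy: "x \<in> carrier X" "y \<in> carrier X" for x y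
  proof -
    let ?p = "frag_of (x \<oplus>\<^bsub>X\<^esub> y) - frag_of x - frag_of y"
    have k: "Poly_Mapping.keys (frag_of z) \<subseteq> carrier X" if "z \<in> carrier X" for z using that by simp
    note k1 = koszul_d[OF k[OF X.M.a_closed[OF xy]] k[OF xy(1)]]
    have "h ?p = (x \<oplus>\<^bsub>X\<^esub> y) \<oplus>\<^bsub>X\<^esub> \<ominus>\<^bsub>X\<^esub> x \<oplus>\<^bsub>X\<^esub> \<ominus>\<^bsub>X\<^esub> y"
      using hd[OF k1 k[OF xy(2)]] hd[OF k[OF X.M.a_closed[OF xy]] k[OF xy(1)]] h(2) xy by simp
    also have "\<dots> = (x \<oplus>\<^bsub>X\<^esub> \<ominus>\<^bsub>X\<^esub> x) \<oplus>\<^bsub>X\<^esub> (y \<oplus>\<^bsub>X\<^esub> \<ominus>\<^bsub>X\<^esub> y)"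
      using xy by (simp only: X.M.a_ac X.M.a_closed X.M.a_inv_closed)
    also have "\<dots> = \<zero>\<^bsub>X\<^esub>" using xy by (simp add: X.M.r_neg)
    finally have "emb ?p \<in> K" unfolding K_def using koszul_d[OF k1 k[OF xy(2)]] by blast
    then show ?thesis by (simp add: emb_diff)
  qed
  moreover have "x = \<zero>\<^bsub>X\<^esub>" if x: "x \<in> carrier X" "emb (frag_of x) \<in> K" for x
  proof -
    from x(2) obtain p where "emb (frag_of x) = emb p" "h p = \<zero>\<^bsub>X\<^esub>" unfolding K_def by blast
    then show ?thesis using emb_inj h(2)[OF x(1)] by metis
  qed
  ultimately show ?thesis by (intro exI[of _ K] exI[of _ "\<lambda>x. emb (frag_of x)"]) auto
qed

section \<open>Cardinality of the universe type\<close>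

lemma inj_lists_infinite:
  assumes "infinite (UNIV :: 'a set)"
  shows "\<exists>f :: 'a list \<Rightarrow> 'a. inj f"
proof -
  obtain f :: "'a list \<Rightarrow> 'a" where "bij_betw f (lists (UNIV :: 'a set)) UNIV" using lists_infinite_bij_betw[OF assms] by blast
  then show ?thesis by (auto simp: bij_betw_def)
qed

text \<open>A finitely supported function is encoded by a list of its support together with its
  values there, the rationals being countable.\<close>

lemma inj_poly_mapping_rat:
  assumes "infinite (UNIV :: 'a set)"
  shows "\<exists>f :: ('a \<Rightarrow>\<^sub>0 rat) \<Rightarrow> 'a. inj f"
proof -
  obtain l :: "'a list \<Rightarrow> 'a" where l: "inj l" using inj_lists_infinite[OF assms] by blast
  obtain e :: "nat \<Rightarrow> 'a" where e: "inj e" using assms infinite_countable_subset[of "UNIV :: 'a set"] by auto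
  define ks where "ks p = (SOME xs. set xs = Poly_Mapping.keys (p :: 'a \<Rightarrow>\<^sub>0 rat))" for p
  have ks: "set (ks p) = Poly_Mapping.keys p" for p
    unfolding ks_def by (rule someI_ex) (use finite_list[OF finite_keys] in blast)
  let ?c = "\<lambda>(p :: 'a \<Rightarrow>\<^sub>0 rat). l (map (\<lambda>x. l [x, e (to_nat (Poly_Mapping.lookup p x))]) (ks p))"
  have "inj ?c"
  proof (rule injI)
    fix p q assume "?c p = ?c q"
    then have m: "map (\<lambda>x. l [x, e (to_nat (Poly_Mapping.lookup p x))]) (ks p) = map (\<lambda>x. l [x, e (to_nat (Poly_Mapping.lookup q x))]) (ks q)"
      using l by (auto dest: injD)
    have "(x, Poly_Mapping.lookup p x) \<in> (\<lambda>x. (x, Poly_Mapping.lookup q x)) ` set (ks q)" if xk: "x \<in> set (ks p)"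
      and mm: "map (\<lambda>x. l [x, e (to_nat (Poly_Mapping.lookup p x))]) (ks p) = map (\<lambda>x. l [x, e (to_nat (Poly_Mapping.lookup q x))]) (ks q)" for x p q
    proof -
      have "l [x, e (to_nat (Poly_Mapping.lookup p x))] \<in> set (map (\<lambda>x. l [x, e (to_nat (Poly_Mapping.lookup p x))]) (ks p))" using xk by simp
      then obtain y where y: "y \<in> set (ks q)" "l [x, e (to_nat (Poly_Mapping.lookup p x))] = l [y, e (to_nat (Poly_Mapping.lookup q y))]"
        unfolding mm by auto
      then have "[x, e (to_nat (Poly_Mapping.lookup p x))] = [y, e (to_nat (Poly_Mapping.lookup q y))]" using l by (auto dest: injD)
      then have "x = y" "Poly_Mapping.lookup p x = Poly_Mapping.lookup q y" using e by (auto dest: injD)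
      then show ?thesis using y by auto
    qed
    note a = this[OF _ m] this[OF _ m[symmetric]]
    show "p = q"
    proof (rule poly_mapping_eqI)
      fix x
      show "Poly_Mapping.lookup p x = Poly_Mapping.lookup q x"
        using a(1)[of x] a(2)[of x] unfolding ks by (cases "x \<in> Poly_Mapping.keys p"; cases "x \<in> Poly_Mapping.keys q") (auto simp: in_keys_iff)
    qed
  qed
  then show ?thesis by blast
qed

text \<open>If \<open>'r\<close> is finite, the inner functions are finite tuples and have codes in
  \<open>'k\<close>. If \<open>'r\<close> is infinite, pairs of arguments have codes in
  \<open>'r\<close>.\<close>

lemma inj_fun_fun:
  assumes "infinite (UNIV :: 'k set)"
  shows "\<exists>f :: ('r \<Rightarrow> ('r \<Rightarrow> 'k)) \<Rightarrow> ('r \<Rightarrow> 'k). inj f"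
proof (cases "finite (UNIV :: 'r set)")
  case True
  obtain l :: "'k list \<Rightarrow> 'k" where l: "inj l" using inj_lists_infinite[OF assms] by blast
  obtain xs where xs: "set xs = (UNIV :: 'r set)" using finite_list[OF True] by blast
  let ?f = "\<lambda>(g :: 'r \<Rightarrow> ('r \<Rightarrow> 'k)) r. l (map (g r) xs)"
  have "inj ?f"
  proof (rule injI)
    fix g h assume "?f g = ?f h"
    then have "l (map (g r) xs) = l (map (h r) xs)" for r by (rule fun_cong)
    then have "map (g r) xs = map (h r) xs" for r by (rule injD[OF l])
    then show "g = h" using xs by (auto simp: fun_eq_iff)
  qed
  then show ?thesis by blast
next
  case False
  obtain l :: "'r list \<Rightarrow> 'r" where l: "inj l" using inj_lists_infinite[OF False] by blast
  let ?i = "\<lambda>x. inv_into UNIV l x"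
  let ?f = "\<lambda>(g :: 'r \<Rightarrow> ('r \<Rightarrow> 'k)) x. g (?i x ! 0) (?i x ! 1)"
  have "inj ?f"
  proof (rule injI)
    fix g h assume e: "?f g = ?f h"
    have "g a b = h a b" for a b using fun_cong[OF e, of "l [a, b]"] l by simp
    then show "g = h" by (simp add: fun_eq_iff)
  qed
  then show ?thesis by blast
qed

section \<open>Construction of an injective resolution\<close>

lemma mod_hom_comp: "f \<in> mod_hom R L M \<Longrightarrow> g \<in> mod_hom R M N \<Longrightarrow> (\<lambda>x. g (f x)) \<in> mod_hom R L N"
  by (auto simp: mod_hom_def Pi_def)

lemma inv_mod_hom:
  assumes "module R M" "module R N" "f \<in> mod_hom R M N" "inj_on f (carrier M)" "f ` carrier M = carrier N"
  shows "inv_into (carrier M) f \<in> mod_hom R N M"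
proof -
  interpret M: module R M by fact
  note f = mod_homD[OF assms(3)]
  let ?i = "inv_into (carrier M) f"
  have i: "?i (f x) = x" if "x \<in> carrier M" for x using assms(4) that by simp
  have ex: "\<exists>x\<in>carrier M. y = f x" if "y \<in> carrier N" for y using that assms(5) by auto
  show ?thesis unfolding mod_hom_def
  proof (intro CollectI conjI ballI funcsetI)
    fix y assume y: "y \<in> carrier N"
    then obtain x where x: "x \<in> carrier M" "y = f x" using ex by blast
    show "?i y \<in> carrier M" using x i by simp
    show "?i (r \<odot>\<^bsub>N\<^esub> y) = r \<odot>\<^bsub>M\<^esub> ?i y" if "r \<in> carrier R" for r
      using x i that i[of "r \<odot>\<^bsub>M\<^esub> x"] f(3) by simp
    fix z assume "z \<in> carrier N"
    then obtain w where w: "w \<in> carrier M" "z = f w" using ex by blast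
    show "?i (y \<oplus>\<^bsub>N\<^esub> z) = ?i y \<oplus>\<^bsub>M\<^esub> ?i z"
      using x w i i[of "x \<oplus>\<^bsub>M\<^esub> w"] f(2) by simp
  qed
qed

text \<open>The code \<open>c\<close> carries the coinduced module back to the element type of
  \<open>X\<close>, so the construction can be iterated without change of type. The cokernel stays
  in this type as well, being formed from one representative of each coset.\<close>

lemma injective_embedding:
  fixes X :: "('r, 'u) module" and c :: "('r \<Rightarrow> ('u \<Rightarrow>\<^sub>0 rat)) \<Rightarrow> 'u"
  assumes "cring R" "module R X" and c: "inj c"
  shows "\<exists>(E :: ('r, 'u) module) e (C :: ('r, 'u) module) q. injective_module R E \<and> e \<in> mod_hom R X E \<and> inj_on e (carrier X) \<and>
    module R C \<and> q \<in> mod_hom R E C \<and> q ` carrier E = carrier C \<and> e ` carrier X = {x \<in> carrier E. q x = \<zero>\<^bsub>C\<^esub>}"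
proof -
  interpret X: module R X by fact
  obtain K :: "('u \<Rightarrow>\<^sub>0 rat) set" and \<delta> where K: "additive_set K" and
    \<delta>: "\<And>x y. x \<in> carrier X \<Longrightarrow> y \<in> carrier X \<Longrightarrow> \<delta> (x \<oplus>\<^bsub>X\<^esub> y) - \<delta> x - \<delta> y \<in> K" "\<And>x. x \<in> carrier X \<Longrightarrow> \<delta> x \<in> K \<Longrightarrow> x = \<zero>\<^bsub>X\<^esub>"
    using divisible_hull[OF assms(2)] by metis
  interpret coinduced R K by (intro coinduced.intro assms(1) coinduced_axioms.intro K)
  let ?E = "push_module (coinduced_module R K) c"
  have ci: "inj_on c (carrier (coinduced_module R K))" using c by (rule inj_on_subset) simp
  note E = push_module_inj[OF coinduced_module_module ci]
  interpret E: module R ?E by (rule E(1))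
  have ic: "inv_into (carrier (coinduced_module R K)) c \<in> mod_hom R ?E (coinduced_module R K)"
    by (rule inv_mod_hom[OF coinduced_module_module E(1,2) ci E(3)])
  have inj: "injective_module R ?E" unfolding injective_module_def
  proof (intro conjI allI impI E(1))
    fix B :: "('r, 'u) module" and A f assume *: "module R B \<and> submodule A R B \<and> f \<in> mod_hom R (B\<lparr>carrier := A\<rparr>) ?E"
    then have B: "module R B" "submodule A R B" and f: "f \<in> mod_hom R (B\<lparr>carrier := A\<rparr>) ?E" by auto
    obtain g where g: "g \<in> mod_hom R B (coinduced_module R K)" "\<And>x. x \<in> A \<Longrightarrow> g x = inv_into (carrier (coinduced_module R K)) c (f x)"
      using coinduced_module_injective[OF B mod_hom_comp[OF f ic]] by blast
    have "c (g x) = f x" if "x \<in> A" for x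
      using g(2)[OF that] mod_homD(1)[OF f, of x] that unfolding E(3)[symmetric] by (simp add: f_inv_into_f)
    then show "\<exists>g\<in>mod_hom R B ?E. \<forall>x\<in>A. g x = f x" using mod_hom_comp[OF g(1) E(2)] by (intro bexI[of _ "\<lambda>x. c (g x)"]) auto
  qed
  let ?h = "\<lambda>b r. if r \<in> carrier R then coset_rep K (\<delta> (r \<odot>\<^bsub>X\<^esub> b)) else 0"
  define e where "e b = c (?h b)" for b
  have e: "e \<in> mod_hom R X ?E" unfolding e_def[abs_def] by (rule mod_hom_comp[OF coinduced_module_hom[OF assms(2) \<delta>(1)] E(2)])
  have ei: "inj_on e (carrier X)"
  proof (rule inj_onI)
    fix x y assume xy: "x \<in> carrier X" "y \<in> carrier X" "e x = e y"
    then have "?h x = ?h y" using c unfolding e_def by (auto dest: injD)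
    \<comment> \<open>Evaluation at one recovers \<open>\<delta> x\<close> modulo \<open>K\<close>,
      which determines \<open>x\<close>.\<close>
    from fun_cong[OF this, of "\<one>\<^bsub>R\<^esub>"] have "coset_rep K (\<delta> x) = coset_rep K (\<delta> y)" using xy by simp
    then have d: "\<delta> x - \<delta> y \<in> K" using coset_rep(2)[OF K] by blast
    have "\<delta> (x \<ominus>\<^bsub>X\<^esub> y \<oplus>\<^bsub>X\<^esub> y) - \<delta> (x \<ominus>\<^bsub>X\<^esub> y) - \<delta> y \<in> K" using \<delta>(1) xy by simp
    moreover have "x \<ominus>\<^bsub>X\<^esub> y \<oplus>\<^bsub>X\<^esub> y = x" using xy by (simp add: a_minus_def X.M.a_assoc X.M.l_neg)
    ultimately have "\<delta> x - \<delta> (x \<ominus>\<^bsub>X\<^esub> y) - \<delta> y \<in> K" by simp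
    from additive_setD(2)[OF K d this] have "\<delta> (x \<ominus>\<^bsub>X\<^esub> y) \<in> K" by simp
    then have "x \<ominus>\<^bsub>X\<^esub> y = \<zero>\<^bsub>X\<^esub>" using \<delta>(2) xy by simp
    then show "x = y" using X.diff_eq_zero_iff xy by simp
  qed
  let ?I = "e ` carrier X"
  note eD = mod_homD[OF e]
  have I: "submodule ?I R ?E"
  proof (rule E.submoduleI)
    show "?I \<subseteq> carrier ?E" using eD by auto
    show "\<zero>\<^bsub>?E\<^esub> \<in> ?I" using mod_hom_zero[OF assms(2) E(1) e] by (metis X.M.zero_closed imageI)
    show "\<ominus>\<^bsub>?E\<^esub> a \<in> ?I" if "a \<in> ?I" for a using that mod_hom_minus[OF assms(2) E(1) e] by (auto simp flip: mod_hom_minus[OF assms(2) E(1) e])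
    show "a \<oplus>\<^bsub>?E\<^esub> b \<in> ?I" if "a \<in> ?I" "b \<in> ?I" for a b using that by (auto simp flip: eD(2))
    show "a \<odot>\<^bsub>?E\<^esub> x \<in> ?I" if "a \<in> carrier R" "x \<in> ?I" for a x using that by (auto simp flip: eD(3))
  qed
  note IE = E.submoduleE[OF I]
  \<comment> \<open>The chosen representative depends only on the coset, because the predicate under
    \<open>SOME\<close> is the same for congruent elements.\<close>
  define h where "h x = (SOME y. y \<in> carrier ?E \<and> x \<ominus>\<^bsub>?E\<^esub> y \<in> ?I)" for x
  have zI: "\<zero>\<^bsub>?E\<^esub> \<in> ?I" using mod_hom_zero[OF assms(2) E(1) e] by (metis X.M.zero_closed imageI)
  have h1: "h x \<in> carrier ?E \<and> x \<ominus>\<^bsub>?E\<^esub> h x \<in> ?I" if "x \<in> carrier ?E" for x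
    unfolding h_def by (rule someI[of _ x]) (use that zI in simp)
  have tri: "a \<ominus>\<^bsub>?E\<^esub> b = (a \<ominus>\<^bsub>?E\<^esub> d) \<oplus>\<^bsub>?E\<^esub> (d \<ominus>\<^bsub>?E\<^esub> b)" if "a \<in> carrier ?E" "b \<in> carrier ?E" "d \<in> carrier ?E" for a b d
  proof -
    have "(a \<ominus>\<^bsub>?E\<^esub> d) \<oplus>\<^bsub>?E\<^esub> (d \<ominus>\<^bsub>?E\<^esub> b) = a \<oplus>\<^bsub>?E\<^esub> (\<ominus>\<^bsub>?E\<^esub> d \<oplus>\<^bsub>?E\<^esub> d) \<oplus>\<^bsub>?E\<^esub> \<ominus>\<^bsub>?E\<^esub> b"
      using that by (simp only: a_minus_def E.M.a_assoc E.M.a_closed E.M.a_inv_closed)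
    then show ?thesis using that by (simp add: E.M.l_neg a_minus_def)
  qed
  have neg: "b \<ominus>\<^bsub>?E\<^esub> a \<in> ?I" if "a \<in> carrier ?E" "b \<in> carrier ?E" "a \<ominus>\<^bsub>?E\<^esub> b \<in> ?I" for a b
  proof -
    have "b \<ominus>\<^bsub>?E\<^esub> a = \<ominus>\<^bsub>?E\<^esub> (a \<ominus>\<^bsub>?E\<^esub> b)" using that by (simp add: a_minus_def E.M.minus_add E.M.a_comm)
    then show ?thesis using IE(3)[OF that(3)] by simp
  qed
  have h: "h x = h y \<longleftrightarrow> x \<ominus>\<^bsub>?E\<^esub> y \<in> ?I" if xy: "x \<in> carrier ?E" "y \<in> carrier ?E" for x y
  proof
    assume "h x = h y"
    then show "x \<ominus>\<^bsub>?E\<^esub> y \<in> ?I" using h1[OF xy(1)] h1[OF xy(2)] tri[OF xy, of "h x"] neg[OF xy(2), of "h y"] IE(5) by simp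
  next
    assume d: "x \<ominus>\<^bsub>?E\<^esub> y \<in> ?I"
    have "x \<ominus>\<^bsub>?E\<^esub> z \<in> ?I \<longleftrightarrow> y \<ominus>\<^bsub>?E\<^esub> z \<in> ?I" if z: "z \<in> carrier ?E" for z
      using tri[OF xy(1) z xy(2)] tri[OF xy(2) z xy(1)] neg[OF xy d] d IE(5) by metis
    then have "(\<lambda>z. z \<in> carrier ?E \<and> x \<ominus>\<^bsub>?E\<^esub> z \<in> ?I) = (\<lambda>z. z \<in> carrier ?E \<and> y \<ominus>\<^bsub>?E\<^esub> z \<in> ?I)" by (intro ext conj_cong refl)
    then show "h x = h y" unfolding h_def by (rule arg_cong)
  qed
  note C = push_module[OF E(1) I h]
  show ?thesis
    by (rule exI[of _ ?E], rule exI[of _ e], rule exI[of _ "push_module ?E h"], rule exI[of _ h])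
      (intro conjI inj e ei C(1,2,3) C(4)[symmetric])
qed

text \<open>The factor \<open>nat\<close> makes the value type infinite. First every finitely
  supported function on the universe is coded by an element of the universe, then a function from
  the ring type into the universe is collapsed to one element.\<close>

lemma universe_code:
  "\<exists>c :: ('r \<Rightarrow> (('r \<Rightarrow> nat \<times> 'm) \<Rightarrow>\<^sub>0 rat)) \<Rightarrow> ('r \<Rightarrow> nat \<times> 'm). inj c"
proof -
  have k: "infinite (UNIV :: (nat \<times> 'm) set)"
    using finite_prod[where 'a=nat and 'b='m] by (simp add: UNIV_Times_UNIV[symmetric] finite_cartesian_product_iff del: UNIV_Times_UNIV)
  have "inj (\<lambda>k (_ :: 'r). k :: nat \<times> 'm)" by (auto simp: inj_def fun_eq_iff)
  then have u: "infinite (UNIV :: ('r \<Rightarrow> nat \<times> 'm) set)" using k by (metis finite_subset finite_imageD subset_UNIV)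
  obtain a :: "(('r \<Rightarrow> nat \<times> 'm) \<Rightarrow>\<^sub>0 rat) \<Rightarrow> ('r \<Rightarrow> nat \<times> 'm)" where a: "inj a" using inj_poly_mapping_rat[OF u] by blast
  obtain b :: "('r \<Rightarrow> ('r \<Rightarrow> nat \<times> 'm)) \<Rightarrow> ('r \<Rightarrow> nat \<times> 'm)" where b: "inj b" using inj_fun_fun[OF k] by blast
  have "inj (\<lambda>\<phi>. b (\<lambda>r. a (\<phi> r)))"
  proof (rule injI)
    fix \<phi> \<psi> assume "b (\<lambda>r. a (\<phi> r)) = b (\<lambda>r. a (\<psi> r))"
    then have "(\<lambda>r. a (\<phi> r)) = (\<lambda>r. a (\<psi> r))" by (rule injD[OF b])
    then have "a (\<phi> r) = a (\<psi> r)" for r by (rule fun_cong)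
    then have "\<phi> r = \<psi> r" for r by (rule injD[OF a])
    then show "\<phi> = \<psi>" by (rule ext)
  qed
  then show ?thesis by blast
qed

text \<open>The modules \<open>X i\<close> are the successive cokernels: \<open>X i\<close> embeds
  in \<open>I i\<close> with cokernel \<open>X (Suc i)\<close>, and \<open>d i\<close> is the
  projection onto \<open>X (Suc i)\<close> followed by its embedding. The start \<open>X 0\<close>
  is a copy of \<open>M\<close> in the universe.\<close>

lemma injective_resolution_exists:
  fixes M :: "('r, 'm, 'y) module_scheme"
  assumes "cring R" "module R M"
  shows "\<exists>(I :: nat \<Rightarrow> ('r, ('r, 'm) resolution_univ) module) e d. injective_resolution R M I e d"
proof -
  obtain c :: "('r \<Rightarrow> (('r \<Rightarrow> nat \<times> 'm) \<Rightarrow>\<^sub>0 rat)) \<Rightarrow> ('r \<Rightarrow> nat \<times> 'm)" where c: "inj c" using universe_code by blast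
  define P where "P X E e C q \<longleftrightarrow> injective_module R E \<and> e \<in> mod_hom R X E \<and> inj_on e (carrier X) \<and>
    module R C \<and> q \<in> mod_hom R E C \<and> q ` carrier E = carrier C \<and> e ` carrier X = {x \<in> carrier E. q x = \<zero>\<^bsub>C\<^esub>}"
    for X E C :: "('r, 'r \<Rightarrow> nat \<times> 'm) module" and e q
  have "\<forall>X. \<exists>E e C q. module R X \<longrightarrow> P X E e C q"
    using injective_embedding[OF assms(1) _ c] unfolding P_def[symmetric] by blast
  then obtain EE ee CC qq where "\<And>X. module R X \<Longrightarrow> P X (EE X) (ee X) (CC X) (qq X)" by metis
  note step = this[unfolded P_def]
  let ?k = "\<lambda>x (_ :: 'r). (0 :: nat, x :: 'm)"
  have ki: "inj_on ?k (carrier M)" by (auto simp: inj_on_def fun_eq_iff)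
  let ?X0 = "push_module M ?k"
  note X0 = push_module_inj[OF assms(2) ki]
  define X where "X i = (CC ^^ i) ?X0" for i
  have X: "module R (X i)" for i by (induction i) (use X0(1) step in \<open>auto simp: X_def\<close>)
  have XS: "X (Suc i) = CC (X i)" for i by (simp add: X_def)
  have X00: "X 0 = ?X0" by (simp add: X_def)
  note s = step[OF X]
  define I where "I i = EE (X i)" for i
  define e where "e x = ee ?X0 (?k x)" for x
  define d where "d i x = ee (X (Suc i)) (qq (X i) x)" for i x
  have Im: "module R (I i)" for i using s[of i] by (simp add: I_def injective_module_def)
  have q: "qq (X i) \<in> mod_hom R (I i) (X (Suc i))" "qq (X i) ` carrier (I i) = carrier (X (Suc i))" for i using s[of i] by (auto simp: I_def XS)
  have ex: "ee (X i) \<in> mod_hom R (X i) (I i)" "inj_on (ee (X i)) (carrier (X i))"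
    "ee (X i) ` carrier (X i) = {x \<in> carrier (I i). qq (X i) x = \<zero>\<^bsub>X (Suc i)\<^esub>}" for i using s[of i] by (auto simp: I_def XS)
  have dz: "d i x = \<zero>\<^bsub>I (Suc i)\<^esub> \<longleftrightarrow> qq (X i) x = \<zero>\<^bsub>X (Suc i)\<^esub>" if "x \<in> carrier (I i)" for i x
  proof -
    interpret XX: module R "X (Suc i)" by (rule X)
    have z: "ee (X (Suc i)) \<zero>\<^bsub>X (Suc i)\<^esub> = \<zero>\<^bsub>I (Suc i)\<^esub>" by (rule mod_hom_zero[OF X Im ex(1)])
    show ?thesis
    proof
      assume "d i x = \<zero>\<^bsub>I (Suc i)\<^esub>"
      then have "ee (X (Suc i)) (qq (X i) x) = ee (X (Suc i)) \<zero>\<^bsub>X (Suc i)\<^esub>" unfolding d_def z .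
      then show "qq (X i) x = \<zero>\<^bsub>X (Suc i)\<^esub>"
        by (rule inj_onD[OF ex(2)]) (use mod_homD(1)[OF q(1) that] in auto)
    qed (simp add: d_def z)
  qed
  have ker: "{x \<in> carrier (I i). d i x = \<zero>\<^bsub>I (Suc i)\<^esub>} = ee (X i) ` carrier (X i)" for i
    unfolding ex(3) using dz by blast
  have "injective_resolution R M I e d" unfolding injective_resolution_def
  proof (intro conjI allI)
    show "injective_module R (I i)" for i using s[of i] by (simp add: I_def)
    show "e \<in> mod_hom R M (I 0)" unfolding e_def[abs_def] using mod_hom_comp[OF X0(2)] ex(1)[of 0] unfolding X00 by blast
    show "d i \<in> mod_hom R (I i) (I (Suc i))" for i unfolding d_def[abs_def] by (rule mod_hom_comp[OF q(1) ex(1)])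
    show "inj_on e (carrier M)"
    proof (rule inj_onI)
      fix x y assume xy: "x \<in> carrier M" "y \<in> carrier M" "e x = e y"
      have "?k x = ?k y"
        by (rule inj_onD[OF ex(2)[of 0, unfolded X00]]) (use xy X0(3) in \<open>auto simp: e_def\<close>)
      then show "x = y" by (auto simp: fun_eq_iff)
    qed
    have "e ` carrier M = ee (X 0) ` carrier (X 0)" unfolding X00 X0(3)[symmetric] by (auto simp: e_def)
    then show "e ` carrier M = {x \<in> carrier (I 0). d 0 x = \<zero>\<^bsub>I 1\<^esub>}" using ker[of 0] by simp
    show "d i ` carrier (I i) = {x \<in> carrier (I (Suc i)). d (Suc i) x = \<zero>\<^bsub>I (Suc (Suc i))\<^esub>}" for i
      unfolding ker q(2)[symmetric] by (auto simp: d_def)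
  qed
  then show ?thesis by blast
qed

text \<open>Degree 0 cocycles are torsion elements, there are no coboundaries, and transitions are
  the identity at the list without \<open>True\<close>. So lifting of classes amounts to lifting of
  torsion elements.\<close>

lemma cocycle_lift_0:
  assumes "short_exact R A B C i g" and ys: "set ys \<subseteq> carrier R"
  shows "cocycle_lift R ys B C g 0 \<longleftrightarrow> module.power_torsion R C (set ys) \<subseteq> g ` module.power_torsion R B (set ys)"
proof -
  interpret short_exact R A B C i g by fact
  note pws = A.R.powers_closed[OF ys]
  let ?t = "length ys" and ?F = "replicate (length ys) False"
  show ?thesis
  proof
    assume L: "cocycle_lift R ys B C g 0"
    show "C.power_torsion (set ys) \<subseteq> g ` B.power_torsion (set ys)"
    proof
      fix z assume "z \<in> C.power_torsion (set ys)"
      then obtain n where z: "z \<in> carrier C" "\<forall>y\<in>set ys. (y [^]\<^bsub>R\<^esub> (n::nat)) \<odot>\<^bsub>C\<^esub> z = \<zero>\<^bsub>C\<^esub>" by (auto simp: C.power_torsion_def)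
      have co: "cocycle C (powers R n ys) (degree0_cochain C ?t z)"
        using C.cocycle_degree0_cochain[OF pws z(1), of n] z(2) by (auto simp: powers_def)
      obtain m b v where b: "cochain B b" "in_degree B ?t 0 b" "cocycle B (powers R (n + m) ys) b" "cochain C v" "in_pred_degree C ?t 0 v"
        and e: "\<forall>bs. length bs = ?t \<longrightarrow> transition R C ys m (degree0_cochain C ?t z) bs = g (b bs) \<oplus>\<^bsub>C\<^esub> koszul_d C (powers R (n + m) ys) v bs"
        using L[unfolded cocycle_lift_def, rule_format, OF C.cochain_degree0_cochain[OF z(1)] C.in_degree_degree0_cochain co] by (elim exE conjE) (rule that)
      have "koszul_d C (powers R (n + m) ys) v ?F = \<zero>\<^bsub>C\<^esub>" using b(5) by (intro C.koszul_d_zero[OF pws]) (auto simp: in_pred_degree_def)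
      moreover have "transition R C ys m (degree0_cochain C ?t z) ?F = z"
        using C.koszul_prod_replicate_False[of "powers R m ys"] z by (simp add: transition_def degree0_cochain_def)
      ultimately have zb: "z = g (b ?F)" using e gD(1) cochainD[OF b(1)] by simp
      have "cocycle B (powers R (n + m) ys) (degree0_cochain B ?t (b ?F))" unfolding cocycle_def
      proof (intro allI impI)
        fix bs :: "bool list" assume bs: "length bs = length (powers R (n + m) ys)"
        have "koszul_d B (powers R (n + m) ys) (degree0_cochain B ?t (b ?F)) bs = koszul_d B (powers R (n + m) ys) b bs"
          by (rule koszul_d_cong) (use bs B.degree0_degree0_cochain[OF b(2), symmetric] in auto)
        then show "koszul_d B (powers R (n + m) ys) (degree0_cochain B ?t (b ?F)) bs = \<zero>\<^bsub>B\<^esub>" using b(3) bs by (simp add: cocycle_def)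
      qed
      then have "b ?F \<in> B.power_torsion (set ys)"
        using B.cocycle_degree0_cochain[OF pws cochainD[OF b(1)], of "n + m"] cochainD[OF b(1)] by (auto simp: powers_def B.power_torsion_def)
      then show "z \<in> g ` B.power_torsion (set ys)" using zb by blast
    qed
  next
    assume T: "C.power_torsion (set ys) \<subseteq> g ` B.power_torsion (set ys)"
    show "cocycle_lift R ys B C g 0" unfolding cocycle_lift_def
    proof (intro allI impI)
      fix n c assume c: "cochain C c" "in_degree C ?t 0 c" "cocycle C (powers R n ys) c"
      let ?z = "c ?F"
      have zc: "?z \<in> carrier C" using c(1) by (rule cochainD)
      have "cocycle C (powers R n ys) (degree0_cochain C ?t ?z)" unfolding cocycle_def
      proof (intro allI impI)
        fix bs :: "bool list" assume bs: "length bs = length (powers R n ys)"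
        have "koszul_d C (powers R n ys) (degree0_cochain C ?t ?z) bs = koszul_d C (powers R n ys) c bs"
          by (rule koszul_d_cong) (use bs C.degree0_degree0_cochain[OF c(2), symmetric] in auto)
        then show "koszul_d C (powers R n ys) (degree0_cochain C ?t ?z) bs = \<zero>\<^bsub>C\<^esub>" using c(3) bs by (simp add: cocycle_def)
      qed
      then have "?z \<in> C.power_torsion (set ys)" using C.cocycle_degree0_cochain[OF pws zc, of n] zc by (auto simp: powers_def C.power_torsion_def)
      then obtain x where x: "x \<in> B.power_torsion (set ys)" "?z = g x" using T by blast
      then obtain m where m: "x \<in> carrier B" "\<forall>y\<in>set ys. (y [^]\<^bsub>R\<^esub> (m::nat)) \<odot>\<^bsub>B\<^esub> x = \<zero>\<^bsub>B\<^esub>" by (auto simp: B.power_torsion_def)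
      have "\<forall>y\<in>set ys. (y [^]\<^bsub>R\<^esub> (n + m)) \<odot>\<^bsub>B\<^esub> x = \<zero>\<^bsub>B\<^esub>"
        using m ys B.pow_kill_mono[OF _ m(1), of _ m "n + m"] by auto
      then have co: "cocycle B (powers R (n + m) ys) (degree0_cochain B ?t x)" using B.cocycle_degree0_cochain[OF pws m(1), of "n + m"] by (auto simp: powers_def)
      have eq: "transition R C ys m c bs = g (degree0_cochain B ?t x bs) \<oplus>\<^bsub>C\<^esub> koszul_d C (powers R (n + m) ys) (\<lambda>_. \<zero>\<^bsub>C\<^esub>) bs" if bs: "length bs = ?t" for bs
      proof -
        have k0: "koszul_d C (powers R (n + m) ys) (\<lambda>_. \<zero>\<^bsub>C\<^esub>) bs = \<zero>\<^bsub>C\<^esub>" using bs by (intro C.koszul_d_zero[OF pws]) auto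
        show ?thesis
        proof (cases "bs = ?F")
          case True
          then show ?thesis using k0 x(2) zc C.koszul_prod_replicate_False[of "powers R m ys"] by (simp add: transition_def degree0_cochain_def)
        next
          case False
          then have "c bs = \<zero>\<^bsub>C\<^esub>" using c(2) bs weight_eq_0[of bs] by (auto simp: in_degree_def)
          then show ?thesis using False k0 g_zero C.transition_zero[OF ys] by (simp add: degree0_cochain_def)
        qed
      qed
      show "\<exists>m b v. cochain B b \<and> in_degree B ?t 0 b \<and> cocycle B (powers R (n + m) ys) b \<and> cochain C v \<and> in_pred_degree C ?t 0 v \<and>
        (\<forall>bs. length bs = ?t \<longrightarrow> transition R C ys m c bs = g (b bs) \<oplus>\<^bsub>C\<^esub> koszul_d C (powers R (n + m) ys) v bs)"
        by (rule exI[of _ m], rule exI[of _ "degree0_cochain B ?t x"], rule exI[of _ "\<lambda>_. \<zero>\<^bsub>C\<^esub>"])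
          (use B.cochain_degree0_cochain[OF m(1)] B.in_degree_degree0_cochain co eq in \<open>auto simp: in_pred_degree_def\<close>)
    qed
  qed
qed

section \<open>Local cohomology and Koszul cohomology\<close>

lemma zero_quotient_iff:
  fixes M :: "('a, 'b, 'c) module_scheme"
  assumes "module R M" "submodule Z R M" "submodule B R M" "B \<subseteq> Z"
  shows "zero_module (quotient_module (M\<lparr>carrier := Z\<rparr>) B) \<longleftrightarrow> Z \<subseteq> B"
proof -
  interpret M: module R M by fact
  note Z = M.submoduleE[OF assms(2)] and B = M.submoduleE[OF assms(3)]
  have cos: "B +>\<^bsub>M\<lparr>carrier := Z\<rparr>\<^esub> a = {b \<oplus>\<^bsub>M\<^esub> a | b. b \<in> B}" for a
    by (auto simp: a_r_coset_def r_coset_def)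
  have z0: "\<zero>\<^bsub>M\<^esub> \<in> B" using submodule.axioms(1)[OF assms(3)] subgroup.one_closed by fastforce
  have "zero_module (quotient_module (M\<lparr>carrier := Z\<rparr>) B) \<longleftrightarrow> a_rcosets\<^bsub>M\<lparr>carrier := Z\<rparr>\<^esub> B = {B}"
    by (simp add: zero_module_def quotient_module_def)
  also have "\<dots> \<longleftrightarrow> (\<forall>a\<in>Z. {b \<oplus>\<^bsub>M\<^esub> a | b. b \<in> B} = B)"
  proof -
    have "a_rcosets\<^bsub>M\<lparr>carrier := Z\<rparr>\<^esub> B = (\<lambda>a. {b \<oplus>\<^bsub>M\<^esub> a | b. b \<in> B}) ` Z"
      using cos by (auto simp: A_RCOSETS_def RCOSETS_def a_r_coset_def)
    moreover have "f ` Z = {B} \<longleftrightarrow> (\<forall>a\<in>Z. f a = B)" for f :: "'b \<Rightarrow> 'b set" using Z(2) by blast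
    ultimately show ?thesis by simp
  qed
  also have "\<dots> \<longleftrightarrow> Z \<subseteq> B"
  proof
    assume h: "\<forall>a\<in>Z. {b \<oplus>\<^bsub>M\<^esub> a | b. b \<in> B} = B"
    show "Z \<subseteq> B"
    proof
      fix a assume a: "a \<in> Z"
      then have "\<zero>\<^bsub>M\<^esub> \<oplus>\<^bsub>M\<^esub> a = a" using Z(1) by (intro M.M.l_zero) (rule subsetD)
      then have "a \<in> {b \<oplus>\<^bsub>M\<^esub> a | b. b \<in> B}" using z0 by (metis (mono_tags, lifting) mem_Collect_eq)
      then show "a \<in> B" using h a by blast
    qed
  next
    assume h: "Z \<subseteq> B"
    show "\<forall>a\<in>Z. {b \<oplus>\<^bsub>M\<^esub> a | b. b \<in> B} = B"
    proof (intro ballI subset_antisym subsetI)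
      fix a x assume a: "a \<in> Z"
      show "x \<in> B" if "x \<in> {b \<oplus>\<^bsub>M\<^esub> a | b. b \<in> B}" using that B(5) h a by auto
      assume x: "x \<in> B"
      have c: "x \<in> carrier M" "a \<in> carrier M" using a x Z(1) B(1) by auto
      then have "x = (x \<ominus>\<^bsub>M\<^esub> a) \<oplus>\<^bsub>M\<^esub> a" by (simp add: a_minus_def M.M.a_assoc M.M.l_neg)
      moreover have "x \<ominus>\<^bsub>M\<^esub> a \<in> B" unfolding a_minus_def by (intro B(5) B(3) x subsetD[OF h a])
      ultimately show "x \<in> {b \<oplus>\<^bsub>M\<^esub> a | b. b \<in> B}" by (intro CollectI exI[of _ "x \<ominus>\<^bsub>M\<^esub> a"] conjI)
    qed
  qed
  finally show ?thesis .
qed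

lemma kernel_submodule:
  assumes "module R M" "module R N" "f \<in> mod_hom R M N" "submodule H R M"
  shows "submodule {x \<in> H. f x = \<zero>\<^bsub>N\<^esub>} R M" "submodule (f ` H) R N"
proof -
  interpret M: module R M by fact
  interpret N: module R N by fact
  note H = M.submoduleE[OF assms(4)] and f = mod_homD[OF assms(3)]
  have Hc: "x \<in> carrier M" if "x \<in> H" for x using H(1) that by auto
  have z0: "\<zero>\<^bsub>M\<^esub> \<in> H" using submodule.axioms(1)[OF assms(4)] subgroup.one_closed by fastforce
  note m = mod_hom_minus[OF assms(1-3)] and z = mod_hom_zero[OF assms(1-3)]
  show "submodule {x \<in> H. f x = \<zero>\<^bsub>N\<^esub>} R M"
    by (rule M.submoduleI) (use H z0 f m z Hc in auto)
  show "submodule (f ` H) R N"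
  proof (rule N.submoduleI)
    show "f ` H \<subseteq> carrier N" using H(1) f(1) by auto
    show "\<zero>\<^bsub>N\<^esub> \<in> f ` H" using z0 z by (metis imageI)
    show "\<ominus>\<^bsub>N\<^esub> a \<in> f ` H" if "a \<in> f ` H" for a using that m[symmetric] Hc H(3) by auto
    show "a \<oplus>\<^bsub>N\<^esub> b \<in> f ` H" if "a \<in> f ` H" "b \<in> f ` H" for a b using that f(2)[symmetric] Hc H(5) by auto
    show "a \<odot>\<^bsub>N\<^esub> x \<in> f ` H" if "a \<in> carrier R" "x \<in> f ` H" for a x using that f(3)[symmetric] Hc H(4) by auto
  qed
qed

section \<open>Dimension shifting along an injective resolution\<close>

context
  fixes R :: "('r, 'x) ring_scheme" (structure) and M :: "('r, 'm, 'y) module_scheme"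
    and I :: "nat \<Rightarrow> ('r, 'u) module" and e d ys
  assumes cr: "cring R" and noeth: "noetherian_ring R" and Mm: "module R M" and res: "injective_resolution R M I e d"
    and ys: "set ys \<subseteq> carrier R" and ei: "\<exists>\<epsilon> :: 'r \<Rightarrow> 'u. inj \<epsilon>"
begin

text \<open>The syzygies of the resolution; \<open>cocycles 0\<close> is the copy of
  \<open>M\<close> inside \<open>I 0\<close>.\<close>

abbreviation "cocycles k \<equiv> (I k)\<lparr>carrier := {x \<in> carrier (I k). d k x = \<zero>\<^bsub>I (Suc k)\<^esub>}\<rparr>"

lemma resolutionD: "injective_module R (I k)" "e \<in> mod_hom R M (I 0)" "d k \<in> mod_hom R (I k) (I (Suc k))" "inj_on e (carrier M)"
  "e ` carrier M = {x \<in> carrier (I 0). d 0 x = \<zero>\<^bsub>I 1\<^esub>}"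
  "d k ` carrier (I k) = {x \<in> carrier (I (Suc k)). d (Suc k) x = \<zero>\<^bsub>I (Suc (Suc k))\<^esub>}"
  using res unfolding injective_resolution_def by blast+

lemma resolution_module: "module R (I k)" using resolutionD(1) by (simp add: injective_module_def)

lemma koszul_vanishes_resolution: "0 < p \<Longrightarrow> koszul_vanishes R ys (I k) p"
  using module.baer_koszul_vanishes[OF resolution_module noeth _ ys] injective_imp_baer[OF cr resolutionD(1)] ei by blast

lemma cocycles_submodule: "submodule {x \<in> carrier (I k). d k x = \<zero>\<^bsub>I (Suc k)\<^esub>} R (I k)"
  using kernel_submodule(1)[OF resolution_module resolution_module resolutionD(3) module.carrier_is_submodule[OF resolution_module]] by simp

lemma cocycles_module: "module R (cocycles k)" by (rule submodule.submodule_is_module[OF cocycles_submodule resolution_module])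

lemma d_cocycles: "d k \<in> mod_hom R (I k) (cocycles (Suc k))"
  using resolutionD(3)[of k] resolutionD(6)[of k] by (auto simp: mod_hom_def)

lemma short_exact_augmentation: "short_exact R M (I 0) (cocycles 1) e (d 0)"
proof (intro short_exact.intro short_exact_axioms.intro Mm resolution_module cocycles_module resolutionD)
  show "d 0 \<in> mod_hom R (I 0) (cocycles 1)" using d_cocycles[of 0] by simp
  show "d 0 ` carrier (I 0) = carrier (cocycles 1)" using resolutionD(6)[of 0] by simp
  show "e ` carrier M = {b \<in> carrier (I 0). d 0 b = \<zero>\<^bsub>cocycles 1\<^esub>}" using resolutionD(5) by simp
qed

lemma short_exact_step: "short_exact R (cocycles k) (I k) (cocycles (Suc k)) (\<lambda>x. x) (d k)"
proof (intro short_exact.intro short_exact_axioms.intro resolution_module cocycles_module)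
  show "(\<lambda>x. x) \<in> mod_hom R (cocycles k) (I k)" by (auto simp: mod_hom_def)
  show "d k ` carrier (I k) = carrier (cocycles (Suc k))" using resolutionD(6)[of k] by simp
qed (use d_cocycles in auto)

text \<open>Injective modules have no Koszul cohomology in positive degrees, so each exact sequence
  of syzygies lowers the degree by one. The last step ends at \<open>cocycle_lift\<close> in degree
  0 instead of a vanishing statement, because an injective module may have torsion.\<close>

lemma dimension_shift_cocycles: "koszul_vanishes R ys (cocycles k) (Suc j) \<longleftrightarrow> cocycle_lift R ys (I (k + j)) (cocycles (Suc (k + j))) (d (k + j)) 0"
proof (induction j arbitrary: k)
  case 0
  show ?case using short_exact.koszul_vanishes_imp_cocycle_lift[OF short_exact_step ys] short_exact.cocycle_lift_imp_koszul_vanishes[OF short_exact_step ys _ koszul_vanishes_resolution] by auto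
next
  case (Suc j)
  have "koszul_vanishes R ys (cocycles k) (Suc (Suc j)) \<longleftrightarrow> cocycle_lift R ys (I k) (cocycles (Suc k)) (d k) (Suc j)"
    using short_exact.koszul_vanishes_imp_cocycle_lift[OF short_exact_step ys] short_exact.cocycle_lift_imp_koszul_vanishes[OF short_exact_step ys _ koszul_vanishes_resolution] by auto
  also have "\<dots> \<longleftrightarrow> koszul_vanishes R ys (cocycles (Suc k)) (Suc j)"
    using short_exact.koszul_vanishes_imp_cocycle_lift_C[OF short_exact_step ys] short_exact.cocycle_lift_imp_koszul_vanishes_C[OF short_exact_step ys _ koszul_vanishes_resolution] by auto
  finally show ?case using Suc[of "Suc k"] by simp
qed

lemma dimension_shift: "koszul_vanishes R ys M (Suc j) \<longleftrightarrow> cocycle_lift R ys (I j) (cocycles (Suc j)) (d j) 0"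
proof (cases j)
  case 0
  have "koszul_vanishes R ys M (Suc 0) \<longleftrightarrow> cocycle_lift R ys (I 0) (cocycles 1) (d 0) 0"
    using short_exact.koszul_vanishes_imp_cocycle_lift[OF short_exact_augmentation ys] short_exact.cocycle_lift_imp_koszul_vanishes[OF short_exact_augmentation ys _ koszul_vanishes_resolution] by auto
  then show ?thesis using 0 by simp
next
  case (Suc i)
  have "koszul_vanishes R ys M (Suc (Suc i)) \<longleftrightarrow> cocycle_lift R ys (I 0) (cocycles 1) (d 0) (Suc i)"
    using short_exact.koszul_vanishes_imp_cocycle_lift[OF short_exact_augmentation ys] short_exact.cocycle_lift_imp_koszul_vanishes[OF short_exact_augmentation ys _ koszul_vanishes_resolution] by auto
  also have "\<dots> \<longleftrightarrow> koszul_vanishes R ys (cocycles 1) (Suc i)"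
    using short_exact.koszul_vanishes_imp_cocycle_lift_C[OF short_exact_augmentation ys] short_exact.cocycle_lift_imp_koszul_vanishes_C[OF short_exact_augmentation ys _ koszul_vanishes_resolution] by auto
  finally show ?thesis using dimension_shift_cocycles[of 1 i] Suc by simp
qed

lemma power_torsion_cocycles: "module.power_torsion R (cocycles k) Y = {x \<in> module.power_torsion R (I k) Y. d k x = \<zero>\<^bsub>I (Suc k)\<^esub>}"
  by (auto simp: module.power_torsion_def[OF resolution_module] module.power_torsion_def[OF cocycles_module])

text \<open>In degree 0 the kernel of \<open>d 0\<close> is the image of \<open>M\<close>, and its
  torsion is that of \<open>M\<close>. In degree \<open>j + 1\<close> the quotient is zero when
  every torsion element of \<open>cocycles (Suc j)\<close> is the image of a torsion element of
  \<open>I j\<close>; by \<open>cocycle_lift_0\<close> this is the condition at which dimension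
  shifting ends.\<close>

lemma resolution_cohomology_zero_iff:
  "zero_module (quotient_module ((I i)\<lparr>carrier := {x \<in> torsion_part R (Idl (set ys)) (I i). d i x = \<zero>\<^bsub>I (Suc i)\<^esub>}\<rparr>)
      (if i = 0 then {\<zero>\<^bsub>I 0\<^esub>} else d (i - 1) ` torsion_part R (Idl (set ys)) (I (i - 1)))) \<longleftrightarrow> koszul_vanishes R ys M i"
proof -
  have t: "torsion_part R (Idl (set ys)) (I k) = module.power_torsion R (I k) (set ys)" for k
    by (rule module.torsion_part_eq_power_torsion[OF resolution_module ys])
  have ts: "submodule (module.power_torsion R (I k) (set ys)) R (I k)" for k by (rule module.power_torsion_submodule[OF resolution_module ys])
  let ?Z = "{x \<in> module.power_torsion R (I i) (set ys). d i x = \<zero>\<^bsub>I (Suc i)\<^esub>}"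
  have Z: "submodule ?Z R (I i)" by (rule kernel_submodule(1)[OF resolution_module resolution_module resolutionD(3) ts])
  show ?thesis
  proof (cases i)
    case 0
    interpret I0: module R "I 0" by (rule resolution_module)
    interpret M: module R M by (rule Mm)
    note e = mod_homD[OF resolutionD(2)]
    have z: "submodule {\<zero>\<^bsub>I 0\<^esub>} R (I 0)" by (rule I0.zero_submodule)
    have zZ: "{\<zero>\<^bsub>I 0\<^esub>} \<subseteq> ?Z" using Z submodule.axioms(1) subgroup.one_closed 0 by fastforce
    have e0: "e m = \<zero>\<^bsub>I 0\<^esub> \<longleftrightarrow> m = \<zero>\<^bsub>M\<^esub>" if "m \<in> carrier M" for m
      using resolutionD(4) that mod_hom_zero[OF Mm resolution_module resolutionD(2)] inj_onD[OF resolutionD(4), of m "\<zero>\<^bsub>M\<^esub>"] by auto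
    have tm: "e m \<in> I0.power_torsion (set ys) \<longleftrightarrow> m \<in> M.power_torsion (set ys)" if m: "m \<in> carrier M" for m
    proof -
      have "(y [^] (n::nat)) \<odot>\<^bsub>I 0\<^esub> e m = \<zero>\<^bsub>I 0\<^esub> \<longleftrightarrow> (y [^] n) \<odot>\<^bsub>M\<^esub> m = \<zero>\<^bsub>M\<^esub>" if "y \<in> set ys" for y n
        using e0[of "(y [^] n) \<odot>\<^bsub>M\<^esub> m"] e(3)[of "y [^] n" m] that ys m by (auto simp: subsetD)
      then show ?thesis using m e(1) by (auto simp: I0.power_torsion_def M.power_torsion_def)
    qed
    have "?Z = e ` M.power_torsion (set ys)"
    proof -
      have "?Z = {x \<in> e ` carrier M. x \<in> I0.power_torsion (set ys)}" unfolding resolutionD(5) using 0 by (auto simp: I0.power_torsion_def)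
      also have "\<dots> = e ` M.power_torsion (set ys)" using tm by (auto simp: M.power_torsion_def)
      finally show ?thesis .
    qed
    then have "?Z \<subseteq> {\<zero>\<^bsub>I 0\<^esub>} \<longleftrightarrow> (\<forall>m\<in>M.power_torsion (set ys). e m = \<zero>\<^bsub>I 0\<^esub>)" by auto
    also have "\<dots> \<longleftrightarrow> (\<forall>m\<in>M.power_torsion (set ys). m = \<zero>\<^bsub>M\<^esub>)" by (intro ball_cong refl e0) (simp add: M.power_torsion_def)
    also have "\<dots> \<longleftrightarrow> M.power_torsion (set ys) = {\<zero>\<^bsub>M\<^esub>}"
    proof
      assume "\<forall>m\<in>M.power_torsion (set ys). m = \<zero>\<^bsub>M\<^esub>"
      then have "M.power_torsion (set ys) \<subseteq> {\<zero>\<^bsub>M\<^esub>}" by auto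
      then show "M.power_torsion (set ys) = {\<zero>\<^bsub>M\<^esub>}"
        using M.submoduleE(2)[OF M.power_torsion_submodule[OF ys]] by (simp add: subset_singleton_iff)
    qed simp
    finally show ?thesis using zero_quotient_iff[OF resolution_module Z, of "{\<zero>\<^bsub>I 0\<^esub>}"] z zZ M.koszul_vanishes_0[OF ys] 0 unfolding t by simp
  next
    case (Suc j)
    let ?B = "d j ` module.power_torsion R (I j) (set ys)"
    have B: "submodule ?B R (I (Suc j))" by (rule kernel_submodule(2)[OF resolution_module resolution_module resolutionD(3) ts])
    have "?B \<subseteq> ?Z"
    proof
      fix x assume "x \<in> ?B"
      then obtain u where u: "u \<in> carrier (I j)" "u \<in> module.power_torsion R (I j) (set ys)" "x = d j u" by (auto simp: module.power_torsion_def[OF resolution_module])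
      then obtain n where n: "\<forall>y\<in>set ys. (y [^] (n::nat)) \<odot>\<^bsub>I j\<^esub> u = \<zero>\<^bsub>I j\<^esub>" by (auto simp: module.power_torsion_def[OF resolution_module])
      have x: "x \<in> carrier (I (Suc j))" "d (Suc j) x = \<zero>\<^bsub>I (Suc (Suc j))\<^esub>" using resolutionD(6)[of j] u by auto
      interpret R: cring R by (rule cr)
      have "(y [^] n) \<odot>\<^bsub>I (Suc j)\<^esub> x = \<zero>\<^bsub>I (Suc j)\<^esub>" if "y \<in> set ys" for y
        using mod_homD(3)[OF resolutionD(3), of "y [^] n" u j] n that u ys mod_hom_zero[OF resolution_module resolution_module resolutionD(3), of j] by (auto simp: subsetD)
      then show "x \<in> ?Z" using x Suc by (auto simp: module.power_torsion_def[OF resolution_module])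
    qed
    moreover have "?Z \<subseteq> ?B \<longleftrightarrow> cocycle_lift R ys (I j) (cocycles (Suc j)) (d j) 0"
      using cocycle_lift_0[OF short_exact_step ys] Suc power_torsion_cocycles by simp
    ultimately show ?thesis using zero_quotient_iff[OF resolution_module Z, of ?B] B dimension_shift Suc unfolding t by simp
  qed
qed

end

lemma local_cohomology_zero_iff:
  fixes R :: "('r, 'x) ring_scheme" and M :: "('r, 'm, 'y) module_scheme"
  assumes "cring R" "noetherian_ring R" "module R M" "set ys \<subseteq> carrier R"
  shows "zero_module (local_cohomology R (Idl\<^bsub>R\<^esub> (set ys)) M i) \<longleftrightarrow> koszul_vanishes R ys M i"
proof -
  \<comment> \<open>The equivalence holds for every injective resolution, hence for the one chosen
    in the definition.\<close>
  let ?P = "\<lambda>(I :: nat \<Rightarrow> ('r, ('r, 'm) resolution_univ) module, e, d). injective_resolution R M I e d"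
  obtain I e d where s: "(SOME x. ?P x) = (I, e, d)" by (metis prod_cases3)
  have "\<exists>x. ?P x" using injective_resolution_exists[OF assms(1,3)] by auto
  then have "?P (SOME x. ?P x)" by (rule someI_ex)
  then have res: "injective_resolution R M I e d" unfolding s by simp
  \<comment> \<open>A ring element is coded by its indicator function, so the universe is at least
    as large as the ring, as the passage to Baer's criterion requires.\<close>
  have "inj (\<lambda>(x :: 'r) y. (if y = x then 1 else 0 :: nat, undefined :: 'm))" by (auto simp: inj_def fun_eq_iff split: if_splits)
  then have ei: "\<exists>\<epsilon> :: 'r \<Rightarrow> ('r, 'm) resolution_univ. inj \<epsilon>" by blast
  show ?thesis unfolding local_cohomology_def s Let_def prod.case
    by (rule resolution_cohomology_zero_iff[OF assms(1-3) res assms(4) ei])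
qed

section \<open>Localized quotients\<close>

lemma quotient_module:
  assumes "module R N" "submodule G R N"
  shows "module R (quotient_module N G)" "(\<lambda>x. G +>\<^bsub>N\<^esub> x) \<in> mod_hom R N (quotient_module N G)"
    "(\<lambda>x. G +>\<^bsub>N\<^esub> x) ` carrier N = carrier (quotient_module N G)"
    "x \<in> carrier N \<Longrightarrow> G +>\<^bsub>N\<^esub> x = \<zero>\<^bsub>quotient_module N G\<^esub> \<longleftrightarrow> x \<in> G"
proof -
  interpret N: module R N by fact
  note GE = N.submoduleE[OF assms(2)]
  have G0: "\<zero>\<^bsub>N\<^esub> \<in> G" by (rule N.submodule_zero[OF assms(2)])
  interpret G: abelian_subgroup G N
    by (rule abelian_subgroupI3[OF additive_subgroup.intro[OF submodule.axioms(1)[OF assms(2)]] N.M.abelian_group_axioms])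
  have c: "G +>\<^bsub>N\<^esub> x = {g \<oplus>\<^bsub>N\<^esub> x | g. g \<in> G}" for x by (auto simp: a_r_coset_def r_coset_def)
  have im: "(\<lambda>x. G +>\<^bsub>N\<^esub> x) ` carrier N = carrier (quotient_module N G)"
    by (auto simp: quotient_module_def A_RCOSETS_def RCOSETS_def a_r_coset_def)
  have add: "G +>\<^bsub>N\<^esub> (x \<oplus>\<^bsub>N\<^esub> y) = (G +>\<^bsub>N\<^esub> x) \<oplus>\<^bsub>quotient_module N G\<^esub> (G +>\<^bsub>N\<^esub> y)" if "x \<in> carrier N" "y \<in> carrier N" for x y
    using G.a_rcos_sum[OF that] by (simp add: quotient_module_def)
  have abs: "G +>\<^bsub>N\<^esub> (g \<oplus>\<^bsub>N\<^esub> x) = G +>\<^bsub>N\<^esub> x" if g: "g \<in> G" and x: "x \<in> carrier N" for g x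
  proof -
    have gc: "g \<in> carrier N" using g GE(1) by auto
    have "G +>\<^bsub>N\<^esub> y = G" if y: "y \<in> G" for y
    proof
      show "G +>\<^bsub>N\<^esub> y \<subseteq> G" unfolding c using y GE(5) by blast
      show "G \<subseteq> G +>\<^bsub>N\<^esub> y"
      proof
        fix z assume z: "z \<in> G"
        have "z \<ominus>\<^bsub>N\<^esub> y \<in> G" using N.submodule_diff[OF assms(2) z y] .
        moreover have "z = (z \<ominus>\<^bsub>N\<^esub> y) \<oplus>\<^bsub>N\<^esub> y"
          using z y GE(1) by (simp add: a_minus_def N.M.a_assoc N.M.l_neg subsetD)
        ultimately show "z \<in> G +>\<^bsub>N\<^esub> y" unfolding c by blast
      qed
    qed
    then have "(G +>\<^bsub>N\<^esub> g) <+>\<^bsub>N\<^esub> (G +>\<^bsub>N\<^esub> x) = (G +>\<^bsub>N\<^esub> \<zero>\<^bsub>N\<^esub>) <+>\<^bsub>N\<^esub> (G +>\<^bsub>N\<^esub> x)"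
      using g G0 by simp
    then show ?thesis using G.a_rcos_sum[OF gc x] G.a_rcos_sum[OF N.M.zero_closed x] x by simp
  qed
  \<comment> \<open>After scaling, all members of a coset give the same coset, so the union in the
    definition of the scalar action is a union of equal sets.\<close>
  have sm: "G +>\<^bsub>N\<^esub> (r \<odot>\<^bsub>N\<^esub> x) = r \<odot>\<^bsub>quotient_module N G\<^esub> (G +>\<^bsub>N\<^esub> x)" if r: "r \<in> carrier R" and x: "x \<in> carrier N" for r x
  proof -
    have "G +>\<^bsub>N\<^esub> (r \<odot>\<^bsub>N\<^esub> z) = G +>\<^bsub>N\<^esub> (r \<odot>\<^bsub>N\<^esub> x)" if z: "z \<in> G +>\<^bsub>N\<^esub> x" for z
    proof -
      from z obtain g where g: "g \<in> G" "z = g \<oplus>\<^bsub>N\<^esub> x" unfolding c by blast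
      have "r \<odot>\<^bsub>N\<^esub> z = r \<odot>\<^bsub>N\<^esub> g \<oplus>\<^bsub>N\<^esub> r \<odot>\<^bsub>N\<^esub> x" using g r x GE(1) by (simp add: N.smult_r_distr subsetD)
      then show ?thesis using abs[OF GE(4)[OF r g(1)], of "r \<odot>\<^bsub>N\<^esub> x"] r x by simp
    qed
    moreover have "x \<in> G +>\<^bsub>N\<^esub> x"
    proof -
      have "\<zero>\<^bsub>N\<^esub> \<oplus>\<^bsub>N\<^esub> x = x" using x by simp
      then show ?thesis unfolding c using G0 by (metis (mono_tags, lifting) mem_Collect_eq)
    qed
    ultimately have "(\<Union>z\<in>G +>\<^bsub>N\<^esub> x. G +>\<^bsub>N\<^esub> (r \<odot>\<^bsub>N\<^esub> z)) = G +>\<^bsub>N\<^esub> (r \<odot>\<^bsub>N\<^esub> x)" by blast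
    then show ?thesis by (simp add: quotient_module_def)
  qed
  have zero: "G +>\<^bsub>N\<^esub> \<zero>\<^bsub>N\<^esub> = \<zero>\<^bsub>quotient_module N G\<^esub>"
    using GE(1) by (simp add: quotient_module_def N.M.a_coset_add_zero)
  show "module R (quotient_module N G)" "(\<lambda>x. G +>\<^bsub>N\<^esub> x) \<in> mod_hom R N (quotient_module N G)"
    "(\<lambda>x. G +>\<^bsub>N\<^esub> x) ` carrier N = carrier (quotient_module N G)"
    using module_image[OF assms(1) im add sm zero] im by auto
  show "G +>\<^bsub>N\<^esub> x = \<zero>\<^bsub>quotient_module N G\<^esub> \<longleftrightarrow> x \<in> G" if x: "x \<in> carrier N"
  proof
    assume "G +>\<^bsub>N\<^esub> x = \<zero>\<^bsub>quotient_module N G\<^esub>"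
    then have e: "G +>\<^bsub>N\<^esub> x = G" by (simp add: quotient_module_def)
    have "\<zero>\<^bsub>N\<^esub> \<oplus>\<^bsub>N\<^esub> x \<in> G +>\<^bsub>N\<^esub> x" unfolding c using G0 by blast
    then show "x \<in> G" using e x by simp
  next
    assume "x \<in> G"
    then show "G +>\<^bsub>N\<^esub> x = \<zero>\<^bsub>quotient_module N G\<^esub>" using abs[of x "\<zero>\<^bsub>N\<^esub>"] zero x by simp
  qed
qed

text \<open>Both quotients enter through their projections; \<open>kernel\<close> says that the
  kernel of \<open>\<pi>'\<close> is the localization of that of \<open>\<pi>\<close>. Injectivity
  of the action of \<open>S\<close> does not pass to quotients by itself; here it comes from
  \<open>units\<close>.\<close>

lemma (in module_localization) quotient_localization:
  fixes P P'
  assumes P: "module R P" "\<pi> \<in> mod_hom R N P" "\<pi> ` carrier N = carrier P"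
    and P': "module R' P'" "\<pi>' \<in> mod_hom R' N' P'" "\<pi>' ` carrier N' = carrier P'"
    and kernel: "\<And>x. x \<in> carrier N \<Longrightarrow> \<pi>' (\<iota> x) = \<zero>\<^bsub>P'\<^esub> \<longleftrightarrow> (\<exists>s\<in>S. \<pi> (s \<odot>\<^bsub>N\<^esub> x) = \<zero>\<^bsub>P\<^esub>)"
    and units: "\<And>s. s \<in> S \<Longrightarrow> \<phi> s \<in> Units R'"
  shows "\<exists>\<iota>'. module_localization R P R' P' S \<phi> \<iota>'"
proof -
  interpret P: module R P by fact
  interpret P': module R' P' by fact
  note \<pi> = mod_homD[OF P(2)] and \<pi>' = mod_homD[OF P'(2)]
  define \<sigma> where "\<sigma> p = (SOME x. x \<in> carrier N \<and> \<pi> x = p)" for p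
  have \<sigma>: "\<sigma> p \<in> carrier N" "\<pi> (\<sigma> p) = p" if "p \<in> carrier P" for p
  proof -
    have "\<exists>x. x \<in> carrier N \<and> \<pi> x = p" using that unfolding P(3)[symmetric] by auto
    from someI_ex[OF this] show "\<sigma> p \<in> carrier N" "\<pi> (\<sigma> p) = p" by (auto simp: \<sigma>_def)
  qed
  define \<iota>' where "\<iota>' p = \<pi>' (\<iota> (\<sigma> p))" for p
  have eq: "\<pi>' (\<iota> x) = \<pi>' (\<iota> y)" if xy: "x \<in> carrier N" "y \<in> carrier N" "\<pi> x = \<pi> y" for x y
  proof -
    have d: "x \<ominus>\<^bsub>N\<^esub> y \<in> carrier N" using xy by simp
    have "\<pi> (\<one>\<^bsub>R\<^esub> \<odot>\<^bsub>N\<^esub> (x \<ominus>\<^bsub>N\<^esub> y)) = \<zero>\<^bsub>P\<^esub>"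
      using mod_hom_diff[OF N.module_axioms P(1,2) xy(1,2)] xy \<pi>(1) d by simp
    then have z: "\<pi>' (\<iota> (x \<ominus>\<^bsub>N\<^esub> y)) = \<zero>\<^bsub>P'\<^esub>" using kernel[OF d] S(2) by blast
    have "x = (x \<ominus>\<^bsub>N\<^esub> y) \<oplus>\<^bsub>N\<^esub> y" using xy by (simp add: a_minus_def N.M.a_assoc N.M.l_neg)
    then have "\<pi>' (\<iota> x) = \<pi>' (\<iota> (x \<ominus>\<^bsub>N\<^esub> y)) \<oplus>\<^bsub>P'\<^esub> \<pi>' (\<iota> y)"
      using \<iota>_add[OF d xy(2)] \<pi>'(2)[OF \<iota>_closed[OF d] \<iota>_closed[OF xy(2)]] by simp
    then show ?thesis using z \<pi>'(1)[OF \<iota>_closed[OF xy(2)]] by simp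
  qed
  have \<iota>'\<pi>: "\<iota>' (\<pi> x) = \<pi>' (\<iota> x)" if "x \<in> carrier N" for x
    unfolding \<iota>'_def using \<sigma>[OF \<pi>(1)[OF that]] that by (intro eq) auto
  have ex: "\<exists>x\<in>carrier N. p = \<pi> x" if "p \<in> carrier P" for p using that unfolding P(3)[symmetric] by auto
  have ex': "\<exists>x\<in>carrier N'. p = \<pi>' x" if "p \<in> carrier P'" for p using that unfolding P'(3)[symmetric] by auto
  have "module_localization R P R' P' S \<phi> \<iota>'"
  proof (intro module_localization.intro module_localization_axioms.intro P(1) P'(1) S \<phi>)
    fix p assume p: "p \<in> carrier P"
    obtain x where x: "x \<in> carrier N" "p = \<pi> x" using ex[OF p] by blast
    show "\<iota>' p \<in> carrier P'" using x \<iota>'\<pi> \<pi>'(1) \<iota>_closed by simp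
    show "\<iota>' (r \<odot>\<^bsub>P\<^esub> p) = \<phi> r \<odot>\<^bsub>P'\<^esub> \<iota>' p" if r: "r \<in> carrier R" for r
      using x r \<iota>'\<pi>[of "r \<odot>\<^bsub>N\<^esub> x"] \<iota>'\<pi>[of x] \<pi>(3) \<iota>_smult \<pi>'(3)[OF \<phi>_closed[OF r] \<iota>_closed[OF x(1)]] by simp
    show "\<exists>s\<in>S. s \<odot>\<^bsub>P\<^esub> p = \<zero>\<^bsub>P\<^esub>" if "\<iota>' p = \<zero>\<^bsub>P'\<^esub>"
    proof -
      have "\<pi>' (\<iota> x) = \<zero>\<^bsub>P'\<^esub>" using that x \<iota>'\<pi> by simp
      then obtain s where s: "s \<in> S" "\<pi> (s \<odot>\<^bsub>N\<^esub> x) = \<zero>\<^bsub>P\<^esub>" using kernel[OF x(1)] by blast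
      then have "s \<odot>\<^bsub>P\<^esub> p = \<zero>\<^bsub>P\<^esub>" using \<pi>(3)[of s x] x S(1) by auto
      then show ?thesis using s by blast
    qed
    fix q assume q: "q \<in> carrier P"
    obtain y where y: "y \<in> carrier N" "q = \<pi> y" using ex[OF q] by blast
    show "\<iota>' (p \<oplus>\<^bsub>P\<^esub> q) = \<iota>' p \<oplus>\<^bsub>P'\<^esub> \<iota>' q"
      using x y \<iota>'\<pi>[of "x \<oplus>\<^bsub>N\<^esub> y"] \<iota>'\<pi> \<pi>(2)[of x y] \<iota>_add \<pi>'(2)[OF \<iota>_closed[OF x(1)] \<iota>_closed[OF y(1)]] by simp
  next
    fix p' assume p': "p' \<in> carrier P'"
    obtain x' where x': "x' \<in> carrier N'" "p' = \<pi>' x'" using ex'[OF p'] by blast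
    obtain x s where s: "x \<in> carrier N" "s \<in> S" "\<phi> s \<odot>\<^bsub>N'\<^esub> x' = \<iota> x" using surj[OF x'(1)] by blast
    have sc: "s \<in> carrier R" using s S(1) by auto
    have "\<phi> s \<odot>\<^bsub>P'\<^esub> p' = \<iota>' (\<pi> x)" using \<pi>'(3)[OF \<phi>_closed[OF sc] x'(1)] x' s \<iota>'\<pi> by simp
    then show "\<exists>x\<in>carrier P. \<exists>s\<in>S. \<phi> s \<odot>\<^bsub>P'\<^esub> p' = \<iota>' x" using \<pi>(1)[OF s(1)] s(2) by blast
  next
    fix s x' assume s: "s \<in> S" and x': "x' \<in> carrier P'"
    note u = units[OF s]
    have uc: "\<phi> s \<in> carrier R'" "inv\<^bsub>R'\<^esub> \<phi> s \<in> carrier R'" using u by auto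
    have i: "inv\<^bsub>R'\<^esub> \<phi> s \<odot>\<^bsub>P'\<^esub> (\<phi> s \<odot>\<^bsub>P'\<^esub> x') = x'" "\<phi> s \<odot>\<^bsub>P'\<^esub> (inv\<^bsub>R'\<^esub> \<phi> s \<odot>\<^bsub>P'\<^esub> x') = x'"
      using u uc x' by (simp_all add: P'.smult_assoc1[symmetric])
    show "x' = \<zero>\<^bsub>P'\<^esub>" if "\<phi> s \<odot>\<^bsub>P'\<^esub> x' = \<zero>\<^bsub>P'\<^esub>" using i(1) that uc by simp
    show "\<exists>x''\<in>carrier P'. \<phi> s \<odot>\<^bsub>P'\<^esub> x'' = x'" using i(2) uc x' by blast
  qed
  then show ?thesis by blast
qed

text \<open>Generation is defined by intersecting submodules. If \<open>H\<close> contains the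
  images of the generators, its preimage in \<open>N\<close> is everything, so \<open>H\<close>
  contains all numerators and, as \<open>S\<close> acts by units, all of \<open>N'\<close>.\<close>

lemma (in module_localization) finitely_generated_localization:
  assumes "finitely_generated R N" and units: "\<And>s. s \<in> S \<Longrightarrow> \<phi> s \<in> Units R'"
  shows "finitely_generated R' N'"
proof -
  obtain A where A: "finite A" "A \<subseteq> carrier N" "\<Inter>{H. submodule H R N \<and> A \<subseteq> H} = carrier N"
    using assms(1) by (auto simp: finitely_generated_def)
  have "carrier N' \<subseteq> H" if H: "submodule H R' N'" "\<iota> ` A \<subseteq> H" for H
  proof
    note HE = N'.submoduleE[OF H(1)]
    let ?G = "{x \<in> carrier N. \<iota> x \<in> H}"
    have "submodule ?G R N"
      by (rule N.submoduleI') (use HE N'.submodule_zero[OF H(1)] \<iota>_add \<iota>_smult \<iota>_zero \<phi>_closed in auto)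
    moreover have "A \<subseteq> ?G" using A(2) H(2) by auto
    ultimately have G: "carrier N \<subseteq> ?G" using A(3) by blast
    fix x' assume x': "x' \<in> carrier N'"
    obtain x s where s: "x \<in> carrier N" "s \<in> S" "\<phi> s \<odot>\<^bsub>N'\<^esub> x' = \<iota> x" using surj[OF x'] by blast
    note u = units[OF s(2)]
    have uc: "\<phi> s \<in> carrier R'" "inv\<^bsub>R'\<^esub> \<phi> s \<in> carrier R'" using u by auto
    have "\<phi> s \<odot>\<^bsub>N'\<^esub> x' \<in> H" using G s by auto
    then have "inv\<^bsub>R'\<^esub> \<phi> s \<odot>\<^bsub>N'\<^esub> (\<phi> s \<odot>\<^bsub>N'\<^esub> x') \<in> H" by (rule HE(4)[OF uc(2)])
    then show "x' \<in> H" using u uc x' by (simp add: N'.smult_assoc1[symmetric])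
  qed
  then have "\<Inter>{H. submodule H R' N' \<and> \<iota> ` A \<subseteq> H} = carrier N'"
    using N'.carrier_is_submodule A(2) \<iota>_closed by (intro subset_antisym Inter_lower Inter_greatest) auto
  then show ?thesis unfolding finitely_generated_def using A(1,2) \<iota>_closed N'.module_axioms
    by (intro conjI exI[of _ "\<iota> ` A"]) auto
qed

section \<open>Rings and modules of fractions\<close>

locale fractions = module R M
  for R :: "('r, 'x) ring_scheme" (structure) and M :: "('r, 'm, 'y) module_scheme" (structure) +
  fixes S :: "'r set"
  assumes S: "S \<subseteq> carrier R" "\<one> \<in> S" "\<And>s t. s \<in> S \<Longrightarrow> t \<in> S \<Longrightarrow> s \<otimes> t \<in> S"
begin

abbreviation "mfrac \<equiv> fraction S M"
abbreviation "L \<equiv> localized_module R S M"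

lemma S_closed [simp]: "s \<in> S \<Longrightarrow> s \<in> carrier R" using S(1) by auto

declare S(2,3) [simp]

lemma mem_frac:
  "(n, t) \<in> mfrac m s \<longleftrightarrow> n \<in> carrier M \<and> t \<in> S \<and> (\<exists>u\<in>S. u \<odot>\<^bsub>M\<^esub> (t \<odot>\<^bsub>M\<^esub> m) = u \<odot>\<^bsub>M\<^esub> (s \<odot>\<^bsub>M\<^esub> n))"
  by (simp add: fraction_def)

lemma frac_self: "m \<in> carrier M \<Longrightarrow> s \<in> S \<Longrightarrow> (m, s) \<in> mfrac m s"
  using S(2) by (auto simp: mem_frac)

text \<open>Transitivity for fractions: \<open>u (t m - s n) = 0\<close> and
  \<open>v (w m - s k) = 0\<close> give \<open>u v s (w n - t k) = 0\<close>.\<close>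

lemma fracI_sub:
  assumes "m \<in> carrier M" "n \<in> carrier M" "s \<in> S" "t \<in> S" "u \<in> S"
    and e: "u \<odot>\<^bsub>M\<^esub> (t \<odot>\<^bsub>M\<^esub> m) = u \<odot>\<^bsub>M\<^esub> (s \<odot>\<^bsub>M\<^esub> n)"
  shows "mfrac m s \<subseteq> mfrac n t"
proof (rule subrelI)
  fix k w assume "(k, w) \<in> mfrac m s"
  then obtain v where k: "k \<in> carrier M" "w \<in> S" "v \<in> S" and e': "v \<odot>\<^bsub>M\<^esub> (w \<odot>\<^bsub>M\<^esub> m) = v \<odot>\<^bsub>M\<^esub> (s \<odot>\<^bsub>M\<^esub> k)"
    by (auto simp: mem_frac)
  have "((u \<otimes> v) \<otimes> s) \<odot>\<^bsub>M\<^esub> (w \<odot>\<^bsub>M\<^esub> n) = (v \<otimes> w) \<odot>\<^bsub>M\<^esub> (u \<odot>\<^bsub>M\<^esub> (s \<odot>\<^bsub>M\<^esub> n))"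
    using assms(1-5) k by (simp add: smult_assoc1[symmetric] m_ac)
  also have "\<dots> = (v \<otimes> w) \<odot>\<^bsub>M\<^esub> (u \<odot>\<^bsub>M\<^esub> (t \<odot>\<^bsub>M\<^esub> m))" using e by simp
  also have "\<dots> = (u \<otimes> t) \<odot>\<^bsub>M\<^esub> (v \<odot>\<^bsub>M\<^esub> (w \<odot>\<^bsub>M\<^esub> m))"
    using assms(1-5) k by (simp add: smult_assoc1[symmetric] m_ac)
  also have "\<dots> = (u \<otimes> t) \<odot>\<^bsub>M\<^esub> (v \<odot>\<^bsub>M\<^esub> (s \<odot>\<^bsub>M\<^esub> k))" using e' by simp
  also have "\<dots> = ((u \<otimes> v) \<otimes> s) \<odot>\<^bsub>M\<^esub> (t \<odot>\<^bsub>M\<^esub> k)"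
    using assms(1-5) k by (simp add: smult_assoc1[symmetric] m_ac)
  finally show "(k, w) \<in> mfrac n t"
    unfolding mem_frac using assms(1-5) k by (intro conjI bexI[of _ "(u \<otimes> v) \<otimes> s"]) simp_all
qed

lemma fracI:
  assumes "m \<in> carrier M" "n \<in> carrier M" "s \<in> S" "t \<in> S" "u \<in> S"
    and "u \<odot>\<^bsub>M\<^esub> (t \<odot>\<^bsub>M\<^esub> m) = u \<odot>\<^bsub>M\<^esub> (s \<odot>\<^bsub>M\<^esub> n)"
  shows "mfrac m s = mfrac n t"
  using fracI_sub[OF assms] fracI_sub[OF assms(2,1,4,3,5) assms(6)[symmetric]] by (rule subset_antisym)

lemma frac_eq_iff:
  assumes "m \<in> carrier M" "n \<in> carrier M" "s \<in> S" "t \<in> S"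
  shows "mfrac m s = mfrac n t \<longleftrightarrow> (\<exists>u\<in>S. u \<odot>\<^bsub>M\<^esub> (t \<odot>\<^bsub>M\<^esub> m) = u \<odot>\<^bsub>M\<^esub> (s \<odot>\<^bsub>M\<^esub> n))"
proof
  assume "mfrac m s = mfrac n t"
  then have "(n, t) \<in> mfrac m s" using frac_self[OF assms(2,4)] by simp
  then show "\<exists>u\<in>S. u \<odot>\<^bsub>M\<^esub> (t \<odot>\<^bsub>M\<^esub> m) = u \<odot>\<^bsub>M\<^esub> (s \<odot>\<^bsub>M\<^esub> n)" by (simp add: mem_frac)
qed (use fracI[OF assms] in blast)

lemma frac_cross:
  "\<lbrakk>m \<in> carrier M; n \<in> carrier M; s \<in> S; t \<in> S; t \<odot>\<^bsub>M\<^esub> m = s \<odot>\<^bsub>M\<^esub> n\<rbrakk> \<Longrightarrow> mfrac m s = mfrac n t"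
  by (rule fracI[of _ _ _ _ "\<one>"]) simp_all

lemma L_carrier: "x \<in> carrier L \<longleftrightarrow> (\<exists>m\<in>carrier M. \<exists>s\<in>S. x = mfrac m s)"
  by (auto simp: localized_module_def)

lemma frac_closed [simp]: "m \<in> carrier M \<Longrightarrow> s \<in> S \<Longrightarrow> mfrac m s \<in> carrier L"
  by (auto simp: L_carrier)

lemma fracE: "x \<in> carrier L \<Longrightarrow> (\<And>m s. m \<in> carrier M \<Longrightarrow> s \<in> S \<Longrightarrow> x = mfrac m s \<Longrightarrow> P) \<Longrightarrow> P"
  by (auto simp: L_carrier)

lemma L_zero: "\<zero>\<^bsub>L\<^esub> = mfrac \<zero>\<^bsub>M\<^esub> \<one>" by (simp add: localized_module_def)

text \<open>The sum is a union over all representatives; each pair of them yields the same class,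
  and the union is not empty.\<close>

lemma frac_add [simp]:
  assumes "m \<in> carrier M" "n \<in> carrier M" "s \<in> S" "t \<in> S"
  shows "mfrac m s \<oplus>\<^bsub>L\<^esub> mfrac n t = mfrac (t \<odot>\<^bsub>M\<^esub> m \<oplus>\<^bsub>M\<^esub> s \<odot>\<^bsub>M\<^esub> n) (s \<otimes> t)" (is "_ = ?r")
proof -
  have c: "mfrac (t' \<odot>\<^bsub>M\<^esub> m' \<oplus>\<^bsub>M\<^esub> s' \<odot>\<^bsub>M\<^esub> n') (s' \<otimes> t') = ?r"
    if 1: "(m', s') \<in> mfrac m s" and 2: "(n', t') \<in> mfrac n t" for m' s' n' t'
  proof -
    from 1 obtain u where u: "m' \<in> carrier M" "s' \<in> S" "u \<in> S" and eu: "u \<odot>\<^bsub>M\<^esub> (s' \<odot>\<^bsub>M\<^esub> m) = u \<odot>\<^bsub>M\<^esub> (s \<odot>\<^bsub>M\<^esub> m')" by (auto simp: mem_frac)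
    from 2 obtain v where v: "n' \<in> carrier M" "t' \<in> S" "v \<in> S" and ev: "v \<odot>\<^bsub>M\<^esub> (t' \<odot>\<^bsub>M\<^esub> n) = v \<odot>\<^bsub>M\<^esub> (t \<odot>\<^bsub>M\<^esub> n')" by (auto simp: mem_frac)
    have "(u \<otimes> v) \<odot>\<^bsub>M\<^esub> ((s \<otimes> t) \<odot>\<^bsub>M\<^esub> (t' \<odot>\<^bsub>M\<^esub> m' \<oplus>\<^bsub>M\<^esub> s' \<odot>\<^bsub>M\<^esub> n'))
      = (v \<otimes> t \<otimes> t') \<odot>\<^bsub>M\<^esub> (u \<odot>\<^bsub>M\<^esub> (s \<odot>\<^bsub>M\<^esub> m')) \<oplus>\<^bsub>M\<^esub> (u \<otimes> s \<otimes> s') \<odot>\<^bsub>M\<^esub> (v \<odot>\<^bsub>M\<^esub> (t \<odot>\<^bsub>M\<^esub> n'))"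
      using assms u v by (simp add: smult_assoc1[symmetric] smult_r_distr m_ac)
    also have "\<dots> = (v \<otimes> t \<otimes> t') \<odot>\<^bsub>M\<^esub> (u \<odot>\<^bsub>M\<^esub> (s' \<odot>\<^bsub>M\<^esub> m)) \<oplus>\<^bsub>M\<^esub> (u \<otimes> s \<otimes> s') \<odot>\<^bsub>M\<^esub> (v \<odot>\<^bsub>M\<^esub> (t' \<odot>\<^bsub>M\<^esub> n))"
      unfolding eu ev ..
    also have "\<dots> = (u \<otimes> v) \<odot>\<^bsub>M\<^esub> ((s' \<otimes> t') \<odot>\<^bsub>M\<^esub> (t \<odot>\<^bsub>M\<^esub> m \<oplus>\<^bsub>M\<^esub> s \<odot>\<^bsub>M\<^esub> n))"
      using assms u v by (simp add: smult_assoc1[symmetric] smult_r_distr m_ac)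
    finally show ?thesis using assms u v by (intro fracI[of _ _ _ _ "u \<otimes> v"]) simp_all
  qed
  have ne: "(m, s) \<in> mfrac m s" "(n, t) \<in> mfrac n t" using frac_self assms by auto
  have "mfrac m s \<oplus>\<^bsub>L\<^esub> mfrac n t = (\<Union>(m, s)\<in>mfrac m s. \<Union>(n, t)\<in>mfrac n t. mfrac (t \<odot>\<^bsub>M\<^esub> m \<oplus>\<^bsub>M\<^esub> s \<odot>\<^bsub>M\<^esub> n) (s \<otimes> t))"
    by (simp add: localized_module_def)
  also have "\<dots> = (\<Union>p\<in>mfrac m s. \<Union>q\<in>mfrac n t. ?r)" by (intro SUP_cong refl) (auto simp only: c split: prod.split)
  also have "\<dots> = ?r" using ne by blast
  finally show ?thesis .
qed

lemma L_abelian_group: "abelian_group L"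
proof (rule abelian_groupI)
  show "x \<oplus>\<^bsub>L\<^esub> y \<in> carrier L" if "x \<in> carrier L" "y \<in> carrier L" for x y
    using that by (elim fracE) simp
  show "\<zero>\<^bsub>L\<^esub> \<in> carrier L" by (simp add: L_zero)
  show "x \<oplus>\<^bsub>L\<^esub> y \<oplus>\<^bsub>L\<^esub> z = x \<oplus>\<^bsub>L\<^esub> (y \<oplus>\<^bsub>L\<^esub> z)" if "x \<in> carrier L" "y \<in> carrier L" "z \<in> carrier L" for x y z
    using that by (elim fracE) (simp add: smult_assoc1[symmetric] smult_r_distr m_ac M.a_ac)
  show "x \<oplus>\<^bsub>L\<^esub> y = y \<oplus>\<^bsub>L\<^esub> x" if "x \<in> carrier L" "y \<in> carrier L" for x y
    using that by (elim fracE) (simp add: m_comm M.a_comm)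
  show "\<zero>\<^bsub>L\<^esub> \<oplus>\<^bsub>L\<^esub> x = x" if "x \<in> carrier L" for x
    using that by (elim fracE) (simp add: L_zero)
  show "\<exists>y\<in>carrier L. y \<oplus>\<^bsub>L\<^esub> x = \<zero>\<^bsub>L\<^esub>" if x: "x \<in> carrier L" for x
  proof -
    obtain m s where m: "m \<in> carrier M" "s \<in> S" "x = mfrac m s" using x by (rule fracE)
    have "mfrac (\<ominus>\<^bsub>M\<^esub> m) s \<oplus>\<^bsub>L\<^esub> x = \<zero>\<^bsub>L\<^esub>"
      using m by (simp add: L_zero smult_r_minus M.l_neg) (rule frac_cross, simp_all)
    then show ?thesis using m by (intro bexI[of _ "mfrac (\<ominus>\<^bsub>M\<^esub> m) s"]) simp_all
  qed
qed

text \<open>The localized ring is built from the regular module, so facts on fractions of modules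
  apply to its addition and, through the scalar action, to its multiplication.\<close>

lemma fractions_regular: "fractions R (regular_module R) S"
  by (intro fractions.intro fractions_axioms.intro regular_module S is_cring)

abbreviation "rfrac \<equiv> fraction S (regular_module R)"

lemma frac_smult [simp]:
  assumes "r \<in> carrier R" "m \<in> carrier M" "s \<in> S" "t \<in> S"
  shows "rfrac r s \<odot>\<^bsub>L\<^esub> mfrac m t = mfrac (r \<odot>\<^bsub>M\<^esub> m) (s \<otimes> t)" (is "_ = ?r")
proof -
  interpret A: fractions R "regular_module R" S by (rule fractions_regular)
  have c: "mfrac (r' \<odot>\<^bsub>M\<^esub> m') (s' \<otimes> t') = ?r"
    if 1: "(r', s') \<in> rfrac r s" and 2: "(m', t') \<in> mfrac m t" for r' s' m' t'
  proof -
    from 1 obtain u where u: "r' \<in> carrier R" "s' \<in> S" "u \<in> S" and eu: "u \<otimes> (s' \<otimes> r) = u \<otimes> (s \<otimes> r')" by (auto simp: A.mem_frac)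
    from 2 obtain v where v: "m' \<in> carrier M" "t' \<in> S" "v \<in> S" and ev: "v \<odot>\<^bsub>M\<^esub> (t' \<odot>\<^bsub>M\<^esub> m) = v \<odot>\<^bsub>M\<^esub> (t \<odot>\<^bsub>M\<^esub> m')" by (auto simp: mem_frac)
    have "(u \<otimes> v) \<odot>\<^bsub>M\<^esub> ((s \<otimes> t) \<odot>\<^bsub>M\<^esub> (r' \<odot>\<^bsub>M\<^esub> m')) = (u \<otimes> (s \<otimes> r')) \<odot>\<^bsub>M\<^esub> (v \<odot>\<^bsub>M\<^esub> (t \<odot>\<^bsub>M\<^esub> m'))"
      using assms u v by (simp add: smult_assoc1[symmetric] m_ac)
    also have "\<dots> = (u \<otimes> (s' \<otimes> r)) \<odot>\<^bsub>M\<^esub> (v \<odot>\<^bsub>M\<^esub> (t' \<odot>\<^bsub>M\<^esub> m))" unfolding eu ev ..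
    also have "\<dots> = (u \<otimes> v) \<odot>\<^bsub>M\<^esub> ((s' \<otimes> t') \<odot>\<^bsub>M\<^esub> (r \<odot>\<^bsub>M\<^esub> m))"
      using assms u v by (simp add: smult_assoc1[symmetric] m_ac)
    finally show ?thesis using assms u v by (intro fracI[of _ _ _ _ "u \<otimes> v"]) simp_all
  qed
  have ne: "(r, s) \<in> rfrac r s" "(m, t) \<in> mfrac m t" using A.frac_self frac_self assms by auto
  have "rfrac r s \<odot>\<^bsub>L\<^esub> mfrac m t = (\<Union>(r, s)\<in>rfrac r s. \<Union>(m, t)\<in>mfrac m t. mfrac (r \<odot>\<^bsub>M\<^esub> m) (s \<otimes> t))"
    by (simp add: localized_module_def)
  also have "\<dots> = (\<Union>p\<in>rfrac r s. \<Union>q\<in>mfrac m t. ?r)" by (intro SUP_cong refl) (auto simp only: c split: prod.split)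
  also have "\<dots> = ?r" using ne by blast
  finally show ?thesis .
qed

abbreviation "RS \<equiv> localized_ring R S"

lemma RS_simps: "carrier RS = carrier (localized_module R S (regular_module R))"
  "\<zero>\<^bsub>RS\<^esub> = rfrac \<zero> \<one>" "\<one>\<^bsub>RS\<^esub> = rfrac \<one> \<one>"
  "add RS = add (localized_module R S (regular_module R))"
  "monoid.mult RS = smult (localized_module R S (regular_module R))"
  by (simp_all add: localized_ring_def localized_module_def)

lemma rfrac_closed [simp]: "r \<in> carrier R \<Longrightarrow> s \<in> S \<Longrightarrow> rfrac r s \<in> carrier RS"
  by (simp add: fractions.frac_closed[OF fractions_regular] RS_simps)

lemma rfracE: "x \<in> carrier RS \<Longrightarrow> (\<And>r s. r \<in> carrier R \<Longrightarrow> s \<in> S \<Longrightarrow> x = rfrac r s \<Longrightarrow> P) \<Longrightarrow> P"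
  unfolding RS_simps by (elim fractions.fracE[OF fractions_regular]) simp

lemma rfrac_add [simp]: "\<lbrakk>r \<in> carrier R; r' \<in> carrier R; s \<in> S; t \<in> S\<rbrakk> \<Longrightarrow>
    rfrac r s \<oplus>\<^bsub>RS\<^esub> rfrac r' t = rfrac (t \<otimes> r \<oplus> s \<otimes> r') (s \<otimes> t)"
  by (simp add: RS_simps fractions.frac_add[OF fractions_regular])

lemma rfrac_mult [simp]: "\<lbrakk>r \<in> carrier R; r' \<in> carrier R; s \<in> S; t \<in> S\<rbrakk> \<Longrightarrow>
    rfrac r s \<otimes>\<^bsub>RS\<^esub> rfrac r' t = rfrac (r \<otimes> r') (s \<otimes> t)"
  by (simp add: RS_simps fractions.frac_smult[OF fractions_regular])

lemma rfrac_cross: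
  "\<lbrakk>m \<in> carrier R; n \<in> carrier R; s \<in> S; t \<in> S; t \<otimes> m = s \<otimes> n\<rbrakk> \<Longrightarrow> rfrac m s = rfrac n t"
  by (rule fractions.frac_cross[OF fractions_regular]) simp_all

lemma RS_cring: "cring RS"
proof (rule cringI)
  let ?L = "localized_module R S (regular_module R)"
  interpret A: abelian_group ?L by (rule fractions.L_abelian_group[OF fractions_regular])
  have e: "carrier RS = carrier ?L" "add RS = add ?L" "\<zero>\<^bsub>RS\<^esub> = \<zero>\<^bsub>?L\<^esub>" by (simp_all add: localized_ring_def Let_def)
  show "abelian_group RS"
  proof (rule abelian_groupI, unfold e)
    show "\<exists>y\<in>carrier ?L. y \<oplus>\<^bsub>?L\<^esub> x = \<zero>\<^bsub>?L\<^esub>" if "x \<in> carrier ?L" for x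
      using that A.l_neg A.a_inv_closed by blast
  qed (simp_all add: A.a_ac)
  show "Group.comm_monoid RS"
  proof (rule comm_monoidI)
    show "x \<otimes>\<^bsub>RS\<^esub> y \<in> carrier RS" if "x \<in> carrier RS" "y \<in> carrier RS" for x y
      using that by (elim rfracE) simp
    show "\<one>\<^bsub>RS\<^esub> \<in> carrier RS" by (simp add: RS_simps(3))
    show "x \<otimes>\<^bsub>RS\<^esub> y \<otimes>\<^bsub>RS\<^esub> z = x \<otimes>\<^bsub>RS\<^esub> (y \<otimes>\<^bsub>RS\<^esub> z)" if "x \<in> carrier RS" "y \<in> carrier RS" "z \<in> carrier RS" for x y z
      using that by (elim rfracE) (simp add: m_assoc)
    show "\<one>\<^bsub>RS\<^esub> \<otimes>\<^bsub>RS\<^esub> x = x" if "x \<in> carrier RS" for x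
      using that by (elim rfracE) (simp add: RS_simps(3))
    show "x \<otimes>\<^bsub>RS\<^esub> y = y \<otimes>\<^bsub>RS\<^esub> x" if "x \<in> carrier RS" "y \<in> carrier RS" for x y
      using that by (elim rfracE) (simp add: m_comm)
  qed
  show "(x \<oplus>\<^bsub>RS\<^esub> y) \<otimes>\<^bsub>RS\<^esub> z = x \<otimes>\<^bsub>RS\<^esub> z \<oplus>\<^bsub>RS\<^esub> y \<otimes>\<^bsub>RS\<^esub> z" if "x \<in> carrier RS" "y \<in> carrier RS" "z \<in> carrier RS" for x y z
    using that by (elim rfracE) (simp, rule rfrac_cross, simp_all add: l_distr r_distr m_ac)
qed

lemma L_module: "module RS L"
proof (rule moduleI[OF RS_cring L_abelian_group])
  show "x \<odot>\<^bsub>L\<^esub> y \<in> carrier L" if "x \<in> carrier RS" "y \<in> carrier L" for x y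
    using that by (elim rfracE fracE) simp
  show "(a \<oplus>\<^bsub>RS\<^esub> b) \<odot>\<^bsub>L\<^esub> x = a \<odot>\<^bsub>L\<^esub> x \<oplus>\<^bsub>L\<^esub> b \<odot>\<^bsub>L\<^esub> x" if "a \<in> carrier RS" "b \<in> carrier RS" "x \<in> carrier L" for a b x
    using that by (elim rfracE fracE) (simp, rule frac_cross, simp_all add: smult_assoc1[symmetric] smult_l_distr smult_r_distr r_distr m_ac)
  show "a \<odot>\<^bsub>L\<^esub> (x \<oplus>\<^bsub>L\<^esub> y) = a \<odot>\<^bsub>L\<^esub> x \<oplus>\<^bsub>L\<^esub> a \<odot>\<^bsub>L\<^esub> y" if "a \<in> carrier RS" "x \<in> carrier L" "y \<in> carrier L" for a x y
    using that by (elim rfracE fracE) (simp, rule frac_cross, simp_all add: smult_assoc1[symmetric] smult_l_distr smult_r_distr r_distr m_ac)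
  show "(a \<otimes>\<^bsub>RS\<^esub> b) \<odot>\<^bsub>L\<^esub> x = a \<odot>\<^bsub>L\<^esub> (b \<odot>\<^bsub>L\<^esub> x)" if "a \<in> carrier RS" "b \<in> carrier RS" "x \<in> carrier L" for a b x
    using that by (elim rfracE fracE) (simp add: smult_assoc1[symmetric] m_ac)
  show "\<one>\<^bsub>RS\<^esub> \<odot>\<^bsub>L\<^esub> x = x" if "x \<in> carrier L" for x
    using that by (elim fracE) (simp add: RS_simps(3))
qed

lemma rfrac_hom: "(\<lambda>r. rfrac r \<one>) \<in> ring_hom R RS"
  by (rule ring_hom_memI) (simp_all add: RS_simps(3))

lemma rfrac_units: "s \<in> S \<Longrightarrow> t \<in> S \<Longrightarrow> rfrac s t \<in> Units RS"
proof -
  assume s: "s \<in> S" "t \<in> S"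
  have "rfrac t s \<otimes>\<^bsub>RS\<^esub> rfrac s t = \<one>\<^bsub>RS\<^esub>" "rfrac s t \<otimes>\<^bsub>RS\<^esub> rfrac t s = \<one>\<^bsub>RS\<^esub>"
    using s by (simp_all add: RS_simps(3)) (rule rfrac_cross, simp_all add: m_comm)+
  then show ?thesis unfolding Units_def using rfrac_closed s S_closed by blast
qed

text \<open>Fractions are formed in \<open>M\<close> and not in \<open>G\<close>, so that the
  classes are elements of \<open>L\<close> and the result is a submodule of
  \<open>L\<close>.\<close>

definition submodule_fractions :: "'m set \<Rightarrow> ('m \<times> 'r) set set" where
  "submodule_fractions G = {mfrac m s | m s. m \<in> G \<and> s \<in> S}"

lemma submodule_fractions_carrier: "submodule_fractions (carrier M) = carrier L"
  by (simp add: submodule_fractions_def localized_module_def)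

lemma submodule_fractionsI: "m \<in> G \<Longrightarrow> s \<in> S \<Longrightarrow> mfrac m s \<in> submodule_fractions G"
  unfolding submodule_fractions_def by blast

lemma submodule_fractions_mono: "G \<subseteq> H \<Longrightarrow> submodule_fractions G \<subseteq> submodule_fractions H"
  by (auto simp: submodule_fractions_def)

text \<open>A fraction in this submodule may be written with a numerator outside \<open>G\<close>;
  only some multiple of that numerator by an element of \<open>S\<close> has to lie in
  \<open>G\<close>.\<close>

lemma mfrac_mem_submodule_fractions:
  assumes G: "submodule G R M" and m: "m \<in> carrier M" "s \<in> S"
  shows "mfrac m s \<in> submodule_fractions G \<longleftrightarrow> (\<exists>u\<in>S. u \<odot>\<^bsub>M\<^esub> m \<in> G)"
proof
  note GE = submoduleE[OF G]
  assume "mfrac m s \<in> submodule_fractions G"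
  then obtain n t where n: "n \<in> G" "t \<in> S" "mfrac m s = mfrac n t" by (auto simp: submodule_fractions_def)
  have nc: "n \<in> carrier M" using n GE(1) by auto
  then obtain u where u: "u \<in> S" "u \<odot>\<^bsub>M\<^esub> (t \<odot>\<^bsub>M\<^esub> m) = u \<odot>\<^bsub>M\<^esub> (s \<odot>\<^bsub>M\<^esub> n)"
    using n(3) unfolding frac_eq_iff[OF m(1) nc m(2) n(2)] by blast
  have "(u \<otimes> t) \<odot>\<^bsub>M\<^esub> m = u \<odot>\<^bsub>M\<^esub> (s \<odot>\<^bsub>M\<^esub> n)" using u m n by (simp add: smult_assoc1)
  also have "\<dots> \<in> G" using u m n GE(4) by simp
  finally show "\<exists>u\<in>S. u \<odot>\<^bsub>M\<^esub> m \<in> G" using u n by (intro bexI[of _ "u \<otimes> t"]) simp_all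
next
  assume "\<exists>u\<in>S. u \<odot>\<^bsub>M\<^esub> m \<in> G"
  then obtain u where u: "u \<in> S" "u \<odot>\<^bsub>M\<^esub> m \<in> G" by blast
  have "mfrac m s = mfrac (u \<odot>\<^bsub>M\<^esub> m) (u \<otimes> s)"
    by (rule frac_cross) (use u m in \<open>simp_all add: smult_assoc1[symmetric] m_comm\<close>)
  then show "mfrac m s \<in> submodule_fractions G" using submodule_fractionsI[OF u(2), of "u \<otimes> s"] u m by simp
qed

lemma submodule_fractions_submodule:
  assumes G: "submodule G R M"
  shows "submodule (submodule_fractions G) RS L"
proof -
  interpret L: module RS L by (rule L_module)
  note GE = submoduleE[OF G]
  have Gc: "m \<in> G \<Longrightarrow> m \<in> carrier M" for m using GE(1) by auto
  show ?thesis
  proof (rule L.submoduleI')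
    show "submodule_fractions G \<subseteq> carrier L" using Gc by (auto simp: submodule_fractions_def)
    show "\<zero>\<^bsub>L\<^esub> \<in> submodule_fractions G" unfolding L_zero using submodule_zero[OF G] S(2) by (rule submodule_fractionsI)
    show "a \<oplus>\<^bsub>L\<^esub> b \<in> submodule_fractions G" if ab: "a \<in> submodule_fractions G" "b \<in> submodule_fractions G" for a b
    proof -
      obtain m s n t where e: "m \<in> G" "s \<in> S" "a = mfrac m s" "n \<in> G" "t \<in> S" "b = mfrac n t"
        using ab by (auto simp: submodule_fractions_def)
      have "t \<odot>\<^bsub>M\<^esub> m \<oplus>\<^bsub>M\<^esub> s \<odot>\<^bsub>M\<^esub> n \<in> G" using e GE(4,5) by simp
      then show ?thesis using e Gc by (simp add: submodule_fractionsI)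
    qed
    show "a \<odot>\<^bsub>L\<^esub> x \<in> submodule_fractions G" if a: "a \<in> carrier RS" and x: "x \<in> submodule_fractions G" for a x
    proof -
      obtain r s where r: "r \<in> carrier R" "s \<in> S" "a = rfrac r s" using a by (rule rfracE)
      obtain m t where e: "m \<in> G" "t \<in> S" "x = mfrac m t" using x by (auto simp: submodule_fractions_def)
      have "r \<odot>\<^bsub>M\<^esub> m \<in> G" using e r GE(4) by simp
      then show ?thesis using e r Gc by (simp add: submodule_fractionsI)
    qed
  qed
qed

text \<open>Division by \<open>s\<close> is the action of the fraction \<open>1/s\<close>, and the
  fractions of \<open>G\<close> are closed under it, so \<open>S\<close> acts bijectively on
  them.\<close>

lemma module_localization_fractions:
  assumes G: "submodule G R M"
  shows "module_localization R (M\<lparr>carrier := G\<rparr>) RS (L\<lparr>carrier := submodule_fractions G\<rparr>) S (\<lambda>r. rfrac r \<one>) (\<lambda>m. mfrac m \<one>)"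
proof -
  interpret L: module RS L by (rule L_module)
  note GE = submoduleE[OF G]
  have Gc: "m \<in> G \<Longrightarrow> m \<in> carrier M" for m using GE(1) by auto
  note GS = L.submoduleE[OF submodule_fractions_submodule[OF G]]
  have u: "rfrac \<one> s \<odot>\<^bsub>L\<^esub> (rfrac s \<one> \<odot>\<^bsub>L\<^esub> x) = x" "rfrac s \<one> \<odot>\<^bsub>L\<^esub> (rfrac \<one> s \<odot>\<^bsub>L\<^esub> x) = x"
    if "s \<in> S" "x \<in> carrier L" for s x
    using that by - (erule fracE; simp; rule frac_cross; simp add: smult_assoc1[symmetric] m_comm)+
  show ?thesis
  proof (intro module_localization.intro module_localization_axioms.intro S rfrac_hom)
    show "module R (M\<lparr>carrier := G\<rparr>)" by (rule submodule.submodule_is_module[OF G module_axioms])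
    show "module RS (L\<lparr>carrier := submodule_fractions G\<rparr>)"
      by (rule submodule.submodule_is_module[OF submodule_fractions_submodule[OF G] L_module])
  next
    fix x assume "x \<in> carrier (M\<lparr>carrier := G\<rparr>)"
    then have x: "x \<in> G" by simp
    show "mfrac x \<one> \<in> carrier (L\<lparr>carrier := submodule_fractions G\<rparr>)" using x by (simp add: submodule_fractionsI)
    show "mfrac (r \<odot>\<^bsub>M\<lparr>carrier := G\<rparr>\<^esub> x) \<one> = rfrac r \<one> \<odot>\<^bsub>L\<lparr>carrier := submodule_fractions G\<rparr>\<^esub> mfrac x \<one>"
      if "r \<in> carrier R" for r using that x Gc by simp
    show "\<exists>s\<in>S. s \<odot>\<^bsub>M\<lparr>carrier := G\<rparr>\<^esub> x = \<zero>\<^bsub>M\<lparr>carrier := G\<rparr>\<^esub>"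
      if "mfrac x \<one> = \<zero>\<^bsub>L\<lparr>carrier := submodule_fractions G\<rparr>\<^esub>"
      using that x Gc by (simp add: L_zero frac_eq_iff)
    fix y assume "y \<in> carrier (M\<lparr>carrier := G\<rparr>)"
    then show "mfrac (x \<oplus>\<^bsub>M\<lparr>carrier := G\<rparr>\<^esub> y) \<one> = mfrac x \<one> \<oplus>\<^bsub>L\<lparr>carrier := submodule_fractions G\<rparr>\<^esub> mfrac y \<one>"
      using x Gc by simp
  next
    fix x' assume "x' \<in> carrier (L\<lparr>carrier := submodule_fractions G\<rparr>)"
    then obtain m s where x': "m \<in> G" "s \<in> S" "x' = mfrac m s" by (auto simp: submodule_fractions_def)
    have "rfrac s \<one> \<odot>\<^bsub>L\<^esub> x' = mfrac m \<one>"
      using x' Gc by simp (rule frac_cross; simp add: smult_assoc1[symmetric] m_comm)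
    then show "\<exists>x\<in>carrier (M\<lparr>carrier := G\<rparr>). \<exists>s\<in>S. rfrac s \<one> \<odot>\<^bsub>L\<lparr>carrier := submodule_fractions G\<rparr>\<^esub> x' = mfrac x \<one>"
      using x' by auto
  next
    fix s x' assume s: "s \<in> S" and "x' \<in> carrier (L\<lparr>carrier := submodule_fractions G\<rparr>)"
    then have x: "x' \<in> submodule_fractions G" "x' \<in> carrier L" using GS(1) by auto
    have sc: "rfrac \<one> s \<in> carrier RS" using s by simp
    show "x' = \<zero>\<^bsub>L\<lparr>carrier := submodule_fractions G\<rparr>\<^esub>"
      if "rfrac s \<one> \<odot>\<^bsub>L\<lparr>carrier := submodule_fractions G\<rparr>\<^esub> x' = \<zero>\<^bsub>L\<lparr>carrier := submodule_fractions G\<rparr>\<^esub>"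
    proof -
      have "x' = rfrac \<one> s \<odot>\<^bsub>L\<^esub> \<zero>\<^bsub>L\<^esub>" using that u(1)[OF s x(2)] by simp
      then show ?thesis using L.smult_r_null[OF sc] by simp
    qed
    have "rfrac \<one> s \<odot>\<^bsub>L\<^esub> x' \<in> submodule_fractions G" by (rule GS(4)[OF sc x(1)])
    then show "\<exists>x''\<in>carrier (L\<lparr>carrier := submodule_fractions G\<rparr>). rfrac s \<one> \<odot>\<^bsub>L\<lparr>carrier := submodule_fractions G\<rparr>\<^esub> x'' = x'"
      using u(2)[OF s x(2)] by auto
  qed
qed

lemma contracted_ideal:
  assumes "ideal K RS"
  shows "ideal {r \<in> carrier R. rfrac r \<one> \<in> K} R"
proof -
  interpret K: ideal K RS by fact
  show ?thesis
  proof (rule idealI_cring)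
    show "\<zero> \<in> {r \<in> carrier R. rfrac r \<one> \<in> K}" using additive_subgroup.zero_closed[OF K.is_additive_subgroup] by (simp add: RS_simps(2))
    show "a \<oplus> b \<in> {r \<in> carrier R. rfrac r \<one> \<in> K}"
      if "a \<in> {r \<in> carrier R. rfrac r \<one> \<in> K}" "b \<in> {r \<in> carrier R. rfrac r \<one> \<in> K}" for a b
      using that additive_subgroup.a_closed[OF K.is_additive_subgroup, of "rfrac a \<one>" "rfrac b \<one>"] by simp
    show "r \<otimes> a \<in> {r \<in> carrier R. rfrac r \<one> \<in> K}"
      if "a \<in> {r \<in> carrier R. rfrac r \<one> \<in> K}" "r \<in> carrier R" for a r
      using that K.I_l_closed[of "rfrac a \<one>" "rfrac r \<one>"] by simp
  qed auto
qed

text \<open>The contraction of an ideal is an ideal, so an ideal containing the images of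
  \<open>A\<close> contains those of all of \<open>Idl A\<close>. This provides generators of the
  extended ideal that come from \<open>R\<close>.\<close>

lemma genideal_extended:
  assumes "A \<subseteq> carrier R"
  shows "Idl\<^bsub>RS\<^esub> ((\<lambda>r. rfrac r \<one>) ` (Idl A)) = Idl\<^bsub>RS\<^esub> ((\<lambda>r. rfrac r \<one>) ` A)" (is "_ = ?K")
proof -
  interpret RS: cring RS by (rule RS_cring)
  have K: "ideal ?K RS" by (rule RS.genideal_ideal) (use assms in auto)
  have AK: "(\<lambda>r. rfrac r \<one>) ` A \<subseteq> ?K" by (rule RS.genideal_self) (use assms in auto)
  have "Idl A \<subseteq> {r \<in> carrier R. rfrac r \<one> \<in> ?K}"
    by (rule genideal_minimal[OF contracted_ideal[OF K]]) (use AK assms in auto)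
  then have 1: "Idl\<^bsub>RS\<^esub> ((\<lambda>r. rfrac r \<one>) ` (Idl A)) \<subseteq> ?K" by (intro RS.genideal_minimal K) auto
  have "A \<subseteq> Idl A" "Idl A \<subseteq> carrier R"
    using genideal_self[OF assms] ideal.Icarr[OF genideal_ideal[OF assms]] by auto
  then have 2: "?K \<subseteq> Idl\<^bsub>RS\<^esub> ((\<lambda>r. rfrac r \<one>) ` (Idl A))"
    by (intro RS.genideal_minimal RS.genideal_ideal subset_trans[OF _ RS.genideal_self]) auto
  show ?thesis using 1 2 by (rule subset_antisym)
qed

text \<open>An ideal of the localization is generated by the images of its contraction, because
  \<open>r/s\<close> and \<open>r/1\<close> differ by a unit. Finitely many generators of the
  contraction therefore suffice.\<close>

lemma noetherian_localized_ring:
  assumes "noetherian_ring R"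
  shows "noetherian_ring RS"
proof -
  interpret noetherian_ring R by fact
  interpret RS: cring RS by (rule RS_cring)
  show ?thesis
  proof (intro noetherian_ring.intro noetherian_ring_axioms.intro RS.ring_axioms)
    fix I assume I: "ideal I RS"
    interpret I: ideal I RS by fact
    let ?J = "{r \<in> carrier R. rfrac r \<one> \<in> I}"
    obtain A where A: "A \<subseteq> carrier R" "finite A" "?J = Idl A" using finetely_gen[OF contracted_ideal[OF I]] by blast
    let ?B = "(\<lambda>r. rfrac r \<one>) ` A"
    have Bc: "?B \<subseteq> carrier RS" using A(1) by auto
    have "?B \<subseteq> I" using genideal_self[OF A(1)] A(3) by auto
    then have 1: "Idl\<^bsub>RS\<^esub> ?B \<subseteq> I" by (rule RS.genideal_minimal[OF I])
    have 2: "I \<subseteq> Idl\<^bsub>RS\<^esub> ?B"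
    proof
      interpret K: ideal "Idl\<^bsub>RS\<^esub> ?B" RS by (rule RS.genideal_ideal[OF Bc])
      fix x assume x: "x \<in> I"
      obtain r s where r: "r \<in> carrier R" "s \<in> S" "x = rfrac r s" using I.Icarr[OF x] by (rule rfracE)
      have "rfrac s \<one> \<otimes>\<^bsub>RS\<^esub> x \<in> I" using x r by (intro I.I_l_closed) simp_all
      moreover have "rfrac s \<one> \<otimes>\<^bsub>RS\<^esub> x = rfrac r \<one>" using r by simp (rule rfrac_cross; simp)
      ultimately have "r \<in> Idl A" using r A(3) by auto
      then have "rfrac r \<one> \<in> Idl\<^bsub>RS\<^esub> ((\<lambda>r. rfrac r \<one>) ` (Idl A))"
        using ideal.Icarr[OF genideal_ideal[OF A(1)]] by (intro subsetD[OF RS.genideal_self] imageI) auto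
      then have "rfrac r \<one> \<in> Idl\<^bsub>RS\<^esub> ?B" by (simp add: genideal_extended[OF A(1)])
      then have "rfrac \<one> s \<otimes>\<^bsub>RS\<^esub> rfrac r \<one> \<in> Idl\<^bsub>RS\<^esub> ?B" using r by (intro K.I_l_closed) simp_all
      then show "x \<in> Idl\<^bsub>RS\<^esub> ?B" using r by simp
    qed
    show "\<exists>A\<subseteq>carrier RS. finite A \<and> I = Idl\<^bsub>RS\<^esub> A" using 1 2 Bc A(2) by (intro exI[of _ ?B]) auto
  qed
qed

text \<open>For \<open>x = r/s\<close> the element is \<open>(s - r y)/s\<close>, and
  \<open>s - r y\<close> lies outside \<open>\<pp>\<close> because \<open>r y\<close> is inside and
  \<open>s\<close> is not.\<close>

lemma one_minus_unit:
  assumes "primeideal \<pp> R" "S = carrier R - \<pp>" "y \<in> \<pp>" "x \<in> carrier RS"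
  shows "\<one>\<^bsub>RS\<^esub> \<ominus>\<^bsub>RS\<^esub> x \<otimes>\<^bsub>RS\<^esub> rfrac y \<one> \<in> Units RS"
proof -
  interpret P: primeideal \<pp> R by fact
  interpret RS: cring RS by (rule RS_cring)
  obtain r s where r: "r \<in> carrier R" "s \<in> S" "x = rfrac r s" using assms(4) by (rule rfracE)
  have y: "y \<in> carrier R" using assms(3) by (rule P.Icarr)
  have ry: "r \<otimes> y \<in> \<pp>" using assms(3) r(1) by (rule P.I_l_closed)
  let ?z = "s \<ominus> r \<otimes> y"
  have zS: "?z \<in> S"
  proof -
    have "?z \<notin> \<pp>"
    proof
      assume "?z \<in> \<pp>"
      then have "?z \<oplus> r \<otimes> y \<in> \<pp>" using ry by (rule P.a_closed)
      moreover have "?z \<oplus> r \<otimes> y = s" using r y by (simp add: a_minus_def R.a_assoc R.l_neg)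
      ultimately show False using r(2) assms(2) by simp
    qed
    then show ?thesis using r y assms(2) by simp
  qed
  have "rfrac ?z s \<oplus>\<^bsub>RS\<^esub> rfrac (r \<otimes> y) s = rfrac (s \<otimes> ?z \<oplus> s \<otimes> (r \<otimes> y)) (s \<otimes> s)" using r y zS by simp
  also have "s \<otimes> ?z \<oplus> s \<otimes> (r \<otimes> y) = s \<otimes> s" using r y by (simp add: r_distr[symmetric] a_minus_def R.a_assoc R.l_neg)
  also have "rfrac (s \<otimes> s) (s \<otimes> s) = \<one>\<^bsub>RS\<^esub>" unfolding RS_simps(3) by (rule rfrac_cross) (use r in simp_all)
  finally have e: "rfrac ?z s \<oplus>\<^bsub>RS\<^esub> x \<otimes>\<^bsub>RS\<^esub> rfrac y \<one> = \<one>\<^bsub>RS\<^esub>" using r y by simp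
  have "\<one>\<^bsub>RS\<^esub> \<ominus>\<^bsub>RS\<^esub> x \<otimes>\<^bsub>RS\<^esub> rfrac y \<one> = rfrac ?z s"
    unfolding e[symmetric] using r y zS by (simp add: a_minus_def RS.a_assoc RS.r_neg del: rfrac_mult rfrac_add)
  then show ?thesis using rfrac_units[OF zS r(2)] by simp
qed

end

section \<open>Relative Cohen-Macaulay filtrations\<close>

text \<open>An element of \<open>H\<close> maps into the fractions of \<open>G\<close> when some
  multiple of it by \<open>S\<close> lies in \<open>G\<close>; this is the kernel condition of
  \<open>quotient_localization\<close>.\<close>

lemma (in fractions) quotient_fractions:
  assumes G: "submodule G R M" and H: "submodule H R M" and GH: "G \<subseteq> H"
  shows "submodule G R (M\<lparr>carrier := H\<rparr>)"
    "submodule (submodule_fractions G) RS (L\<lparr>carrier := submodule_fractions H\<rparr>)"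
    "\<exists>\<iota>. module_localization R (quotient_module (M\<lparr>carrier := H\<rparr>) G)
      RS (quotient_module (L\<lparr>carrier := submodule_fractions H\<rparr>) (submodule_fractions G)) S (\<lambda>r. rfrac r \<one>) \<iota>"
proof -
  let ?H = "M\<lparr>carrier := H\<rparr>" and ?GS = "submodule_fractions G" and ?HS = "L\<lparr>carrier := submodule_fractions H\<rparr>"
  interpret L: module RS L by (rule L_module)
  interpret X: module_localization R ?H RS ?HS S "\<lambda>r. rfrac r \<one>" "\<lambda>m. mfrac m \<one>"
    by (rule module_localization_fractions[OF H])
  note GE = submoduleE[OF G] and GSE = L.submoduleE[OF submodule_fractions_submodule[OF G]]
  show G': "submodule G R ?H"
    by (rule X.N.submoduleI') (use GH submodule_zero[OF G] GE(4,5) in auto)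
  show GS': "submodule ?GS RS ?HS"
    by (rule X.N'.submoduleI') (use submodule_fractions_mono[OF GH] L.submodule_zero[OF submodule_fractions_submodule[OF G]] GSE(4,5) in auto)
  note q = quotient_module[OF X.N.module_axioms G'] and q' = quotient_module[OF X.N'.module_axioms GS']
  show "\<exists>\<iota>. module_localization R (quotient_module ?H G) RS (quotient_module ?HS ?GS) S (\<lambda>r. rfrac r \<one>) \<iota>"
  proof (rule X.quotient_localization[OF q(1-3) q'(1-3)])
    fix x assume x: "x \<in> carrier ?H"
    have xc: "x \<in> carrier M" using x submoduleE(1)[OF H] by auto
    have "?GS +>\<^bsub>?HS\<^esub> mfrac x \<one> = \<zero>\<^bsub>quotient_module ?HS ?GS\<^esub> \<longleftrightarrow> mfrac x \<one> \<in> ?GS"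
      by (rule q'(4)[OF X.\<iota>_closed[OF x]])
    also have "\<dots> \<longleftrightarrow> (\<exists>s\<in>S. s \<odot>\<^bsub>M\<^esub> x \<in> G)" by (rule mfrac_mem_submodule_fractions[OF G xc S(2)])
    also have "\<dots> \<longleftrightarrow> (\<exists>s\<in>S. G +>\<^bsub>?H\<^esub> (s \<odot>\<^bsub>?H\<^esub> x) = \<zero>\<^bsub>quotient_module ?H G\<^esub>)"
    proof (rule bex_cong[OF refl])
      fix s assume "s \<in> S"
      then have "s \<odot>\<^bsub>?H\<^esub> x \<in> carrier ?H" by (intro X.N.smult_closed x S_closed)
      from q(4)[OF this] show "s \<odot>\<^bsub>M\<^esub> x \<in> G \<longleftrightarrow> G +>\<^bsub>?H\<^esub> (s \<odot>\<^bsub>?H\<^esub> x) = \<zero>\<^bsub>quotient_module ?H G\<^esub>" by simp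
    qed
    finally show "?GS +>\<^bsub>?HS\<^esub> mfrac x \<one> = \<zero>\<^bsub>quotient_module ?HS ?GS\<^esub> \<longleftrightarrow>
      (\<exists>s\<in>S. G +>\<^bsub>?H\<^esub> (s \<odot>\<^bsub>?H\<^esub> x) = \<zero>\<^bsub>quotient_module ?H G\<^esub>)" .
  next
    show "rfrac s \<one> \<in> Units RS" if "s \<in> S" for s using that by (intro rfrac_units) simp_all
  qed
qed

lemma mod_hom_restrict:
  assumes "f \<in> mod_hom R (M\<lparr>carrier := H\<rparr>) Q" "G \<subseteq> H"
  shows "f \<in> mod_hom R (M\<lparr>carrier := G\<rparr>) Q"
  unfolding mod_hom_def using mod_homD[OF assms(1)] assms(2)
  by (intro CollectI conjI ballI Pi_I) (simp_all add: subsetD)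

lemma cd_le_iff:
  assumes "cring R" "noetherian_ring R" "module R M" "set ys \<subseteq> carrier R"
  shows "cd R (Idl\<^bsub>R\<^esub> (set ys)) M \<le> ereal (real k) \<longleftrightarrow> (\<forall>i>k. koszul_vanishes R ys M i)"
proof -
  have "cd R (Idl\<^bsub>R\<^esub> (set ys)) M \<le> ereal (real k) \<longleftrightarrow> (\<forall>i. \<not> koszul_vanishes R ys M i \<longrightarrow> i \<le> k)"
    unfolding cd_def Sup_le_iff local_cohomology_zero_iff[OF assms] by auto
  then show ?thesis by (meson not_le)
qed

lemma cd_upper:
  assumes "cring R" "noetherian_ring R" "module R M" "set ys \<subseteq> carrier R" "\<not> koszul_vanishes R ys M i"
  shows "ereal (real i) \<le> cd R (Idl\<^bsub>R\<^esub> (set ys)) M"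
  unfolding cd_def by (rule Sup_upper) (use local_cohomology_zero_iff[OF assms(1-4)] assms(5) in blast)

lemma zero_module_koszul_vanishes:
  assumes "module R M" "zero_module M" "set ys \<subseteq> carrier R"
  shows "koszul_vanishes R ys M p"
proof -
  interpret M: module R M by fact
  have z: "x = \<zero>\<^bsub>M\<^esub>" if "x \<in> carrier M" for x using that assms(2) by (simp add: zero_module_def)
  show ?thesis unfolding koszul_vanishes_iff
  proof (intro allI impI)
    fix n w assume w: "cochain M w"
    have c: "cochain M (\<lambda>_. \<zero>\<^bsub>M\<^esub>)" by (simp add: cochain_def)
    have "transition R M ys 0 w bs = koszul_d M (powers R (n + 0) ys) (\<lambda>_. \<zero>\<^bsub>M\<^esub>) bs" for bs
      using z[OF cochainD[OF M.cochain_transition[OF assms(3) w]]] z[OF M.koszul_d_closed[OF M.R.powers_closed[OF assms(3)] c]] by simp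
    moreover have "in_pred_degree M (length ys) p (\<lambda>_. \<zero>\<^bsub>M\<^esub>)" by (simp add: in_pred_degree_def)
    ultimately show "\<exists>m v. cochain M v \<and> in_pred_degree M (length ys) p v \<and> (\<forall>bs. length bs = length ys \<longrightarrow> transition R M ys m w bs = koszul_d M (powers R (n + m) ys) v bs)"
      using c by blast
  qed
qed

lemma zero_module_finitely_generated:
  assumes "module R M" "zero_module M"
  shows "finitely_generated R M"
proof -
  interpret M: module R M by fact
  have "\<Inter>{H. submodule H R M \<and> {} \<subseteq> H} = carrier M"
  proof (rule subset_antisym)
    show "\<Inter>{H. submodule H R M \<and> {} \<subseteq> H} \<subseteq> carrier M"
      by (rule Inter_lower) (simp add: M.carrier_is_submodule)
    show "carrier M \<subseteq> \<Inter>{H. submodule H R M \<and> {} \<subseteq> H}"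
      using assms(2) M.submodule_zero by (auto simp: zero_module_def)
  qed
  then show ?thesis unfolding finitely_generated_def using assms(1) by blast
qed

text \<open>If there is a single nonvanishing degree, the supremum in \<open>cd\<close> is that
  degree.\<close>

lemma relative_Cohen_Macaulay_iff:
  assumes "cring R" "noetherian_ring R" "module R M" "set ys \<subseteq> carrier R"
  shows "relative_Cohen_Macaulay R (Idl\<^bsub>R\<^esub> (set ys)) M \<and> cd R (Idl\<^bsub>R\<^esub> (set ys)) M = ereal (real k)
    \<longleftrightarrow> finitely_generated R M \<and> (\<forall>i. koszul_vanishes R ys M i \<longleftrightarrow> i \<noteq> k)" (is "?l \<longleftrightarrow> ?r")
proof
  note z = local_cohomology_zero_iff[OF assms]
  assume l: ?l
  then obtain i where i: "\<And>j. \<not> koszul_vanishes R ys M j \<longleftrightarrow> j = i" unfolding relative_Cohen_Macaulay_def z by blast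
  have "cd R (Idl\<^bsub>R\<^esub> (set ys)) M = ereal (real i)" unfolding cd_def z i by simp
  then have "i = k" using l by simp
  then show ?r using l i unfolding relative_Cohen_Macaulay_def by blast
next
  note z = local_cohomology_zero_iff[OF assms]
  assume r: ?r
  then have "cd R (Idl\<^bsub>R\<^esub> (set ys)) M = ereal (real k)" unfolding cd_def z by simp
  then show ?l using r unfolding relative_Cohen_Macaulay_def z by auto
qed

theorem proposition2p25:
  fixes R :: "('r, 'x) ring_scheme" and \<aa> :: "'r set" and M :: "('r, 'm, 'y) module_scheme"
  assumes "cring R" and "noetherian_ring R"
    and "ideal \<aa> R" and "\<aa> \<noteq> carrier R"
    and "RCMF R \<aa> M"
    and "\<pp> \<in> Supp R M \<inter> primes_containing R \<aa>"
  shows "RCMF (ring_at R \<pp>) (extended_ideal_at R \<pp> \<aa>) (module_at R \<pp> M)"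
proof -
  interpret R: cring R by fact
  have p: "primeideal \<pp> R" "\<aa> \<subseteq> \<pp>" using assms(6) by (auto simp: primes_containing_def)
  interpret P: primeideal \<pp> R by fact
  obtain F where fg: "finitely_generated R M" and F: "cd_filtration R \<aa> M F"
    and FQ: "\<And>i. 1 \<le> i \<Longrightarrow> ereal (real i) \<le> cd R \<aa> M \<Longrightarrow>
      (let Q = quotient_module (M\<lparr>carrier := F i\<rparr>) (F (i - 1))
       in zero_module Q \<or> relative_Cohen_Macaulay R \<aa> Q \<and> cd R \<aa> Q = ereal (real i))"
    using assms(5) unfolding RCMF_def by blast
  obtain A where A: "A \<subseteq> carrier R" "finite A" "\<aa> = Idl\<^bsub>R\<^esub> A"
    using noetherian_ring.finetely_gen[OF assms(2,3)] by blast
  obtain ys where ys: "set ys = A" using finite_list[OF A(2)] by blast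
  have \<aa>: "\<aa> = Idl\<^bsub>R\<^esub> (set ys)" and ysc: "set ys \<subseteq> carrier R" using A ys by auto
  define S where "S = carrier R - \<pp>"
  interpret M: module R M using fg by (simp add: finitely_generated_def)
  interpret fractions R M S
  proof (intro fractions.intro fractions_axioms.intro M.module_axioms)
    show "\<one>\<^bsub>R\<^esub> \<in> S" using P.I_notcarr P.one_imp_carrier by (auto simp: S_def)
    show "s \<otimes>\<^bsub>R\<^esub> t \<in> S" if "s \<in> S" "t \<in> S" for s t using that P.I_prime[of s t] by (auto simp: S_def)
  qed (auto simp: S_def)
  let ?\<phi> = "\<lambda>r. rfrac r \<one>\<^bsub>R\<^esub>"
  define zs where "zs = map ?\<phi> ys"
  have zsc: "set zs \<subseteq> carrier RS" using ysc by (auto simp: zs_def)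
  \<comment> \<open>A finite list \<open>ys\<close> and its image \<open>zs\<close> generate the
    ideals on the two sides, so the Koszul conditions correspond.\<close>
  have \<aa>': "extended_ideal_at R \<pp> \<aa> = Idl\<^bsub>RS\<^esub> (set zs)"
    unfolding extended_ideal_at_def ring_at_def S_def[symmetric] \<aa> using genideal_extended[OF ysc] by (simp add: zs_def)
  note noeth = noetherian_localized_ring[OF assms(2)]
  have rad: "\<one>\<^bsub>RS\<^esub> \<ominus>\<^bsub>RS\<^esub> x \<otimes>\<^bsub>RS\<^esub> z \<in> Units RS" if z: "z \<in> set zs" "x \<in> carrier RS" for z x
  proof -
    obtain y where y: "y \<in> set ys" "z = ?\<phi> y" using z(1) by (auto simp: zs_def)
    have "y \<in> \<pp>" using R.genideal_self[OF ysc] y p(2) \<aa> by auto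
    then show ?thesis unfolding y(2) using one_minus_unit[OF p(1) S_def _ z(2)] by simp
  qed
  have unit: "?\<phi> s \<in> Units RS" if "s \<in> S" for s using that by (intro rfrac_units) simp_all
  note cdR = cd_le_iff[OF assms(1,2) _ ysc, folded \<aa>] and cdRS = cd_le_iff[OF RS_cring noeth _ zsc]
  have sub_mod: "module R (M\<lparr>carrier := G\<rparr>)" if "submodule G R M" for G
    by (rule submodule.submodule_is_module[OF that M.module_axioms])
  have subS_mod: "module RS (L\<lparr>carrier := G\<rparr>)" if "submodule G RS L" for G
    by (rule submodule.submodule_is_module[OF that L_module])
  let ?FS = "\<lambda>i. submodule_fractions (F i)"

  have M_loc: "module_localization R M RS L S ?\<phi> (\<lambda>m. mfrac m \<one>\<^bsub>R\<^esub>)"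
    using module_localization_fractions[OF M.carrier_is_submodule] by (simp add: submodule_fractions_carrier)
  have fgL: "finitely_generated RS L" by (rule module_localization.finitely_generated_localization[OF M_loc fg unit])
  \<comment> \<open>Vanishing localizes, so the index range of the new filtration is contained in
    that of \<open>F\<close>; beyond the latter nothing is known about \<open>F\<close>.\<close>
  have cd_mono: "cd RS (Idl\<^bsub>RS\<^esub> (set zs)) L \<le> cd R \<aa> M"
    unfolding cd_def local_cohomology_zero_iff[OF RS_cring noeth L_module zsc]
      local_cohomology_zero_iff[OF assms(1,2) M.module_axioms ysc, folded \<aa>]
    using module_localization.koszul_vanishes_localization[OF M_loc ysc, folded zs_def] by (intro Sup_subset_mono) blast

  \<comment> \<open>\<open>F i\<close> is constrained only up to the cohomological dimension of
    \<open>M\<close>, so each fact carries the bound on \<open>i\<close>.\<close>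
  have Fsub: "submodule (F i) R M" and FKV: "\<And>q. i < q \<Longrightarrow> koszul_vanishes R ys (M\<lparr>carrier := F i\<rparr>) q"
    and Fmax: "\<And>N. submodule N R M \<Longrightarrow> (\<And>q. i < q \<Longrightarrow> koszul_vanishes R ys (M\<lparr>carrier := N\<rparr>) q) \<Longrightarrow> N \<subseteq> F i"
    if i: "ereal (real i) \<le> cd R \<aa> M" for i
  proof -
    from F i show s: "submodule (F i) R M" unfolding cd_filtration_def by blast
    from F i have "cd R \<aa> (M\<lparr>carrier := F i\<rparr>) \<le> ereal (real i)" unfolding cd_filtration_def by blast
    then show "koszul_vanishes R ys (M\<lparr>carrier := F i\<rparr>) q" if "i < q" for q using cdR[OF sub_mod[OF s]] that by blast
    show "N \<subseteq> F i" if N: "submodule N R M" "\<And>q. i < q \<Longrightarrow> koszul_vanishes R ys (M\<lparr>carrier := N\<rparr>) q" for N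
      using F i N cdR[OF sub_mod[OF N(1)]] unfolding cd_filtration_def by blast
  qed
  have le: "ereal (real i) \<le> cd R \<aa> M" if "ereal (real j) \<le> cd R \<aa> M" "i \<le> j" for i j :: nat
    using that by (meson ereal_less_eq(3) of_nat_mono order_trans)
  \<comment> \<open>\<open>F i\<close> also satisfies the weaker bound for \<open>j\<close>, so the
    maximality of \<open>F j\<close> applies to it.\<close>
  have Fmono: "F i \<subseteq> F j" if j: "ereal (real j) \<le> cd R \<aa> M" "i \<le> j" for i j
    using FKV[OF le[OF j]] j(2) by (intro Fmax[OF j(1) Fsub[OF le[OF j]]]) simp

  define Q where "Q k = quotient_module (M\<lparr>carrier := F k\<rparr>) (F (k - 1))" for k
  define QS where "QS k = quotient_module (L\<lparr>carrier := ?FS k\<rparr>) (?FS (k - 1))" for k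
  have QS: "module RS (QS k)" "finitely_generated RS (QS k)" "\<And>q. q \<noteq> k \<Longrightarrow> koszul_vanishes RS zs (QS k) q"
    "\<And>x. x \<in> ?FS k \<Longrightarrow> ?FS (k - 1) +>\<^bsub>L\<lparr>carrier := ?FS k\<rparr>\<^esub> x = \<zero>\<^bsub>QS k\<^esub> \<longleftrightarrow> x \<in> ?FS (k - 1)"
    "(\<lambda>x. ?FS (k - 1) +>\<^bsub>L\<lparr>carrier := ?FS k\<rparr>\<^esub> x) \<in> mod_hom RS (L\<lparr>carrier := ?FS k\<rparr>) (QS k)"
    if k: "1 \<le> k" "ereal (real k) \<le> cd R \<aa> M" for k
  proof -
    have k': "ereal (real (k - 1)) \<le> cd R \<aa> M" by (rule le[OF k(2)]) simp
    have "F (k - 1) \<subseteq> F k" by (rule Fmono[OF k(2)]) simp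
    note q = quotient_fractions[OF Fsub[OF k'] Fsub[OF k(2)] this]
    have Qm: "module R (Q k)" unfolding Q_def by (rule quotient_module[OF sub_mod[OF Fsub[OF k(2)]] q(1)])
    have Qz: "zero_module (Q k) \<or> relative_Cohen_Macaulay R \<aa> (Q k) \<and> cd R \<aa> (Q k) = ereal (real k)"
      using FQ[OF k] by (simp add: Let_def Q_def)
    \<comment> \<open>A zero quotient has no cohomology in any degree, so both alternatives in the
      definition give vanishing away from \<open>k\<close>.\<close>
    have Q: "finitely_generated R (Q k)" "\<And>q. q \<noteq> k \<Longrightarrow> koszul_vanishes R ys (Q k) q"
      using Qz unfolding relative_Cohen_Macaulay_iff[OF assms(1,2) Qm ysc, folded \<aa>]
      using zero_module_finitely_generated[OF Qm] zero_module_koszul_vanishes[OF Qm _ ysc] by blast+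
    obtain \<iota> where \<iota>: "module_localization R (Q k) RS (QS k) S ?\<phi> \<iota>" using q(3) unfolding Q_def QS_def by blast
    show "finitely_generated RS (QS k)" by (rule module_localization.finitely_generated_localization[OF \<iota> Q(1) unit])
    show "koszul_vanishes RS zs (QS k) q" if "q \<noteq> k" for q
      unfolding zs_def by (rule module_localization.koszul_vanishes_localization[OF \<iota> ysc Q(2)[OF that]])
    note q' = quotient_module[OF subS_mod[OF submodule_fractions_submodule[OF Fsub[OF k(2)]]] q(2), folded QS_def]
    show "module RS (QS k)" by (rule q'(1))
    show "?FS (k - 1) +>\<^bsub>L\<lparr>carrier := ?FS k\<rparr>\<^esub> x = \<zero>\<^bsub>QS k\<^esub> \<longleftrightarrow> x \<in> ?FS (k - 1)" if "x \<in> ?FS k" for x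
      using q'(4)[of x] that by simp
    show "(\<lambda>x. ?FS (k - 1) +>\<^bsub>L\<lparr>carrier := ?FS k\<rparr>\<^esub> x) \<in> mod_hom RS (L\<lparr>carrier := ?FS k\<rparr>) (QS k)" by (rule q'(2))
  qed

  have max: "N \<subseteq> ?FS i" if i: "ereal (real i) \<le> cd R \<aa> M" and N: "submodule N RS L"
    and NKV: "\<And>q. i < q \<Longrightarrow> koszul_vanishes RS zs (L\<lparr>carrier := N\<rparr>) q" for i N
  proof -
    \<comment> \<open>\<open>c\<close> is the cohomological dimension of \<open>M\<close> as a
      natural number. The maximum exists, as \<open>i\<close> is a candidate and the number of
      generators is a bound. It is the starting point because \<open>F c\<close> is all of
      \<open>M\<close>.\<close>
    define c where "c = (GREATEST c. ereal (real c) \<le> cd R \<aa> M)"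
    have "cd R \<aa> M \<le> ereal (real (length ys))" using cdR[OF M.module_axioms] M.koszul_vanishes_large[OF ysc] by blast
    then have bound: "\<forall>j. ereal (real j) \<le> cd R \<aa> M \<longrightarrow> j \<le> length ys"
      by (meson ereal_less_eq(3) of_nat_le_iff order_trans)
    have c: "ereal (real c) \<le> cd R \<aa> M" and ic: "i \<le> c" unfolding c_def
      using GreatestI_nat[of "\<lambda>c. ereal (real c) \<le> cd R \<aa> M", OF i] Greatest_le_nat[of "\<lambda>c. ereal (real c) \<le> cd R \<aa> M", OF i] bound by auto
    have "koszul_vanishes R ys M q" if "c < q" for q
    proof (rule ccontr)
      assume "\<not> koszul_vanishes R ys M q"
      then have "ereal (real q) \<le> cd R \<aa> M" using cd_upper[OF assms(1,2) M.module_axioms ysc] \<aa> by simp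
      then have "q \<le> c" unfolding c_def using bound by (intro Greatest_le_nat) auto
      then show False using that by simp
    qed
    then have "carrier M \<subseteq> F c" by (intro Fmax[OF c M.carrier_is_submodule]) simp
    then have "carrier L \<subseteq> ?FS c" using submodule_fractions_mono submodule_fractions_carrier by metis
    then have Nc: "N \<subseteq> ?FS c" using module.submoduleE(1)[OF L_module N] by blast
    \<comment> \<open>Descending induction: if \<open>N\<close> lies in the localized submodule of
      index \<open>n + 1\<close>, its map to the quotient there is zero, so it lies in the one of
      index \<open>n\<close>.\<close>
    show ?thesis using ic
    proof (induction rule: inc_induct)
      case base show ?case by (rule Nc)
    next
      case (step n)
      have n: "1 \<le> Suc n" "ereal (real (Suc n)) \<le> cd R \<aa> M" using le[OF c, of "Suc n"] step.hyps by auto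
      note Q = QS[OF n, simplified diff_Suc_1]
      let ?f = "\<lambda>x. ?FS n +>\<^bsub>L\<lparr>carrier := ?FS (Suc n)\<rparr>\<^esub> x"
      have f: "?f \<in> mod_hom RS (L\<lparr>carrier := N\<rparr>) (QS (Suc n))"
        by (rule mod_hom_restrict[OF Q(5) step.IH])
      show ?case
      proof
        fix x assume x: "x \<in> N"
        \<comment> \<open>The cohomology of \<open>N\<close> vanishes above degree \<open>i\<close>,
          and \<open>i \<le> n\<close>, while the quotient can have cohomology in degree
          \<open>n + 1\<close> only; so \<open>Suc n\<close> separates the two.\<close>
        have "?f x = \<zero>\<^bsub>QS (Suc n)\<^esub>"
          using hom_eq_zero[OF subS_mod[OF N] Q(1) f zsc finitely_generated_acc[OF noeth Q(2)] rad, of "Suc n" x] x NKV Q(3) step.hyps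
          by simp
        then show "x \<in> ?FS n" using Q(4)[of x] x step.IH by auto
      qed
    qed
  qed

  have filt: "cd_filtration RS (Idl\<^bsub>RS\<^esub> (set zs)) L ?FS"
    unfolding cd_filtration_def
  proof (intro allI impI conjI)
    fix i assume "ereal (real i) \<le> cd RS (Idl\<^bsub>RS\<^esub> (set zs)) L"
    then have i: "ereal (real i) \<le> cd R \<aa> M" using cd_mono by (rule order_trans)
    show s: "submodule (?FS i) RS L" by (rule submodule_fractions_submodule[OF Fsub[OF i]])
    show "cd RS (Idl\<^bsub>RS\<^esub> (set zs)) (L\<lparr>carrier := ?FS i\<rparr>) \<le> ereal (real i)"
      unfolding cdRS[OF subS_mod[OF s]]
      using module_localization.koszul_vanishes_localization[OF module_localization_fractions[OF Fsub[OF i]] ysc, folded zs_def] FKV[OF i] by blast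
    show "N \<subseteq> ?FS i" if N: "submodule N RS L \<and> cd RS (Idl\<^bsub>RS\<^esub> (set zs)) (L\<lparr>carrier := N\<rparr>) \<le> ereal (real i)" for N
      using N cdRS[OF subS_mod[of N]] by (intro max[OF i]) auto
  qed
  have "zero_module (QS i) \<or> relative_Cohen_Macaulay RS (Idl\<^bsub>RS\<^esub> (set zs)) (QS i) \<and> cd RS (Idl\<^bsub>RS\<^esub> (set zs)) (QS i) = ereal (real i)"
    if "1 \<le> i" "ereal (real i) \<le> cd RS (Idl\<^bsub>RS\<^esub> (set zs)) L" for i
  proof -
    note Q = QS[OF that(1) order_trans[OF that(2) cd_mono]]
    \<comment> \<open>If degree \<open>i\<close> vanishes too, there is no cohomology at all, and by
      the local nonvanishing statement the quotient is zero. So localization may annihilate a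
      quotient but cannot move its degree.\<close>
    have "zero_module (QS i)" if "koszul_vanishes RS zs (QS i) i"
    proof (rule koszul_vanishes_nonvanishing[OF Q(1) zsc finitely_generated_acc[OF noeth Q(2)] rad])
      show "koszul_vanishes RS zs (QS i) q" for q using Q(3) that by (cases "q = i") simp_all
    qed
    then show ?thesis unfolding relative_Cohen_Macaulay_iff[OF RS_cring noeth Q(1) zsc] using Q(2,3) by blast
  qed
  then have "RCMF RS (Idl\<^bsub>RS\<^esub> (set zs)) L"
    unfolding RCMF_def Let_def using fgL filt by (auto simp: QS_def)
  then show ?thesis unfolding \<aa>' ring_at_def module_at_def S_def .
qed

end
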